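(* Assume A1--A5 (stated in the context), and let $\epsilon_n=\sqrt{\max\{q,s_0^\Omega,s_0^B\}\log(\max\{p,q\})/n}$. Then there is a constant $M_1>0$, not depending on $n$, such that, as $n\to\infty$, $$\sup_{B_0\in\mathcal{B}_0,\ \Omega_0\in\mathcal{H}_0}\mathbb{E}_0\,\Pi\left(B:\ \|X(B-B_0)\|_F^2\ge M_1 n\epsilon_n^2\ \middle|\ Y_1,\dots,Y_n\right)\longrightarrow 0$$ and $$\sup_{B_0\in\mathcal{B}_0,\ \Omega_0\in\mathcal{H}_0}\mathbb{E}_0\,\Pi\left(\Omega:\ \|\Omega-\Omega_0\|_F^2\ge M_1\epsilon_n^2\ \middle|\ Y_1,\dots,Y_n\right)\longrightarrow 0 .$$ Here the suprema are over true parameters $(B_0,\Omega_0)$ having $s_0^B$ non-zero entries in $B_0$ and $s_0^\Omega$ non-zero entries strictly above the diagonal of $\Omega_0$.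
   Context: Setting. For each $n$, let $p=p_n$, $q=q_n$, and $Q=q(q-1)/2$. $X\in\mathbb{R}^{n\times p}$ is a fixed design matrix with $i$-th row $\bm{x}_i^\top$, whose columns have Euclidean norm $\sqrt n$. Under parameters $(B,\Omega)$, with $B=(\beta_{j,k})\in\mathbb{R}^{p\times q}$ and $\Omega=(\omega_{k,k'})\in\mathbb{R}^{q\times q}$ symmetric positive definite, the observations $Y_1,\dots,Y_n\in\mathbb{R}^q$ are independent with $Y_i\sim\mathcal{N}_q(B^\top \bm{x}_i,\Omega^{-1})$. The data are generated from true parameters $(B_0,\Omega_0)$; $\mathbb{E}_0$ is expectation under them. $s_0^B$ is the number of non-zero entries of $B_0$ and $s_0^\Omega$ the number of non-zero entries of $\Omega_0$ strictly above the diagonal. Prior. $B$ and $\Omega$ are independent a priori, with $\theta,\eta\in(0,1)$, $0<\lambda_1<\lambda_0$, $0<\xi_1<\xi_0$ fixed and known (depending on $n$). The entries of $B$ are i.i.d. with density $\theta\frac{\lambda_1}{2}e^{-\lambda_1|\beta|}+(1-\theta)\frac{\lambda_0}{2}e^{-\lambda_0|\beta|}$. The prior density of $\Omega$ is proportional to $$\mathbf 1(\Omega\succ\tau I)\prod_{k=1}^q\Big[\xi_1e^{-\xi_1\omega_{k,k}}\prod_{k'>k}\Big(\eta\tfrac{\xi_1}{2}e^{-\xi_1|\omega_{k,k'}|}+(1-\eta)\tfrac{\xi_0}{2}e^{-\xi_0|\omega_{k,k'}|}\Big)\Big],$$ where $\tau\in(0,b_1^{-1})$ is a constant not depending on $n$.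 $\Pi(\cdot\mid Y_1,\dots,Y_n)$ is the resulting posterior distribution. Assumptions. A1: $\Omega_0\in\mathcal{H}_0=\{\Omega:\text{all eigenvalues of }\Omega\text{ lie in }[b_1^{-1},b_2^{-1}]\}$, where $b_1>b_2>0$ do not depend on $n$. A2: $B_0\in\mathcal{B}_0=\{B:\max_{j,k}|\beta_{j,k}|<a_1\}$, where $a_1>0$ does not depend on $n$. A3: $\log n\lesssim\log q$, $\log n\lesssim\log p$ and $\max\{q,s_0^\Omega,s_0^B\}\log(\max\{p,q\})/n\to0$. A4: for constants $a'>0$, $b'>1/2$ not depending on $n$: $(1-\theta)/\theta\asymp(pq)^{2+a'}$, $\lambda_0\asymp\max\{n,pq\}^{2+b'}$, $\lambda_1\asymp1/n$. A5: for constants $a,b>0$ not depending on $n$: $(1-\eta)/\eta\asymp Q^{2+a}$, $\xi_0\asymp\max\{Q,n\}^{4+b}$, $\xi_1\asymp1/\max\{Q,n\}$. $a_n\lesssim b_n$ means $a_n\le Cb_n$ for some constant $C$ and all large $n$; $a_n\asymp b_n$ means $a_n\lesssim b_n\lesssim a_n$. $\|\cdot\|_F$ is the Frobenius norm. *)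

theory Defs
  imports
    "HOL-Probability.Probability"
    "HOL-Library.Landau_Symbols"
    "Jordan_Normal_Form.Char_Poly"
begin

(* Names such as mat, vec, det, row exist both in HOL-Analysis and in Jordan_Normal_Form;
   the latter, whose dimensions are natural numbers, are used throughout. *)

definition pos_def_mat :: "real mat \<Rightarrow> bool" where
  "pos_def_mat A \<longleftrightarrow> transpose_mat A = A \<and>
     (\<forall>v \<in> carrier_vec (dim_row A). v \<noteq> 0\<^sub>v (dim_row A) \<longrightarrow> scalar_prod v (A *\<^sub>v v) > 0)"

definition frobenius_norm :: "real mat \<Rightarrow> real" where
  "frobenius_norm A = sqrt (\<Sum>i<dim_row A. \<Sum>j<dim_col A. (A $$ (i, j))\<^sup>2)"

definition nnz :: "real mat \<Rightarrow> nat" where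
  "nnz A = card {(j, k). j < dim_row A \<and> k < dim_col A \<and> A $$ (j, k) \<noteq> 0}"

definition nnz_upper :: "real mat \<Rightarrow> nat" where
  "nnz_upper A = card {(j, k). j < dim_row A \<and> k < dim_col A \<and> j < k \<and> A $$ (j, k) \<noteq> 0}"


subsection \<open>Sampling model\<close>

(* Lebesgue density on R^q of the normal law with mean mu and covariance matrix Omega^{-1},
   as a function of the precision matrix Omega; points of R^q are functions on {..<q}. *)
definition normal_density_prec ::
    "nat \<Rightarrow> real Matrix.vec \<Rightarrow> real mat \<Rightarrow> (nat \<Rightarrow> real) \<Rightarrow> real" where
  "normal_density_prec q \<mu> \<Omega> y =
     sqrt (Determinant.det \<Omega> / (2 * pi) ^ q) *
     exp (- scalar_prod (Matrix.vec q y - \<mu>) (\<Omega> *\<^sub>v (Matrix.vec q y - \<mu>)) / 2)"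

lemma normal_density_prec_covariance:
  assumes S: "\<Sigma> \<in> carrier_mat q q" and W: "\<Omega> \<in> carrier_mat q q" and inv: "\<Sigma> * \<Omega> = 1\<^sub>m q"
  shows "normal_density_prec q \<mu> \<Omega> y =
     exp (- scalar_prod (Matrix.vec q y - \<mu>) (\<Omega> *\<^sub>v (Matrix.vec q y - \<mu>)) / 2) /
     sqrt ((2 * pi) ^ q * Determinant.det \<Sigma>)"
proof -
  have "Determinant.det \<Sigma> * Determinant.det \<Omega> = 1"
    using Determinant.det_mult[OF S W] inv by simp
  then have "Determinant.det \<Omega> = 1 / Determinant.det \<Sigma>"
    by (metis eq_divide_eq mult.commute mult_zero_left zero_neq_one)
  then show ?thesis
    by (simp add: normal_density_prec_def real_sqrt_divide real_sqrt_mult)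
qed

definition obs_mean :: "real mat \<Rightarrow> real mat \<Rightarrow> nat \<Rightarrow> real Matrix.vec" where
  "obs_mean X B i = transpose_mat B *\<^sub>v Matrix.row X i"

definition sampling_measure ::
    "nat \<Rightarrow> nat \<Rightarrow> real mat \<Rightarrow> real mat \<Rightarrow> real mat \<Rightarrow> (nat \<Rightarrow> nat \<Rightarrow> real) measure" where
  "sampling_measure n q X B \<Omega> =
     (\<Pi>\<^sub>M i\<in>{..<n}. density (\<Pi>\<^sub>M k\<in>{..<q}. lborel)
        (\<lambda>y. ennreal (normal_density_prec q (obs_mean X B i) \<Omega> y)))"

definition likelihood ::
    "nat \<Rightarrow> nat \<Rightarrow> real mat \<Rightarrow> (nat \<Rightarrow> nat \<Rightarrow> real) \<Rightarrow> real mat \<Rightarrow> real mat \<Rightarrow> real" where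
  "likelihood n q X Y B \<Omega> = (\<Prod>i<n. normal_density_prec q (obs_mean X B i) \<Omega> (Y i))"


subsection \<open>Prior and posterior\<close>

(* Spike-and-slab LASSO density: slab rate l1, spike rate l0, slab weight w. *)
definition ssl_density :: "real \<Rightarrow> real \<Rightarrow> real \<Rightarrow> real \<Rightarrow> real" where
  "ssl_density w l1 l0 x =
     w * (l1 / 2 * exp (- l1 * \<bar>x\<bar>)) + (1 - w) * (l0 / 2 * exp (- l0 * \<bar>x\<bar>))"

(* The priors live on coordinate spaces: B is given by its p * q entries, a symmetric Omega by
   its entries on and above the diagonal. *)
definition B_of :: "nat \<Rightarrow> nat \<Rightarrow> (nat \<times> nat \<Rightarrow> real) \<Rightarrow> real mat" where
  "B_of p q b = Matrix.mat p q b"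

definition Omega_of :: "nat \<Rightarrow> (nat \<times> nat \<Rightarrow> real) \<Rightarrow> real mat" where
  "Omega_of q w = Matrix.mat q q (\<lambda>(j, k). w (min j k, max j k))"

definition prior_B :: "nat \<Rightarrow> nat \<Rightarrow> real \<Rightarrow> real \<Rightarrow> real \<Rightarrow> (nat \<times> nat \<Rightarrow> real) measure" where
  "prior_B p q \<theta> lam1 lam0 =
     (\<Pi>\<^sub>M jk \<in> {..<p} \<times> {..<q}. density lborel (\<lambda>x. ennreal (ssl_density \<theta> lam1 lam0 x)))"

definition upper_lborel :: "nat \<Rightarrow> (nat \<times> nat \<Rightarrow> real) measure" where
  "upper_lborel q = (\<Pi>\<^sub>M kk \<in> {(k, k'). k \<le> k' \<and> k' < q}. lborel)"

definition prior_Omega_unnorm ::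
    "nat \<Rightarrow> real \<Rightarrow> real \<Rightarrow> real \<Rightarrow> real \<Rightarrow> (nat \<times> nat \<Rightarrow> real) \<Rightarrow> real" where
  "prior_Omega_unnorm q \<eta> \<xi>1 \<xi>0 \<tau> w =
     (if pos_def_mat (Omega_of q w - \<tau> \<cdot>\<^sub>m 1\<^sub>m q) then 1 else 0) *
     (\<Prod>k<q. \<xi>1 * exp (- \<xi>1 * w (k, k)) * (\<Prod>k'\<in>{k<..<q}. ssl_density \<eta> \<xi>1 \<xi>0 (w (k, k'))))"

definition prior_Omega ::
    "nat \<Rightarrow> real \<Rightarrow> real \<Rightarrow> real \<Rightarrow> real \<Rightarrow> (nat \<times> nat \<Rightarrow> real) measure" where
  "prior_Omega q \<eta> \<xi>1 \<xi>0 \<tau> =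
     density (upper_lborel q)
       (\<lambda>w. ennreal (prior_Omega_unnorm q \<eta> \<xi>1 \<xi>0 \<tau> w) /
            (\<integral>\<^sup>+ w'. ennreal (prior_Omega_unnorm q \<eta> \<xi>1 \<xi>0 \<tau> w') \<partial>upper_lborel q))"

definition prior ::
    "nat \<Rightarrow> nat \<Rightarrow> real \<Rightarrow> real \<Rightarrow> real \<Rightarrow> real \<Rightarrow> real \<Rightarrow> real \<Rightarrow> real \<Rightarrow>
     ((nat \<times> nat \<Rightarrow> real) \<times> (nat \<times> nat \<Rightarrow> real)) measure" where
  "prior p q \<theta> lam1 lam0 \<eta> \<xi>1 \<xi>0 \<tau> = prior_B p q \<theta> lam1 lam0 \<Otimes>\<^sub>M prior_Omega q \<eta> \<xi>1 \<xi>0 \<tau>"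

definition posterior ::
    "nat \<Rightarrow> nat \<Rightarrow> nat \<Rightarrow> real mat \<Rightarrow> ((nat \<times> nat \<Rightarrow> real) \<times> (nat \<times> nat \<Rightarrow> real)) measure \<Rightarrow>
     (nat \<Rightarrow> nat \<Rightarrow> real) \<Rightarrow> ((nat \<times> nat \<Rightarrow> real) \<times> (nat \<times> nat \<Rightarrow> real)) measure" where
  "posterior n p q X P Y =
     density P (\<lambda>(b, w). ennreal (likelihood n q X Y (B_of p q b) (Omega_of q w)) /
       (\<integral>\<^sup>+ (b', w'). ennreal (likelihood n q X Y (B_of p q b') (Omega_of q w')) \<partial>P))"

definition prob_of ::
    "nat \<Rightarrow> nat \<Rightarrow> ((nat \<times> nat \<Rightarrow> real) \<times> (nat \<times> nat \<Rightarrow> real)) measure \<Rightarrow>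
     (real mat \<Rightarrow> real mat \<Rightarrow> bool) \<Rightarrow> ennreal" where
  "prob_of p q M R = emeasure M {(b, w) \<in> space M. R (B_of p q b) (Omega_of q w)}"


subsection \<open>True parameters and rate\<close>

definition B_class :: "nat \<Rightarrow> nat \<Rightarrow> real \<Rightarrow> real mat set" where
  "B_class p q a1 = {B \<in> carrier_mat p q. \<forall>j<p. \<forall>k<q. \<bar>B $$ (j, k)\<bar> < a1}"

definition Omega_class :: "nat \<Rightarrow> real \<Rightarrow> real \<Rightarrow> real mat set" where
  "Omega_class q b1 b2 = {\<Omega> \<in> carrier_mat q q. pos_def_mat \<Omega> \<and>
     (\<forall>e. eigenvalue \<Omega> e \<longrightarrow> inverse b1 \<le> e \<and> e \<le> inverse b2)}"

definition true_params ::
    "nat \<Rightarrow> nat \<Rightarrow> real \<Rightarrow> real \<Rightarrow> real \<Rightarrow> nat \<Rightarrow> nat \<Rightarrow> (real mat \<times> real mat) set" where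
  "true_params p q a1 b1 b2 sB s\<Omega> =
     {(B, \<Omega>). B \<in> B_class p q a1 \<and> \<Omega> \<in> Omega_class q b1 b2 \<and> nnz B = sB \<and> nnz_upper \<Omega> = s\<Omega>}"

definition contraction_rate :: "nat \<Rightarrow> nat \<Rightarrow> nat \<Rightarrow> nat \<Rightarrow> nat \<Rightarrow> real" where
  "contraction_rate n p q sB s\<Omega> =
     sqrt (real (Max {q, s\<Omega>, sB}) * ln (real (max p q)) / real n)"

end

(*
  Let r be the likelihood ratio of (B, Omega) against the truth, so that the posterior mass of a set A
  is the quotient of the prior integrals of r over A and over the whole space.

  Denominator: if E_0 (1/r) <= exp K on a set S, then r + c^2/r >= 2c and Markov's inequality show that
  the denominator is at least exp(-2K) Pi(S) outside an event of probability exp(-K). For S a small box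
  around the truth, Pi(S) >= exp(-C R), where R = n epsilon_n^2.

  Numerator: the parameter space is cut into product cells so small that chi-square divergences within
  a cell are under control. For alpha < 1 a Young inequality bounds E_0 min(1, c * (integral of r over a
  cell)) by a constant times (c Pi(cell))^alpha (E_0 sqrt r)^(2 - 2 alpha). On A the Hellinger affinities
  E_0 sqrt r are at most exp(-c M_1 R), and the sum of Pi(cell)^alpha over all cells factorises over the
  coordinates. The spike puts almost all mass of an off-diagonal or regression coefficient into one
  cell, so such a coordinate contributes a factor 1 + O(1 / number of coordinates), whereas each of the
  q diagonal entries contributes a power of n. Hence the sum is at most exp(C R), and M_1 large wins.
  Neither tests nor a sieve of effectively sparse matrices are needed.
*)

theory Submission
  imports Defs "HOL-Real_Asymp.Real_Asymp"
begin

section \<open>Quadratic forms\<close>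

text \<open>For \<open>t\<close> and \<open>u\<close> in one cell, the expectation under the truth
  of r_t^2 / r_u does not involve the density of the truth, which cancels. Hence one grid width
  serves everywhere, although most cells are far from the truth and their precision matrices have no
  upper spectral bound. What does grow with the precision matrix is the effect of a change of mean;
  it is bounded through the trace, so that its cost is a product over the diagonal coordinates,
  whose exponential prior can pay for it. The power \<alpha> balances two demands: below 1, to leave
  a positive power of the affinity, and so close to 1 that the slab, which is spread over
  polynomially many cells, adds little to the sum, since this power inflates its share by the number
  of cells to the power 1 - \<alpha>. As log n is at most a constant times log p and log q, a fixed
  \<alpha> suffices. The affinity in the precision matrix saturates at a constant per observation,
  so it yields exp(-c M_1 R) only while M_1 R is at most a multiple of n; this is where epsilon_n ->
  0 enters.\<close>

definition bform :: "'i set \<Rightarrow> ('i \<Rightarrow> 'i \<Rightarrow> real) \<Rightarrow> ('i \<Rightarrow> real) \<Rightarrow> ('i \<Rightarrow> real) \<Rightarrow> real" where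
  "bform I A u v = (\<Sum>i\<in>I. \<Sum>j\<in>I. A i j * u i * v j)"

definition sym_on :: "'i set \<Rightarrow> ('i \<Rightarrow> 'i \<Rightarrow> real) \<Rightarrow> bool" where
  "sym_on I A \<longleftrightarrow> (\<forall>i\<in>I. \<forall>j\<in>I. A i j = A j i)"

text \<open>Forms are indexed by arbitrary sets, so that a Schur complement, which drops one index,
  needs no renumbering.\<close>

definition pd_on :: "'i set \<Rightarrow> ('i \<Rightarrow> 'i \<Rightarrow> real) \<Rightarrow> bool" where
  "pd_on I A \<longleftrightarrow> sym_on I A \<and> (\<forall>v. (\<exists>i\<in>I. v i \<noteq> 0) \<longrightarrow> bform I A v v > 0)"

lemma bform_add_left: "bform I A (\<lambda>i. u i + v i) w = bform I A u w + bform I A v w"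
  by (simp add: bform_def algebra_simps sum.distrib)

lemma bform_add_right: "bform I A w (\<lambda>i. u i + v i) = bform I A w u + bform I A w v"
  by (simp add: bform_def algebra_simps sum.distrib)

lemma bform_diff_left: "bform I A (\<lambda>i. u i - v i) w = bform I A u w - bform I A v w"
  by (simp add: bform_def algebra_simps sum_subtractf)

lemma bform_diff_right: "bform I A w (\<lambda>i. u i - v i) = bform I A w u - bform I A w v"
  by (simp add: bform_def algebra_simps sum_subtractf)

lemma bform_scale_left: "bform I A (\<lambda>i. c * u i) w = c * bform I A u w"
  by (simp add: bform_def sum_distrib_left algebra_simps)

lemma bform_scale_right: "bform I A w (\<lambda>i. c * u i) = c * bform I A w u"
  by (simp add: bform_def sum_distrib_left algebra_simps)

lemma bform_lin_mat:
  "bform I (\<lambda>i j. a * A i j + b * B i j) u v = a * bform I A u v + b * bform I B u v"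
  by (simp add: bform_def sum_distrib_left algebra_simps sum.distrib)

lemma bform_cong:
  assumes "\<And>i j. i \<in> I \<Longrightarrow> j \<in> I \<Longrightarrow> A i j = B i j"
    and "\<And>i. i \<in> I \<Longrightarrow> u i = u' i" and "\<And>i. i \<in> I \<Longrightarrow> v i = v' i"
  shows "bform I A u v = bform I B u' v'"
  unfolding bform_def using assms by (intro sum.cong refl) auto

lemma bform_commute: "sym_on I A \<Longrightarrow> bform I A u v = bform I A v u"
  unfolding bform_def sym_on_def
  by (subst sum.swap, intro sum.cong refl) (auto simp: mult_ac)

lemma bform_zero_left: "(\<And>i. i \<in> I \<Longrightarrow> u i = 0) \<Longrightarrow> bform I A u v = 0"
  by (simp add: bform_def)

lemma bform_outer:
  "finite I \<Longrightarrow> bform I (\<lambda>i j. a i * b j) u v = (\<Sum>i\<in>I. a i * u i) * (\<Sum>j\<in>I. b j * v j)"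
  by (simp add: bform_def sum_product mult_ac)

lemmas bform_bilinear =
  bform_add_left bform_add_right bform_diff_left bform_diff_right bform_scale_left bform_scale_right

lemma bform_square_add:
  assumes "sym_on I A"
  shows "bform I A (\<lambda>i. u i + t * v i) (\<lambda>i. u i + t * v i)
       = bform I A u u + 2 * t * bform I A u v + t\<^sup>2 * bform I A v v"
  using bform_commute[OF assms, of v u]
  by (simp add: bform_bilinear algebra_simps power2_eq_square)

lemma sym_onD: "sym_on I A \<Longrightarrow> i \<in> I \<Longrightarrow> j \<in> I \<Longrightarrow> A i j = A j i"
  by (simp add: sym_on_def)

lemma pd_on_sym: "pd_on I A \<Longrightarrow> sym_on I A" by (simp add: pd_on_def)

lemma pd_on_pos: "pd_on I A \<Longrightarrow> i \<in> I \<Longrightarrow> v i \<noteq> 0 \<Longrightarrow> bform I A v v > 0"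
  by (auto simp: pd_on_def)

lemma pd_on_nonneg: "pd_on I A \<Longrightarrow> bform I A v v \<ge> 0"
  by (cases "\<exists>i\<in>I. v i \<noteq> 0") (auto simp: pd_on_def bform_zero_left intro: less_imp_le)

lemma bform_unit:
  assumes "finite I" "r \<in> I" "s \<in> I"
  shows "bform I A (\<lambda>i. if i = r then 1 else 0) (\<lambda>i. if i = s then 1 else 0) = A r s"
proof -
  have "bform I A (\<lambda>i. if i = r then 1 else 0) (\<lambda>i. if i = s then 1 else 0)
      = (\<Sum>i\<in>I. if i = r then (\<Sum>j\<in>I. if j = s then A i j else 0) else 0)"
    unfolding bform_def by (intro sum.cong refl) (auto intro!: sum.cong)
  then show ?thesis using assms by simp
qed

lemma pd_on_diag_pos: "finite I \<Longrightarrow> pd_on I A \<Longrightarrow> r \<in> I \<Longrightarrow> A r r > 0"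
  using bform_unit[of I r r A] pd_on_pos[of I A r "\<lambda>i. if i = r then 1 else 0"] by simp

text \<open>Polarisation: the values at e_i, e_j and e_i + e_j determine the entry.\<close>

lemma sym_form_eqD:
  assumes fin: "finite I" and A: "sym_on I A" and B: "sym_on I B"
    and eq: "\<And>x. bform I A x x = bform I B x x" and i: "i \<in> I" and j: "j \<in> I"
  shows "A i j = B i j"
proof -
  define e :: "'a \<Rightarrow> 'a \<Rightarrow> real" where "e = (\<lambda>r i. if i = r then 1 else 0)"
  have "bform I A (e i) (e j) = bform I B (e i) (e j)"
    using eq[of "\<lambda>k. e i k + 1 * e j k"] eq[of "e i"] eq[of "e j"]
    unfolding bform_square_add[OF A] bform_square_add[OF B] by simp
  then show ?thesis using bform_unit[OF fin i j] unfolding e_def by simp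
qed

text \<open>Completing the square in the coordinate \<open>r\<close>; the remainder is the Schur
  complement. Coercivity and Gaussian integrals follow from it by removing one coordinate at a
  time.\<close>

lemma bform_insert_schur:
  fixes A :: "'i \<Rightarrow> 'i \<Rightarrow> real"
  assumes fin: "finite J" and r: "r \<notin> J" and sym: "sym_on (insert r J) A" and A: "A r r \<noteq> 0"
  shows "bform (insert r J) A v v = A r r * (v r + (\<Sum>j\<in>J. A r j * v j) / A r r)\<^sup>2
           + bform J (\<lambda>i j. A i j - A i r * A r j / A r r) v v"
proof -
  define s where "s = (\<Sum>j\<in>J. A r j * v j)"
  have s2: "(\<Sum>i\<in>J. A i r * v i) = s"
    unfolding s_def
  proof (intro sum.cong refl)
    fix i assume "i \<in> J"
    then show "A i r * v i = A r i * v i" using sym_onD[OF sym, of i r] by simp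
  qed
  have "bform (insert r J) A v v = A r r * (v r)\<^sup>2 + (\<Sum>j\<in>J. A r j * v r * v j)
      + (\<Sum>i\<in>J. A i r * v i * v r) + bform J A v v"
    using fin r by (simp add: bform_def sum.distrib power2_eq_square)
  also have "(\<Sum>j\<in>J. A r j * v r * v j) = v r * s"
    by (simp add: s_def sum_distrib_left mult_ac)
  also have "(\<Sum>i\<in>J. A i r * v i * v r) = v r * s"
    by (simp add: s2[symmetric] sum_distrib_left mult_ac)
  finally have 1: "bform (insert r J) A v v = A r r * (v r)\<^sup>2 + 2 * v r * s + bform J A v v"
    by simp
  have "bform J (\<lambda>i j. A i j - A i r * A r j / A r r) v v
      = bform J (\<lambda>i j. 1 * A i j + (- 1 / A r r) * (A i r * A r j)) v v"
    by (intro bform_cong) auto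
  also have "\<dots> = bform J A v v - s\<^sup>2 / A r r"
    unfolding bform_lin_mat bform_outer[OF fin] s2 s_def[symmetric] by (simp add: power2_eq_square)
  finally have 2: "bform J (\<lambda>i j. A i j - A i r * A r j / A r r) v v = bform J A v v - s\<^sup>2 / A r r" .
  show ?thesis
    unfolding 1 2 s_def[symmetric] using A by (simp add: field_simps power2_eq_square)
qed

lemma pd_on_schur:
  assumes fin: "finite J" and r: "r \<notin> J" and pd: "pd_on (insert r J) A"
  shows "pd_on J (\<lambda>i j. A i j - A i r * A r j / A r r)"
  unfolding pd_on_def
proof safe
  show "sym_on J (\<lambda>i j. A i j - A i r * A r j / A r r)"
    unfolding sym_on_def
  proof safe
    fix i j assume "i \<in> J" "j \<in> J"
    then show "A i j - A i r * A r j / A r r = A j i - A j r * A r i / A r r"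
      using sym_onD[OF pd_on_sym[OF pd], of i j] sym_onD[OF pd_on_sym[OF pd], of i r]
        sym_onD[OF pd_on_sym[OF pd], of j r] by simp
  qed
next
  fix v :: "'a \<Rightarrow> real" and i assume i: "i \<in> J" "v i \<noteq> 0"
  have Ar: "A r r > 0" using pd_on_diag_pos[OF _ pd, of r] fin by simp
  \<comment> \<open>This value at \<open>r\<close> annihilates the square in
    \<open>bform_insert_schur\<close>.\<close>
  define w where "w = v(r := - (\<Sum>j\<in>J. A r j * v j) / A r r)"
  have eq: "(\<Sum>j\<in>J. A r j * w j) = (\<Sum>j\<in>J. A r j * v j)"
    using r by (intro sum.cong) (auto simp: w_def)
  have "0 < bform (insert r J) A w w"
    by (rule pd_on_pos[OF pd, of i]) (use i r in \<open>auto simp: w_def\<close>)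
  also have "\<dots> = bform J (\<lambda>i j. A i j - A i r * A r j / A r r) w w"
    using bform_insert_schur[OF fin r pd_on_sym[OF pd], of w] Ar unfolding eq
    by (simp add: w_def)
  also have "\<dots> = bform J (\<lambda>i j. A i j - A i r * A r j / A r r) v v"
    using r by (intro bform_cong) (auto simp: w_def)
  finally show "0 < bform J (\<lambda>i j. A i j - A i r * A r j / A r r) v v" .
qed

text \<open>Induction through Schur complements replaces compactness of the unit sphere.\<close>

lemma pd_on_coercive:
  assumes "finite I" "pd_on I A"
  shows "\<exists>c>0. \<forall>v. c * (\<Sum>i\<in>I. (v i)\<^sup>2) \<le> bform I A v v"
  using assms
proof (induction I arbitrary: A rule: finite_induct)
  case empty
  then show ?case by (auto simp: bform_def intro!: exI[of _ 1])
next
  case (insert r J)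
  have Ar: "A r r > 0" using pd_on_diag_pos[OF _ insert.prems, of r] insert by simp
  define S where "S = (\<lambda>i j. A i j - A i r * A r j / A r r)"
  obtain c where c: "c > 0" "\<And>v. c * (\<Sum>i\<in>J. (v i)\<^sup>2) \<le> bform J S v v"
    using insert.IH[OF pd_on_schur[OF insert.hyps(1,2) insert.prems]] unfolding S_def by blast
  define K where "K = (\<Sum>j\<in>J. (A r j / A r r)\<^sup>2)"
  have K: "K \<ge> 0" unfolding K_def by (intro sum_nonneg) auto
  \<comment> \<open>With \<open>l\<close> the shift in the completed square, (v r)^2 <= 2 (v r +
    l)^2 + 2 l^2, and l^2 is at most \<open>K\<close> times the squared norm of \<open>v\<close> on
    \<open>J\<close>. The two entries of the minimum pay for the two resulting terms.\<close>
  define d where "d = min (A r r / 2) (c / (1 + 2 * K))"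
  have d: "d > 0" "2 * d \<le> A r r" "d * (1 + 2 * K) \<le> c"
    subgoal using Ar c(1) K by (auto simp: d_def intro!: divide_pos_pos)
    subgoal by (simp add: d_def)
    subgoal using K by (simp add: d_def min.coboundedI2 flip: pos_le_divide_eq)
    done
  have "d * (\<Sum>i\<in>insert r J. (v i)\<^sup>2) \<le> bform (insert r J) A v v" for v
  proof -
    define l where "l = (\<Sum>j\<in>J. A r j * v j) / A r r"
    define N where "N = (\<Sum>j\<in>J. (v j)\<^sup>2)"
    have N: "N \<ge> 0" unfolding N_def by (intro sum_nonneg) auto
    have "l\<^sup>2 \<le> K * N"
      using Cauchy_Schwarz_ineq_sum[of "\<lambda>j. A r j / A r r" v J]
      unfolding K_def N_def l_def by (simp add: sum_divide_distrib)
    have "(v r)\<^sup>2 \<le> 2 * (v r + l)\<^sup>2 + 2 * l\<^sup>2"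
      using zero_le_power2[of "v r + 2 * l"] by (simp add: power2_eq_square algebra_simps)
    then have "d * (v r)\<^sup>2 \<le> d * (2 * (v r + l)\<^sup>2 + 2 * (K * N))"
      using \<open>l\<^sup>2 \<le> K * N\<close> d(1) by (intro mult_left_mono) auto
    then have "d * ((v r)\<^sup>2 + N) \<le> (2 * d) * (v r + l)\<^sup>2 + (d * (1 + 2 * K)) * N"
      by (simp add: algebra_simps)
    also have "\<dots> \<le> A r r * (v r + l)\<^sup>2 + c * N"
      using d N by (intro add_mono mult_right_mono) auto
    also have "\<dots> \<le> A r r * (v r + l)\<^sup>2 + bform J S v v"
      using c(2)[of v] by (simp add: N_def)
    also have "\<dots> = bform (insert r J) A v v"
      using bform_insert_schur[OF insert.hyps(1,2) pd_on_sym[OF insert.prems], of v] Ar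
      by (simp add: S_def l_def)
    finally show ?thesis using insert.hyps by (simp add: N_def)
  qed
  then show ?case using d(1) by blast
qed

section \<open>Simultaneous diagonalisation of two forms\<close>

lemma bform_bounded:
  assumes "finite I"
  shows "\<exists>M>0. \<forall>v. \<bar>bform I A v v\<bar> \<le> M * (\<Sum>i\<in>I. (v i)\<^sup>2)"
proof -
  define M where "M = 1 + (\<Sum>i\<in>I. \<Sum>j\<in>I. \<bar>A i j\<bar>)"
  have "\<bar>bform I A v v\<bar> \<le> M * (\<Sum>i\<in>I. (v i)\<^sup>2)" for v
  proof -
    define N where "N = (\<Sum>i\<in>I. (v i)\<^sup>2)"
    have le: "(v i)\<^sup>2 \<le> N" if "i \<in> I" for i
      unfolding N_def using assms that by (intro member_le_sum) auto
    have "\<bar>v i * v j\<bar> \<le> N" if "i \<in> I" "j \<in> I" for i j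
    proof -
      have "2 * \<bar>v i * v j\<bar> \<le> (v i)\<^sup>2 + (v j)\<^sup>2"
        using sum_squares_bound[of "\<bar>v i\<bar>" "\<bar>v j\<bar>"] by (simp add: abs_mult)
      then show ?thesis using le[OF that(1)] le[OF that(2)] by simp
    qed
    then have "\<bar>A i j * v i * v j\<bar> \<le> \<bar>A i j\<bar> * N" if "i \<in> I" "j \<in> I" for i j
      using that by (simp add: abs_mult mult.assoc mult_left_mono)
    then have "\<bar>bform I A v v\<bar> \<le> (\<Sum>i\<in>I. \<Sum>j\<in>I. \<bar>A i j\<bar> * N)"
      unfolding bform_def
      by (intro order.trans[OF sum_abs] sum_mono) (auto intro!: order.trans[OF sum_abs] sum_mono)
    also have "\<dots> \<le> M * N"
      unfolding M_def distrib_right sum_distrib_right N_def by (simp add: sum_nonneg)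
    finally show ?thesis unfolding N_def .
  qed
  moreover have "M > 0"
    unfolding M_def by (intro add_pos_nonneg sum_nonneg) auto
  ultimately show ?thesis by blast
qed

text \<open>Otherwise the form would change linearly along the line through \<open>u\<close> in
  direction \<open>v\<close> and become negative; \<open>t\<close> is chosen to reach the value
  -1.\<close>

lemma psd_null:
  assumes sym: "sym_on I F" and psd: "\<And>v. bform I F v v \<ge> 0" and v: "bform I F v v = 0"
  shows "bform I F u v = 0"
proof (rule ccontr)
  define b where "b = bform I F u v"
  define t where "t = - (bform I F u u + 1) / (2 * b)"
  assume "bform I F u v \<noteq> 0"
  then have "b \<noteq> 0" by (simp add: b_def)
  have "0 \<le> bform I F u u + 2 * t * b"
    using psd[of "\<lambda>i. u i + t * v i"] unfolding bform_square_add[OF sym] v b_def by simp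
  also have "\<dots> = - 1" using \<open>b \<noteq> 0\<close> by (simp add: t_def field_simps)
  finally show False by simp
qed

lemma generalized_eigenvector:
  assumes fin: "finite I" and ne: "I \<noteq> {}" and A0: "pd_on I A0" and A1: "sym_on I A1"
  shows "\<exists>d v. bform I A0 v v = 1 \<and> (\<forall>u. bform I A1 u v = d * bform I A0 u v)"
proof -
  \<comment> \<open>At \<open>d = Inf S\<close>, the largest Rayleigh quotient, \<open>d * A0 - A1\<close> is semidefinite but not coercive.\<close>
  define S where "S = {d. \<forall>v. bform I A1 v v \<le> d * bform I A0 v v}"
  obtain c where c: "c > 0" "\<And>v. c * (\<Sum>i\<in>I. (v i)\<^sup>2) \<le> bform I A0 v v"
    using pd_on_coercive[OF fin A0] by blast
  obtain M where M: "M > 0" "\<And>v. \<bar>bform I A1 v v\<bar> \<le> M * (\<Sum>i\<in>I. (v i)\<^sup>2)"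
    using bform_bounded[OF fin, of A1] by blast
  obtain M0 where M0: "M0 > 0" "\<And>v. \<bar>bform I A0 v v\<bar> \<le> M0 * (\<Sum>i\<in>I. (v i)\<^sup>2)"
    using bform_bounded[OF fin, of A0] by blast
  obtain r where r: "r \<in> I" using ne by blast
  define e :: "'a \<Rightarrow> real" where "e = (\<lambda>i. if i = r then 1 else 0)"
  have e: "bform I A0 e e > 0" using r by (intro pd_on_pos[OF A0, of r]) (auto simp: e_def)
  have "M / c \<in> S"
  proof -
    have "bform I A1 v v \<le> M / c * bform I A0 v v" for v
    proof -
      have "bform I A1 v v \<le> M / c * (c * (\<Sum>i\<in>I. (v i)\<^sup>2))" using M(2)[of v] c by simp
      also have "\<dots> \<le> M / c * bform I A0 v v" using c M by (intro mult_left_mono) auto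
      finally show ?thesis .
    qed
    then show ?thesis by (simp add: S_def)
  qed
  have bdd: "bdd_below S"
  proof (rule bdd_belowI)
    fix d assume "d \<in> S"
    then have "bform I A1 e e \<le> d * bform I A0 e e" by (simp add: S_def)
    then show "bform I A1 e e / bform I A0 e e \<le> d" using e by (simp add: field_simps)
  qed
  define d where "d = Inf S"
  define F where "F = (\<lambda>i j. d * A0 i j + (- 1) * A1 i j)"
  have Ff: "bform I F u v = d * bform I A0 u v - bform I A1 u v" for u v
    unfolding F_def bform_lin_mat by simp
  have Fsym: "sym_on I F" using A1 pd_on_sym[OF A0] by (auto simp: F_def sym_on_def)
  have psd: "bform I F v v \<ge> 0" for v
  proof (cases "bform I A0 v v = 0")
    case True
    then have "\<not> (\<exists>i\<in>I. v i \<noteq> 0)" using pd_on_pos[OF A0] by fastforce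
    then show ?thesis by (simp add: bform_zero_left)
  next
    case False
    then have pos: "bform I A0 v v > 0" using pd_on_nonneg[OF A0, of v] by simp
    have "bform I A1 v v / bform I A0 v v \<le> d"
      unfolding d_def
    proof (rule cInf_greatest)
      show "S \<noteq> {}" using \<open>M / c \<in> S\<close> by blast
      show "bform I A1 v v / bform I A0 v v \<le> x" if "x \<in> S" for x
        using that pos by (simp add: S_def field_simps)
    qed
    then show ?thesis using pos by (simp add: Ff field_simps)
  qed
  have "\<not> pd_on I F"
  proof
    assume "pd_on I F"
    then obtain k where k: "k > 0" "\<And>v. k * (\<Sum>i\<in>I. (v i)\<^sup>2) \<le> bform I F v v"
      using pd_on_coercive[OF fin] by blast
    have "bform I A1 v v \<le> (d - k / M0) * bform I A0 v v" for v
    proof -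
      have "k / M0 * bform I A0 v v \<le> k / M0 * (M0 * (\<Sum>i\<in>I. (v i)\<^sup>2))"
        using M0(1) M0(2)[of v] k by (intro mult_left_mono) auto
      also have "\<dots> = k * (\<Sum>i\<in>I. (v i)\<^sup>2)" using M0 by simp
      also have "\<dots> \<le> bform I F v v" by (rule k)
      finally show ?thesis by (simp add: Ff algebra_simps)
    qed
    then have "d - k / M0 \<in> S" by (simp add: S_def)
    then have "d \<le> d - k / M0" unfolding d_def by (rule cInf_lower[OF _ bdd])
    then show False using divide_pos_pos[OF k(1) M0(1)] by simp
  qed
  then obtain w i where w: "i \<in> I" "w i \<noteq> 0" "bform I F w w \<le> 0"
    using Fsym by (auto simp: pd_on_def not_less)
  then have "bform I F w w = 0" using psd[of w] by simp
  note null = psd_null[OF Fsym psd this]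
  define a where "a = 1 / sqrt (bform I A0 w w)"
  have pos: "bform I A0 w w > 0" using pd_on_pos[OF A0, of i w] w by simp
  then have a2: "a * a * bform I A0 w w = 1" by (simp add: a_def)
  define v where "v = (\<lambda>i. a * w i)"
  have "bform I A0 v v = 1" using a2 by (simp add: v_def bform_bilinear mult.assoc)
  moreover have "bform I A1 u v = d * bform I A0 u v" for u
    using null[of u] unfolding Ff by (simp add: v_def bform_bilinear)
  ultimately show ?thesis by blast
qed

text \<open>Deflation: subtracting from both forms their part along a generalized eigenvector
  \<open>v\<close> leaves forms that vanish on \<open>v\<close>. These are determined by the
  coordinates other than one \<open>r\<close> with \<open>v r \<noteq> 0\<close>, and there the
  first one is still positive definite.\<close>

lemma simultaneous_diagonalization_forms:
  assumes "finite I" "pd_on I A0" "sym_on I A1"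
  shows "\<exists>C d. \<forall>x. bform I A0 x x = (\<Sum>k\<in>I. (\<Sum>i\<in>I. C k i * x i)\<^sup>2)
                  \<and> bform I A1 x x = (\<Sum>k\<in>I. d k * (\<Sum>i\<in>I. C k i * x i)\<^sup>2)"
  using assms
proof (induction "card I" arbitrary: I A0 A1)
  case 0
  then show ?case by (auto simp: bform_def)
next
  case (Suc n)
  note fin = Suc.prems(1) and A0 = Suc.prems(2) and A1 = Suc.prems(3)
  have "I \<noteq> {}" using Suc.hyps(2) by auto
  then obtain d v where v: "bform I A0 v v = 1" "\<And>u. bform I A1 u v = d * bform I A0 u v"
    using generalized_eigenvector[OF fin _ A0 A1] by blast
  have "\<exists>r\<in>I. v r \<noteq> 0"
    using v(1) bform_zero_left[of I v A0 v] by (metis zero_neq_one)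
  then obtain r where r: "r \<in> I" "v r \<noteq> 0" by blast
  define J where "J = I - {r}"
  have J: "finite J" "r \<notin> J" "I = insert r J" using fin r by (auto simp: J_def)
  define l where "l = (\<lambda>i. \<Sum>j\<in>I. A0 i j * v j)"
  have l: "(\<Sum>i\<in>I. l i * x i) = bform I A0 x v" for x
    by (simp add: l_def bform_def sum_distrib_left sum_distrib_right mult_ac)
  define B0 where "B0 = (\<lambda>i j. 1 * A0 i j + (- 1) * (l i * l j))"
  define B1 where "B1 = (\<lambda>i j. 1 * A1 i j + (- d) * (l i * l j))"
  have B0f: "bform I B0 x y = bform I A0 x y - bform I A0 x v * bform I A0 y v" for x y
    unfolding B0_def bform_lin_mat bform_outer[OF fin] l by simp
  have B1f: "bform I B1 x y = bform I A1 x y - d * (bform I A0 x v * bform I A0 y v)" for x y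
    unfolding B1_def bform_lin_mat bform_outer[OF fin] l by simp
  have B0s: "sym_on I B0" and B1s: "sym_on I B1"
    using pd_on_sym[OF A0] A1 by (auto simp: B0_def B1_def sym_on_def)
  have B0v: "bform I B0 x v = 0" and B1v: "bform I B1 x v = 0" for x
    by (simp_all add: B0f B1f v)
  define P where "P = (\<lambda>x i. x i + (- (x r / v r)) * v i)"
  have Pr: "P x r = 0" for x using r by (simp add: P_def)
  have restrict: "bform I B x x = bform J B x x" if "x r = 0" for x B
    using J that by (simp add: bform_def)
  have B0P: "bform I B0 x x = bform J B0 (P x) (P x)" for x
    using restrict[of "P x" B0, OF Pr] bform_square_add[OF B0s, of x "- (x r / v r)" v]
    by (simp add: P_def B0v)
  have B1P: "bform I B1 x x = bform J B1 (P x) (P x)" for x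
    using restrict[of "P x" B1, OF Pr] bform_square_add[OF B1s, of x "- (x r / v r)" v]
    by (simp add: P_def B1v)
  have pd: "pd_on J B0"
    unfolding pd_on_def
  proof safe
    show "sym_on J B0" using B0s by (auto simp: sym_on_def J_def)
  next
    fix x :: "'a \<Rightarrow> real" and i assume i: "i \<in> J" "x i \<noteq> 0"
    define w where "w = x(r := 0)"
    define s where "s = bform I A0 w v"
    \<comment> \<open>Removing the component along \<open>v\<close> turns the deflated form at
      \<open>w\<close> into \<open>A0\<close> at \<open>y\<close>. The vector \<open>y\<close> is
      not zero: if \<open>s\<close> is not 0, then \<open>y\<close> does not vanish at
      \<open>r\<close>, since \<open>w\<close> does and \<open>v\<close> does not.\<close>
    define y where "y = (\<lambda>i. w i + (- s) * v i)"
    have "\<exists>k\<in>I. y k \<noteq> 0"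
    proof (cases "s = 0")
      case True
      then show ?thesis using i J by (intro bexI[of _ i]) (auto simp: y_def w_def)
    next
      case False
      then show ?thesis using r by (intro bexI[of _ r]) (auto simp: y_def w_def)
    qed
    then have "0 < bform I A0 y y" using pd_on_pos[OF A0] by blast
    also have "\<dots> = bform I B0 w w"
      unfolding y_def bform_square_add[OF pd_on_sym[OF A0]] B0f
      by (simp add: v s_def[symmetric] power2_eq_square)
    also have "\<dots> = bform J B0 w w" by (rule restrict) (simp add: w_def)
    also have "\<dots> = bform J B0 x x"
      using J by (intro bform_cong) (auto simp: w_def)
    finally show "0 < bform J B0 x x" .
  qed
  have "n = card J" using Suc.hyps(2) J by simp
  from Suc.hyps(1)[OF this J(1) pd, of B1] B1s obtain C' d' where
    C': "\<And>x. bform J B0 x x = (\<Sum>k\<in>J. (\<Sum>i\<in>J. C' k i * x i)\<^sup>2)"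
        "\<And>x. bform J B1 x x = (\<Sum>k\<in>J. d' k * (\<Sum>i\<in>J. C' k i * x i)\<^sup>2)"
    unfolding sym_on_def J(3) by blast
  \<comment> \<open>Coefficients of the old functionals composed with \<open>P\<close>: the entry at
    \<open>r\<close> collects what \<open>P\<close> subtracts along \<open>v\<close>. Row
    \<open>r\<close> is the new functional, \<open>A0\<close> against \<open>v\<close>.\<close>
  define C where "C = (\<lambda>k i. if k = r then l i
      else if i = r then - (\<Sum>i\<in>J. C' k i * v i) / v r else C' k i)"
  define D where "D = d'(r := d)"
  have CJ: "(\<Sum>i\<in>I. C k i * x i) = (\<Sum>i\<in>J. C' k i * P x i)" if "k \<in> J" for k x
  proof -
    have "k \<noteq> r" using that J by auto
    have "(\<Sum>i\<in>I. C k i * x i) = C k r * x r + (\<Sum>i\<in>J. C k i * x i)" using J by simp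
    also have "(\<Sum>i\<in>J. C k i * x i) = (\<Sum>i\<in>J. C' k i * x i)"
      using J \<open>k \<noteq> r\<close> by (intro sum.cong) (auto simp: C_def)
    also have "C k r * x r = (\<Sum>i\<in>J. C' k i * ((- (x r / v r)) * v i))"
      using \<open>k \<noteq> r\<close> by (simp add: C_def sum_distrib_left sum_negf sum_divide_distrib mult_ac
          flip: sum_distrib_right)
    finally show ?thesis unfolding P_def distrib_left sum.distrib by simp
  qed
  have Cr: "(\<Sum>i\<in>I. C r i * x i) = bform I A0 x v" for x
    by (simp add: C_def l)
  have D: "D k = d' k" if "k \<in> J" for k using that J by (auto simp: D_def)
  have Dr: "D r = d" by (simp add: D_def)
  have "bform I A0 x x = (\<Sum>k\<in>I. (\<Sum>i\<in>I. C k i * x i)\<^sup>2)" for x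
  proof -
    have "bform I A0 x x = (bform I A0 x v)\<^sup>2 + bform I B0 x x"
      by (simp add: B0f power2_eq_square)
    also have "\<dots> = (\<Sum>i\<in>I. C r i * x i)\<^sup>2 + (\<Sum>k\<in>J. (\<Sum>i\<in>I. C k i * x i)\<^sup>2)"
      by (simp add: Cr B0P C' CJ cong: sum.cong)
    also have "\<dots> = (\<Sum>k\<in>insert r J. (\<Sum>i\<in>I. C k i * x i)\<^sup>2)"
      using J(1,2) by simp
    finally show ?thesis using J(3) by simp
  qed
  moreover have "bform I A1 x x = (\<Sum>k\<in>I. D k * (\<Sum>i\<in>I. C k i * x i)\<^sup>2)" for x
  proof -
    have "bform I A1 x x = d * (bform I A0 x v)\<^sup>2 + bform I B1 x x"
      by (simp add: B1f power2_eq_square)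
    also have "\<dots> = D r * (\<Sum>i\<in>I. C r i * x i)\<^sup>2 + (\<Sum>k\<in>J. D k * (\<Sum>i\<in>I. C k i * x i)\<^sup>2)"
      by (simp add: Cr B1P C' CJ D Dr cong: sum.cong)
    also have "\<dots> = (\<Sum>k\<in>insert r J. D k * (\<Sum>i\<in>I. C k i * x i)\<^sup>2)"
      using J(1,2) by simp
    finally show ?thesis using J(3) by simp
  qed
  ultimately show ?case by (intro exI[of _ C] exI[of _ D] allI conjI)
qed

lemma sum_rotate:
  "(\<Sum>i\<in>A. \<Sum>j\<in>B. \<Sum>k\<in>D. f i j k) = (\<Sum>k\<in>D. \<Sum>i\<in>A. \<Sum>j\<in>B. f i j k)"
  by (rule trans[OF sum.cong[OF refl sum.swap] sum.swap])

lemma bform_congruence: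
  "bform I (\<lambda>i j. \<Sum>k\<in>K. e k * C k i * C k j) x x = (\<Sum>k\<in>K. e k * (\<Sum>i\<in>I. C k i * x i)\<^sup>2)"
proof -
  have "bform I (\<lambda>i j. \<Sum>k\<in>K. e k * C k i * C k j) x x
      = (\<Sum>i\<in>I. \<Sum>j\<in>I. \<Sum>k\<in>K. e k * ((C k i * x i) * (C k j * x j)))"
    unfolding bform_def
    by (intro sum.cong refl) (simp add: sum_distrib_right sum_distrib_left mult_ac)
  also have "\<dots> = (\<Sum>k\<in>K. \<Sum>i\<in>I. \<Sum>j\<in>I. e k * ((C k i * x i) * (C k j * x j)))"
    by (rule sum_rotate)
  also have "\<dots> = (\<Sum>k\<in>K. e k * (\<Sum>i\<in>I. C k i * x i)\<^sup>2)"
    by (simp only: power2_eq_square sum_product) (simp only: sum_distrib_left)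
  finally show ?thesis .
qed

lemma simultaneous_diagonalization:
  assumes fin: "finite I" and A0: "pd_on I A0" and A1: "sym_on I A1"
  obtains C d where "\<And>i j. i \<in> I \<Longrightarrow> j \<in> I \<Longrightarrow> A0 i j = (\<Sum>k\<in>I. C k i * C k j)"
    and "\<And>i j. i \<in> I \<Longrightarrow> j \<in> I \<Longrightarrow> A1 i j = (\<Sum>k\<in>I. d k * C k i * C k j)"
proof -
  obtain C d where C: "\<And>x. bform I A0 x x = (\<Sum>k\<in>I. (\<Sum>i\<in>I. C k i * x i)\<^sup>2)"
    "\<And>x. bform I A1 x x = (\<Sum>k\<in>I. d k * (\<Sum>i\<in>I. C k i * x i)\<^sup>2)"
    using simultaneous_diagonalization_forms[OF assms] by blast
  have s: "sym_on I (\<lambda>i j. \<Sum>k\<in>I. e k * C k i * C k j)" for e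
    by (simp add: sym_on_def mult_ac)
  have "A0 i j = (\<Sum>k\<in>I. C k i * C k j)" if "i \<in> I" "j \<in> I" for i j
    using sym_form_eqD[OF fin pd_on_sym[OF A0] s[of "\<lambda>_. 1"] _ that] bform_congruence[of I "\<lambda>_. 1" C I]
    by (simp add: C)
  moreover have "A1 i j = (\<Sum>k\<in>I. d k * C k i * C k j)" if "i \<in> I" "j \<in> I" for i j
    using sym_form_eqD[OF fin A1 s[of d] _ that] bform_congruence[of I d C I] by (simp add: C)
  ultimately show ?thesis using that by blast
qed

section \<open>Determinants\<close>

definition fdet :: "nat \<Rightarrow> (nat \<Rightarrow> nat \<Rightarrow> real) \<Rightarrow> real" where
  "fdet q A = Determinant.det (Matrix.mat q q (\<lambda>(i, j). A i j))"

lemma fdet_cong: "(\<And>i j. i < q \<Longrightarrow> j < q \<Longrightarrow> A i j = B i j) \<Longrightarrow> fdet q A = fdet q B"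
  unfolding fdet_def by (intro arg_cong[of _ _ Determinant.det] eq_matI) auto

lemma fdet_mult: "fdet q (\<lambda>i j. \<Sum>k<q. A i k * B k j) = fdet q A * fdet q B"
proof -
  have "Matrix.mat q q (\<lambda>(i, j). \<Sum>k<q. A i k * B k j)
      = Matrix.mat q q (\<lambda>(i, j). A i j) * Matrix.mat q q (\<lambda>(i, j). B i j)"
    by (intro eq_matI) (auto simp: scalar_prod_def lessThan_atLeast0)
  then show ?thesis unfolding fdet_def by (simp add: Determinant.det_mult[of _ q])
qed

lemma fdet_transpose: "fdet q (\<lambda>i j. A j i) = fdet q A"
proof -
  have "Matrix.mat q q (\<lambda>(i, j). A j i) = transpose_mat (Matrix.mat q q (\<lambda>(i, j). A i j))"
    by (intro eq_matI) auto
  then show ?thesis unfolding fdet_def by (simp add: Determinant.det_transpose[of _ q])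
qed

lemma fdet_smult: "fdet q (\<lambda>i j. c * A i j) = c ^ q * fdet q A"
proof -
  have "Matrix.mat q q (\<lambda>(i, j). c * A i j) = c \<cdot>\<^sub>m Matrix.mat q q (\<lambda>(i, j). A i j)"
    by (intro eq_matI) auto
  then show ?thesis unfolding fdet_def by simp
qed

lemma fdet_block:
  assumes "\<And>j. j < q \<Longrightarrow> A q j = 0"
  shows "fdet (Suc q) A = A q q * fdet q A"
proof -
  have "Matrix.mat (Suc q) (Suc q) (\<lambda>(i, j). A i j)
     = four_block_mat (Matrix.mat q q (\<lambda>(i, j). A i j)) (Matrix.mat q 1 (\<lambda>(i, j). A i q))
         (0\<^sub>m 1 q) (Matrix.mat 1 1 (\<lambda>(i, j). A q q))"
    using assms by (intro eq_matI) (auto simp: four_block_mat_def Let_def less_Suc_eq)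
  then have "fdet (Suc q) A = fdet q A * Determinant.det (Matrix.mat 1 1 (\<lambda>(i, j). A q q))"
    unfolding fdet_def by (simp add: det_four_block_mat_lower_left_zero[of _ q _ 1])
  also have "Determinant.det (Matrix.mat 1 1 (\<lambda>(i, j). A q q)) = A q q"
    by (subst det_single) auto
  finally show ?thesis by simp
qed

lemma fdet_diag: "fdet q (\<lambda>i j. if i = j then e i else 0) = (\<Prod>i<q. e i)"
proof (induction q)
  case 0
  then show ?case by (simp add: fdet_def)
next
  case (Suc q)
  then show ?case by (subst fdet_block) auto
qed

text \<open>Multiplying by the unit triangular \<open>E\<close> adds multiples of the last column to
  the others and clears the last row off the diagonal.\<close>

lemma fdet_schur:
  assumes "A q q \<noteq> 0"
  shows "fdet (Suc q) A = A q q * fdet q (\<lambda>i j. A i j - A i q * A q j / A q q)"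
proof -
  define E where "E = (\<lambda>i j. if i = j then 1 else if i = q then - A q j / A q q else 0)"
  define B where "B = (\<lambda>i j. \<Sum>k<Suc q. A i k * E k j)"
  have E: "fdet (Suc q) E = 1"
  proof -
    have "fdet (Suc q) E = fdet (Suc q) (\<lambda>i j. E j i)" by (rule fdet_transpose[symmetric])
    also have "\<dots> = fdet q (\<lambda>i j. E j i)" by (subst fdet_block) (auto simp: E_def)
    also have "\<dots> = fdet q (\<lambda>i j. if i = j then 1 else 0)" by (rule fdet_cong) (auto simp: E_def)
    finally show ?thesis by (simp add: fdet_diag)
  qed
  have B: "B i j = A i j - A i q * A q j / A q q" if "j < q" for i j
  proof -
    have "(\<Sum>k<q. A i k * E k j) = (\<Sum>k<q. if k = j then A i j else 0)"
      using that by (intro sum.cong) (auto simp: E_def)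
    then show ?thesis using that by (simp add: B_def E_def)
  qed
  have Bq: "B q q = A q q"
    by (simp add: B_def) (simp add: E_def)
  have "fdet (Suc q) A = fdet (Suc q) B"
    unfolding B_def fdet_mult E by simp
  also have "\<dots> = B q q * fdet q B"
    using assms by (intro fdet_block) (simp add: B)
  also have "fdet q B = fdet q (\<lambda>i j. A i j - A i q * A q j / A q q)"
    by (intro fdet_cong) (simp add: B)
  finally show ?thesis by (simp add: Bq)
qed

lemma fdet_pos: "pd_on {..<q} A \<Longrightarrow> fdet q A > 0"
proof (induction q arbitrary: A)
  case 0
  then show ?case by (simp add: fdet_def)
next
  case (Suc q)
  have pd: "pd_on (insert q {..<q}) A" using Suc.prems by (simp add: lessThan_Suc)
  have "A q q > 0" using pd_on_diag_pos[OF _ Suc.prems, of q] by simp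
  then show ?case using Suc.IH[OF pd_on_schur[OF _ _ pd]] by (subst fdet_schur) auto
qed

text \<open>Solved by the adjugate matrix. It supplies vectors dual to the rows of a matrix and the
  common centre of two normal densities.\<close>

lemma linear_system_solvable:
  assumes "fdet q A \<noteq> 0"
  shows "\<exists>y. \<forall>i<q. (\<Sum>j<q. A i j * y j) = b i"
proof -
  define M where "M = Matrix.mat q q (\<lambda>(i, j). A i j)"
  have M: "M \<in> carrier_mat q q" by (simp add: M_def)
  have d: "Determinant.det M \<noteq> 0" using assms by (simp add: M_def fdet_def)
  define K where "K = adj_mat M"
  have K: "K \<in> carrier_mat q q" using adj_mat(1)[OF M] by (simp add: K_def)
  have MK: "(\<Sum>j<q. A i j * K $$ (j, k)) = (if i = k then Determinant.det M else 0)"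
    if "i < q" "k < q" for i k
  proof -
    have "(M * K) $$ (i, k) = (Determinant.det M \<cdot>\<^sub>m 1\<^sub>m q) $$ (i, k)"
      using adj_mat(2)[OF M] by (simp add: K_def)
    then show ?thesis using that M K by (simp add: scalar_prod_def lessThan_atLeast0 M_def)
  qed
  define y where "y = (\<lambda>j. (\<Sum>k<q. K $$ (j, k) * b k) / Determinant.det M)"
  have "(\<Sum>j<q. A i j * y j) = b i" if i: "i < q" for i
  proof -
    have "(\<Sum>j<q. A i j * y j) = (\<Sum>j<q. \<Sum>k<q. A i j * K $$ (j, k) * b k) / Determinant.det M"
      unfolding y_def by (simp add: sum_distrib_left sum_divide_distrib mult.assoc)
    also have "(\<Sum>j<q. \<Sum>k<q. A i j * K $$ (j, k) * b k) = (\<Sum>k<q. (\<Sum>j<q. A i j * K $$ (j, k)) * b k)"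
      by (subst sum.swap) (simp add: sum_distrib_right)
    also have "\<dots> = (\<Sum>k<q. if i = k then Determinant.det M * b k else 0)"
      using MK[OF i] by (intro sum.cong) auto
    also have "\<dots> = Determinant.det M * b i" using i by simp
    finally show ?thesis using d by simp
  qed
  then show ?thesis by blast
qed

lemma fdet_congruence: "fdet q (\<lambda>i j. \<Sum>k<q. e k * C k i * C k j) = (fdet q C)\<^sup>2 * (\<Prod>k<q. e k)"
proof -
  have "fdet q (\<lambda>i j. \<Sum>k<q. e k * C k i * C k j)
      = fdet q (\<lambda>i j. \<Sum>k<q. C k i * (\<Sum>l<q. (if k = l then e k else 0) * C l j))"
  proof (intro fdet_cong sum.cong refl)
    fix i j k assume "k \<in> {..<q}"
    then have "(\<Sum>l<q. (if k = l then e k else 0) * C l j) = e k * C k j"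
      by (subst sum.cong[OF refl, of _ _ "\<lambda>l. if k = l then e k * C k j else 0"]) auto
    then show "e k * C k i * C k j = C k i * (\<Sum>l<q. (if k = l then e k else 0) * C l j)" by simp
  qed
  also have "\<dots> = fdet q C * ((\<Prod>k<q. e k) * fdet q C)"
    unfolding fdet_mult fdet_diag fdet_transpose[of q C] ..
  finally show ?thesis by (simp add: power2_eq_square)
qed

section \<open>Determinant bound for the Hellinger affinity\<close>

lemma sum_triple_product:
  fixes e :: "nat \<Rightarrow> real"
  shows "(\<Sum>i<q. \<Sum>j<q. (\<Sum>k<q. e k * C k i * C k j)\<^sup>2)
    = (\<Sum>k<q. \<Sum>l<q. e k * e l * (\<Sum>i<q. C k i * C l i)\<^sup>2)"
proof -
  have "(\<Sum>i<q. \<Sum>j<q. (\<Sum>k<q. e k * C k i * C k j)\<^sup>2)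
      = (\<Sum>i<q. \<Sum>j<q. \<Sum>k<q. \<Sum>l<q. e k * e l * ((C k i * C l i) * (C k j * C l j)))"
    by (simp add: power2_eq_square sum_product mult_ac)
  also have "\<dots> = (\<Sum>i<q. \<Sum>k<q. \<Sum>l<q. \<Sum>j<q. e k * e l * ((C k i * C l i) * (C k j * C l j)))"
    by (intro sum.cong refl sum_rotate[symmetric])
  also have "\<dots> = (\<Sum>k<q. \<Sum>l<q. \<Sum>i<q. \<Sum>j<q. e k * e l * ((C k i * C l i) * (C k j * C l j)))"
    by (rule sum_rotate[symmetric])
  also have "\<dots> = (\<Sum>k<q. \<Sum>l<q. e k * e l * (\<Sum>i<q. C k i * C l i)\<^sup>2)"
    by (simp only: power2_eq_square sum_product) (simp only: sum_distrib_left)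
  finally show ?thesis .
qed

text \<open>The quotient 4 d / (1 + d)^2 is the fourth power of the affinity of two centred normal
  laws on the line whose precisions have the ratio \<open>d\<close>. It decays only like 1/d for
  large \<open>d\<close>, hence the truncated exponent. As (1 + d)^2 = 4 d + (d - 1)^2, the claim
  reduces to 4 d x <= (d - 1)^2.\<close>

lemma hellinger_factor_ge:
  fixes d :: real assumes "d > 0"
  shows "4 * d * exp (min ((d - 1)\<^sup>2) 1 / 16) \<le> (1 + d)\<^sup>2"
proof -
  define x where "x = min ((d - 1)\<^sup>2) 1 / 8"
  have x: "0 \<le> x" "x \<le> 1" by (auto simp: x_def)
  have "exp (x / 2) \<le> 1 + x / 2 + (x / 2)\<^sup>2"
    using x by (intro exp_bound) auto
  also have "\<dots> \<le> 1 + x"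
    using x mult_left_mono[of x 1 x] by (simp add: power2_eq_square)
  finally have e: "exp (x / 2) \<le> 1 + x" .
  have "4 * d * x \<le> (d - 1)\<^sup>2"
  proof (cases "d \<le> 2")
    case True
    have "4 * d * x \<le> 4 * 2 * ((d - 1)\<^sup>2 / 8)"
      using True assms x by (intro mult_mono) (auto simp: x_def)
    then show ?thesis by simp
  next
    case False
    have "4 * d * x \<le> 4 * d * (1 / 8)" using assms by (intro mult_left_mono) (auto simp: x_def)
    also have "\<dots> \<le> (d - 1)\<^sup>2"
    proof -
      have "0 \<le> (d - 2) * (2 * d - 1)" using False by (intro mult_nonneg_nonneg) auto
      then show ?thesis by (simp add: power2_eq_square algebra_simps)
    qed
    finally show ?thesis .
  qed
  then have "4 * d * (1 + x) \<le> (1 + d)\<^sup>2"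
    by (simp add: power2_eq_square algebra_simps)
  moreover have "4 * d * exp (x / 2) \<le> 4 * d * (1 + x)" using e assms by simp
  ultimately show ?thesis by (simp add: x_def)
qed

lemma sum_min_one_ge:
  fixes f :: "'a \<Rightarrow> real"
  assumes "finite S" "\<And>i. i \<in> S \<Longrightarrow> f i \<ge> 0"
  shows "min (sum f S) 1 \<le> (\<Sum>i\<in>S. min (f i) 1)"
  using assms
proof (induction rule: finite_induct)
  case (insert x F)
  have "(\<Sum>i\<in>F. min (f i) 1) \<ge> 0" using insert by (intro sum_nonneg) auto
  moreover have "f x \<ge> 0" "min (sum f F) 1 \<le> (\<Sum>i\<in>F. min (f i) 1)" using insert by auto
  ultimately show ?case using insert.hyps by (simp add: min_def split: if_splits)
qed auto

text \<open>After simultaneous diagonalisation the determinants factor over the relative eigenvalues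
  \<open>d k\<close>, to which \<open>hellinger_factor_ge\<close> applies. The upper bound is on
  \<open>A0\<close> alone: the prior bounds precision matrices from below only, so \<open>A1\<close>
  may be arbitrarily large.\<close>

lemma affinity_det_bound:
  fixes A0 A1 :: "nat \<Rightarrow> nat \<Rightarrow> real"
  assumes A0: "pd_on {..<q} A0" and A1: "pd_on {..<q} A1" and \<beta>: "\<beta> > 0"
    and up: "\<And>v. bform {..<q} A0 v v \<le> \<beta> * (\<Sum>i<q. (v i)\<^sup>2)"
  shows "fdet q A0 * fdet q A1 * exp (min ((\<Sum>i<q. \<Sum>j<q. (A1 i j - A0 i j)\<^sup>2) / \<beta>\<^sup>2) 1 / 16)
       \<le> (fdet q (\<lambda>i j. (A0 i j + A1 i j) / 2))\<^sup>2"
proof -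
  obtain C d where C: "\<And>i j. i \<in> {..<q} \<Longrightarrow> j \<in> {..<q} \<Longrightarrow> A0 i j = (\<Sum>k<q. C k i * C k j)"
    "\<And>i j. i \<in> {..<q} \<Longrightarrow> j \<in> {..<q} \<Longrightarrow> A1 i j = (\<Sum>k<q. d k * C k i * C k j)"
    by (rule simultaneous_diagonalization[OF finite_lessThan A0 pd_on_sym[OF A1]]) (rule that; assumption)
  note C0 = C(1)[unfolded lessThan_iff] and C1 = C(2)[unfolded lessThan_iff]
  define D where "D = fdet q C"
  have det0: "fdet q A0 = D\<^sup>2"
    using fdet_congruence[of q "\<lambda>_. 1" C] fdet_cong[OF C0, of q] by (simp add: D_def)
  have det1: "fdet q A1 = D\<^sup>2 * (\<Prod>k<q. d k)"
    using fdet_congruence[of q d C] fdet_cong[OF C1, of q] by (simp add: D_def)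
  have det2: "fdet q (\<lambda>i j. (A0 i j + A1 i j) / 2) = D\<^sup>2 * (\<Prod>k<q. (1 + d k) / 2)"
    unfolding D_def fdet_congruence[symmetric]
    by (intro fdet_cong)
       (simp add: C0 C1 sum.distrib[symmetric] sum_divide_distrib algebra_simps add_divide_distrib)
  have D: "D \<noteq> 0" using fdet_pos[OF A0] det0 by auto
  have form0: "bform {..<q} A0 x x = (\<Sum>k<q. (\<Sum>i<q. C k i * x i)\<^sup>2)" for x
    using bform_congruence[of "{..<q}" "\<lambda>_. 1" C "{..<q}" x]
      bform_cong[of "{..<q}" A0, OF C(1) refl refl, of x x] by simp
  have form1: "bform {..<q} A1 x x = (\<Sum>k<q. d k * (\<Sum>i<q. C k i * x i)\<^sup>2)" for x
    using bform_congruence[of "{..<q}" d C "{..<q}" x]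
      bform_cong[of "{..<q}" A1, OF C(2) refl refl, of x x] by simp
  have dpos: "d k > 0" if k: "k < q" for k
  proof -
    \<comment> \<open>The vector dual to row \<open>k\<close> of \<open>C\<close>; the form of
      \<open>A1\<close> has the value \<open>d k\<close> there.\<close>
    obtain x where x: "\<And>i. i < q \<Longrightarrow> (\<Sum>j<q. C i j * x j) = (if i = k then 1 else 0)"
      using linear_system_solvable[of q C "\<lambda>i. if i = k then 1 else 0"] D by (auto simp: D_def)
    have "\<exists>j<q. x j \<noteq> 0"
    proof (rule ccontr)
      assume "\<not> (\<exists>j<q. x j \<noteq> 0)"
      then have "(\<Sum>j<q. C k j * x j) = 0" by simp
      then show False using x[OF k] by simp
    qed
    then have "0 < bform {..<q} A1 x x" using pd_on_pos[OF A1] by auto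
    also have "\<dots> = (\<Sum>l<q. if l = k then d l else 0)"
      unfolding form1 by (intro sum.cong) (auto simp: x)
    also have "\<dots> = d k" using k by simp
    finally show ?thesis .
  qed
  \<comment> \<open>Gram matrix of the rows of \<open>C\<close>. The squared norm of its row
    \<open>k\<close> is the value of \<open>A0\<close> at row \<open>k\<close> of \<open>C\<close>,
    so \<open>up\<close> bounds it by \<beta> times the diagonal entry, and hence by the square of
    \<beta>.\<close>
  define G where "G = (\<lambda>k l. \<Sum>i<q. C k i * C l i)"
  have Gsym: "G k l = G l k" for k l by (simp add: G_def mult_ac)
  have Gk: "(\<Sum>l<q. (G k l)\<^sup>2) \<le> \<beta> * G k k" for k
  proof -
    have "(\<Sum>l<q. (G k l)\<^sup>2) = bform {..<q} A0 (C k) (C k)"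
      unfolding form0 G_def by (simp add: mult_ac)
    also have "\<dots> \<le> \<beta> * G k k" using up[of "C k"] by (simp add: G_def power2_eq_square)
    finally show ?thesis .
  qed
  have Gb: "(\<Sum>l<q. (G k l)\<^sup>2) \<le> \<beta>\<^sup>2" if k: "k < q" for k
  proof -
    have "(G k k)\<^sup>2 \<le> (\<Sum>l<q. (G k l)\<^sup>2)" using k by (intro member_le_sum) auto
    then have "G k k * G k k \<le> \<beta> * G k k" using Gk[of k] by (simp add: power2_eq_square)
    moreover have "G k k \<ge> 0" unfolding G_def by (intro sum_nonneg) auto
    ultimately have "G k k \<le> \<beta>" using \<beta> by (cases "G k k = 0") (auto simp: mult_le_cancel_right)
    then have "\<beta> * G k k \<le> \<beta>\<^sup>2" using \<beta> by (simp add: power2_eq_square)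
    then show ?thesis using Gk[of k] by simp
  qed
  have "(\<Sum>i<q. \<Sum>j<q. (A1 i j - A0 i j)\<^sup>2) = (\<Sum>i<q. \<Sum>j<q. (\<Sum>k<q. (d k - 1) * C k i * C k j)\<^sup>2)"
    by (intro sum.cong refl) (simp add: C0 C1 algebra_simps sum_subtractf)
  also have "\<dots> = (\<Sum>k<q. \<Sum>l<q. (d k - 1) * (d l - 1) * (G k l)\<^sup>2)"
    unfolding sum_triple_product G_def ..
  \<comment> \<open>As in a Schur test, symmetrising the product of the two deviations leaves only
    row norms of \<open>G\<close>.\<close>
  also have "\<dots> \<le> (\<Sum>k<q. \<Sum>l<q. ((d k - 1)\<^sup>2 * (G k l)\<^sup>2 + (d l - 1)\<^sup>2 * (G l k)\<^sup>2) / 2)"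
  proof (intro sum_mono)
    fix k l
    have ab: "a * b \<le> (a\<^sup>2 + b\<^sup>2) / 2" for a b :: real
      using sum_squares_bound[of a b] by simp
    have "(d k - 1) * (d l - 1) \<le> ((d k - 1)\<^sup>2 + (d l - 1)\<^sup>2) / 2"
      by (rule ab)
    then have "(d k - 1) * (d l - 1) * (G k l)\<^sup>2 \<le> ((d k - 1)\<^sup>2 + (d l - 1)\<^sup>2) / 2 * (G k l)\<^sup>2"
      by (rule mult_right_mono) simp
    then show "(d k - 1) * (d l - 1) * (G k l)\<^sup>2
        \<le> ((d k - 1)\<^sup>2 * (G k l)\<^sup>2 + (d l - 1)\<^sup>2 * (G l k)\<^sup>2) / 2"
      unfolding Gsym[of l k] by (simp add: field_simps)
  qed
  also have "\<dots> = (\<Sum>k<q. (d k - 1)\<^sup>2 * (\<Sum>l<q. (G k l)\<^sup>2))"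
  proof -
    have "(\<Sum>k<q. \<Sum>l<q. (d l - 1)\<^sup>2 * (G l k)\<^sup>2) = (\<Sum>k<q. \<Sum>l<q. (d k - 1)\<^sup>2 * (G k l)\<^sup>2)"
      by (rule sum.swap)
    then show ?thesis
      unfolding add_divide_distrib sum.distrib sum_divide_distrib[symmetric] by (simp add: sum_distrib_left)
  qed
  also have "\<dots> \<le> (\<Sum>k<q. (d k - 1)\<^sup>2 * \<beta>\<^sup>2)"
    by (intro sum_mono mult_left_mono Gb) auto
  finally have F: "(\<Sum>i<q. \<Sum>j<q. (A1 i j - A0 i j)\<^sup>2) / \<beta>\<^sup>2 \<le> (\<Sum>k<q. (d k - 1)\<^sup>2)"
    using \<beta> by (simp add: pos_divide_le_eq sum_distrib_right)
  have "min ((\<Sum>i<q. \<Sum>j<q. (A1 i j - A0 i j)\<^sup>2) / \<beta>\<^sup>2) 1 \<le> min (\<Sum>k<q. (d k - 1)\<^sup>2) 1"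
    using F by simp
  also have "\<dots> \<le> (\<Sum>k<q. min ((d k - 1)\<^sup>2) 1)" by (intro sum_min_one_ge) auto
  finally have "exp (min ((\<Sum>i<q. \<Sum>j<q. (A1 i j - A0 i j)\<^sup>2) / \<beta>\<^sup>2) 1 / 16)
      \<le> (\<Prod>k<q. exp (min ((d k - 1)\<^sup>2) 1 / 16))"
    by (simp add: exp_sum[symmetric] sum_divide_distrib[symmetric])
  then have "fdet q A0 * fdet q A1 * exp (min ((\<Sum>i<q. \<Sum>j<q. (A1 i j - A0 i j)\<^sup>2) / \<beta>\<^sup>2) 1 / 16)
      \<le> fdet q A0 * fdet q A1 * (\<Prod>k<q. exp (min ((d k - 1)\<^sup>2) 1 / 16))"
    using fdet_pos[OF A0] fdet_pos[OF A1] by (intro mult_left_mono) auto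
  also have "\<dots> = (D\<^sup>2)\<^sup>2 * (\<Prod>k<q. d k * exp (min ((d k - 1)\<^sup>2) 1 / 16))"
    by (simp add: det0 det1 prod.distrib power2_eq_square)
  also have "\<dots> \<le> (D\<^sup>2)\<^sup>2 * (\<Prod>k<q. ((1 + d k) / 2)\<^sup>2)"
  proof (intro mult_left_mono prod_mono conjI)
    fix k assume k: "k \<in> {..<q}"
    show "0 \<le> d k * exp (min ((d k - 1)\<^sup>2) 1 / 16)" using dpos[of k] k by simp
    show "d k * exp (min ((d k - 1)\<^sup>2) 1 / 16) \<le> ((1 + d k) / 2)\<^sup>2"
      using hellinger_factor_ge[OF dpos[of k]] k by (simp add: power_divide)
  qed simp
  also have "\<dots> = (fdet q (\<lambda>i j. (A0 i j + A1 i j) / 2))\<^sup>2"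
    unfolding det2 power_mult_distrib prod_power_distrib ..
  finally show ?thesis .
qed

section \<open>Matrices as forms, eigenvalues as bounds of forms\<close>

lemma bform_mat:
  assumes "M \<in> carrier_mat q q" "u \<in> carrier_vec q" "v \<in> carrier_vec q"
  shows "scalar_prod u (M *\<^sub>v v) = bform {..<q} (\<lambda>i j. M $$ (i, j)) (vec_index u) (vec_index v)"
  using assms unfolding bform_def
  by (simp add: scalar_prod_def mult_mat_vec_def lessThan_atLeast0 sum_distrib_left mult_ac)

lemma pos_def_mat_iff:
  assumes M: "M \<in> carrier_mat q q"
  shows "pos_def_mat M \<longleftrightarrow> pd_on {..<q} (\<lambda>i j. M $$ (i, j))"
proof -
  have "transpose_mat M = M \<longleftrightarrow> sym_on {..<q} (\<lambda>i j. M $$ (i, j))"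
    using M by (auto simp: sym_on_def mat_eq_iff)
  moreover have "(\<forall>v\<in>carrier_vec (dim_row M). v \<noteq> 0\<^sub>v (dim_row M) \<longrightarrow> scalar_prod v (M *\<^sub>v v) > 0)
    \<longleftrightarrow> (\<forall>v. (\<exists>i\<in>{..<q}. v i \<noteq> 0) \<longrightarrow> bform {..<q} (\<lambda>i j. M $$ (i, j)) v v > 0)" (is "?L \<longleftrightarrow> ?R")
  proof
    assume L: ?L
    show ?R
    proof safe
      fix v :: "nat \<Rightarrow> real" and i assume i: "i < q" "v i \<noteq> 0"
      define w where "w = Matrix.vec q v"
      have w: "w \<in> carrier_vec q" by (simp add: w_def)
      have "w \<noteq> 0\<^sub>v q" using i by (auto simp: w_def vec_eq_iff)
      then have "0 < scalar_prod w (M *\<^sub>v w)" using L w M by auto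
      also have "\<dots> = bform {..<q} (\<lambda>i j. M $$ (i, j)) v v"
        unfolding bform_mat[OF M w w] by (intro bform_cong) (auto simp: w_def)
      finally show "0 < bform {..<q} (\<lambda>i j. M $$ (i, j)) v v" .
    qed
  next
    assume R: ?R
    show ?L
    proof (intro ballI impI)
      fix v :: "real Matrix.vec" assume v: "v \<in> carrier_vec (dim_row M)" "v \<noteq> 0\<^sub>v (dim_row M)"
      then have v': "v \<in> carrier_vec q" using M by auto
      then have "\<exists>i\<in>{..<q}. vec_index v i \<noteq> 0" using v M by (auto simp: vec_eq_iff)
      then show "0 < scalar_prod v (M *\<^sub>v v)" using R unfolding bform_mat[OF M v' v'] by blast
    qed
  qed
  ultimately show ?thesis by (simp add: pos_def_mat_def pd_on_def)
qed

text \<open>Spectral theorem by diagonalising against the identity form: \<open>C\<close> is then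
  orthogonal, its rows are eigenvectors, and each \<open>d k\<close> is an eigenvalue to which
  \<open>ev\<close> applies.\<close>

lemma eigenvalue_form_bounds:
  assumes M: "M \<in> carrier_mat q q" and sym: "sym_on {..<q} (\<lambda>i j. M $$ (i, j))"
    and ev: "\<And>e. eigenvalue M e \<Longrightarrow> lo \<le> e \<and> e \<le> hi"
  shows "lo * (\<Sum>i<q. (v i)\<^sup>2) \<le> bform {..<q} (\<lambda>i j. M $$ (i, j)) v v"
    and "bform {..<q} (\<lambda>i j. M $$ (i, j)) v v \<le> hi * (\<Sum>i<q. (v i)\<^sup>2)"
proof -
  define I :: "nat \<Rightarrow> nat \<Rightarrow> real" where "I = (\<lambda>i j. if i = j then 1 else 0)"
  have If: "bform {..<q} I x x = (\<Sum>i<q. (x i)\<^sup>2)" for x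
  proof -
    have "bform {..<q} I x x = (\<Sum>i<q. \<Sum>j<q. if i = j then (x i)\<^sup>2 else 0)"
      unfolding bform_def I_def by (intro sum.cong refl) (auto simp: power2_eq_square)
    then show ?thesis by simp
  qed
  have I: "pd_on {..<q} I"
    unfolding pd_on_def If
    by (auto simp: sym_on_def I_def intro!: sum_pos2)
  obtain C d where C: "\<And>i j. i \<in> {..<q} \<Longrightarrow> j \<in> {..<q} \<Longrightarrow> I i j = (\<Sum>k<q. C k i * C k j)"
    "\<And>i j. i \<in> {..<q} \<Longrightarrow> j \<in> {..<q} \<Longrightarrow> M $$ (i, j) = (\<Sum>k<q. d k * C k i * C k j)"
    by (rule simultaneous_diagonalization[OF finite_lessThan I sym]) (rule that; assumption)
  note C0 = C(1)[unfolded lessThan_iff] and C1 = C(2)[unfolded lessThan_iff]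
  define Cm where "Cm = Matrix.mat q q (\<lambda>(i, j). C i j)"
  have Cm: "Cm \<in> carrier_mat q q" by (simp add: Cm_def)
  have "transpose_mat Cm * Cm = 1\<^sub>m q"
    by (intro eq_matI) (auto simp: Cm_def scalar_prod_def C0[symmetric] I_def
        simp flip: lessThan_atLeast0)
  \<comment> \<open>Orthonormality passes from the columns of \<open>C\<close> to its rows, because
    a left inverse of a square matrix is also a right inverse.\<close>
  then have "Cm * transpose_mat Cm = 1\<^sub>m q"
    using mat_mult_left_right_inverse[of "transpose_mat Cm" q Cm] Cm by simp
  then have CC: "(\<Sum>j<q. C k j * C l j) = (if k = l then 1 else 0)" if "k < q" "l < q" for k l
  proof -
    have "(Cm * transpose_mat Cm) $$ (k, l) = (if k = l then 1 else 0)"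
      using \<open>Cm * transpose_mat Cm = 1\<^sub>m q\<close> that by simp
    then show ?thesis using that by (simp add: Cm_def scalar_prod_def lessThan_atLeast0)
  qed
  have d: "lo \<le> d k" "d k \<le> hi" if k: "k < q" for k
  proof -
    define v where "v = Matrix.vec q (C k)"
    have "v \<noteq> 0\<^sub>v q"
    proof
      assume "v = 0\<^sub>v q"
      then have "C k j = 0" if "j < q" for j using that by (auto simp: v_def vec_eq_iff)
      then show False using CC[OF k k] by simp
    qed
    moreover have "M *\<^sub>v v = d k \<cdot>\<^sub>v v"
    proof (rule eq_vecI)
      fix i assume "i < dim_vec (d k \<cdot>\<^sub>v v)"
      then have i: "i < q" by (simp add: v_def)
      have "vec_index (M *\<^sub>v v) i = (\<Sum>j<q. M $$ (i, j) * C k j)"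
        using i M by (simp add: scalar_prod_def v_def lessThan_atLeast0)
      also have "\<dots> = (\<Sum>j<q. \<Sum>l<q. d l * C l i * (C l j * C k j))"
        using i by (intro sum.cong refl) (simp add: C1 sum_distrib_left sum_distrib_right mult_ac)
      also have "\<dots> = (\<Sum>l<q. d l * C l i * (\<Sum>j<q. C l j * C k j))"
        by (subst sum.swap) (simp add: sum_distrib_left)
      also have "\<dots> = (\<Sum>l<q. if l = k then d l * C l i else 0)"
        by (intro sum.cong refl) (simp add: CC k)
      finally show "vec_index (M *\<^sub>v v) i = vec_index (d k \<cdot>\<^sub>v v) i"
        using i k by (simp add: v_def)
    qed (use M in \<open>auto simp: v_def\<close>)
    ultimately have "eigenvalue M (d k)"
      using M unfolding eigenvalue_def eigenvector_def by (intro exI[of _ v]) (auto simp: v_def)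
    then show "lo \<le> d k" "d k \<le> hi" using ev by auto
  qed
  have n: "(\<Sum>i<q. (v i)\<^sup>2) = (\<Sum>k<q. (\<Sum>i<q. C k i * v i)\<^sup>2)"
    using bform_congruence[of "{..<q}" "\<lambda>_. 1" C "{..<q}" v]
      bform_cong[of "{..<q}" I, OF C(1) refl refl, of v v] by (simp add: If)
  have m: "bform {..<q} (\<lambda>i j. M $$ (i, j)) v v = (\<Sum>k<q. d k * (\<Sum>i<q. C k i * v i)\<^sup>2)"
    using bform_congruence[of "{..<q}" d C "{..<q}" v]
      bform_cong[of "{..<q}" "\<lambda>i j. M $$ (i, j)", OF C(2) refl refl, of v v] by simp
  show "lo * (\<Sum>i<q. (v i)\<^sup>2) \<le> bform {..<q} (\<lambda>i j. M $$ (i, j)) v v"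
    unfolding n m sum_distrib_left using d by (intro sum_mono mult_right_mono) auto
  show "bform {..<q} (\<lambda>i j. M $$ (i, j)) v v \<le> hi * (\<Sum>i<q. (v i)\<^sup>2)"
    unfolding n m sum_distrib_left using d by (intro sum_mono mult_right_mono) auto
qed

section \<open>Gaussian integrals\<close>

text \<open>Normal density with mean \<mu> and precision matrix \<open>A\<close>, with the matrices
  and vectors of the sampling model read as functions.\<close>

definition nd :: "nat \<Rightarrow> (nat \<Rightarrow> nat \<Rightarrow> real) \<Rightarrow> (nat \<Rightarrow> real) \<Rightarrow> (nat \<Rightarrow> real) \<Rightarrow> real" where
  "nd q A \<mu> y = sqrt (fdet q A / (2 * pi) ^ q) *
     exp (- bform {..<q} A (\<lambda>k. y k - \<mu> k) (\<lambda>k. y k - \<mu> k) / 2)"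

abbreviation lborel_pow :: "nat \<Rightarrow> (nat \<Rightarrow> real) measure" where
  "lborel_pow q \<equiv> (\<Pi>\<^sub>M k\<in>{..<q}. lborel)"

interpretation lborel_prod: product_sigma_finite "\<lambda>_. lborel :: real measure"
  by standard

lemma bform_measurable [measurable]:
  assumes [measurable]: "\<And>i. i \<in> I \<Longrightarrow> u i \<in> borel_measurable M" "\<And>i. i \<in> I \<Longrightarrow> v i \<in> borel_measurable M"
    "\<And>i j. i \<in> I \<Longrightarrow> j \<in> I \<Longrightarrow> A i j \<in> borel_measurable M"
  shows "(\<lambda>x. bform I (\<lambda>i j. A i j x) (\<lambda>i. u i x) (\<lambda>i. v i x)) \<in> borel_measurable M"
  unfolding bform_def by measurable

lemma nd_measurable [measurable]: "nd q A \<mu> \<in> borel_measurable (lborel_pow q)"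
  unfolding nd_def[abs_def] by measurable

lemma nn_integral_exp_square:
  fixes a c :: real assumes a: "a > 0"
  shows "(\<integral>\<^sup>+t. ennreal (exp (- (a * (t + c)\<^sup>2) / 2)) \<partial>lborel) = ennreal (sqrt (2 * pi / a))"
proof -
  interpret N: prob_space "density lborel (\<lambda>x. ennreal (normal_density (- c) (1 / sqrt a) x))"
    by (rule prob_space_normal_density) (use a in simp)
  have 1: "(\<integral>\<^sup>+t. ennreal (normal_density (- c) (1 / sqrt a) t) \<partial>lborel) = 1"
    using N.emeasure_space_1 by (simp add: emeasure_density)
  have "exp (- (a * (t + c)\<^sup>2) / 2) = sqrt (2 * pi / a) * normal_density (- c) (1 / sqrt a) t" for t
    using a by (simp add: normal_density_def power_divide)
  then have "(\<integral>\<^sup>+t. ennreal (exp (- (a * (t + c)\<^sup>2) / 2)) \<partial>lborel)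
      = (\<integral>\<^sup>+t. ennreal (sqrt (2 * pi / a)) * ennreal (normal_density (- c) (1 / sqrt a) t) \<partial>lborel)"
    using a by (simp add: ennreal_mult')
  also have "\<dots> = ennreal (sqrt (2 * pi / a))"
    by (subst nn_integral_cmult) (auto simp: 1)
  finally show ?thesis .
qed

text \<open>The last coordinate is integrated first; completing the square leaves a one-dimensional
  normal integral and the Schur complement.\<close>

lemma gaussian_integral:
  assumes "pd_on {..<q} A"
  shows "(\<integral>\<^sup>+y. ennreal (exp (- bform {..<q} A (\<lambda>k. y k - \<mu> k) (\<lambda>k. y k - \<mu> k) / 2)) \<partial>lborel_pow q)
    = ennreal (sqrt ((2 * pi) ^ q / fdet q A))"
  using assms
proof (induction q arbitrary: A)
  case 0
  then show ?case by (simp add: PiM_empty nn_integral_count_space_finite bform_def fdet_def)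
next
  case (Suc q)
  define S where "S = (\<lambda>i j. A i j - A i q * A q j / A q q)"
  have pd: "pd_on (insert q {..<q}) A" using Suc.prems by (simp add: lessThan_Suc)
  have S: "pd_on {..<q} S" unfolding S_def by (rule pd_on_schur[OF _ _ pd]) auto
  have Aq: "A q q > 0" using pd_on_diag_pos[OF _ Suc.prems, of q] by simp
  define s where "s = (\<lambda>y. (\<Sum>j<q. A q j * (y j - \<mu> j)) / A q q)"
  define F where "F = (\<lambda>y. ennreal (exp (- bform {..<Suc q} A (\<lambda>k. y k - \<mu> k) (\<lambda>k. y k - \<mu> k) / 2)))"
  have F: "F (y(q := t)) = ennreal (exp (- bform {..<q} S (\<lambda>k. y k - \<mu> k) (\<lambda>k. y k - \<mu> k) / 2)) *
      ennreal (exp (- (A q q * (t + (s y - \<mu> q))\<^sup>2) / 2))" for y t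
  proof -
    define v where "v = (\<lambda>k. (y(q := t)) k - \<mu> k)"
    have 1: "(\<Sum>j<q. A q j * v j) / A q q = s y"
      unfolding s_def v_def by (intro arg_cong2[of _ _ _ _ "(/)"] sum.cong) auto
    have 2: "bform {..<q} S v v = bform {..<q} S (\<lambda>k. y k - \<mu> k) (\<lambda>k. y k - \<mu> k)"
      unfolding v_def by (intro bform_cong) auto
    have 3: "v q = t - \<mu> q" by (simp add: v_def)
    have 4: "bform {..<Suc q} A v v = A q q * (t - \<mu> q + s y)\<^sup>2
        + bform {..<q} S (\<lambda>k. y k - \<mu> k) (\<lambda>k. y k - \<mu> k)"
      using bform_insert_schur[OF _ _ pd_on_sym[OF pd], of v] Aq
      unfolding lessThan_Suc S_def[symmetric] 1 2 3 by simp
    have 5: "- (A q q * (t - \<mu> q + s y)\<^sup>2 + z) / 2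
       = - z / 2 + - (A q q * (t + (s y - \<mu> q))\<^sup>2) / 2" for z
      by (simp add: algebra_simps add_divide_distrib diff_divide_distrib)
    show ?thesis
      unfolding F_def v_def[symmetric] 4 5 exp_add by (simp add: ennreal_mult')
  qed
  have [measurable]: "F \<in> borel_measurable (lborel_pow (Suc q))" unfolding F_def by measurable
  have "(\<integral>\<^sup>+y. F y \<partial>lborel_pow (Suc q)) = (\<integral>\<^sup>+y. \<integral>\<^sup>+t. F (y(q := t)) \<partial>lborel \<partial>lborel_pow q)"
    unfolding lessThan_Suc
    by (rule lborel_prod.product_nn_integral_insert) (simp_all add: lessThan_Suc[symmetric])
  also have "\<dots> = (\<integral>\<^sup>+y. ennreal (exp (- bform {..<q} S (\<lambda>k. y k - \<mu> k) (\<lambda>k. y k - \<mu> k) / 2)) *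
      ennreal (sqrt (2 * pi / A q q)) \<partial>lborel_pow q)"
    unfolding F by (simp add: nn_integral_cmult nn_integral_exp_square[OF Aq, simplified])
  also have "\<dots> = ennreal (sqrt ((2 * pi) ^ q / fdet q S)) * ennreal (sqrt (2 * pi / A q q))"
    by (subst nn_integral_multc) (auto simp: Suc.IH[OF S, simplified])
  also have "\<dots> = ennreal (sqrt ((2 * pi) ^ q / fdet q S) * sqrt (2 * pi / A q q))"
    using fdet_pos[OF S] by (simp add: ennreal_mult')
  also have "sqrt ((2 * pi) ^ q / fdet q S) * sqrt (2 * pi / A q q) = sqrt ((2 * pi) ^ Suc q / fdet (Suc q) A)"
    using Aq unfolding S_def
    by (subst fdet_schur) (auto simp: real_sqrt_mult[symmetric] mult_ac)
  finally show ?case unfolding F_def .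
qed

lemma nd_pos: "pd_on {..<q} A \<Longrightarrow> nd q A \<mu> y > 0"
  using fdet_pos[of q A] by (simp add: nd_def)

lemma nd_integral:
  assumes "pd_on {..<q} A" shows "(\<integral>\<^sup>+y. ennreal (nd q A \<mu> y) \<partial>lborel_pow q) = 1"
proof -
  have d: "fdet q A > 0" using fdet_pos[OF assms] .
  have "(\<integral>\<^sup>+y. ennreal (nd q A \<mu> y) \<partial>lborel_pow q)
      = ennreal (sqrt (fdet q A / (2 * pi) ^ q)) * ennreal (sqrt ((2 * pi) ^ q / fdet q A))"
    unfolding nd_def using d
    by (simp add: ennreal_mult' nn_integral_cmult gaussian_integral[OF assms, simplified])
  also have "\<dots> = ennreal (sqrt (fdet q A / (2 * pi) ^ q * ((2 * pi) ^ q / fdet q A)))"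
    unfolding real_sqrt_mult by (rule ennreal_mult'[symmetric]) (use d in simp)
  finally show ?thesis using d by simp
qed

section \<open>Chi-square divergence and Hellinger affinity of normal laws\<close>

lemma pd_on_scale: "c > 0 \<Longrightarrow> pd_on I A \<Longrightarrow> pd_on I (\<lambda>i j. c * A i j)"
proof -
  assume c: "c > 0" and A: "pd_on I A"
  have "bform I (\<lambda>i j. c * A i j) v v = c * bform I A v v" for v
    using bform_lin_mat[of I c A 0 A v v] by simp
  then show ?thesis using c A by (simp add: pd_on_def sym_on_def)
qed

lemma bform_scale_mat: "bform I (\<lambda>i j. c * A i j) u v = c * bform I A u v"
  using bform_lin_mat[of I c A 0 A u v] by simp

text \<open>Read off from Gaussian integrals: a larger form has a smaller integral, and the integral
  decreases in the determinant.\<close>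

lemma fdet_mono:
  assumes A: "pd_on {..<q} A" and B: "pd_on {..<q} B" and c: "c > 0"
    and le: "\<And>v. c * bform {..<q} A v v \<le> bform {..<q} B v v"
  shows "c ^ q * fdet q A \<le> fdet q B"
proof -
  let ?A = "\<lambda>i j. c * A i j"
  have cA: "pd_on {..<q} ?A" by (rule pd_on_scale[OF c A])
  have dB: "fdet q B > 0" and dc: "fdet q ?A > 0"
    using fdet_pos[OF B] fdet_pos[OF cA] by auto
  have "ennreal (sqrt ((2 * pi) ^ q / fdet q B)) \<le> ennreal (sqrt ((2 * pi) ^ q / fdet q ?A))"
    unfolding gaussian_integral[OF B, of "\<lambda>_. 0", symmetric] gaussian_integral[OF cA, of "\<lambda>_. 0", symmetric]
    by (intro nn_integral_mono ennreal_leI) (simp add: bform_scale_mat le)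
  then have "(2 * pi) ^ q / fdet q B \<le> (2 * pi) ^ q / fdet q ?A"
    using dc by (simp add: ennreal_le_iff)
  then have "fdet q ?A \<le> fdet q B"
    using dB dc by (simp add: divide_le_cancel frac_le_eq field_simps)
  then show ?thesis unfolding fdet_smult .
qed

text \<open>Bounding \<open>A\<close> by multiples of \<open>A0\<close> dominates the integrand by a
  multiple of a normal density with precision \<open>(1 - g) * A0\<close>. Of the power
  \<open>q\<close> of \<open>1 - g\<close>, one half comes from the determinant of \<open>A\<close>
  and the other from the integral.\<close>

lemma chi_square_bound:
  assumes A0: "pd_on {..<q} A0" and A: "pd_on {..<q} A" and g: "0 \<le> g" "g < 1"
    and lo: "\<And>v. (1 - g) * bform {..<q} A0 v v \<le> bform {..<q} A v v"
    and up: "\<And>v. bform {..<q} A v v \<le> (1 + g) * bform {..<q} A0 v v"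
  shows "(\<integral>\<^sup>+y. ennreal ((nd q A0 \<mu>0 y)\<^sup>2 / nd q A \<mu>1 y) \<partial>lborel_pow q)
    \<le> ennreal (exp ((1 + g) / (1 - g) * bform {..<q} A0 (\<lambda>k. \<mu>1 k - \<mu>0 k) (\<lambda>k. \<mu>1 k - \<mu>0 k)) / (1 - g) ^ q)"
proof -
  let ?Q = "\<lambda>v. bform {..<q} A0 v v"
  define m where "m = (\<lambda>k. \<mu>1 k - \<mu>0 k)"
  \<comment> \<open>The square in the exponent is completed around \<mu>0 - \<rho> m, and the
    constant left over is again \<rho> times the form at \<open>m\<close>.\<close>
  define \<rho> where "\<rho> = (1 + g) / (1 - g)"
  have d0: "fdet q A0 > 0" and dA: "fdet q A > 0" using fdet_pos[OF A0] fdet_pos[OF A] by auto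
  define K where "K = (2 * pi) ^ q"
  have K: "K > 0" by (simp add: K_def)
  have g1: "(1 - g) ^ q > 0" using g by simp
  have dd: "(1 - g) ^ q * fdet q A0 \<le> fdet q A"
    using g by (intro fdet_mono[OF A0 A _ lo]) auto
  define c where "c = sqrt (fdet q A0 / K) / sqrt ((1 - g) ^ q) * exp (\<rho> * ?Q m)"
  have c: "c \<ge> 0" using d0 K g1 by (simp add: c_def)
  have pw: "(nd q A0 \<mu>0 y)\<^sup>2 / nd q A \<mu>1 y
      \<le> c * exp (- bform {..<q} (\<lambda>i j. (1 - g) * A0 i j) (\<lambda>k. y k - (\<mu>0 k - \<rho> * m k)) (\<lambda>k. y k - (\<mu>0 k - \<rho> * m k)) / 2)"
    for y
  proof -
    define z where "z = (\<lambda>k. y k - \<mu>0 k)"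
    have z1: "(\<lambda>k. y k - \<mu>1 k) = (\<lambda>k. z k + (- 1) * m k)" by (auto simp: z_def m_def)
    have z2: "(\<lambda>k. y k - (\<mu>0 k - \<rho> * m k)) = (\<lambda>k. z k + \<rho> * m k)" by (auto simp: z_def)
    have q1: "?Q (\<lambda>k. y k - \<mu>1 k) = ?Q z - 2 * bform {..<q} A0 z m + ?Q m"
      unfolding z1 bform_square_add[OF pd_on_sym[OF A0]] by simp
    have q2: "?Q (\<lambda>k. y k - (\<mu>0 k - \<rho> * m k)) = ?Q z + 2 * \<rho> * bform {..<q} A0 z m + \<rho>\<^sup>2 * ?Q m"
      unfolding z2 bform_square_add[OF pd_on_sym[OF A0]] by simp
    have \<rho>g: "(1 - g) * \<rho> = 1 + g" using g by (simp add: \<rho>_def)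
    have \<rho>2: "(1 - g) * \<rho>\<^sup>2 = (1 + g) * \<rho>"
      using \<rho>g by (metis mult.assoc power2_eq_square)
    have \<rho>3: "(1 + g) * \<rho> + (1 + g) = 2 * \<rho>"
    proof -
      have "(1 + g) * \<rho> + (1 + g) = (1 + g) * \<rho> + (1 - g) * \<rho>" using \<rho>g by simp
      then show ?thesis by (simp add: algebra_simps)
    qed
    have ex: "- ?Q z + (1 + g) * ?Q (\<lambda>k. y k - \<mu>1 k) / 2
        = \<rho> * ?Q m - (1 - g) * ?Q (\<lambda>k. y k - (\<mu>0 k - \<rho> * m k)) / 2"
    proof -
      have "(1 - g) * ?Q (\<lambda>k. y k - (\<mu>0 k - \<rho> * m k))
          = (1 - g) * ?Q z + 2 * ((1 - g) * \<rho>) * bform {..<q} A0 z m + ((1 - g) * \<rho>\<^sup>2) * ?Q m"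
        unfolding q2 by (simp add: algebra_simps)
      also have "\<dots> = (1 - g) * ?Q z + 2 * (1 + g) * bform {..<q} A0 z m + (2 * \<rho> - (1 + g)) * ?Q m"
        unfolding \<rho>g \<rho>2 using \<rho>3 by (simp add: eq_diff_eq)
      finally show ?thesis unfolding q1 by (simp add: field_simps)
    qed
    have "nd q A \<mu>1 y \<ge> sqrt ((1 - g) ^ q * fdet q A0 / K) * exp (- ((1 + g) * ?Q (\<lambda>k. y k - \<mu>1 k) / 2))"
      unfolding nd_def K_def[symmetric] using dd K d0 dA g1 up
      by (intro mult_mono) (auto simp: divide_right_mono)
    moreover have pos: "sqrt ((1 - g) ^ q * fdet q A0 / K) * exp (- ((1 + g) * ?Q (\<lambda>k. y k - \<mu>1 k) / 2)) > 0"
      using g1 d0 K by simp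
    ultimately have "(nd q A0 \<mu>0 y)\<^sup>2 / nd q A \<mu>1 y
        \<le> (nd q A0 \<mu>0 y)\<^sup>2 / (sqrt ((1 - g) ^ q * fdet q A0 / K) * exp (- ((1 + g) * ?Q (\<lambda>k. y k - \<mu>1 k) / 2)))"
      using divide_left_mono[OF _ zero_le_power2[of "nd q A0 \<mu>0 y"] mult_pos_pos[OF nd_pos[OF A] pos]] by blast
    also have "\<dots> = (sqrt (fdet q A0 / K) / sqrt ((1 - g) ^ q)) *
        (exp (- ?Q z) / exp (- ((1 + g) * ?Q (\<lambda>k. y k - \<mu>1 k) / 2)))"
    proof -
      have sq: "(exp (- ?Q z / 2))\<^sup>2 = exp (- ?Q z)"
        by (simp add: power2_eq_square flip: exp_add)
      have n1: "(nd q A0 \<mu>0 y)\<^sup>2 = sqrt (fdet q A0 / K) * sqrt (fdet q A0 / K) * exp (- ?Q z)"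
        unfolding nd_def K_def[symmetric] z_def[symmetric] power_mult_distrib[of "sqrt (fdet q A0 / K)"] sq
        by (simp only: power2_eq_square)
      have n2: "sqrt ((1 - g) ^ q * fdet q A0 / K) = sqrt ((1 - g) ^ q) * sqrt (fdet q A0 / K)"
        by (simp add: real_sqrt_mult real_sqrt_divide)
      have gen: "s * s * E / (t * s * F) = (s / t) * (E / F)" if "s \<noteq> 0" for s E t F :: real
        using that by simp
      show ?thesis unfolding n1 n2 using d0 K by (intro gen) simp
    qed
    also have "exp (- ?Q z) / exp (- ((1 + g) * ?Q (\<lambda>k. y k - \<mu>1 k) / 2))
        = exp (- ?Q z + (1 + g) * ?Q (\<lambda>k. y k - \<mu>1 k) / 2)"
      by (simp add: exp_diff[symmetric])
    also have "\<dots> = exp (\<rho> * ?Q m) * exp (- ((1 - g) * ?Q (\<lambda>k. y k - (\<mu>0 k - \<rho> * m k))) / 2)"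
      unfolding ex by (simp flip: exp_add)
    finally show ?thesis
      by (simp add: c_def bform_scale_mat mult.assoc)
  qed
  have pdg: "pd_on {..<q} (\<lambda>i j. (1 - g) * A0 i j)" using g by (intro pd_on_scale[OF _ A0]) auto
  have "(\<integral>\<^sup>+y. ennreal ((nd q A0 \<mu>0 y)\<^sup>2 / nd q A \<mu>1 y) \<partial>lborel_pow q)
    \<le> (\<integral>\<^sup>+y. ennreal c * ennreal (exp (- bform {..<q} (\<lambda>i j. (1 - g) * A0 i j)
        (\<lambda>k. y k - (\<mu>0 k - \<rho> * m k)) (\<lambda>k. y k - (\<mu>0 k - \<rho> * m k)) / 2)) \<partial>lborel_pow q)"
    using pw c by (intro nn_integral_mono) (simp flip: ennreal_mult')
  also have "\<dots> = ennreal c * ennreal (sqrt (K / ((1 - g) ^ q * fdet q A0)))"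
    unfolding K_def fdet_smult[symmetric] gaussian_integral[OF pdg, of "\<lambda>k. \<mu>0 k - \<rho> * m k", symmetric]
    by (rule nn_integral_cmult) measurable
  also have "\<dots> = ennreal (c * sqrt (K / ((1 - g) ^ q * fdet q A0)))"
    using c by (simp add: ennreal_mult')
  also have "c * sqrt (K / ((1 - g) ^ q * fdet q A0)) = exp (\<rho> * ?Q m) / (1 - g) ^ q"
    using K d0 g1 unfolding c_def
    by (simp add: real_sqrt_divide real_sqrt_mult field_simps)
  finally show ?thesis unfolding \<rho>_def m_def .
qed

text \<open>The geometric mean of two normal densities is a multiple of the normal density with the
  average precision \<open>Am\<close>. The multiple consists of a ratio of determinants, bounded by
  \<open>affinity_det_bound\<close>, and the contribution of the means, for which the lower spectral
  bounds suffice.\<close>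

lemma affinity_bound:
  assumes A0: "pd_on {..<q} A0" and A1: "pd_on {..<q} A1" and \<tau>: "\<tau> \<ge> 0"
    and lo0: "\<And>v. \<tau> * (\<Sum>k<q. (v k)\<^sup>2) \<le> bform {..<q} A0 v v"
    and lo1: "\<And>v. \<tau> * (\<Sum>k<q. (v k)\<^sup>2) \<le> bform {..<q} A1 v v"
    and \<beta>: "\<beta> > 0" and up0: "\<And>v. bform {..<q} A0 v v \<le> \<beta> * (\<Sum>k<q. (v k)\<^sup>2)"
  shows "(\<integral>\<^sup>+y. ennreal (sqrt (nd q A0 \<mu>0 y * nd q A1 \<mu>1 y)) \<partial>lborel_pow q)
    \<le> ennreal (exp (- (\<tau> / 8 * (\<Sum>k<q. (\<mu>0 k - \<mu>1 k)\<^sup>2))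
         - min ((\<Sum>i<q. \<Sum>j<q. (A1 i j - A0 i j)\<^sup>2) / \<beta>\<^sup>2) 1 / 64))"
proof -
  define Am where "Am = (\<lambda>i j. (1 / 2) * A0 i j + (1 / 2) * A1 i j)"
  have Amf: "bform {..<q} Am u v = bform {..<q} A0 u v / 2 + bform {..<q} A1 u v / 2" for u v
    unfolding Am_def bform_lin_mat by simp
  have Am: "pd_on {..<q} Am"
    unfolding pd_on_def Amf using pd_on_pos[OF A0] pd_on_pos[OF A1] pd_on_sym[OF A0] pd_on_sym[OF A1]
    by (fastforce simp: sym_on_def Am_def intro!: add_pos_pos)
  have d0: "fdet q A0 > 0" and d1: "fdet q A1 > 0" and dm: "fdet q Am > 0"
    using fdet_pos[OF A0] fdet_pos[OF A1] fdet_pos[OF Am] by auto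
  define K where "K = (2 * pi) ^ q"
  have K: "K > 0" by (simp add: K_def)
  \<comment> \<open>Precision-weighted mean, at which the average of the two quadratic exponents is
    stationary.\<close>
  obtain y0 where y0: "\<And>i. i < q \<Longrightarrow> (\<Sum>j<q. Am i j * y0 j)
      = (\<Sum>j<q. A0 i j * \<mu>0 j) / 2 + (\<Sum>j<q. A1 i j * \<mu>1 j) / 2"
    using linear_system_solvable[of q Am "\<lambda>i. (\<Sum>j<q. A0 i j * \<mu>0 j) / 2 + (\<Sum>j<q. A1 i j * \<mu>1 j) / 2"] dm
    by auto
  have y0': "bform {..<q} Am u y0 = bform {..<q} A0 u \<mu>0 / 2 + bform {..<q} A1 u \<mu>1 / 2" for u
  proof -
    have r: "bform {..<q} A u v = (\<Sum>i<q. u i * (\<Sum>j<q. A i j * v j))" for A u v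
      by (simp add: bform_def sum_distrib_left mult_ac)
    show ?thesis unfolding r
      by (simp add: y0 distrib_left sum.distrib flip: sum_divide_distrib)
  qed
  define R where "R = \<tau> / 4 * (\<Sum>k<q. (\<mu>0 k - \<mu>1 k)\<^sup>2)"
  define Q0 where "Q0 = (\<lambda>v. bform {..<q} A0 v v)"
  define Q1 where "Q1 = (\<lambda>v. bform {..<q} A1 v v)"
  define Qm where "Qm = (\<lambda>v. bform {..<q} Am v v)"
  have split: "Q0 (\<lambda>k. y k - \<mu>0 k) / 2 + Q1 (\<lambda>k. y k - \<mu>1 k) / 2
      = Qm (\<lambda>k. y k - y0 k) + (Q0 (\<lambda>k. y0 k - \<mu>0 k) / 2 + Q1 (\<lambda>k. y0 k - \<mu>1 k) / 2)" for y
  proof -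
    define z where "z = (\<lambda>k. y k - y0 k)"
    have e: "Q (\<lambda>k. y k - \<mu> k) = bform {..<q} A z z + 2 * bform {..<q} A z (\<lambda>k. y0 k - \<mu> k) + Q (\<lambda>k. y0 k - \<mu> k)"
      if "sym_on {..<q} A" "Q = (\<lambda>v. bform {..<q} A v v)" for A Q \<mu>
      using bform_square_add[OF that(1), of z 1 "\<lambda>k. y0 k - \<mu> k"] that(2) by (simp add: z_def)
    have "bform {..<q} A0 z (\<lambda>k. y0 k - \<mu>0 k) + bform {..<q} A1 z (\<lambda>k. y0 k - \<mu>1 k) = 0"
      using y0'[of z] unfolding Amf bform_diff_right by simp
    then show ?thesis
      unfolding e[OF pd_on_sym[OF A0] Q0_def] e[OF pd_on_sym[OF A1] Q1_def]
      unfolding Qm_def Amf z_def[symmetric] by (simp add: field_simps)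
  qed
  \<comment> \<open>Wherever the centre lies, the squared distance of the means is at most twice the
    sum of their squared distances from it.\<close>
  have rest: "R \<le> Q0 (\<lambda>k. y0 k - \<mu>0 k) / 2 + Q1 (\<lambda>k. y0 k - \<mu>1 k) / 2"
  proof -
    have "(\<Sum>k<q. (\<mu>0 k - \<mu>1 k)\<^sup>2) \<le> (\<Sum>k<q. 2 * (y0 k - \<mu>0 k)\<^sup>2 + 2 * (y0 k - \<mu>1 k)\<^sup>2)"
    proof (intro sum_mono)
      fix k show "(\<mu>0 k - \<mu>1 k)\<^sup>2 \<le> 2 * (y0 k - \<mu>0 k)\<^sup>2 + 2 * (y0 k - \<mu>1 k)\<^sup>2"
        using zero_le_power2[of "(y0 k - \<mu>0 k) + (y0 k - \<mu>1 k)"] by (simp add: power2_eq_square algebra_simps)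
    qed
    also have "\<dots> = 2 * (\<Sum>k<q. (y0 k - \<mu>0 k)\<^sup>2) + 2 * (\<Sum>k<q. (y0 k - \<mu>1 k)\<^sup>2)"
      by (simp add: sum.distrib sum_distrib_left)
    finally have "R \<le> \<tau> / 4 * (2 * (\<Sum>k<q. (y0 k - \<mu>0 k)\<^sup>2) + 2 * (\<Sum>k<q. (y0 k - \<mu>1 k)\<^sup>2))"
      unfolding R_def using \<tau> by (intro mult_left_mono) auto
    also have "\<dots> = \<tau> * (\<Sum>k<q. (y0 k - \<mu>0 k)\<^sup>2) / 2 + \<tau> * (\<Sum>k<q. (y0 k - \<mu>1 k)\<^sup>2) / 2"
      by (simp add: field_simps)
    also have "\<dots> \<le> Q0 (\<lambda>k. y0 k - \<mu>0 k) / 2 + Q1 (\<lambda>k. y0 k - \<mu>1 k) / 2"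
      unfolding Q0_def Q1_def using lo0[of "\<lambda>k. y0 k - \<mu>0 k"] lo1[of "\<lambda>k. y0 k - \<mu>1 k"] by simp
    finally show ?thesis .
  qed
  define c where "c = sqrt (sqrt (fdet q A0 / K) * sqrt (fdet q A1 / K)) * exp (- R / 2)"
  have c: "c \<ge> 0" using d0 d1 K by (simp add: c_def)
  have pw: "sqrt (nd q A0 \<mu>0 y * nd q A1 \<mu>1 y) \<le> c * exp (- Qm (\<lambda>k. y k - y0 k) / 2)" for y
  proof -
    have "sqrt (nd q A0 \<mu>0 y * nd q A1 \<mu>1 y) = sqrt (sqrt (fdet q A0 / K) * sqrt (fdet q A1 / K)) *
        sqrt (exp (- Q0 (\<lambda>k. y k - \<mu>0 k) / 2) * exp (- Q1 (\<lambda>k. y k - \<mu>1 k) / 2))"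
      unfolding nd_def K_def[symmetric] Q0_def Q1_def by (simp only: real_sqrt_mult mult_ac)
    also have "sqrt (exp (- Q0 (\<lambda>k. y k - \<mu>0 k) / 2) * exp (- Q1 (\<lambda>k. y k - \<mu>1 k) / 2))
        = exp (- (Q0 (\<lambda>k. y k - \<mu>0 k) / 2 + Q1 (\<lambda>k. y k - \<mu>1 k) / 2) / 2)"
      by (intro real_sqrt_unique) (auto simp: power2_eq_square simp flip: exp_add)
    also have "\<dots> \<le> exp (- R / 2) * exp (- Qm (\<lambda>k. y k - y0 k) / 2)"
      unfolding split[of y] using rest by (simp flip: exp_add)
    finally show ?thesis
      using d0 d1 K by (simp add: c_def mult.assoc mult_left_mono)
  qed
  have "(\<integral>\<^sup>+y. ennreal (sqrt (nd q A0 \<mu>0 y * nd q A1 \<mu>1 y)) \<partial>lborel_pow q)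
     \<le> (\<integral>\<^sup>+y. ennreal c * ennreal (exp (- bform {..<q} Am (\<lambda>k. y k - y0 k) (\<lambda>k. y k - y0 k) / 2)) \<partial>lborel_pow q)"
    using pw c by (intro nn_integral_mono) (simp add: Qm_def flip: ennreal_mult')
  also have "\<dots> = ennreal c * ennreal (sqrt (K / fdet q Am))"
    unfolding K_def gaussian_integral[OF Am, of y0, symmetric] by (rule nn_integral_cmult) measurable
  also have "\<dots> = ennreal (c * sqrt (K / fdet q Am))"
    using c by (simp add: ennreal_mult')
  also have "\<dots> \<le> ennreal (exp (- (\<tau> / 8 * (\<Sum>k<q. (\<mu>0 k - \<mu>1 k)\<^sup>2))
         - min ((\<Sum>i<q. \<Sum>j<q. (A1 i j - A0 i j)\<^sup>2) / \<beta>\<^sup>2) 1 / 64))"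
  proof (rule ennreal_leI)
    \<comment> \<open>The determinant bound concerns the fourth power of the affinity, hence 16
      becomes 64.\<close>
    define x where "x = min ((\<Sum>i<q. \<Sum>j<q. (A1 i j - A0 i j)\<^sup>2) / \<beta>\<^sup>2) 1"
    have "fdet q (\<lambda>i j. (A0 i j + A1 i j) / 2) = fdet q Am"
      by (intro fdet_cong) (simp add: Am_def field_simps)
    then have "fdet q A0 * fdet q A1 * exp (x / 16) \<le> (fdet q Am)\<^sup>2"
      using affinity_det_bound[OF A0 A1 \<beta> up0] by (simp add: x_def)
    then have "fdet q A0 * fdet q A1 \<le> (fdet q Am)\<^sup>2 * exp (- (x / 16))"
      by (simp add: exp_minus field_simps)
    then have "fdet q A0 * fdet q A1 / (fdet q Am)\<^sup>2 \<le> exp (- (x / 16))"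
      using dm by (simp add: divide_le_eq mult.commute)
    then have "sqrt (sqrt (fdet q A0 * fdet q A1 / (fdet q Am)\<^sup>2)) \<le> sqrt (sqrt (exp (- (x / 16))))"
      by simp
    also have "sqrt (exp (- (x / 16))) = exp (- (x / 32))"
      by (intro real_sqrt_unique) (auto simp: power2_eq_square simp flip: exp_add)
    also have "sqrt (exp (- (x / 32))) = exp (- (x / 64))"
      by (intro real_sqrt_unique) (auto simp: power2_eq_square simp flip: exp_add)
    also have "sqrt (sqrt (fdet q A0 * fdet q A1 / (fdet q Am)\<^sup>2))
        = sqrt (sqrt (fdet q A0 / K) * sqrt (fdet q A1 / K)) * sqrt (K / fdet q Am)"
    proof -
      have "sqrt (fdet q A0 / K) * sqrt (fdet q A1 / K) * (K / fdet q Am)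
          = sqrt (fdet q A0 * fdet q A1 / (fdet q Am)\<^sup>2)"
        using K d0 d1 dm by (simp add: real_sqrt_divide real_sqrt_mult)
      then show ?thesis by (metis real_sqrt_mult)
    qed
    finally have "c * sqrt (K / fdet q Am) \<le> exp (- (x / 64)) * exp (- R / 2)"
      by (simp add: c_def mult_ac mult_left_mono)
    also have "\<dots> = exp (- (\<tau> / 8 * (\<Sum>k<q. (\<mu>0 k - \<mu>1 k)\<^sup>2)) - x / 64)"
      by (simp add: R_def algebra_simps flip: exp_add)
    finally show "c * sqrt (K / fdet q Am) \<le> exp (- (\<tau> / 8 * (\<Sum>k<q. (\<mu>0 k - \<mu>1 k)\<^sup>2))
         - min ((\<Sum>i<q. \<Sum>j<q. (A1 i j - A0 i j)\<^sup>2) / \<beta>\<^sup>2) 1 / 64)"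
      unfolding x_def .
  qed
  finally show ?thesis .
qed

section \<open>Posterior mass of a set\<close>

text \<open>The product of x^2 / (r U), sqrt r / V and \<open>r\<close>, raised to the exponents
  \<alpha>/2, 2 - 2 \<alpha> and 3 \<alpha>/2 - 1, is at most their sum, as the exponents sum to 1.
  With them all powers of \<open>r\<close> cancel; the last is nonnegative because \<alpha> >= 2/3.
  For suitable \<open>U\<close> and \<open>V\<close> each of the three terms will have expectation
  at most 1.\<close>

lemma min_one_le_young:
  fixes x r U V \<alpha> :: real
  assumes x: "x \<ge> 0" and pos: "r > 0" "U > 0" "V > 0" and \<alpha>: "2 / 3 \<le> \<alpha>" "\<alpha> < 1"
  shows "min 1 x \<le> U powr (\<alpha> / 2) * V powr (2 - 2 * \<alpha>) * (x\<^sup>2 / (r * U) + sqrt r / V + r)"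
proof (cases "x = 0")
  case True
  then show ?thesis using pos by simp
next
  case False
  then have x: "x > 0" using assms by simp
  define a where "a = x\<^sup>2 / (r * U)"
  define b where "b = sqrt r / V"
  define m where "m = max a (max b r)"
  have ab: "a > 0" "b > 0" using x pos by (auto simp: a_def b_def)
  have m: "a \<le> m" "b \<le> m" "r \<le> m" "m > 0" using ab pos by (auto simp: m_def)
  have "a powr (\<alpha> / 2) * b powr (2 - 2 * \<alpha>) * r powr (3 * \<alpha> / 2 - 1)
      \<le> m powr (\<alpha> / 2) * m powr (2 - 2 * \<alpha>) * m powr (3 * \<alpha> / 2 - 1)"
    using m ab pos \<alpha> by (intro mult_mono powr_mono2) auto
  also have "\<dots> = m powr ((\<alpha> / 2) + (2 - 2 * \<alpha>) + (3 * \<alpha> / 2 - 1))"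
    by (simp only: powr_add)
  also have "(\<alpha> / 2) + (2 - 2 * \<alpha>) + (3 * \<alpha> / 2 - 1) = 1" by simp
  also have "m powr 1 = m" using m by simp
  also have "m \<le> a + b + r" using ab pos by (auto simp: m_def)
  finally have 1: "a powr (\<alpha> / 2) * b powr (2 - 2 * \<alpha>) * r powr (3 * \<alpha> / 2 - 1) \<le> a + b + r" .
  have la: "ln a = 2 * ln x - ln r - ln U" and lb: "ln b = ln r / 2 - ln V"
    using x pos by (simp_all add: a_def b_def ln_div ln_mult ln_realpow ln_sqrt)
  have "x powr \<alpha> = U powr (\<alpha> / 2) * V powr (2 - 2 * \<alpha>) *
      (a powr (\<alpha> / 2) * b powr (2 - 2 * \<alpha>) * r powr (3 * \<alpha> / 2 - 1))"
    using x pos ab unfolding powr_def la lb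
    by (simp add: exp_add[symmetric] algebra_simps add_divide_distrib diff_divide_distrib)
  also have "\<dots> \<le> U powr (\<alpha> / 2) * V powr (2 - 2 * \<alpha>) * (a + b + r)"
    using 1 by (intro mult_left_mono) auto
  finally have 2: "x powr \<alpha> \<le> U powr (\<alpha> / 2) * V powr (2 - 2 * \<alpha>) * (a + b + r)" .
  have "min 1 x \<le> x powr \<alpha>"
  proof (cases "x \<le> 1")
    case True
    then have "x powr 1 \<le> x powr \<alpha>" using x \<alpha> by (intro powr_mono') auto
    then show ?thesis using x True by simp
  next
    case False
    then have "1 \<le> x powr \<alpha>" using \<alpha> by (intro ge_one_powr_ge_zero) auto
    then show ?thesis by simp
  qed
  then show ?thesis using 2 unfolding a_def b_def by simp
qed

text \<open>Either some summand alone reaches 1, or no summand is affected by the truncation. Each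
  cell can thus be truncated separately.\<close>

lemma min_one_nn_integral_le:
  fixes f :: "'a \<Rightarrow> ennreal"
  shows "min 1 (\<integral>\<^sup>+j. f j \<partial>count_space J) \<le> (\<integral>\<^sup>+j. min 1 (f j) \<partial>count_space J)"
proof (cases "\<exists>j\<in>J. f j \<ge> 1")
  case True
  then obtain j where j: "j \<in> J" "f j \<ge> 1" by blast
  have "min 1 (f j) \<le> (\<integral>\<^sup>+j. min 1 (f j) \<partial>count_space J)"
    by (rule nn_integral_ge_point) (use j in simp)
  then have "1 \<le> (\<integral>\<^sup>+j. min 1 (f j) \<partial>count_space J)" using j by (simp add: min_absorb1)
  then show ?thesis by (rule order_trans[OF min.cobounded1])
next
  case False
  then have "(\<integral>\<^sup>+j. f j \<partial>count_space J) = (\<integral>\<^sup>+j. min 1 (f j) \<partial>count_space J)"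
    by (intro nn_integral_cong) (auto simp: min_def not_le dest: less_imp_le)
  then show ?thesis by simp
qed

text \<open>Here \<open>r\<close> is the likelihood ratio of a reference parameter of the cell.
  Cauchy-Schwarz over the cell and Fubini reduce the second moment of the cell integral, weighted by
  1/r, to the divergences in \<open>chi\<close>. The affinity is needed at the reference parameter
  only.\<close>

lemma cell_bound:
  fixes M :: "'y measure" and \<mu> :: "'t measure" and \<rho> :: "'t \<Rightarrow> 'y \<Rightarrow> real" and r :: "'y \<Rightarrow> real"
  assumes "prob_space M" "sigma_finite_measure \<mu>"
    and [measurable]: "(\<lambda>(t, y). \<rho> t y) \<in> borel_measurable (\<mu> \<Otimes>\<^sub>M M)" "r \<in> borel_measurable M" "E \<in> sets \<mu>"
    and r: "\<And>y. r y > 0" and \<rho>: "\<And>t y. t \<in> E \<Longrightarrow> \<rho> t y \<ge> 0"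
    and chi: "\<And>t. t \<in> E \<Longrightarrow> (\<integral>\<^sup>+y. ennreal ((\<rho> t y)\<^sup>2 / r y) \<partial>M) \<le> ennreal X"
    and aff: "(\<integral>\<^sup>+y. ennreal (sqrt (r y)) \<partial>M) \<le> ennreal V"
    and one: "(\<integral>\<^sup>+y. ennreal (r y) \<partial>M) \<le> 1"
    and m: "emeasure \<mu> E \<le> ennreal m" "m > 0" and pos: "X > 0" "V > 0" "c > 0"
    and \<alpha>: "2 / 3 \<le> \<alpha>" "\<alpha> < 1"
  shows "(\<integral>\<^sup>+y. min 1 (ennreal c * (\<integral>\<^sup>+t\<in>E. ennreal (\<rho> t y) \<partial>\<mu>)) \<partial>M)
    \<le> ennreal (3 * ((c * m) powr \<alpha> * X powr (\<alpha> / 2) * V powr (2 - 2 * \<alpha>)))"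
proof -
  interpret M: prob_space M by fact
  interpret \<mu>: sigma_finite_measure \<mu> by fact
  interpret pair_sigma_finite \<mu> M ..
  define N where "N = (\<lambda>y. \<integral>\<^sup>+t. ennreal (\<rho> t y) * indicator E t \<partial>\<mu>)"
  have [measurable]: "N \<in> borel_measurable M"
    unfolding N_def by (intro \<mu>.borel_measurable_nn_integral) measurable
  \<comment> \<open>Normalises the first term of \<open>min_one_le_young\<close> to expectation at
    most 1. Together with \<open>V\<close> for the second term and \<open>one\<close> for the third
    this gives the factor 3.\<close>
  define U where "U = c\<^sup>2 * m\<^sup>2 * X"
  have U: "U > 0" using m pos by (simp add: U_def)
  define W where "W = U powr (\<alpha> / 2) * V powr (2 - 2 * \<alpha>)"
  have W: "W > 0" using U pos by (simp add: W_def)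
  have pw: "min 1 (ennreal c * N y) \<le> ennreal W * (ennreal (c\<^sup>2 / U) * ((N y)\<^sup>2 * ennreal (1 / r y))
      + ennreal (1 / V) * ennreal (sqrt (r y)) + ennreal (r y))" for y
  proof (cases "N y")
    case (real x)
    have "min 1 (c * x) \<le> W * ((c * x)\<^sup>2 / (r y * U) + sqrt (r y) / V + r y)"
      unfolding W_def using min_one_le_young[of "c * x" "r y" U V \<alpha>] real pos r[of y] U \<alpha> by simp
    also have "(c * x)\<^sup>2 / (r y * U) = c\<^sup>2 / U * (x\<^sup>2 * (1 / r y))"
      by (simp add: power_mult_distrib)
    finally have "ennreal (min 1 (c * x)) \<le> ennreal (W * (c\<^sup>2 / U * (x\<^sup>2 * (1 / r y)) + 1 / V * sqrt (r y) + r y))"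
      by (intro ennreal_leI) simp
    also have "\<dots> = ennreal W * (ennreal (c\<^sup>2 / U) * ((N y)\<^sup>2 * ennreal (1 / r y))
      + ennreal (1 / V) * ennreal (sqrt (r y)) + ennreal (r y))"
    proof -
      have e1: "ennreal (c\<^sup>2 / U * (x\<^sup>2 * (1 / r y))) = ennreal (c\<^sup>2 / U) * (ennreal (x\<^sup>2) * ennreal (1 / r y))"
        using U r[of y] by (subst ennreal_mult, simp, simp, subst ennreal_mult, auto simp: less_imp_le)
      have e2: "ennreal (1 / V * sqrt (r y)) = ennreal (1 / V) * ennreal (sqrt (r y))"
        using pos r[of y] by (intro ennreal_mult) (auto simp: less_imp_le)
      have e3: "ennreal (W * (a + b + d)) = ennreal W * (ennreal a + ennreal b + ennreal d)"
        if "a \<ge> 0" "b \<ge> 0" "d \<ge> 0" for a b d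
        using that W by (simp add: ennreal_mult)
      show ?thesis
        unfolding e1[symmetric] e2[symmetric] real(2) ennreal_power[OF real(1)]
        by (intro e3) (use U pos r[of y] in \<open>auto simp: less_imp_le\<close>)
    qed
    also have "ennreal (min 1 (c * x)) = min 1 (ennreal c * N y)"
      using real pos by (simp add: min_def flip: ennreal_mult)
    finally show ?thesis .
  next
    case top
    have "ennreal (c\<^sup>2 / U) * ((N y)\<^sup>2 * ennreal (1 / r y)) = \<top>"
      using top U pos r[of y] by (simp add: ennreal_mult_top ennreal_top_mult power2_eq_square)
    then show ?thesis using W by (simp add: ennreal_mult_top)
  qed
  have N2: "(\<integral>\<^sup>+y. (N y)\<^sup>2 * ennreal (1 / r y) \<partial>M) \<le> ennreal m * (ennreal m * ennreal X)"
  proof -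
    have CS: "(N y)\<^sup>2 \<le> ennreal m * (\<integral>\<^sup>+t. ennreal ((\<rho> t y)\<^sup>2) * indicator E t \<partial>\<mu>)" if [simp]: "y \<in> space M" for y
    proof -
      have [measurable]: "(\<lambda>t. \<rho> t y) \<in> borel_measurable \<mu>" by measurable
      have "(N y)\<^sup>2 = (\<integral>\<^sup>+t. indicator E t * (ennreal (\<rho> t y) * indicator E t) \<partial>\<mu>)\<^sup>2"
        unfolding N_def by (intro arg_cong[of _ _ "\<lambda>x. x\<^sup>2"] nn_integral_cong) (simp split: split_indicator)
      also have "\<dots> \<le> (\<integral>\<^sup>+t. (indicator E t)\<^sup>2 \<partial>\<mu>) * (\<integral>\<^sup>+t. (ennreal (\<rho> t y) * indicator E t)\<^sup>2 \<partial>\<mu>)"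
        by (rule Cauchy_Schwarz_nn_integral) measurable
      also have "(\<integral>\<^sup>+t. (indicator E t)\<^sup>2 \<partial>\<mu>) = (\<integral>\<^sup>+t. indicator E t \<partial>\<mu>)"
        by (intro nn_integral_cong) (simp split: split_indicator)
      also have "\<dots> = emeasure \<mu> E" by simp
      also have "(\<integral>\<^sup>+t. (ennreal (\<rho> t y) * indicator E t)\<^sup>2 \<partial>\<mu>) = (\<integral>\<^sup>+t. ennreal ((\<rho> t y)\<^sup>2) * indicator E t \<partial>\<mu>)"
        using \<rho> by (intro nn_integral_cong) (simp split: split_indicator add: ennreal_power)
      finally show ?thesis using m(1) by (meson mult_right_mono order_trans zero_le)
    qed
    have "(\<integral>\<^sup>+y. (N y)\<^sup>2 * ennreal (1 / r y) \<partial>M)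
      \<le> (\<integral>\<^sup>+y. ennreal m * ((\<integral>\<^sup>+t. ennreal ((\<rho> t y)\<^sup>2) * indicator E t \<partial>\<mu>) * ennreal (1 / r y)) \<partial>M)"
      using CS by (intro nn_integral_mono) (simp add: mult.assoc[symmetric] mult_right_mono)
    also have "\<dots> = ennreal m * (\<integral>\<^sup>+y. (\<integral>\<^sup>+t. ennreal ((\<rho> t y)\<^sup>2) * indicator E t \<partial>\<mu>) * ennreal (1 / r y) \<partial>M)"
      by (rule nn_integral_cmult) measurable
    finally have outer: "(\<integral>\<^sup>+y. (N y)\<^sup>2 * ennreal (1 / r y) \<partial>M)
      \<le> ennreal m * (\<integral>\<^sup>+y. (\<integral>\<^sup>+t. ennreal ((\<rho> t y)\<^sup>2) * indicator E t \<partial>\<mu>) * ennreal (1 / r y) \<partial>M)" .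
    have "(\<integral>\<^sup>+y. (\<integral>\<^sup>+t. ennreal ((\<rho> t y)\<^sup>2) * indicator E t \<partial>\<mu>) * ennreal (1 / r y) \<partial>M)
        = (\<integral>\<^sup>+y. \<integral>\<^sup>+t. ennreal ((\<rho> t y)\<^sup>2) * indicator E t * ennreal (1 / r y) \<partial>\<mu> \<partial>M)"
      by (intro nn_integral_cong nn_integral_multc[symmetric]) measurable
    also have "\<dots> = (\<integral>\<^sup>+t. \<integral>\<^sup>+y. ennreal ((\<rho> t y)\<^sup>2) * indicator E t * ennreal (1 / r y) \<partial>M \<partial>\<mu>)"
      by (rule Fubini') measurable
    also have "\<dots> \<le> (\<integral>\<^sup>+t. ennreal X * indicator E t \<partial>\<mu>)"
    proof (intro nn_integral_mono)
      fix t assume "t \<in> space \<mu>"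
      have "(\<integral>\<^sup>+y. ennreal ((\<rho> t y)\<^sup>2) * indicator E t * ennreal (1 / r y) \<partial>M)
        = (\<integral>\<^sup>+y. ennreal ((\<rho> t y)\<^sup>2 / r y) \<partial>M) * indicator E t"
        by (cases "t \<in> E") (auto intro!: nn_integral_cong simp: less_imp_le[OF r] simp flip: ennreal_mult)
      also have "\<dots> \<le> ennreal X * indicator E t"
        using chi[of t] by (cases "t \<in> E") auto
      finally show "(\<integral>\<^sup>+y. ennreal ((\<rho> t y)\<^sup>2) * indicator E t * ennreal (1 / r y) \<partial>M) \<le> ennreal X * indicator E t" .
    qed
    also have "\<dots> = ennreal X * emeasure \<mu> E" by (simp add: nn_integral_cmult_indicator)
    also have "\<dots> \<le> ennreal X * ennreal m" using m by (intro mult_left_mono) auto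
    finally have "(\<integral>\<^sup>+y. (\<integral>\<^sup>+t. ennreal ((\<rho> t y)\<^sup>2) * indicator E t \<partial>\<mu>) * ennreal (1 / r y) \<partial>M)
      \<le> ennreal m * ennreal X" by (simp add: mult.commute)
    then show ?thesis by (intro order_trans[OF outer] mult_left_mono) auto
  qed
  have "(\<integral>\<^sup>+y. min 1 (ennreal c * N y) \<partial>M)
    \<le> (\<integral>\<^sup>+y. ennreal W * (ennreal (c\<^sup>2 / U) * ((N y)\<^sup>2 * ennreal (1 / r y))
      + ennreal (1 / V) * ennreal (sqrt (r y)) + ennreal (r y)) \<partial>M)"
    by (intro nn_integral_mono pw)
  also have "\<dots> = ennreal W * (ennreal (c\<^sup>2 / U) * (\<integral>\<^sup>+y. (N y)\<^sup>2 * ennreal (1 / r y) \<partial>M)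
      + ennreal (1 / V) * (\<integral>\<^sup>+y. ennreal (sqrt (r y)) \<partial>M) + (\<integral>\<^sup>+y. ennreal (r y) \<partial>M))"
    by (simp add: nn_integral_cmult nn_integral_add)
  also have "\<dots> \<le> ennreal W * (ennreal (c\<^sup>2 / U) * (ennreal m * (ennreal m * ennreal X))
      + ennreal (1 / V) * ennreal V + 1)"
    using N2 aff one by (intro mult_left_mono add_mono) auto
  also have "ennreal (c\<^sup>2 / U) * (ennreal m * (ennreal m * ennreal X)) = 1"
  proof -
    have "c\<^sup>2 / U * (m * (m * X)) = 1" using m pos by (simp add: U_def power2_eq_square)
    then show ?thesis using m pos U by (simp flip: ennreal_mult)
  qed
  also have "ennreal (1 / V) * ennreal V = 1"
    using pos by (simp flip: ennreal_mult)
  also have "ennreal W * (1 + 1 + 1) = ennreal (3 * W)"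
    using W by (simp add: ennreal_mult mult.commute)
  also have "W = (c * m) powr \<alpha> * X powr (\<alpha> / 2) * V powr (2 - 2 * \<alpha>)"
  proof -
    have "U powr (\<alpha> / 2) = (c * m) powr \<alpha> * X powr (\<alpha> / 2)"
      unfolding U_def using m pos
      by (simp add: powr_mult power_mult_distrib[symmetric] powr_powr flip: powr_numeral)
    then show ?thesis by (simp add: W_def)
  qed
  finally show ?thesis unfolding N_def .
qed

lemma evidence_lower_bound:
  fixes M :: "'y measure" and \<mu> :: "'t measure" and \<rho> :: "'t \<Rightarrow> 'y \<Rightarrow> real"
  assumes "prob_space M" "sigma_finite_measure \<mu>"
    and [measurable]: "(\<lambda>(t, y). \<rho> t y) \<in> borel_measurable (\<mu> \<Otimes>\<^sub>M M)" "S \<in> sets \<mu>"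
    and \<rho>: "\<And>t y. t \<in> S \<Longrightarrow> \<rho> t y > 0"
    and chi: "\<And>t. t \<in> S \<Longrightarrow> (\<integral>\<^sup>+y. ennreal (1 / \<rho> t y) \<partial>M) \<le> ennreal (exp K)"
    and s: "emeasure \<mu> S \<ge> ennreal s" "emeasure \<mu> S < \<top>" "s > 0"
  shows "emeasure M {y \<in> space M. (\<integral>\<^sup>+t. ennreal (\<rho> t y) \<partial>\<mu>) < ennreal (s * exp (- 2 * K))} \<le> ennreal (exp (- K))"
proof -
  interpret M: prob_space M by fact
  interpret \<mu>: sigma_finite_measure \<mu> by fact
  interpret pair_sigma_finite \<mu> M ..
  define J where "J = (\<lambda>y. \<integral>\<^sup>+t. ennreal (1 / \<rho> t y) * indicator S t \<partial>\<mu>)"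
  have [measurable]: "J \<in> borel_measurable M"
    unfolding J_def by (intro \<mu>.borel_measurable_nn_integral) measurable
  define p where "p = measure \<mu> S"
  have p: "emeasure \<mu> S = ennreal p" using s(2) by (simp add: p_def emeasure_eq_ennreal_measure)
  have sp: "s \<le> p" "p > 0" using s p by (auto simp: p_def intro: less_le_trans)
  \<comment> \<open>Small evidence forces \<open>J y\<close> to be at least \<open>p / c\<close>,
    whereas the mean of \<open>J\<close> is at most \<open>p * exp K\<close>; with this
    \<open>c\<close> Markov's inequality gives \<open>exp (- K)\<close>.\<close>
  define c where "c = exp (- 2 * K)"
  have c: "c > 0" by (simp add: c_def)
  have EJ: "(\<integral>\<^sup>+y. J y \<partial>M) \<le> ennreal (p * exp K)"
  proof -
    have "(\<integral>\<^sup>+y. J y \<partial>M) = (\<integral>\<^sup>+t. \<integral>\<^sup>+y. ennreal (1 / \<rho> t y) * indicator S t \<partial>M \<partial>\<mu>)"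
      unfolding J_def by (rule Fubini') measurable
    also have "\<dots> \<le> (\<integral>\<^sup>+t. ennreal (exp K) * indicator S t \<partial>\<mu>)"
    proof (intro nn_integral_mono)
      fix t show "(\<integral>\<^sup>+y. ennreal (1 / \<rho> t y) * indicator S t \<partial>M) \<le> ennreal (exp K) * indicator S t"
        using chi[of t] by (cases "t \<in> S") auto
    qed
    also have "\<dots> = ennreal (p * exp K)"
      using sp by (simp add: nn_integral_cmult_indicator p ennreal_mult mult.commute)
    finally show ?thesis .
  qed
  have "{y \<in> space M. (\<integral>\<^sup>+t. ennreal (\<rho> t y) \<partial>\<mu>) < ennreal (s * c)} \<subseteq> {y \<in> space M. 1 \<le> ennreal (c / p) * J y}"
  proof safe
    fix y assume y: "y \<in> space M" and lt: "(\<integral>\<^sup>+t. ennreal (\<rho> t y) \<partial>\<mu>) < ennreal (s * c)"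
    have [measurable]: "(\<lambda>t. \<rho> t y) \<in> borel_measurable \<mu>" using y by measurable
    have "ennreal (2 * c * p) = (\<integral>\<^sup>+t. ennreal (2 * c) * indicator S t \<partial>\<mu>)"
      using c sp by (simp add: nn_integral_cmult_indicator p ennreal_mult)
    also have "\<dots> \<le> (\<integral>\<^sup>+t. ennreal (\<rho> t y) + ennreal (c\<^sup>2) * (ennreal (1 / \<rho> t y) * indicator S t) \<partial>\<mu>)"
    proof (intro nn_integral_mono)
      fix t
      show "ennreal (2 * c) * indicator S t \<le> ennreal (\<rho> t y) + ennreal (c\<^sup>2) * (ennreal (1 / \<rho> t y) * indicator S t)"
      proof (cases "t \<in> S")
        case True
        define a where "a = \<rho> t y"
        have a: "a > 0" using \<rho> True by (simp add: a_def)
        have "2 * c \<le> a + c\<^sup>2 * (1 / a)"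
          using zero_le_power2[of "a - c"] a by (simp add: power2_eq_square field_simps)
        then have "ennreal (2 * c) \<le> ennreal (a + c\<^sup>2 * (1 / a))" by (rule ennreal_leI)
        also have "\<dots> = ennreal a + ennreal (c\<^sup>2) * ennreal (1 / a)"
          using a by (subst ennreal_plus) (auto simp flip: ennreal_mult)
        finally show ?thesis using True by (simp add: a_def)
      qed simp
    qed
    also have "\<dots> = (\<integral>\<^sup>+t. ennreal (\<rho> t y) \<partial>\<mu>) + ennreal (c\<^sup>2) * J y"
      unfolding J_def by (subst nn_integral_add) (auto simp: nn_integral_cmult)
    also have "\<dots> \<le> ennreal (p * c) + ennreal (c\<^sup>2) * J y"
    proof (rule add_right_mono)
      have "ennreal (s * c) \<le> ennreal (p * c)" using sp c by (intro ennreal_leI) simp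
      then show "(\<integral>\<^sup>+t. ennreal (\<rho> t y) \<partial>\<mu>) \<le> ennreal (p * c)" using lt by simp
    qed
    finally have le: "ennreal (2 * c * p) \<le> ennreal (p * c) + ennreal (c\<^sup>2) * J y" .
    show "1 \<le> ennreal (c / p) * J y"
    proof (cases "J y")
      case (real j)
      then have "2 * c * p \<le> p * c + c\<^sup>2 * j"
        using le c sp by (simp flip: ennreal_mult ennreal_plus)
      then have "c * p \<le> c * (c * j)" by (simp add: power2_eq_square mult_ac)
      then have "p \<le> c * j" using c by simp
      then have "1 \<le> c / p * j" using sp by (simp add: field_simps)
      then have "ennreal 1 \<le> ennreal (c / p * j)" by (rule ennreal_leI)
      moreover have "ennreal (c / p * j) = ennreal (c / p) * J y"
        using real c sp by (simp only: real(2)) (intro ennreal_mult, auto)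
      ultimately show ?thesis by (metis ennreal_1)
    next
      case top
      then show ?thesis using c sp by (simp add: ennreal_mult_top)
    qed
  qed
  then have "emeasure M {y \<in> space M. (\<integral>\<^sup>+t. ennreal (\<rho> t y) \<partial>\<mu>) < ennreal (s * c)}
     \<le> emeasure M {y \<in> space M. 1 \<le> ennreal (c / p) * J y}"
    by (intro emeasure_mono) auto
  also have "\<dots> \<le> ennreal (c / p) * (\<integral>\<^sup>+y. J y \<partial>M)"
  proof -
    have "(\<integral>\<^sup>+y. J y * indicator (space M) y \<partial>M) = (\<integral>\<^sup>+y. J y \<partial>M)"
      by (intro nn_integral_cong) simp
    then show ?thesis
      using nn_integral_Markov_inequality[where u = J and A = "space M" and M = M and c = "ennreal (c / p)"]
      by simp
  qed
  also have "\<dots> \<le> ennreal (c / p) * ennreal (p * exp K)" by (intro mult_left_mono EJ) auto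
  also have "\<dots> = ennreal (exp (- K))"
    using c sp by (simp add: c_def flip: ennreal_mult exp_add)
  finally show ?thesis unfolding c_def .
qed

section \<open>Quotients in the extended reals and the assembled bound\<close>

lemma ennreal_cancel_ratio:
  fixes a b :: ennreal
  assumes c: "0 < c" shows "ennreal c * a / (ennreal c * b) = a / b"
proof -
  have 1: "ennreal c * inverse (ennreal c) = 1"
    using c by (simp add: inverse_ennreal flip: ennreal_mult)
  have "inverse (ennreal c * b) = inverse (ennreal c) * inverse b"
    using c by (intro ennreal_inverse_mult') auto
  then have "ennreal c * a / (ennreal c * b) = (ennreal c * inverse (ennreal c)) * (a * inverse b)"
    by (simp add: divide_ennreal_def mult_ac)
  then show ?thesis by (simp add: 1 divide_ennreal_def)
qed

lemma ennreal_divide_le_one: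
  fixes a b :: ennreal
  assumes "a \<le> b" shows "a / b \<le> 1"
proof (cases "b = 0 \<or> b = \<top>")
  case True
  then show ?thesis using assms by (auto simp: divide_ennreal_def)
next
  case False
  then have "a / b \<le> b / b" using assms by (intro divide_right_mono_ennreal)
  also have "b / b = 1" using False by (simp add: less_top)
  finally show ?thesis .
qed

lemma ennreal_divide_le_mult:
  fixes a D :: ennreal
  assumes c: "c > 0" and D: "ennreal (1 / c) \<le> D"
  shows "a / D \<le> ennreal c * a"
proof (cases D)
  case (real d)
  have d: "1 / c \<le> d" using D real by simp
  then have "d > 0" using c by (meson less_le_trans zero_less_divide_1_iff)
  then have "1 / d \<le> c" using d c by (simp add: field_simps)
  then have "ennreal (1 / d) \<le> ennreal c" by (rule ennreal_leI)
  then have "a * ennreal (1 / d) \<le> a * ennreal c" by (intro mult_left_mono) auto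
  then show ?thesis using \<open>d > 0\<close> real
    by (simp add: divide_ennreal_def inverse_ennreal mult.commute inverse_eq_divide)
next
  case top
  then show ?thesis by (simp add: divide_ennreal_def)
qed

lemma nn_integral_add_count_space:
  assumes J: "countable J" and [measurable]: "f \<in> borel_measurable M"
    "\<And>j. j \<in> J \<Longrightarrow> g j \<in> borel_measurable M"
  shows "(\<integral>\<^sup>+y. f y + (\<integral>\<^sup>+j. g j y \<partial>count_space J) \<partial>M)
    = (\<integral>\<^sup>+y. f y \<partial>M) + (\<integral>\<^sup>+j. \<integral>\<^sup>+y. g j y \<partial>M \<partial>count_space J)"
proof -
  interpret J: sigma_finite_measure "count_space J"
    by (rule sigma_finite_measure_count_space_countable[OF J])
  have 1: "(\<lambda>(j, y). g j y) \<in> borel_measurable (count_space J \<Otimes>\<^sub>M M)"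
    by (rule measurable_pair_measure_countable1[OF J]) simp
  have "(\<lambda>(y, j). g j y) \<in> borel_measurable (M \<Otimes>\<^sub>M count_space J)"
    using measurable_compose[OF measurable_pair_swap' 1] by (simp add: case_prod_beta')
  then have "(\<lambda>y. \<integral>\<^sup>+j. g j y \<partial>count_space J) \<in> borel_measurable M"
    by (rule J.borel_measurable_nn_integral)
  then show ?thesis
    by (simp add: nn_integral_add nn_integral_count_space_nn_integral[OF J])
qed

text \<open>Outside the event of \<open>evidence_lower_bound\<close> the quotient is at most
  \<open>c\<close> times its numerator, and it is always at most 1; together this permits the
  truncation that \<open>cell_bound\<close> requires, cell by cell. The cells have to cover the set
  but not to be disjoint. \<open>T\<close> carries the prior, and likelihood ratios are positive on
  it.\<close>

lemma posterior_mass_bound: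
  fixes M :: "'y measure" and \<mu> :: "'t measure" and \<rho> :: "'t \<Rightarrow> 'y \<Rightarrow> real" and J :: "'j set"
  assumes "prob_space M" "sigma_finite_measure \<mu>"
    and [measurable]: "(\<lambda>(t, y). \<rho> t y) \<in> borel_measurable (\<mu> \<Otimes>\<^sub>M M)"
      "S \<in> sets \<mu>" "A \<in> sets \<mu>" "\<And>j. j \<in> J \<Longrightarrow> C j \<in> sets \<mu>" "T \<in> sets \<mu>"
    and AE: "AE t in \<mu>. t \<in> T"
    and \<rho>: "\<And>t y. t \<in> T \<Longrightarrow> \<rho> t y > 0" and ST: "S \<subseteq> T"
    and chi: "\<And>t. t \<in> S \<Longrightarrow> (\<integral>\<^sup>+y. ennreal (1 / \<rho> t y) \<partial>M) \<le> ennreal (exp K)"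
    and s: "emeasure \<mu> S \<ge> ennreal s" "emeasure \<mu> S < \<top>" "s > 0"
    and J: "countable J" and cover: "A \<inter> T \<subseteq> (\<Union>j\<in>J. C j)"
    and one: "\<And>t. t \<in> A \<inter> T \<Longrightarrow> (\<integral>\<^sup>+y. ennreal (\<rho> t y) \<partial>M) \<le> 1"
    and aff: "\<And>t. t \<in> A \<inter> T \<Longrightarrow> (\<integral>\<^sup>+y. ennreal (sqrt (\<rho> t y)) \<partial>M) \<le> ennreal V"
    and chij: "\<And>j t u. j \<in> J \<Longrightarrow> t \<in> C j \<inter> T \<Longrightarrow> u \<in> C j \<inter> T \<Longrightarrow>
        (\<integral>\<^sup>+y. ennreal ((\<rho> t y)\<^sup>2 / \<rho> u y) \<partial>M) \<le> ennreal (X j)"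
    and m: "\<And>j. j \<in> J \<Longrightarrow> emeasure \<mu> (C j \<inter> T) \<le> ennreal (m j)" "\<And>j. j \<in> J \<Longrightarrow> m j > 0"
    and pos: "\<And>j. j \<in> J \<Longrightarrow> X j > 0" "V > 0" and \<alpha>: "2 / 3 \<le> \<alpha>" "\<alpha> < 1"
  shows "(\<integral>\<^sup>+y. (\<integral>\<^sup>+t\<in>A. ennreal (\<rho> t y) \<partial>\<mu>) / (\<integral>\<^sup>+t. ennreal (\<rho> t y) \<partial>\<mu>) \<partial>M)
    \<le> ennreal (exp (- K)) + ennreal (3 * ((exp (2 * K) / s) powr \<alpha> * V powr (2 - 2 * \<alpha>))) *
        (\<integral>\<^sup>+j. ennreal (m j powr \<alpha> * X j powr (\<alpha> / 2)) \<partial>count_space J)"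
proof -
  interpret M: prob_space M by fact
  interpret \<mu>: sigma_finite_measure \<mu> by fact
  define c where "c = exp (2 * K) / s"
  have c: "c > 0" using s by (simp add: c_def)
  \<comment> \<open>Cells are cut down to \<open>A\<close>, because the affinity bound, needed at
    the reference point \<open>u\<close>, is available only there.\<close>
  define E where "E = (\<lambda>j. C j \<inter> A \<inter> T)"
  have E[measurable]: "E j \<in> sets \<mu>" if "j \<in> J" for j using that unfolding E_def by measurable
  define N where "N = (\<lambda>j y. \<integral>\<^sup>+t\<in>E j. ennreal (\<rho> t y) \<partial>\<mu>)"
  define D where "D = (\<lambda>y. \<integral>\<^sup>+t. ennreal (\<rho> t y) \<partial>\<mu>)"
  define NA where "NA = (\<lambda>y. \<integral>\<^sup>+t\<in>A. ennreal (\<rho> t y) \<partial>\<mu>)"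
  have [measurable]: "D \<in> borel_measurable M"
    unfolding D_def by (intro \<mu>.borel_measurable_nn_integral) measurable
  have [measurable]: "N j \<in> borel_measurable M" if "j \<in> J" for j
    unfolding N_def using that by (intro \<mu>.borel_measurable_nn_integral) measurable
  define Bad where "Bad = {y \<in> space M. D y < ennreal (s * exp (- 2 * K))}"
  have [measurable]: "Bad \<in> sets M" unfolding Bad_def by measurable
  have sum: "NA y \<le> (\<integral>\<^sup>+j. N j y \<partial>count_space J)" if y: "y \<in> space M" for y
  proof -
    have [measurable]: "(\<lambda>t. \<rho> t y) \<in> borel_measurable \<mu>" using y by measurable
    have "NA y = (\<integral>\<^sup>+t. ennreal (\<rho> t y) * indicator (A \<inter> T) t \<partial>\<mu>)"
      unfolding NA_def using AE by (intro nn_integral_cong_AE) (auto split: split_indicator)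
    also have "\<dots> \<le> (\<integral>\<^sup>+t. \<integral>\<^sup>+j. ennreal (\<rho> t y) * indicator (E j) t \<partial>count_space J \<partial>\<mu>)"
    proof (intro nn_integral_mono)
      fix t show "ennreal (\<rho> t y) * indicator (A \<inter> T) t \<le> (\<integral>\<^sup>+j. ennreal (\<rho> t y) * indicator (E j) t \<partial>count_space J)"
      proof (cases "t \<in> A \<inter> T")
        case True
        then obtain j where j: "j \<in> J" "t \<in> C j" using cover by blast
        have "ennreal (\<rho> t y) * indicator (E j) t \<le> (\<integral>\<^sup>+j. ennreal (\<rho> t y) * indicator (E j) t \<partial>count_space J)"
          by (rule nn_integral_ge_point) (rule j)
        then show ?thesis using True j by (simp add: E_def)
      qed simp
    qed
    also have "\<dots> = (\<integral>\<^sup>+j. N j y \<partial>count_space J)"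
      unfolding N_def by (rule nn_integral_count_space_nn_integral[OF J]) measurable
    finally show ?thesis .
  qed
  have pw: "NA y / D y \<le> indicator Bad y + (\<integral>\<^sup>+j. min 1 (ennreal c * N j y) \<partial>count_space J)"
    if y: "y \<in> space M" for y
  proof (cases "y \<in> Bad")
    case True
    have "NA y \<le> D y"
      unfolding NA_def D_def by (intro nn_integral_mono) (simp split: split_indicator)
    then have "NA y / D y \<le> 1"
      by (rule ennreal_divide_le_one)
    then show ?thesis using True by (simp add: add_increasing2)
  next
    case False
    then have D: "D y \<ge> ennreal (1 / c)"
      using y by (simp add: Bad_def not_less c_def exp_minus divide_inverse mult.commute)
    have "NA y \<le> D y"
      unfolding NA_def D_def by (intro nn_integral_mono) (simp split: split_indicator)
    then have 1: "NA y / D y \<le> 1" by (rule ennreal_divide_le_one)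
    have "NA y / D y \<le> ennreal c * NA y"
      using c D by (rule ennreal_divide_le_mult)
    also have "\<dots> \<le> ennreal c * (\<integral>\<^sup>+j. N j y \<partial>count_space J)"
      by (intro mult_left_mono sum y) auto
    also have "\<dots> = (\<integral>\<^sup>+j. ennreal c * N j y \<partial>count_space J)"
      by (rule nn_integral_cmult[symmetric]) simp
    finally have "NA y / D y \<le> min 1 (\<integral>\<^sup>+j. ennreal c * N j y \<partial>count_space J)" using 1 by simp
    also have "\<dots> \<le> (\<integral>\<^sup>+j. min 1 (ennreal c * N j y) \<partial>count_space J)"
      by (rule min_one_nn_integral_le)
    finally show ?thesis using False by simp
  qed
  have cell: "(\<integral>\<^sup>+y. min 1 (ennreal c * N j y) \<partial>M)
      \<le> ennreal (3 * (c powr \<alpha> * V powr (2 - 2 * \<alpha>))) * ennreal (m j powr \<alpha> * X j powr (\<alpha> / 2))"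
    if j: "j \<in> J" for j
  proof (cases "E j = {}")
    case True
    then show ?thesis by (simp add: N_def)
  next
    case False
    then obtain u where u: "u \<in> E j" by blast
    have mE: "emeasure \<mu> (E j) \<le> ennreal (m j)"
      by (rule order_trans[OF emeasure_mono m(1)[OF j]]) (use j in \<open>auto simp: E_def\<close>)
    have "u \<in> T" "u \<in> A \<inter> T" using u by (auto simp: E_def)
    have uS: "u \<in> space \<mu>" using sets.sets_into_space[OF E[OF j]] u by auto
    have [measurable]: "\<rho> u \<in> borel_measurable M"
      using measurable_compose_Pair1[OF uS, of "\<lambda>(t, y). \<rho> t y" M borel] by simp
    have "(\<integral>\<^sup>+y. min 1 (ennreal c * N j y) \<partial>M)
        \<le> ennreal (3 * ((c * m j) powr \<alpha> * X j powr (\<alpha> / 2) * V powr (2 - 2 * \<alpha>)))"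
      unfolding N_def
    proof (rule cell_bound[OF \<open>prob_space M\<close> \<open>sigma_finite_measure \<mu>\<close>, where r = "\<rho> u"])
      show "0 < \<rho> u y" for y using \<rho> \<open>u \<in> T\<close> by blast
      show "0 \<le> \<rho> t y" if "t \<in> E j" for t y using \<rho>[of t y] that by (auto simp: E_def)
      show "(\<integral>\<^sup>+y. ennreal ((\<rho> t y)\<^sup>2 / \<rho> u y) \<partial>M) \<le> ennreal (X j)" if "t \<in> E j" for t
        using that u by (intro chij[OF j]) (auto simp: E_def)
    qed (use mE m j pos c \<alpha> aff one \<open>u \<in> A \<inter> T\<close> in auto)
    also have "3 * ((c * m j) powr \<alpha> * X j powr (\<alpha> / 2) * V powr (2 - 2 * \<alpha>))
       = 3 * (c powr \<alpha> * V powr (2 - 2 * \<alpha>)) * (m j powr \<alpha> * X j powr (\<alpha> / 2))"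
      using c m(2)[OF j] by (simp add: powr_mult)
    finally show ?thesis by (simp add: ennreal_mult')
  qed
  have "(\<integral>\<^sup>+y. NA y / D y \<partial>M)
      \<le> (\<integral>\<^sup>+y. indicator Bad y + (\<integral>\<^sup>+j. min 1 (ennreal c * N j y) \<partial>count_space J) \<partial>M)"
    by (intro nn_integral_mono pw)
  also have "\<dots> = (\<integral>\<^sup>+y. indicator Bad y \<partial>M) + (\<integral>\<^sup>+j. \<integral>\<^sup>+y. min 1 (ennreal c * N j y) \<partial>M \<partial>count_space J)"
    by (rule nn_integral_add_count_space[OF J]) measurable
  also have "(\<integral>\<^sup>+j. \<integral>\<^sup>+y. min 1 (ennreal c * N j y) \<partial>M \<partial>count_space J)
      \<le> (\<integral>\<^sup>+j. ennreal (3 * (c powr \<alpha> * V powr (2 - 2 * \<alpha>))) *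
        ennreal (m j powr \<alpha> * X j powr (\<alpha> / 2)) \<partial>count_space J)"
    by (intro nn_integral_mono) (use cell in simp)
  also have "\<dots> = ennreal (3 * (c powr \<alpha> * V powr (2 - 2 * \<alpha>))) *
        (\<integral>\<^sup>+j. ennreal (m j powr \<alpha> * X j powr (\<alpha> / 2)) \<partial>count_space J)"
    by (rule nn_integral_cmult) simp
  also have "(\<integral>\<^sup>+y. indicator Bad y \<partial>M) \<le> ennreal (exp (- K))"
    using evidence_lower_bound[OF \<open>prob_space M\<close> \<open>sigma_finite_measure \<mu>\<close>, of \<rho> S K s] s chi \<rho> ST
    by (auto simp: Bad_def D_def)
  finally show ?thesis unfolding NA_def D_def c_def by (simp add: add_right_mono)
qed

section \<open>The regression model in coordinates\<close>

text \<open>Component \<open>k\<close> of the mean of observation \<open>i\<close>, as a function of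
  the coordinates of the coefficient matrix.\<close>

definition mu :: "nat \<Rightarrow> real mat \<Rightarrow> (nat \<times> nat \<Rightarrow> real) \<Rightarrow> nat \<Rightarrow> nat \<Rightarrow> real" where
  "mu p X b i k = (\<Sum>j<p. b (j, k) * X $$ (i, j))"

definition om :: "(nat \<times> nat \<Rightarrow> real) \<Rightarrow> nat \<Rightarrow> nat \<Rightarrow> real" where
  "om w i j = w (min i j, max i j)"

definition upper_idx :: "nat \<Rightarrow> (nat \<times> nat) set" where
  "upper_idx q = {(k, k'). k \<le> k' \<and> k' < q}"

lemma finite_upper_idx [simp]: "finite (upper_idx q)"
  by (rule finite_subset[of _ "{..<q} \<times> {..<q}"]) (auto simp: upper_idx_def)

lemma sym_on_om: "sym_on I (om w)"
  by (simp add: sym_on_def om_def min.commute max.commute)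

lemma normal_density_prec_eq_nd:
  assumes "X \<in> carrier_mat n p" "i < n"
  shows "normal_density_prec q (obs_mean X (B_of p q b) i) (Omega_of q w) y = nd q (om w) (mu p X b i) y"
proof -
  define v where "v = Matrix.vec q y - obs_mean X (B_of p q b) i"
  have om: "obs_mean X (B_of p q b) i \<in> carrier_vec q"
    by (rule carrier_vecI) (simp add: obs_mean_def B_of_def)
  have v: "v \<in> carrier_vec q" unfolding v_def using om by simp
  have O: "Omega_of q w \<in> carrier_mat q q" by (simp add: Omega_of_def)
  have vk: "vec_index v k = y k - mu p X b i k" if "k < q" for k
    using that assms om
    by (simp add: v_def obs_mean_def B_of_def mu_def scalar_prod_def lessThan_atLeast0)
  have "scalar_prod v (Omega_of q w *\<^sub>v v)
      = bform {..<q} (om w) (\<lambda>k. y k - mu p X b i k) (\<lambda>k. y k - mu p X b i k)"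
    unfolding bform_mat[OF O v v] by (intro bform_cong) (auto simp: Omega_of_def om_def vk)
  moreover have "Determinant.det (Omega_of q w) = fdet q (om w)"
    unfolding fdet_def Omega_of_def om_def ..
  ultimately show ?thesis by (simp add: normal_density_prec_def nd_def v_def)
qed

definition sm :: "nat \<Rightarrow> nat \<Rightarrow> nat \<Rightarrow> real mat \<Rightarrow> (nat \<times> nat \<Rightarrow> real) \<Rightarrow> (nat \<times> nat \<Rightarrow> real) \<Rightarrow> (nat \<Rightarrow> nat \<Rightarrow> real) measure" where
  "sm n p q X b w = (\<Pi>\<^sub>M i\<in>{..<n}. density (lborel_pow q) (\<lambda>y. ennreal (nd q (om w) (mu p X b i) y)))"

lemma sampling_measure_eq_sm:
  assumes "X \<in> carrier_mat n p"
  shows "sampling_measure n q X (B_of p q b) (Omega_of q w) = sm n p q X b w"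
  unfolding sampling_measure_def sm_def
  by (intro PiM_cong refl) (simp add: normal_density_prec_eq_nd[OF assms])

section \<open>Likelihood ratios against the truth\<close>

definition lr :: "nat \<Rightarrow> nat \<Rightarrow> nat \<Rightarrow> real mat \<Rightarrow> (nat \<times> nat \<Rightarrow> real) \<Rightarrow> (nat \<times> nat \<Rightarrow> real) \<Rightarrow>
    (nat \<times> nat \<Rightarrow> real) \<times> (nat \<times> nat \<Rightarrow> real) \<Rightarrow> (nat \<Rightarrow> nat \<Rightarrow> real) \<Rightarrow> real" where
  "lr n p q X b0 w0 t Y = (\<Prod>i<n. nd q (om (snd t)) (mu p X (fst t) i) (Y i) / nd q (om w0) (mu p X b0 i) (Y i))"

lemma prob_space_nd:
  assumes "pd_on {..<q} A"
  shows "prob_space (density (lborel_pow q) (\<lambda>y. ennreal (nd q A \<mu> y)))"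
proof
  have "emeasure (density (lborel_pow q) (\<lambda>y. ennreal (nd q A \<mu> y))) (space (lborel_pow q)) = 1"
    by (subst emeasure_density) (auto simp: nd_integral[OF assms] intro!: trans[OF nn_integral_cong nd_integral[OF assms]])
  then show "emeasure (density (lborel_pow q) (\<lambda>y. ennreal (nd q A \<mu> y)))
      (space (density (lborel_pow q) (\<lambda>y. ennreal (nd q A \<mu> y)))) = 1" by simp
qed

lemma prob_space_sm: "pd_on {..<q} (om w) \<Longrightarrow> prob_space (sm n p q X b w)"
  unfolding sm_def by (intro prob_space_PiM prob_space_nd)

lemma nn_integral_sm_prod:
  assumes pd: "pd_on {..<q} (om w)" and [measurable]: "\<And>i. i < n \<Longrightarrow> f i \<in> borel_measurable (lborel_pow q)"
    and f: "\<And>i y. i < n \<Longrightarrow> f i y \<ge> 0"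
  shows "(\<integral>\<^sup>+Y. ennreal (\<Prod>i<n. f i (Y i)) \<partial>sm n p q X b w)
    = (\<Prod>i<n. \<integral>\<^sup>+y. ennreal (nd q (om w) (mu p X b i) y * f i y) \<partial>lborel_pow q)"
proof -
  let ?D = "\<lambda>i. density (lborel_pow q) (\<lambda>y. ennreal (nd q (om w) (mu p X b i) y))"
  interpret product_sigma_finite ?D
    by (intro product_sigma_finite.intro prob_space_imp_sigma_finite prob_space_nd pd)
  have "(\<integral>\<^sup>+Y. ennreal (\<Prod>i<n. f i (Y i)) \<partial>sm n p q X b w)
      = (\<integral>\<^sup>+Y. (\<Prod>i<n. ennreal (f i (Y i))) \<partial>sm n p q X b w)"
    using f by (intro nn_integral_cong) (subst prod_ennreal, auto)
  also have "\<dots> = (\<Prod>i<n. \<integral>\<^sup>+y. ennreal (f i y) \<partial>?D i)"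
    unfolding sm_def by (rule product_nn_integral_prod) auto
  also have "\<dots> = (\<Prod>i<n. \<integral>\<^sup>+y. ennreal (nd q (om w) (mu p X b i) y * f i y) \<partial>lborel_pow q)"
  proof (intro prod.cong refl)
    fix i assume "i \<in> {..<n}"
    then have i: "i < n" by simp
    show "(\<integral>\<^sup>+y. ennreal (f i y) \<partial>?D i)
        = (\<integral>\<^sup>+y. ennreal (nd q (om w) (mu p X b i) y * f i y) \<partial>lborel_pow q)"
      using i f[OF i] less_imp_le[OF nd_pos[OF pd]] by (simp add: nn_integral_density ennreal_mult)
  qed
  finally show ?thesis .
qed

lemma lr_pos: "pd_on {..<q} (om (snd t)) \<Longrightarrow> pd_on {..<q} (om w0) \<Longrightarrow> lr n p q X b0 w0 t Y > 0"
  unfolding lr_def by (intro prod_pos) (simp add: nd_pos)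

lemma lr_integral:
  assumes pd: "pd_on {..<q} (om w0)" and pt: "pd_on {..<q} (om (snd t))"
  shows "(\<integral>\<^sup>+Y. ennreal (lr n p q X b0 w0 t Y) \<partial>sm n p q X b0 w0) = 1"
proof -
  have nz: "nd q (om w0) \<mu> y \<noteq> 0" for \<mu> y using nd_pos[OF pd, of \<mu> y] by simp
  show ?thesis
    unfolding lr_def
    by (subst nn_integral_sm_prod[OF pd])
      (auto simp: nz nd_integral[OF pt] less_imp_le[OF nd_pos[OF pd]] less_imp_le[OF nd_pos[OF pt]]
        intro!: divide_nonneg_nonneg)
qed

lemma prod_mono_ennreal:
  fixes f g :: "'a \<Rightarrow> ennreal"
  assumes "\<And>i. i \<in> S \<Longrightarrow> f i \<le> g i"
  shows "(\<Prod>i\<in>S. f i) \<le> (\<Prod>i\<in>S. g i)"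
  using assms by (induction S rule: infinite_finite_induct) (auto intro!: mult_mono)

lemma real_sqrt_prod: "sqrt (\<Prod>i\<in>S. f i) = (\<Prod>i\<in>S. sqrt (f i))"
  by (induction S rule: infinite_finite_induct) (auto simp: real_sqrt_mult)

lemma lr_affinity:
  assumes pd: "pd_on {..<q} (om w0)" and pt: "pd_on {..<q} (om w)" and \<tau>: "\<tau> \<ge> 0"
    and lo0: "\<And>v. \<tau> * (\<Sum>k<q. (v k)\<^sup>2) \<le> bform {..<q} (om w0) v v"
    and lo1: "\<And>v. \<tau> * (\<Sum>k<q. (v k)\<^sup>2) \<le> bform {..<q} (om w) v v"
    and \<beta>: "\<beta> > 0" and up0: "\<And>v. bform {..<q} (om w0) v v \<le> \<beta> * (\<Sum>k<q. (v k)\<^sup>2)"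
  shows "(\<integral>\<^sup>+Y. ennreal (sqrt (lr n p q X b0 w0 (b, w) Y)) \<partial>sm n p q X b0 w0)
    \<le> ennreal (exp (- (\<tau> / 8 * (\<Sum>i<n. \<Sum>k<q. (mu p X b0 i k - mu p X b i k)\<^sup>2))
         - real n * (min ((\<Sum>i<q. \<Sum>j<q. (om w i j - om w0 i j)\<^sup>2) / \<beta>\<^sup>2) 1 / 64)))"
proof -
  note p0 = nd_pos[OF pd] and p1 = nd_pos[OF pt]
  let ?f = "\<lambda>i y. sqrt (nd q (om w) (mu p X b i) y / nd q (om w0) (mu p X b0 i) y)"
  have "(\<integral>\<^sup>+Y. ennreal (sqrt (lr n p q X b0 w0 (b, w) Y)) \<partial>sm n p q X b0 w0)
      = (\<integral>\<^sup>+Y. ennreal (\<Prod>i<n. ?f i (Y i)) \<partial>sm n p q X b0 w0)"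
    by (simp add: lr_def real_sqrt_prod)
  also have "\<dots> = (\<Prod>i<n. \<integral>\<^sup>+y. ennreal (nd q (om w0) (mu p X b0 i) y * ?f i y) \<partial>lborel_pow q)"
    by (rule nn_integral_sm_prod[OF pd]) (auto simp: less_imp_le[OF p0] less_imp_le[OF p1])
  also have "\<dots> = (\<Prod>i<n. \<integral>\<^sup>+y. ennreal (sqrt (nd q (om w0) (mu p X b0 i) y * nd q (om w) (mu p X b i) y)) \<partial>lborel_pow q)"
  proof (intro prod.cong refl nn_integral_cong arg_cong[of _ _ ennreal])
    fix i y
    define a where "a = nd q (om w0) (mu p X b0 i) y"
    define c where "c = nd q (om w) (mu p X b i) y"
    have "a > 0" "c > 0" using p0 p1 by (auto simp: a_def c_def)
    then have "a * c = a\<^sup>2 * (c / a)" by (simp add: power2_eq_square)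
    then have "a * sqrt (c / a) = sqrt (a * c)" using \<open>a > 0\<close> by (simp only: real_sqrt_mult) simp
    then show "nd q (om w0) (mu p X b0 i) y * ?f i y = sqrt (nd q (om w0) (mu p X b0 i) y * nd q (om w) (mu p X b i) y)"
      by (simp add: a_def c_def)
  qed
  also have "\<dots> \<le> (\<Prod>i<n. ennreal (exp (- (\<tau> / 8 * (\<Sum>k<q. (mu p X b0 i k - mu p X b i k)\<^sup>2))
         - min ((\<Sum>i<q. \<Sum>j<q. (om w i j - om w0 i j)\<^sup>2) / \<beta>\<^sup>2) 1 / 64)))"
    by (intro prod_mono_ennreal affinity_bound[OF pd pt \<tau> lo0 lo1 \<beta> up0])
  also have "\<dots> = ennreal (exp (\<Sum>i<n. - (\<tau> / 8 * (\<Sum>k<q. (mu p X b0 i k - mu p X b i k)\<^sup>2))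
         - min ((\<Sum>i<q. \<Sum>j<q. (om w i j - om w0 i j)\<^sup>2) / \<beta>\<^sup>2) 1 / 64))"
    by (simp add: prod_ennreal exp_sum)
  also have "(\<Sum>i<n. - (\<tau> / 8 * (\<Sum>k<q. (mu p X b0 i k - mu p X b i k)\<^sup>2))
         - min ((\<Sum>i<q. \<Sum>j<q. (om w i j - om w0 i j)\<^sup>2) / \<beta>\<^sup>2) 1 / 64)
       = - (\<tau> / 8 * (\<Sum>i<n. \<Sum>k<q. (mu p X b0 i k - mu p X b i k)\<^sup>2))
         - real n * (min ((\<Sum>i<q. \<Sum>j<q. (om w i j - om w0 i j)\<^sup>2) / \<beta>\<^sup>2) 1 / 64)"
    by (simp add: sum_subtractf sum_negf sum_distrib_left)
  finally show ?thesis .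
qed

text \<open>Under the truth, the mean of the squared ratio at \<open>t\<close> over the ratio at
  \<open>u\<close> is the integral of f_t^2 / f_u. The density of the truth has cancelled, so only
  the closeness of \<open>t\<close> and \<open>u\<close> matters.\<close>

lemma lr_chi_square:
  assumes pd: "pd_on {..<q} (om w0)" and pt: "pd_on {..<q} (om (snd t))" and pu: "pd_on {..<q} (om (snd u))"
    and g: "0 \<le> g" "g < 1"
    and lo: "\<And>v. (1 - g) * bform {..<q} (om (snd t)) v v \<le> bform {..<q} (om (snd u)) v v"
    and up: "\<And>v. bform {..<q} (om (snd u)) v v \<le> (1 + g) * bform {..<q} (om (snd t)) v v"
    and K: "n > 0 \<Longrightarrow> (1 + g) / (1 - g) * (\<Sum>i<n. bform {..<q} (om (snd t))
        (\<lambda>k. mu p X (fst u) i k - mu p X (fst t) i k) (\<lambda>k. mu p X (fst u) i k - mu p X (fst t) i k)) \<le> K"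
      "K \<ge> 0"
  shows "(\<integral>\<^sup>+Y. ennreal ((lr n p q X b0 w0 t Y)\<^sup>2 / lr n p q X b0 w0 u Y) \<partial>sm n p q X b0 w0)
    \<le> ennreal (exp K / (1 - g) ^ (q * n))"
proof -
  note p0 = nd_pos[OF pd] and p2 = nd_pos[OF pu]
  let ?m = "\<lambda>i k. mu p X (fst u) i k - mu p X (fst t) i k"
  let ?f = "\<lambda>i y. (nd q (om (snd t)) (mu p X (fst t) i) y / nd q (om w0) (mu p X b0 i) y)\<^sup>2 /
       (nd q (om (snd u)) (mu p X (fst u) i) y / nd q (om w0) (mu p X b0 i) y)"
  have "(\<integral>\<^sup>+Y. ennreal ((lr n p q X b0 w0 t Y)\<^sup>2 / lr n p q X b0 w0 u Y) \<partial>sm n p q X b0 w0)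
      = (\<integral>\<^sup>+Y. ennreal (\<Prod>i<n. ?f i (Y i)) \<partial>sm n p q X b0 w0)"
    by (simp add: lr_def prod_dividef prod_power_distrib power_divide prod.distrib)
  also have "\<dots> = (\<Prod>i<n. \<integral>\<^sup>+y. ennreal (nd q (om w0) (mu p X b0 i) y * ?f i y) \<partial>lborel_pow q)"
    by (rule nn_integral_sm_prod[OF pd]) (auto simp: less_imp_le[OF p0] less_imp_le[OF p2])
  also have "\<dots> = (\<Prod>i<n. \<integral>\<^sup>+y. ennreal ((nd q (om (snd t)) (mu p X (fst t) i) y)\<^sup>2 / nd q (om (snd u)) (mu p X (fst u) i) y) \<partial>lborel_pow q)"
  proof (intro prod.cong refl nn_integral_cong arg_cong[of _ _ ennreal])
    fix i y
    have "nd q (om w0) (mu p X b0 i) y \<noteq> 0" using p0[of "mu p X b0 i" y] by simp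
    then show "nd q (om w0) (mu p X b0 i) y * ?f i y
        = (nd q (om (snd t)) (mu p X (fst t) i) y)\<^sup>2 / nd q (om (snd u)) (mu p X (fst u) i) y"
      by (simp add: power_divide power2_eq_square)
  qed
  also have "\<dots> \<le> (\<Prod>i<n. ennreal (exp ((1 + g) / (1 - g) * bform {..<q} (om (snd t)) (?m i) (?m i)) / (1 - g) ^ q))"
    by (intro prod_mono_ennreal chi_square_bound[OF pt pu g lo up])
  also have "\<dots> = ennreal (\<Prod>i<n. exp ((1 + g) / (1 - g) * bform {..<q} (om (snd t)) (?m i) (?m i)) / (1 - g) ^ q)"
    using g by (intro prod_ennreal) auto
  also have "(\<Prod>i<n. exp ((1 + g) / (1 - g) * bform {..<q} (om (snd t)) (?m i) (?m i)) / (1 - g) ^ q)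
      = exp ((1 + g) / (1 - g) * (\<Sum>i<n. bform {..<q} (om (snd t)) (?m i) (?m i))) / (1 - g) ^ (q * n)"
    by (simp add: prod_dividef exp_sum sum_distrib_left power_mult)
  also have "ennreal \<dots> \<le> ennreal (exp K / (1 - g) ^ (q * n))"
    using g K by (intro ennreal_leI divide_right_mono) (cases "n = 0", auto)
  finally show ?thesis .
qed

lemma lr_self: "pd_on {..<q} (om w0) \<Longrightarrow> lr n p q X b0 w0 (b0, w0) Y = 1"
  unfolding lr_def
  using nd_pos[of q "om w0"] by (intro prod.neutral ballI) (simp add: less_imp_neq[symmetric])

subsection \<open>Measurability\<close>

abbreviation B_space :: "nat \<Rightarrow> nat \<Rightarrow> (nat \<times> nat \<Rightarrow> real) measure" where
  "B_space p q \<equiv> (\<Pi>\<^sub>M jk \<in> {..<p} \<times> {..<q}. borel)"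

abbreviation O_space :: "nat \<Rightarrow> (nat \<times> nat \<Rightarrow> real) measure" where
  "O_space q \<equiv> (\<Pi>\<^sub>M kk \<in> upper_idx q. borel)"

lemma om_measurable [measurable]:
  "i < q \<Longrightarrow> j < q \<Longrightarrow> (\<lambda>w. om w i j) \<in> borel_measurable (O_space q)"
  unfolding om_def by (rule measurable_component_singleton) (auto simp: upper_idx_def)

lemma mu_measurable [measurable]:
  "k < q \<Longrightarrow> (\<lambda>b. mu p X b i k) \<in> borel_measurable (B_space p q)"
  unfolding mu_def by (intro borel_measurable_sum borel_measurable_times measurable_component_singleton) auto

text \<open>By the Leibniz formula the determinant is a polynomial in the entries.\<close>

lemma fdet_measurable:
  assumes "\<And>i j. i < q \<Longrightarrow> j < q \<Longrightarrow> (\<lambda>x. A x i j) \<in> borel_measurable M"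
  shows "(\<lambda>x. fdet q (A x)) \<in> borel_measurable M"
proof -
  have "fdet q (A x) = (\<Sum>\<pi>\<in>{\<pi>. \<pi> permutes {0..<q}}. of_int (sign \<pi>) * (\<Prod>i = 0..<q. A x i (\<pi> i)))" for x
    unfolding fdet_def Determinant.det_def
    by (auto intro!: sum.cong prod.cong simp: permutes_in_image[of _ "{0..<q}", simplified])
  then show ?thesis
    using assms
    by (auto intro!: borel_measurable_sum borel_measurable_times borel_measurable_prod
        simp: permutes_in_image[of _ "{0..<q}", simplified])
qed

lemma bform_measurable_mat [measurable (raw)]:
  assumes "\<And>i j. i < q \<Longrightarrow> j < q \<Longrightarrow> (\<lambda>x. A x i j) \<in> borel_measurable M"
    and "\<And>i. i < q \<Longrightarrow> (\<lambda>x. u x i) \<in> borel_measurable M" "\<And>i. i < q \<Longrightarrow> (\<lambda>x. v x i) \<in> borel_measurable M"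
  shows "(\<lambda>x. bform {..<q} (A x) (u x) (v x)) \<in> borel_measurable M"
  unfolding bform_def using assms
  by (intro borel_measurable_sum borel_measurable_times) auto

lemma lr_measurable:
  "(\<lambda>(t, Y). lr n p q X b0 w0 t Y)
     \<in> borel_measurable ((B_space p q \<Otimes>\<^sub>M O_space q) \<Otimes>\<^sub>M (\<Pi>\<^sub>M i\<in>{..<n}. \<Pi>\<^sub>M k\<in>{..<q}. borel))"
proof -
  let ?N = "(B_space p q \<Otimes>\<^sub>M O_space q) \<Otimes>\<^sub>M (\<Pi>\<^sub>M i\<in>{..<n}. \<Pi>\<^sub>M k\<in>{..<q}. (borel :: real measure))"
  have Y: "(\<lambda>x. snd x i k) \<in> borel_measurable ?N" if "i < n" "k < q" for i k
  proof -
    have "(\<lambda>Y. Y i k) \<in> borel_measurable (\<Pi>\<^sub>M i\<in>{..<n}. \<Pi>\<^sub>M k\<in>{..<q}. (borel :: real measure))"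
      using that
      by (intro measurable_compose[OF measurable_component_singleton[of i] measurable_component_singleton[of k]]) auto
    then show ?thesis by (rule measurable_compose[OF measurable_snd])
  qed
  have b: "(\<lambda>x. mu p X (fst (fst x)) i k) \<in> borel_measurable ?N" if "k < q" for i k
    by (rule measurable_compose[OF measurable_compose[OF measurable_fst measurable_fst] mu_measurable[OF that]])
  have w: "(\<lambda>x. om (snd (fst x)) i j) \<in> borel_measurable ?N" if "i < q" "j < q" for i j
    by (rule measurable_compose[OF measurable_compose[OF measurable_fst measurable_snd] om_measurable[OF that]])
  have nd: "(\<lambda>x. nd q (A x) (m x) (snd x i)) \<in> borel_measurable ?N"
    if i: "i < n" and A: "\<And>i j. i < q \<Longrightarrow> j < q \<Longrightarrow> (\<lambda>x. A x i j) \<in> borel_measurable ?N"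
      and m: "\<And>k. k < q \<Longrightarrow> (\<lambda>x. m x k) \<in> borel_measurable ?N" for A m i
  proof -
    have [measurable]: "(\<lambda>x. fdet q (A x)) \<in> borel_measurable ?N"
      by (rule fdet_measurable) (rule A)
    have [measurable]: "(\<lambda>x. bform {..<q} (A x) (\<lambda>k. snd x i k - m x k) (\<lambda>k. snd x i k - m x k)) \<in> borel_measurable ?N"
      by (intro bform_measurable_mat A borel_measurable_diff Y i m)
    show ?thesis unfolding nd_def by measurable
  qed
  show ?thesis
    unfolding lr_def case_prod_beta
    by (intro borel_measurable_prod borel_measurable_divide nd w b) auto
qed

section \<open>Measurability of the positive definiteness constraint\<close>

lemma psd_pd:
  assumes sym: "sym_on {..<q} A" and psd: "\<And>v. bform {..<q} A v v \<ge> 0" and d: "fdet q A \<noteq> 0"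
  shows "pd_on {..<q} A"
  unfolding pd_on_def
proof (intro conjI allI impI sym)
  fix v :: "nat \<Rightarrow> real" assume "\<exists>i\<in>{..<q}. v i \<noteq> 0"
  then obtain k where k: "k < q" "v k \<noteq> 0" by auto
  show "0 < bform {..<q} A v v"
  proof (rule ccontr)
    assume "\<not> 0 < bform {..<q} A v v"
    then have "bform {..<q} A v v = 0" using psd[of v] by simp
    then have null: "bform {..<q} A u v = 0" for u by (rule psd_null[OF sym psd])
    obtain u where u: "\<And>i. i < q \<Longrightarrow> (\<Sum>j<q. A i j * u j) = (if i = k then 1 else 0)"
      using linear_system_solvable[OF d, of "\<lambda>i. if i = k then 1 else 0"] by blast
    have "bform {..<q} A u v = bform {..<q} A v u" by (rule bform_commute[OF sym])
    also have "\<dots> = (\<Sum>i<q. v i * (\<Sum>j<q. A i j * u j))"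
      by (simp add: bform_def sum_distrib_left mult_ac)
    also have "\<dots> = (\<Sum>i<q. if i = k then v i else 0)" by (intro sum.cong) (auto simp: u)
    also have "\<dots> = v k" using k by simp
    finally show False using null[of u] k by simp
  qed
qed

text \<open>By continuity: \<open>v\<close> is the limit of its roundings to denominators
  \<open>m + 1\<close>.\<close>

lemma psd_rational:
  assumes "\<And>v. v \<in> (\<Pi>\<^sub>E k\<in>{..<q}. \<rat>) \<Longrightarrow> bform {..<q} A v v \<ge> 0"
  shows "bform {..<q} A v v \<ge> 0"
proof -
  define r where "r = (\<lambda>m k. real_of_int \<lfloor>real (Suc m) * v k\<rfloor> / real (Suc m))"
  have r: "(\<lambda>m. r m k) \<longlonglongrightarrow> v k" for k
  proof -
    have "\<bar>r m k - v k\<bar> \<le> 1 / real (Suc m)" for m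
    proof -
      have "r m k - v k = (real_of_int \<lfloor>real (Suc m) * v k\<rfloor> - real (Suc m) * v k) / real (Suc m)"
        by (simp add: r_def field_simps)
      moreover have "\<bar>real_of_int \<lfloor>real (Suc m) * v k\<rfloor> - real (Suc m) * v k\<bar> \<le> 1" by linarith
      ultimately show ?thesis by (simp add: divide_right_mono)
    qed
    then have "(\<lambda>m. r m k - v k) \<longlonglongrightarrow> 0"
      by (intro tendsto_rabs_zero_cancel[OF tendsto_sandwich[OF _ _ tendsto_const LIMSEQ_inverse_real_of_nat]])
         (auto simp: inverse_eq_divide intro!: always_eventually)
    then show ?thesis by (simp add: LIM_zero_iff)
  qed
  have "(\<lambda>m. bform {..<q} A (r m) (r m)) \<longlonglongrightarrow> bform {..<q} A v v"
    unfolding bform_def by (intro tendsto_sum tendsto_mult tendsto_const r)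
  moreover have "bform {..<q} A (r m) (r m) \<ge> 0" for m
  proof -
    have "bform {..<q} A (r m) (r m) = bform {..<q} A (restrict (r m) {..<q}) (restrict (r m) {..<q})"
      by (intro bform_cong) auto
    also have "\<dots> \<ge> 0" by (intro assms) (auto simp: r_def)
    finally show ?thesis .
  qed
  ultimately show ?thesis by (intro LIMSEQ_le_const) auto
qed

definition om_shift :: "real \<Rightarrow> (nat \<times> nat \<Rightarrow> real) \<Rightarrow> nat \<Rightarrow> nat \<Rightarrow> real" where
  "om_shift \<tau> w i j = om w i j - (if i = j then \<tau> else 0)"

lemma sym_on_om_shift: "sym_on I (om_shift \<tau> w)"
  by (auto simp: sym_on_def om_shift_def om_def min.commute max.commute)

lemma bform_om_shift: "bform {..<q} (om_shift \<tau> w) v v = bform {..<q} (om w) v v - \<tau> * (\<Sum>k<q. (v k)\<^sup>2)"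
proof -
  have "bform {..<q} (om_shift \<tau> w) v v
      = (\<Sum>i<q. \<Sum>j<q. om w i j * v i * v j) - (\<Sum>i<q. \<Sum>j<q. if i = j then \<tau> * (v i)\<^sup>2 else 0)"
    unfolding bform_def om_shift_def sum_subtractf[symmetric]
    by (intro sum.cong refl) (auto simp: algebra_simps power2_eq_square)
  then show ?thesis by (simp add: bform_def sum_distrib_left)
qed

lemma pos_def_mat_Omega_iff:
  "pos_def_mat (Omega_of q w - \<tau> \<cdot>\<^sub>m 1\<^sub>m q) \<longleftrightarrow> pd_on {..<q} (om_shift \<tau> w)"
proof -
  have c: "Omega_of q w - \<tau> \<cdot>\<^sub>m 1\<^sub>m q \<in> carrier_mat q q"
    by (rule carrier_matI) (simp_all add: Omega_of_def)
  have e: "(Omega_of q w - \<tau> \<cdot>\<^sub>m 1\<^sub>m q) $$ (i, j) = om_shift \<tau> w i j" if "i < q" "j < q" for i j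
    using that by (simp add: Omega_of_def om_shift_def om_def)
  have "bform {..<q} (\<lambda>i j. (Omega_of q w - \<tau> \<cdot>\<^sub>m 1\<^sub>m q) $$ (i, j)) v v = bform {..<q} (om_shift \<tau> w) v v" for v
    by (intro bform_cong e refl) auto
  moreover have "sym_on {..<q} (\<lambda>i j. (Omega_of q w - \<tau> \<cdot>\<^sub>m 1\<^sub>m q) $$ (i, j))"
    using sym_on_om_shift[of "{..<q}" \<tau> w] unfolding sym_on_def by (metis e lessThan_iff)
  ultimately show ?thesis
    unfolding pos_def_mat_iff[OF c] pd_on_def using sym_on_om_shift by auto
qed

definition O_set :: "nat \<Rightarrow> real \<Rightarrow> (nat \<times> nat \<Rightarrow> real) set" where
  "O_set q \<tau> = {w \<in> space (O_space q). pd_on {..<q} (om_shift \<tau> w)}"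

text \<open>The definition imposes uncountably many strict inequalities. Semidefiniteness can be
  tested on the countably many rational vectors, and a semidefinite matrix is definite when its
  determinant is not 0, since a vector with form value 0 lies in the kernel.\<close>

lemma O_set_measurable [measurable]: "O_set q \<tau> \<in> sets (O_space q)"
proof -
  have eq: "pd_on {..<q} (om_shift \<tau> w) \<longleftrightarrow>
      (\<forall>v\<in>(\<Pi>\<^sub>E k\<in>{..<q}. \<rat>). bform {..<q} (om_shift \<tau> w) v v \<ge> 0) \<and> fdet q (om_shift \<tau> w) \<noteq> 0" for w
  proof
    assume "pd_on {..<q} (om_shift \<tau> w)"
    then show "(\<forall>v\<in>(\<Pi>\<^sub>E k\<in>{..<q}. \<rat>). bform {..<q} (om_shift \<tau> w) v v \<ge> 0) \<and> fdet q (om_shift \<tau> w) \<noteq> 0"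
      using pd_on_nonneg[of "{..<q}" "om_shift \<tau> w"] fdet_pos[of q "om_shift \<tau> w"] by auto
  next
    assume R: "(\<forall>v\<in>(\<Pi>\<^sub>E k\<in>{..<q}. \<rat>). bform {..<q} (om_shift \<tau> w) v v \<ge> 0) \<and> fdet q (om_shift \<tau> w) \<noteq> 0"
    have "bform {..<q} (om_shift \<tau> w) v v \<ge> 0" for v
      by (rule psd_rational) (use R in blast)
    then show "pd_on {..<q} (om_shift \<tau> w)"
      using R by (intro psd_pd sym_on_om_shift) auto
  qed
  have cnt: "countable (\<Pi>\<^sub>E k\<in>{..<q}. (\<rat> :: real set))"
    by (intro countable_PiE countable_rat) auto
  have ent: "(\<lambda>w. om_shift \<tau> w i j) \<in> borel_measurable (O_space q)" if "i < q" "j < q" for i j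
    unfolding om_shift_def using that by measurable
  have [measurable]: "(\<lambda>w. fdet q (om_shift \<tau> w)) \<in> borel_measurable (O_space q)"
    by (rule fdet_measurable) (rule ent)
  have [measurable]: "(\<lambda>w. bform {..<q} (om_shift \<tau> w) v v) \<in> borel_measurable (O_space q)" for v
    by (rule bform_measurable_mat) (auto intro: ent)
  have "{w \<in> space (O_space q). \<forall>v\<in>(\<Pi>\<^sub>E k\<in>{..<q}. \<rat>). bform {..<q} (om_shift \<tau> w) v v \<ge> 0} \<in> sets (O_space q)"
    by (rule sets.sets_Collect_countable_All'[OF _ cnt]) measurable
  moreover have "{w \<in> space (O_space q). fdet q (om_shift \<tau> w) \<noteq> 0} \<in> sets (O_space q)"
    by measurable
  ultimately have "{w \<in> space (O_space q). \<forall>v\<in>(\<Pi>\<^sub>E k\<in>{..<q}. \<rat>). bform {..<q} (om_shift \<tau> w) v v \<ge> 0}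
      \<inter> {w \<in> space (O_space q). fdet q (om_shift \<tau> w) \<noteq> 0} \<in> sets (O_space q)"
    by (rule sets.Int)
  then show ?thesis unfolding O_set_def eq by (simp add: Collect_conj_eq Int_ac)
qed

section \<open>The spike-and-slab prior\<close>

lemma nn_integral_even:
  fixes f :: "real \<Rightarrow> ennreal"
  assumes even: "\<And>x. f (- x) = f x" and [measurable]: "f \<in> borel_measurable borel"
  shows "(\<integral>\<^sup>+x. f x \<partial>lborel) = 2 * (\<integral>\<^sup>+x. f x * indicator {0..} x \<partial>lborel)"
proof -
  have "(\<integral>\<^sup>+x. f x \<partial>lborel) = (\<integral>\<^sup>+x. f x * indicator {0..} x + f x * indicator {..0} x \<partial>lborel)"
  proof (rule nn_integral_cong_AE)
    show "AE x in lborel. f x = f x * indicator {0..} x + f x * indicator {..0} x"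
      using AE_lborel_singleton[of 0] by eventually_elim (auto split: split_indicator)
  qed
  also have "\<dots> = (\<integral>\<^sup>+x. f x * indicator {0..} x \<partial>lborel) + (\<integral>\<^sup>+x. f x * indicator {..0} x \<partial>lborel)"
    by (rule nn_integral_add) measurable
  also have "(\<integral>\<^sup>+x. f x * indicator {..0} x \<partial>lborel) = (\<integral>\<^sup>+x. f x * indicator {0..} x \<partial>lborel)"
    by (subst nn_integral_real_affine[of _ "-1" 0])
       (auto simp: even intro!: nn_integral_cong split: split_indicator)
  finally show ?thesis by (simp add: mult_2)
qed

section \<open>Laplace and spike-and-slab densities\<close>

definition laplace :: "real \<Rightarrow> real \<Rightarrow> real" where
  "laplace l x = l / 2 * exp (- l * \<bar>x\<bar>)"

lemma laplace_measurable [measurable]: "laplace l \<in> borel_measurable borel"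
  unfolding laplace_def[abs_def] by measurable

lemma laplace_nonneg: "l > 0 \<Longrightarrow> laplace l x \<ge> 0" by (simp add: laplace_def)

lemma laplace_total:
  assumes "l > 0" shows "(\<integral>\<^sup>+x. ennreal (laplace l x) \<partial>lborel) = 1"
proof -
  have "(\<integral>\<^sup>+x. ennreal (laplace l x) * indicator {0..} x \<partial>lborel)
      = (\<integral>\<^sup>+x. ennreal (l / 2 * exp (- l * x)) * indicator {0..} x \<partial>lborel)"
    by (intro nn_integral_cong) (auto simp: laplace_def split: split_indicator)
  also have "\<dots> = ennreal (0 - (- exp (- l * 0) / 2))"
  proof (rule nn_integral_FTC_atLeast[where F = "\<lambda>x. - exp (- l * x) / 2"])
    show "((\<lambda>x. - exp (- l * x) / 2) \<longlongrightarrow> 0) at_top" using assms by real_asymp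
    show "((\<lambda>x. - exp (- l * x) / 2) has_real_derivative l / 2 * exp (- l * x)) (at x)" for x
      by (auto intro!: derivative_eq_intros)
  qed (use assms in auto)
  finally have "(\<integral>\<^sup>+x. ennreal (laplace l x) * indicator {0..} x \<partial>lborel) = ennreal (1 / 2)" by simp
  moreover have "(\<integral>\<^sup>+x. ennreal (laplace l x) \<partial>lborel)
      = 2 * (\<integral>\<^sup>+x. ennreal (laplace l x) * indicator {0..} x \<partial>lborel)"
    by (rule nn_integral_even) (auto simp: laplace_def)
  moreover have "2 * ennreal (1 / 2) = ennreal (2 * (1 / 2))"
    by (subst ennreal_mult) auto
  ultimately show ?thesis by simp
qed

lemma laplace_central:
  assumes "l > 0" "w \<ge> 0"
  shows "(\<integral>\<^sup>+x. ennreal (laplace l x) * indicator {- w..w} x \<partial>lborel) = ennreal (1 - exp (- l * w))"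
proof -
  have "(\<integral>\<^sup>+x. ennreal (laplace l x) * indicator {- w..w} x * indicator {0..} x \<partial>lborel)
      = (\<integral>\<^sup>+x. ennreal (l / 2 * exp (- l * x)) * indicator {0..w} x \<partial>lborel)"
    by (intro nn_integral_cong) (auto simp: laplace_def split: split_indicator)
  also have "\<dots> = ennreal ((- exp (- l * w) / 2) - (- exp (- l * 0) / 2))"
  proof (rule nn_integral_FTC_Icc[where F = "\<lambda>x. - exp (- l * x) / 2"])
    show "((\<lambda>x. - exp (- l * x) / 2) has_real_derivative l / 2 * exp (- l * x)) (at x)" for x
      by (auto intro!: derivative_eq_intros)
  qed (use assms in auto)
  finally have "(\<integral>\<^sup>+x. ennreal (laplace l x) * indicator {- w..w} x * indicator {0..} x \<partial>lborel)
      = ennreal ((1 - exp (- l * w)) / 2)" by (simp add: diff_divide_distrib)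
  moreover have "(\<integral>\<^sup>+x. ennreal (laplace l x) * indicator {- w..w} x \<partial>lborel)
      = 2 * (\<integral>\<^sup>+x. ennreal (laplace l x) * indicator {- w..w} x * indicator {0..} x \<partial>lborel)"
    by (rule nn_integral_even) (auto simp: laplace_def split: split_indicator)
  moreover have "2 * ennreal (z / 2) = ennreal z" if "z \<ge> 0" for z
    using that ennreal_mult[of 2 "z / 2"] by simp
  moreover have "1 - exp (- l * w) \<ge> 0" using assms by simp
  ultimately show ?thesis by (simp only:)
qed

lemma ssl_density_laplace: "ssl_density t l1 l0 x = t * laplace l1 x + (1 - t) * laplace l0 x"
  by (simp add: ssl_density_def laplace_def)

lemma ssl_density_measurable [measurable]: "ssl_density t l1 l0 \<in> borel_measurable borel"
  unfolding ssl_density_laplace[abs_def] by measurable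

lemma ssl_density_nonneg: "0 < t \<Longrightarrow> t < 1 \<Longrightarrow> 0 < l1 \<Longrightarrow> 0 < l0 \<Longrightarrow> ssl_density t l1 l0 x \<ge> 0"
  by (simp add: ssl_density_laplace laplace_nonneg)

lemma ssl_density_total:
  assumes "0 < t" "t < 1" "0 < l1" "0 < l0"
  shows "(\<integral>\<^sup>+x. ennreal (ssl_density t l1 l0 x) \<partial>lborel) = 1"
proof -
  have "(\<integral>\<^sup>+x. ennreal (ssl_density t l1 l0 x) \<partial>lborel)
      = (\<integral>\<^sup>+x. ennreal t * ennreal (laplace l1 x) + ennreal (1 - t) * ennreal (laplace l0 x) \<partial>lborel)"
    using assms by (simp add: ssl_density_laplace laplace_nonneg ennreal_mult)
  also have "\<dots> = ennreal t + ennreal (1 - t)"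
    using assms by (simp add: nn_integral_add nn_integral_cmult laplace_total)
  also have "\<dots> = 1" using assms by (simp flip: ennreal_plus)
  finally show ?thesis .
qed

text \<open>The cells are centred at multiples of \<open>w\<close>, so that the mass of the spike sits in the single cell \<open>0\<close>.\<close>

definition cell :: "real \<Rightarrow> int \<Rightarrow> real set" where
  "cell w z = {x. \<lfloor>x / w + 1 / 2\<rfloor> = z}"

lemma cell_measurable [measurable]: "cell w z \<in> sets borel"
proof -
  have "cell w z = (\<lambda>x. \<lfloor>x / w + 1 / 2\<rfloor>) -` {z} \<inter> space borel" by (auto simp: cell_def)
  also have "\<dots> \<in> sets borel"
    by (rule measurable_sets[of _ borel "count_space UNIV"]) measurable
  finally show ?thesis .
qed

lemma cellD:
  assumes "w > 0" "x \<in> cell w z"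
  shows "(real_of_int z - 1 / 2) * w \<le> x" "x < (real_of_int z + 1 / 2) * w"
    "(\<bar>real_of_int z\<bar> - 1 / 2) * w \<le> \<bar>x\<bar>" "\<bar>x\<bar> \<le> (\<bar>real_of_int z\<bar> + 1) * w"
proof -
  have a: "real_of_int z \<le> x / w + 1 / 2" "x / w + 1 / 2 < real_of_int z + 1"
    using assms(2) by (auto simp: cell_def)
  show 1: "(real_of_int z - 1 / 2) * w \<le> x" and 2: "x < (real_of_int z + 1 / 2) * w"
    using a assms(1) by (auto simp: field_simps)
  have zx: "\<bar>real_of_int z - x / w\<bar> \<le> 1 / 2" using a by linarith
  have "\<bar>real_of_int z\<bar> - 1 / 2 \<le> \<bar>x / w\<bar>" "\<bar>x / w\<bar> \<le> \<bar>real_of_int z\<bar> + 1" using zx by linarith+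
  then show "(\<bar>real_of_int z\<bar> - 1 / 2) * w \<le> \<bar>x\<bar>" "\<bar>x\<bar> \<le> (\<bar>real_of_int z\<bar> + 1) * w"
    using assms(1) by (auto simp: abs_divide field_simps)
qed

lemma cell_diff:
  assumes "w > 0" "x \<in> cell w z" "y \<in> cell w z" shows "\<bar>x - y\<bar> \<le> w"
  using cellD(1,2)[OF assms(1,2)] cellD(1,2)[OF assms(1,3)] by (simp add: algebra_simps)

lemma emeasure_cell:
  assumes w: "w > 0" shows "emeasure lborel (cell w z) = ennreal w"
proof -
  have "cell w z = {(real_of_int z - 1 / 2) * w ..< (real_of_int z + 1 / 2) * w}"
    using w unfolding cell_def floor_eq_iff by (auto simp: field_simps)
  moreover have "(real_of_int z - 1 / 2) * w \<le> (real_of_int z + 1 / 2) * w" using w by simp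
  ultimately show ?thesis by (simp add: emeasure_lborel_Ico algebra_simps)
qed

lemma nn_integral_cell_le:
  assumes w: "w > 0" and c: "c \<ge> 0" and le: "\<And>x. x \<in> cell w z \<Longrightarrow> f x \<le> c"
  shows "(\<integral>\<^sup>+x. ennreal (f x) * indicator (cell w z) x \<partial>lborel) \<le> ennreal (c * w)"
proof -
  have "(\<integral>\<^sup>+x. ennreal (f x) * indicator (cell w z) x \<partial>lborel) \<le> (\<integral>\<^sup>+x. ennreal c * indicator (cell w z) x \<partial>lborel)"
    using le by (intro nn_integral_mono) (auto split: split_indicator intro!: ennreal_leI)
  also have "\<dots> = ennreal (c * w)"
    using c w by (subst nn_integral_cmult_indicator) (auto simp: emeasure_cell ennreal_mult)
  finally show ?thesis .
qed

text \<open>The cell at 0 holds the spike, so the trivial bound 1 is adequate there. Elsewhere the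
  density is taken at the point nearest to 0, at distance
  \<open>(\<bar>z\<bar> - 1 / 2) * w\<close>, with the spike weight \<open>1 - t\<close> replaced by
  1.\<close>

definition ssl_cell_bound :: "real \<Rightarrow> real \<Rightarrow> real \<Rightarrow> real \<Rightarrow> int \<Rightarrow> real" where
  "ssl_cell_bound t l1 l0 w z =
     (if z = 0 then 1 else t * laplace l1 ((\<bar>real_of_int z\<bar> - 1 / 2) * w) * w + laplace l0 ((\<bar>real_of_int z\<bar> - 1 / 2) * w) * w)"

lemma ssl_cell_bound:
  assumes "0 < t" "t < 1" "0 < l1" "0 < l0" "w > 0"
  shows "(\<integral>\<^sup>+x. ennreal (ssl_density t l1 l0 x) * indicator (cell w z) x \<partial>lborel) \<le> ennreal (ssl_cell_bound t l1 l0 w z)"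
proof (cases "z = 0")
  case True
  have "(\<integral>\<^sup>+x. ennreal (ssl_density t l1 l0 x) * indicator (cell w z) x \<partial>lborel)
      \<le> (\<integral>\<^sup>+x. ennreal (ssl_density t l1 l0 x) \<partial>lborel)"
    by (intro nn_integral_mono) (auto split: split_indicator)
  then show ?thesis using assms True by (simp add: ssl_density_total ssl_cell_bound_def)
next
  case False
  define d where "d = (\<bar>real_of_int z\<bar> - 1 / 2) * w"
  have "\<bar>real_of_int z\<bar> \<ge> 1" using False by linarith
  then have d: "d \<ge> 0" using assms by (simp add: d_def)
  have lap: "laplace l x \<le> laplace l d" if "x \<in> cell w z" "l > 0" for x l
    using cellD(3)[OF \<open>w > 0\<close> that(1)] d that(2) by (simp add: laplace_def d_def[symmetric])
  have "ssl_density t l1 l0 x \<le> t * laplace l1 d + laplace l0 d" if "x \<in> cell w z" for x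
  proof -
    have "(1 - t) * laplace l0 x \<le> 1 * laplace l0 x"
      using assms laplace_nonneg[of l0 x] by (intro mult_right_mono) auto
    also have "\<dots> \<le> laplace l0 d" using lap[OF that, of l0] assms by simp
    finally show ?thesis
      unfolding ssl_density_laplace using lap[OF that, of l1] assms by (intro add_mono mult_left_mono) auto
  qed
  then have "(\<integral>\<^sup>+x. ennreal (ssl_density t l1 l0 x) * indicator (cell w z) x \<partial>lborel)
      \<le> ennreal ((t * laplace l1 d + laplace l0 d) * w)"
    using assms laplace_nonneg[of l1 d] laplace_nonneg[of l0 d] by (intro nn_integral_cell_le) auto
  then show ?thesis using False by (simp add: ssl_cell_bound_def d_def[symmetric] distrib_right)
qed

lemma ssl_cell_bound_pos:
  assumes "0 < t" "0 < l1" "0 < l0" "w > 0" shows "ssl_cell_bound t l1 l0 w z > 0"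
  using assms by (auto simp: ssl_cell_bound_def laplace_def intro!: add_pos_pos mult_pos_pos)

text \<open>Only the spike is counted: what is lost is the slab weight \<open>t\<close> and the tail
  of the spike.\<close>

lemma ssl_zero_interval:
  assumes "0 < t" "t < 1" "0 < l1" "0 < l0" "w > 0"
  shows "(\<integral>\<^sup>+x. ennreal (ssl_density t l1 l0 x) * indicator {- w..w} x \<partial>lborel) \<ge> ennreal (1 - t - exp (- l0 * w))"
proof -
  have "1 - t - exp (- l0 * w) \<le> (1 - t) * (1 - exp (- l0 * w))"
    using assms by (simp add: algebra_simps)
  then have "ennreal (1 - t - exp (- l0 * w)) \<le> ennreal (1 - t) * ennreal (1 - exp (- l0 * w))"
    using assms by (subst ennreal_mult[symmetric]) (auto intro: ennreal_leI)
  also have "\<dots> = (\<integral>\<^sup>+x. ennreal (1 - t) * (ennreal (laplace l0 x) * indicator {- w..w} x) \<partial>lborel)"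
    using assms by (subst nn_integral_cmult) (auto simp: laplace_central)
  also have "\<dots> \<le> (\<integral>\<^sup>+x. ennreal (ssl_density t l1 l0 x) * indicator {- w..w} x \<partial>lborel)"
    using assms
    by (intro nn_integral_mono)
       (auto simp: ssl_density_laplace laplace_nonneg split: split_indicator simp flip: ennreal_mult intro!: ennreal_leI)
  finally show ?thesis .
qed

lemma nn_integral_interval_ge:
  assumes w: "w > 0" and c: "c \<ge> 0" and le: "\<And>x. \<bar>x - a\<bar> \<le> w \<Longrightarrow> c \<le> f x"
  shows "(\<integral>\<^sup>+x. ennreal (f x) * indicator {a - w..a + w} x \<partial>lborel) \<ge> ennreal (2 * c * w)"
proof -
  have "ennreal (2 * c * w) = (\<integral>\<^sup>+x. ennreal c * indicator {a - w..a + w} x \<partial>lborel)"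
    using c w by (subst nn_integral_cmult_indicator) (auto simp flip: ennreal_mult)
  also have "\<dots> \<le> (\<integral>\<^sup>+x. ennreal (f x) * indicator {a - w..a + w} x \<partial>lborel)"
    using le by (intro nn_integral_mono) (auto split: split_indicator intro!: ennreal_leI)
  finally show ?thesis .
qed

text \<open>Only the slab is counted, whose density on the interval is at least its value at
  \<open>A + w\<close>.\<close>

lemma ssl_interval:
  assumes "0 < t" "t < 1" "0 < l1" "0 < l0" "w > 0" and a: "\<bar>a\<bar> \<le> A"
  shows "(\<integral>\<^sup>+x. ennreal (ssl_density t l1 l0 x) * indicator {a - w..a + w} x \<partial>lborel)
    \<ge> ennreal (t * l1 * w * exp (- l1 * (A + w)))"
proof -
  have "t * laplace l1 (A + w) \<le> ssl_density t l1 l0 x" if "\<bar>x - a\<bar> \<le> w" for x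
  proof -
    have "\<bar>x\<bar> \<le> A + w" using that a by linarith
    moreover have "0 \<le> A + w" using calculation by linarith
    ultimately have "laplace l1 (A + w) \<le> laplace l1 x" using assms by (simp add: laplace_def)
    then have "t * laplace l1 (A + w) \<le> t * laplace l1 x" using assms by simp
    also have "\<dots> \<le> ssl_density t l1 l0 x"
      using assms laplace_nonneg[of l0 x] by (simp add: ssl_density_laplace)
    finally show ?thesis .
  qed
  then have "ennreal (2 * (t * laplace l1 (A + w)) * w) \<le> (\<integral>\<^sup>+x. ennreal (ssl_density t l1 l0 x) * indicator {a - w..a + w} x \<partial>lborel)"
    using assms laplace_nonneg[of l1] by (intro nn_integral_interval_ge) auto
  moreover have "0 \<le> A + w" using a assms by linarith
  ultimately show ?thesis by (simp add: laplace_def mult_ac)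
qed

subsection \<open>Sums over the grid\<close>

lemma nn_integral_int_symmetric:
  fixes f :: "int \<Rightarrow> ennreal"
  assumes "\<And>z. f (- z) = f z"
  shows "(\<integral>\<^sup>+z. f z \<partial>count_space UNIV) = f 0 + 2 * (\<Sum>n. f (int (Suc n)))"
proof -
  define g where "g = (\<lambda>s :: nat option + nat. case s of Inl None \<Rightarrow> 0 | Inl (Some n) \<Rightarrow> int (Suc n) | Inr n \<Rightarrow> - int (Suc n))"
  have pos: "(\<integral>\<^sup>+z. f z \<partial>count_space {0<..}) = (\<Sum>n. f (int (Suc n)))"
  proof -
    have "bij_betw (\<lambda>n. int (Suc n)) UNIV {0<..}"
      by (rule bij_betwI[where g = "\<lambda>z. nat z - 1"]) auto
    from nn_integral_bij_count_space[OF this, of f, symmetric] show ?thesis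
      by (simp add: nn_integral_count_space_nat)
  qed
  have neg: "(\<integral>\<^sup>+z. f z \<partial>count_space {..<0}) = (\<Sum>n. f (int (Suc n)))"
  proof -
    have "bij_betw (\<lambda>n. - int (Suc n)) UNIV {..<0}"
      by (rule bij_betwI[where g = "\<lambda>z. nat (- z) - 1"]) auto
    from nn_integral_bij_count_space[OF this, of f, symmetric] show ?thesis
      using assms by (simp add: nn_integral_count_space_nat del: of_nat_Suc)
  qed
  have "(\<integral>\<^sup>+z. f z \<partial>count_space UNIV)
      = (\<integral>\<^sup>+z. f z * indicator {0} z + (f z * indicator {0<..} z + f z * indicator {..<0} z) \<partial>count_space UNIV)"
    by (intro nn_integral_cong) (auto split: split_indicator)
  also have "\<dots> = (\<integral>\<^sup>+z. f z * indicator {0} z \<partial>count_space UNIV) +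
      ((\<integral>\<^sup>+z. f z * indicator {0<..} z \<partial>count_space UNIV) + (\<integral>\<^sup>+z. f z * indicator {..<0} z \<partial>count_space UNIV))"
    by (simp add: nn_integral_add)
  also have "(\<integral>\<^sup>+z. f z * indicator {0<..} z \<partial>count_space UNIV) = (\<Sum>n. f (int (Suc n)))"
    unfolding pos[symmetric] by (simp add: nn_integral_count_space_indicator)
  also have "(\<integral>\<^sup>+z. f z * indicator {..<0} z \<partial>count_space UNIV) = (\<Sum>n. f (int (Suc n)))"
    unfolding neg[symmetric] by (simp add: nn_integral_count_space_indicator)
  also have "(\<integral>\<^sup>+z. f z * indicator {0} z \<partial>count_space UNIV) = f 0"
    by (subst nn_integral_count_space'[of "{0}"]) auto
  finally show ?thesis by (simp add: mult_2)
qed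

text \<open>The left side is 1 / (2 sinh (x / 2)), and sinh y >= y for nonnegative y.\<close>

lemma sinh_half_ge: fixes x :: real assumes "x > 0" shows "exp (- x / 2) / (1 - exp (- x)) \<le> 1 / x"
proof -
  define h where "h = (\<lambda>x :: real. exp (x / 2) - exp (- x / 2) - x)"
  have "h 0 \<le> h x"
  proof (rule DERIV_nonneg_imp_nondecreasing[where f = h and a = 0 and b = x])
    fix t :: real
    have "(h has_real_derivative (exp (t / 2) + exp (- t / 2)) / 2 - 1) (at t)"
      unfolding h_def by (auto intro!: derivative_eq_intros simp: field_simps)
    moreover have "0 \<le> (exp (t / 2) + exp (- t / 2)) / 2 - 1"
      using add_mono[OF exp_ge_add_one_self[of "t / 2"] exp_ge_add_one_self[of "- t / 2"]] by simp
    ultimately show "\<exists>d. (h has_real_derivative d) (at t) \<and> 0 \<le> d" by blast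
  qed (use assms in simp)
  then have "x \<le> exp (x / 2) - exp (- x / 2)" by (simp add: h_def)
  then have "x * exp (- x / 2) \<le> (exp (x / 2) - exp (- x / 2)) * exp (- x / 2)"
    by (intro mult_right_mono) auto
  also have "\<dots> = 1 - exp (- x)" by (simp add: algebra_simps flip: exp_add)
  finally have "x * exp (- x / 2) \<le> 1 - exp (- x)" .
  moreover have "1 - exp (- x) > 0" using assms by simp
  ultimately show ?thesis using assms by (simp add: field_simps)
qed

lemma suminf_exp_grid:
  fixes x c :: real assumes x: "x > 0" and c: "c \<ge> 0"
  shows "(\<Sum>n. ennreal (c * exp (- x * (real (Suc n) - 1 / 2)))) = ennreal (c * (exp (- x / 2) / (1 - exp (- x))))"
proof -
  have "exp (- x) < 1" using x by simp
  then have "(\<lambda>n. exp (- x) ^ n) sums (1 / (1 - exp (- x)))"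
    by (intro geometric_sums) simp
  then have "(\<lambda>n. (c * exp (- x / 2)) * exp (- x) ^ n) sums ((c * exp (- x / 2)) * (1 / (1 - exp (- x))))"
    by (rule sums_mult)
  moreover have "(c * exp (- x / 2)) * exp (- x) ^ n = c * exp (- x * (real (Suc n) - 1 / 2))" for n
  proof -
    have "exp (- x / 2) * exp (- x) ^ n = exp (- x * (real (Suc n) - 1 / 2))"
      by (simp add: exp_of_nat_mult[symmetric] algebra_simps flip: exp_add)
    then show ?thesis by (simp only: mult.assoc)
  qed
  moreover have "(c * exp (- x / 2)) * (1 / (1 - exp (- x))) = c * (exp (- x / 2) / (1 - exp (- x)))"
    by simp
  ultimately have "(\<lambda>n. c * exp (- x * (real (Suc n) - 1 / 2))) sums (c * (exp (- x / 2) / (1 - exp (- x))))"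
    by (simp only:)
  then show ?thesis
    using c by (intro suminf_ennreal_eq) auto
qed

lemma powr_exp: "exp y powr a = exp (a * (y :: real))"
  by (simp add: powr_def)

lemma powr_mult_exp: "B \<ge> 0 \<Longrightarrow> (B * exp e) powr a = B powr a * exp (a * (e :: real))"
  by (simp add: powr_mult powr_exp)

text \<open>Half of the exponential decay absorbs the power of \<open>y\<close>; the denominator is
  at least 1/2 since 2 a y >= 1.\<close>

lemma spike_factor_le:
  fixes y a :: real assumes "y > 0" "0 < a" "a \<le> 1" "2 * a * y \<ge> 1"
  shows "(y) powr a * (exp (- a * y) / (1 - exp (- (2 * a * y)))) \<le> 2 * exp (- a * y / 2)"
proof -
  have "1 / 2 \<le> 1 - exp (- (2 * a * y))"
  proof -
    have "exp (- (2 * a * y)) \<le> exp (- 1)" using assms by simp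
    also have "exp (- 1 :: real) \<le> 1 / 2" using exp_ge_add_one_self[of 1] by (simp add: exp_minus field_simps)
    finally show ?thesis by simp
  qed
  then have "exp (- a * y) / (1 - exp (- (2 * a * y))) \<le> exp (- a * y) / (1 / 2)"
    using assms by (intro divide_left_mono) auto
  moreover have "y powr a \<le> exp (a * y / 2)"
  proof -
    have "1 + (y / 2 - 1) \<le> exp (y / 2 - 1)" by (rule exp_ge_add_one_self)
    then have "y \<le> 2 * exp (y / 2 - 1)" by simp
    also have "\<dots> \<le> exp 1 * exp (y / 2 - 1)"
      using exp_ge_add_one_self[of 1] by (intro mult_right_mono) auto
    also have "\<dots> = exp (y / 2)" by (simp flip: exp_add)
    finally have "y powr a \<le> exp (y / 2) powr a" using assms by (intro powr_mono2) auto
    then show ?thesis by (simp add: powr_exp)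
  qed
  ultimately have "y powr a * (exp (- a * y) / (1 - exp (- (2 * a * y)))) \<le> exp (a * y / 2) * (exp (- a * y) / (1 / 2))"
    using assms by (intro mult_mono) (auto intro!: divide_nonneg_nonneg)
  also have "\<dots> = 2 * exp (- a * y / 2)"
    by (simp add: field_simps flip: exp_add)
  finally show ?thesis .
qed

text \<open>Subadditivity of the power \<open>a\<close> separates slab and spike. The slab is spread
  over about \<open>1 / (l1 * w)\<close> cells of mass about \<open>t * l1 * w\<close>, which
  explains the exponent \<open>a - 1\<close>; the spike is negligible outside the cell at 0 because
  \<open>l0 * w\<close> is large.\<close>

lemma ssl_grid_sum:
  assumes "0 < t" "t < 1" "0 < l1" "0 < l0" "w > 0" and a: "0 < a" "a \<le> 1" and big: "a * l0 * w \<ge> 1"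
  shows "(\<integral>\<^sup>+z. ennreal (ssl_cell_bound t l1 l0 w z powr a) \<partial>count_space UNIV)
    \<le> ennreal (1 + 2 / a * (t powr a * (l1 * w) powr (a - 1)) + 4 * exp (- a * l0 * w / 4))"
proof -
  define F where "F = (\<lambda>l c z. (c * laplace l ((\<bar>real_of_int z\<bar> - 1 / 2) * w) * w) powr a)"
  have sub: "(x + y) powr a \<le> x powr a + y powr a" if "x > 0" "y > 0" for x y :: real
  proof -
    have "x / (x + y) \<le> (x / (x + y)) powr a" "y / (x + y) \<le> (y / (x + y)) powr a"
      using that a powr_mono'[of a 1 "x / (x + y)"] powr_mono'[of a 1 "y / (x + y)"] by auto
    then have "x / (x + y) + y / (x + y) \<le> x powr a / (x + y) powr a + y powr a / (x + y) powr a"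
      using that by (simp add: powr_divide)
    moreover have "x / (x + y) + y / (x + y) = 1" using that by (simp flip: add_divide_distrib)
    ultimately have "1 \<le> (x powr a + y powr a) / (x + y) powr a" by (simp add: add_divide_distrib)
    moreover have "(x + y) powr a > 0" using that by simp
    ultimately show ?thesis by (simp add: field_simps)
  qed
  have F: "(\<Sum>n. ennreal (F l c (int (Suc n)))) = ennreal ((c * l * w / 2) powr a * (exp (- (a * l * w) / 2) / (1 - exp (- (a * l * w)))))"
    if "l > 0" "c > 0" for l c
  proof -
    have "F l c (int (Suc n)) = (c * l * w / 2) powr a * exp (- (a * l * w) * (real (Suc n) - 1 / 2))" for n
    proof -
      have "F l c (int (Suc n)) = ((c * l * w / 2) * exp (- l * ((real (Suc n) - 1 / 2) * w))) powr a"
        using \<open>w > 0\<close> by (simp add: F_def laplace_def abs_mult mult_ac)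
      also have "\<dots> = (c * l * w / 2) powr a * exp (a * (- l * ((real (Suc n) - 1 / 2) * w)))"
        using that \<open>w > 0\<close> by (intro powr_mult_exp) simp
      finally show ?thesis by (simp add: mult_ac)
    qed
    then have "(\<Sum>n. ennreal (F l c (int (Suc n))))
        = (\<Sum>n. ennreal ((c * l * w / 2) powr a * exp (- (a * l * w) * (real (Suc n) - 1 / 2))))"
      by (simp only:)
    also have "\<dots> = ennreal ((c * l * w / 2) powr a * (exp (- (a * l * w) / 2) / (1 - exp (- (a * l * w)))))"
      using that a \<open>w > 0\<close> by (intro suminf_exp_grid) auto
    finally show ?thesis .
  qed
  have "(\<integral>\<^sup>+z. ennreal (ssl_cell_bound t l1 l0 w z powr a) \<partial>count_space UNIV)
      = ennreal (ssl_cell_bound t l1 l0 w 0 powr a) + 2 * (\<Sum>n. ennreal (ssl_cell_bound t l1 l0 w (int (Suc n)) powr a))"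
    by (rule nn_integral_int_symmetric) (simp add: ssl_cell_bound_def)
  also have "ennreal (ssl_cell_bound t l1 l0 w 0 powr a) = ennreal 1" by (simp add: ssl_cell_bound_def)
  also have "(\<Sum>n. ennreal (ssl_cell_bound t l1 l0 w (int (Suc n)) powr a))
      \<le> (\<Sum>n. ennreal (F l1 t (int (Suc n))) + ennreal (F l0 1 (int (Suc n))))"
  proof (intro suminf_le)
    fix n
    have "ssl_cell_bound t l1 l0 w (int (Suc n)) powr a \<le> F l1 t (int (Suc n)) + F l0 1 (int (Suc n))"
      unfolding ssl_cell_bound_def F_def using assms
      by (simp del: of_nat_Suc of_int_of_nat_eq) (intro sub, auto simp: laplace_def)
    then have "ennreal (ssl_cell_bound t l1 l0 w (int (Suc n)) powr a) \<le> ennreal (F l1 t (int (Suc n)) + F l0 1 (int (Suc n)))"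
      by (rule ennreal_leI)
    also have "\<dots> = ennreal (F l1 t (int (Suc n))) + ennreal (F l0 1 (int (Suc n)))"
      by (rule ennreal_plus) (simp_all add: F_def)
    finally show "ennreal (ssl_cell_bound t l1 l0 w (int (Suc n)) powr a) \<le> ennreal (F l1 t (int (Suc n))) + ennreal (F l0 1 (int (Suc n)))" .
  qed auto
  also have "\<dots> = (\<Sum>n. ennreal (F l1 t (int (Suc n)))) + (\<Sum>n. ennreal (F l0 1 (int (Suc n))))"
    by (rule suminf_add[symmetric]) auto
  also have "(\<Sum>n. ennreal (F l1 t (int (Suc n)))) \<le> ennreal (1 / a * (t powr a * (l1 * w) powr (a - 1)))"
  proof -
    have "(t * l1 * w / 2) powr a * (exp (- (a * l1 * w) / 2) / (1 - exp (- (a * l1 * w))))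
        \<le> (t * l1 * w) powr a * (1 / (a * l1 * w))"
      using assms sinh_half_ge[of "a * l1 * w"] by (intro mult_mono powr_mono2) auto
    also have "\<dots> = 1 / a * (t powr a * (l1 * w) powr (a - 1))"
      using assms by (simp add: powr_diff powr_mult field_simps)
    finally show ?thesis using F[of l1 t] assms by (simp add: ennreal_leI)
  qed
  also have "(\<Sum>n. ennreal (F l0 1 (int (Suc n)))) \<le> ennreal (2 * exp (- a * l0 * w / 4))"
  proof -
    have "(l0 * w / 2) powr a * (exp (- a * (l0 * w / 2)) / (1 - exp (- (2 * a * (l0 * w / 2))))) \<le> 2 * exp (- a * (l0 * w / 2) / 2)"
      using assms by (intro spike_factor_le) (auto simp: mult_ac)
    then show ?thesis using F[of l0 1] assms by (simp add: ennreal_leI mult_ac)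
  qed
  finally have "(\<integral>\<^sup>+z. ennreal (ssl_cell_bound t l1 l0 w z powr a) \<partial>count_space UNIV)
    \<le> ennreal 1 + 2 * (ennreal (1 / a * (t powr a * (l1 * w) powr (a - 1))) + ennreal (2 * exp (- a * l0 * w / 4)))"
    by (simp add: add_left_mono mult_left_mono add_right_mono)
  also have "\<dots> = ennreal (1 + 2 * (1 / a * (t powr a * (l1 * w) powr (a - 1)) + 2 * exp (- a * l0 * w / 4)))"
  proof -
    have e: "ennreal 1 + 2 * (ennreal u + ennreal v) = ennreal (1 + 2 * (u + v))" if "u \<ge> 0" "v \<ge> 0" for u v
    proof -
      have "ennreal (1 + 2 * (u + v)) = ennreal 1 + ennreal (2 * (u + v))"
        using that by (intro ennreal_plus) auto
      also have "ennreal (2 * (u + v)) = 2 * (ennreal u + ennreal v)"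
        using that by (subst ennreal_mult) auto
      finally show ?thesis ..
    qed
    show ?thesis using a by (intro e) auto
  qed
  finally show ?thesis by (simp add: algebra_simps)
qed

text \<open>The second exponential is the chi-square cost of a diagonal entry. It uses up a quarter
  of the decay of the prior, so the sum still behaves like one over about
  \<open>1 / (\<xi> * w)\<close> cells of mass \<open>\<xi> * w\<close>.\<close>

lemma diag_grid_sum:
  fixes \<xi> w a :: real
  assumes "\<xi> > 0" "w > 0" and a: "2 / 3 \<le> a" "a \<le> 1" and small: "\<xi> * w \<le> 1"
  shows "(\<integral>\<^sup>+z. ennreal ((\<xi> * w * exp (- \<xi> * w * (\<bar>real_of_int z\<bar> - 1 / 2))) powr a *
      exp (a * \<xi> / 4 * ((\<bar>real_of_int z\<bar> + 1) * w))) \<partial>count_space UNIV)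
    \<le> ennreal (15 * (\<xi> * w) powr (a - 1))"
proof -
  define y where "y = \<xi> * w"
  have y: "0 < y" "y \<le> 1" using assms by (auto simp: y_def)
  define x where "x = 3 / 4 * a * y"
  have x: "x > 0" using y a by (simp add: x_def)
  define c where "c = y powr a * exp (a * y / 2 + a * y / 4)"
  have c: "c > 0" using y by (simp add: c_def)
  have cell_term: "(\<xi> * w * exp (- \<xi> * w * (\<bar>real_of_int z\<bar> - 1 / 2))) powr a *
      exp (a * \<xi> / 4 * ((\<bar>real_of_int z\<bar> + 1) * w)) = c * exp (- x * \<bar>real_of_int z\<bar>)" for z
  proof -
    have "(\<xi> * w * exp (- \<xi> * w * (\<bar>real_of_int z\<bar> - 1 / 2))) powr a
        = y powr a * exp (a * (- y * (\<bar>real_of_int z\<bar> - 1 / 2)))"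
      using y powr_mult_exp[of y "- y * (\<bar>real_of_int z\<bar> - 1 / 2)" a] by (simp add: y_def)
    moreover have "a * \<xi> / 4 * ((\<bar>real_of_int z\<bar> + 1) * w) = a * y / 4 * (\<bar>real_of_int z\<bar> + 1)"
      by (simp add: y_def)
    ultimately show ?thesis
      by (simp add: c_def x_def algebra_simps flip: exp_add)
  qed
  have "(\<integral>\<^sup>+z. ennreal (c * exp (- x * \<bar>real_of_int z\<bar>)) \<partial>count_space UNIV)
      = ennreal c + 2 * (\<Sum>n. ennreal (c * exp (- x * real (Suc n))))"
    by (subst nn_integral_int_symmetric) (auto simp del: of_nat_Suc)
  also have "(\<Sum>n. ennreal (c * exp (- x * real (Suc n))))
      = (\<Sum>n. ennreal ((c * exp (- x / 2)) * exp (- x * (real (Suc n) - 1 / 2))))"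
    by (intro suminf_cong arg_cong[of _ _ ennreal]) (simp add: algebra_simps flip: exp_add)
  also have "\<dots> = ennreal (c * exp (- x / 2) * (exp (- x / 2) / (1 - exp (- x))))"
    using x c by (intro suminf_exp_grid) auto
  also have "\<dots> \<le> ennreal (c * 1 * (1 / x))"
    using x c sinh_half_ge[OF x] by (intro ennreal_leI mult_mono) auto
  finally have "(\<integral>\<^sup>+z. ennreal (c * exp (- x * \<bar>real_of_int z\<bar>)) \<partial>count_space UNIV)
      \<le> ennreal c + 2 * ennreal (c * 1 * (1 / x))"
    by (simp add: add_left_mono mult_left_mono)
  also have "\<dots> = ennreal (c + 2 * (c * (1 / x)))"
  proof -
    have "ennreal (c + 2 * (c * (1 / x))) = ennreal c + ennreal (2 * (c * (1 / x)))"
      using c x by (intro ennreal_plus) auto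
    then show ?thesis using c x by (simp add: ennreal_mult[of 2] del: times_divide_eq_right)
  qed
  also have "\<dots> \<le> ennreal (15 * y powr (a - 1))"
  proof (rule ennreal_leI)
    \<comment> \<open>The constant is 15 = 3 * 5, with \<open>exp 1 \<le> 3\<close> for the
      exponential in \<open>c\<close> and \<open>1 + 2 * (1 / x) \<le> 5 / y\<close> for the
      sum.\<close>
    have "a * y / 2 + a * y / 4 \<le> 1"
    proof -
      have "a * y \<le> 1 * 1" using a y by (intro mult_mono) auto
      then show ?thesis by simp
    qed
    then have "exp (a * y / 2 + a * y / 4) \<le> exp 1" by simp
    also have "exp 1 \<le> (3 :: real)" using exp_le by simp
    finally have c3: "c \<le> y powr a * 3" using y by (simp add: c_def)
    have "y / 2 \<le> x" using a y by (simp add: x_def)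
    then have "y / x \<le> 2" using x by (simp add: field_simps)
    then have "(1 + 2 * (1 / x)) * y \<le> 5" using y by (simp add: distrib_right)
    then have "1 + 2 * (1 / x) \<le> 5 / y" using y by (simp add: pos_le_divide_eq)
    then have "c * (1 + 2 * (1 / x)) \<le> (y powr a * 3) * (5 / y)"
      using c3 x y by (intro mult_mono) auto
    also have "\<dots> = 15 * y powr (a - 1)" using y by (simp add: powr_diff)
    finally show "c + 2 * (c * (1 / x)) \<le> 15 * y powr (a - 1)" by (simp add: algebra_simps)
  qed
  finally show ?thesis unfolding cell_term y_def .
qed

text \<open>The counting measure on integer vectors is a product measure, so this is Tonelli's
  theorem.\<close>

lemma nn_integral_PiE_prod:
  fixes f :: "'i \<Rightarrow> int \<Rightarrow> ennreal"
  assumes "finite I"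
  shows "(\<integral>\<^sup>+k. (\<Prod>c\<in>I. f c (k c)) \<partial>count_space (\<Pi>\<^sub>E c\<in>I. UNIV)) = (\<Prod>c\<in>I. \<integral>\<^sup>+z. f c z \<partial>count_space UNIV)"
proof -
  interpret product_sigma_finite "\<lambda>_. count_space (UNIV :: int set)"
    by (intro product_sigma_finite.intro sigma_finite_measure_count_space_countable) auto
  have "count_space (\<Pi>\<^sub>E c\<in>I. (UNIV :: int set)) = PiM I (\<lambda>_. count_space UNIV)"
    using count_space_PiM_finite[OF assms, of "\<lambda>_. UNIV :: int set"] by simp
  then show ?thesis using product_nn_integral_prod[OF assms, of f] by simp
qed

subsection \<open>The unnormalised prior on the precision matrix\<close>

abbreviation B_idx :: "nat \<Rightarrow> nat \<Rightarrow> (nat \<times> nat) set" where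
  "B_idx p q \<equiv> {..<p} \<times> {..<q}"

definition O_dens :: "real \<Rightarrow> real \<Rightarrow> real \<Rightarrow> nat \<times> nat \<Rightarrow> real \<Rightarrow> real" where
  "O_dens \<eta> \<xi>1 \<xi>0 c x = (if fst c = snd c then \<xi>1 * exp (- \<xi>1 * x) else ssl_density \<eta> \<xi>1 \<xi>0 x)"

definition nu_Omega :: "nat \<Rightarrow> real \<Rightarrow> real \<Rightarrow> real \<Rightarrow> real \<Rightarrow> (nat \<times> nat \<Rightarrow> real) measure" where
  "nu_Omega q \<eta> \<xi>1 \<xi>0 \<tau> = density (upper_lborel q) (\<lambda>w. ennreal (prior_Omega_unnorm q \<eta> \<xi>1 \<xi>0 \<tau> w))"

lemma upper_lborel_eq: "upper_lborel q = (\<Pi>\<^sub>M c\<in>upper_idx q. lborel)"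
  by (simp add: upper_lborel_def upper_idx_def)

lemma sets_upper_lborel [measurable_cong]: "sets (upper_lborel q) = sets (O_space q)"
  unfolding upper_lborel_eq by (intro sets_PiM_cong) auto

lemma sets_nu_Omega [measurable_cong]: "sets (nu_Omega q \<eta> \<xi>1 \<xi>0 \<tau>) = sets (O_space q)"
  by (simp add: nu_Omega_def sets_upper_lborel)

lemma space_upper_lborel: "space (upper_lborel q) = space (O_space q)"
  by (rule sets_eq_imp_space_eq[OF sets_upper_lborel])

lemma O_dens_measurable [measurable]: "O_dens \<eta> \<xi>1 \<xi>0 c \<in> borel_measurable borel"
  unfolding O_dens_def[abs_def] by measurable

lemma prior_Omega_unnorm_eq:
  assumes w: "w \<in> space (O_space q)"
  shows "prior_Omega_unnorm q \<eta> \<xi>1 \<xi>0 \<tau> w = indicator (O_set q \<tau>) w * (\<Prod>c\<in>upper_idx q. O_dens \<eta> \<xi>1 \<xi>0 c (w c))"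
proof -
  have Sig: "upper_idx q = Sigma {..<q} (\<lambda>k. {k..<q})" by (auto simp: upper_idx_def)
  have "(\<Prod>c\<in>upper_idx q. O_dens \<eta> \<xi>1 \<xi>0 c (w c)) = (\<Prod>k<q. \<Prod>k'\<in>{k..<q}. O_dens \<eta> \<xi>1 \<xi>0 (k, k') (w (k, k')))"
    unfolding Sig by (subst prod.Sigma) (auto simp: case_prod_beta)
  also have "\<dots> = (\<Prod>k<q. \<xi>1 * exp (- \<xi>1 * w (k, k)) * (\<Prod>k'\<in>{k<..<q}. ssl_density \<eta> \<xi>1 \<xi>0 (w (k, k'))))"
  proof (intro prod.cong refl)
    fix k assume "k \<in> {..<q}"
    then have "{k..<q} = insert k {k<..<q}" by auto
    then show "(\<Prod>k'\<in>{k..<q}. O_dens \<eta> \<xi>1 \<xi>0 (k, k') (w (k, k')))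
        = \<xi>1 * exp (- \<xi>1 * w (k, k)) * (\<Prod>k'\<in>{k<..<q}. ssl_density \<eta> \<xi>1 \<xi>0 (w (k, k')))"
      by (simp add: O_dens_def)
  qed
  finally show ?thesis
    using w by (simp add: prior_Omega_unnorm_def pos_def_mat_Omega_iff O_set_def)
qed

lemma prior_Omega_unnorm_measurable [measurable]:
  "prior_Omega_unnorm q \<eta> \<xi>1 \<xi>0 \<tau> \<in> borel_measurable (O_space q)"
proof -
  have "(\<lambda>w. indicator (O_set q \<tau>) w * (\<Prod>c\<in>upper_idx q. O_dens \<eta> \<xi>1 \<xi>0 c (w c))) \<in> borel_measurable (O_space q)"
    by measurable
  then show ?thesis
    using prior_Omega_unnorm_eq by (subst measurable_cong) auto
qed

lemma O_dens_nonneg: "0 < \<eta> \<Longrightarrow> \<eta> < 1 \<Longrightarrow> 0 < \<xi>1 \<Longrightarrow> 0 < \<xi>0 \<Longrightarrow> O_dens \<eta> \<xi>1 \<xi>0 c x \<ge> 0"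
  by (simp add: O_dens_def ssl_density_nonneg)

lemma emeasure_nu_Omega:
  assumes S: "S \<in> sets (O_space q)"
  shows "emeasure (nu_Omega q \<eta> \<xi>1 \<xi>0 \<tau>) S
    = (\<integral>\<^sup>+w. ennreal (\<Prod>c\<in>upper_idx q. O_dens \<eta> \<xi>1 \<xi>0 c (w c)) * indicator (S \<inter> O_set q \<tau>) w \<partial>upper_lborel q)"
proof -
  have S': "S \<in> sets (upper_lborel q)" using S sets_upper_lborel by blast
  have [measurable]: "prior_Omega_unnorm q \<eta> \<xi>1 \<xi>0 \<tau> \<in> borel_measurable (upper_lborel q)"
    using prior_Omega_unnorm_measurable measurable_cong_sets[OF sets_upper_lborel refl] by blast
  have "emeasure (nu_Omega q \<eta> \<xi>1 \<xi>0 \<tau>) S = (\<integral>\<^sup>+w\<in>S. ennreal (prior_Omega_unnorm q \<eta> \<xi>1 \<xi>0 \<tau> w) \<partial>upper_lborel q)"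
    unfolding nu_Omega_def using S S' by (intro emeasure_density) measurable
  also have "\<dots> = (\<integral>\<^sup>+w. ennreal (\<Prod>c\<in>upper_idx q. O_dens \<eta> \<xi>1 \<xi>0 c (w c)) * indicator (S \<inter> O_set q \<tau>) w \<partial>upper_lborel q)"
    by (intro nn_integral_cong) (auto simp: prior_Omega_unnorm_eq space_upper_lborel split: split_indicator)
  finally show ?thesis .
qed

lemma nn_integral_box:
  fixes h :: "nat \<times> nat \<Rightarrow> real \<Rightarrow> real"
  assumes I: "finite I" and [measurable]: "\<And>c. h c \<in> borel_measurable borel" "\<And>c. Jc c \<in> sets borel"
    and h: "\<And>c x. h c x \<ge> 0"
  shows "(\<integral>\<^sup>+w. ennreal (\<Prod>c\<in>I. h c (w c)) * indicator (\<Pi>\<^sub>E c\<in>I. Jc c) w \<partial>(\<Pi>\<^sub>M c\<in>I. lborel))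
    = (\<Prod>c\<in>I. \<integral>\<^sup>+x. ennreal (h c x) * indicator (Jc c) x \<partial>lborel)"
proof -
  have "(\<integral>\<^sup>+w. ennreal (\<Prod>c\<in>I. h c (w c)) * indicator (\<Pi>\<^sub>E c\<in>I. Jc c) w \<partial>(\<Pi>\<^sub>M c\<in>I. lborel))
    = (\<integral>\<^sup>+w. (\<Prod>c\<in>I. ennreal (h c (w c)) * indicator (Jc c) (w c)) \<partial>(\<Pi>\<^sub>M c\<in>I. lborel))"
  proof (intro nn_integral_cong)
    fix w :: "nat \<times> nat \<Rightarrow> real" assume "w \<in> space (\<Pi>\<^sub>M c\<in>I. lborel)"
    then have "indicator (\<Pi>\<^sub>E c\<in>I. Jc c) w = (\<Prod>c\<in>I. indicator (Jc c) (w c) :: ennreal)"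
      using I by (auto simp: space_PiM PiE_iff indicator_def prod_zero_iff)
    then show "ennreal (\<Prod>c\<in>I. h c (w c)) * indicator (\<Pi>\<^sub>E c\<in>I. Jc c) w = (\<Prod>c\<in>I. ennreal (h c (w c)) * indicator (Jc c) (w c))"
      using h by (simp add: prod_ennreal prod.distrib)
  qed
  also have "\<dots> = (\<Prod>c\<in>I. \<integral>\<^sup>+x. ennreal (h c x) * indicator (Jc c) x \<partial>lborel)"
    by (rule lborel_prod.product_nn_integral_prod[OF I]) measurable
  finally show ?thesis .
qed

lemma nu_Omega_box_ge:
  assumes par: "0 < \<eta>" "\<eta> < 1" "0 < \<xi>1" "0 < \<xi>0" and [measurable]: "\<And>c. Jc c \<in> sets borel"
    and sub: "(\<Pi>\<^sub>E c\<in>upper_idx q. Jc c) \<subseteq> O_set q \<tau>"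
  shows "emeasure (nu_Omega q \<eta> \<xi>1 \<xi>0 \<tau>) (\<Pi>\<^sub>E c\<in>upper_idx q. Jc c)
    = (\<Prod>c\<in>upper_idx q. \<integral>\<^sup>+x. ennreal (O_dens \<eta> \<xi>1 \<xi>0 c x) * indicator (Jc c) x \<partial>lborel)"
proof -
  have "(\<Pi>\<^sub>E c\<in>upper_idx q. Jc c) \<inter> O_set q \<tau> = (\<Pi>\<^sub>E c\<in>upper_idx q. Jc c)" using sub by blast
  then show ?thesis
    using nn_integral_box[of "upper_idx q" "O_dens \<eta> \<xi>1 \<xi>0" Jc] O_dens_nonneg[OF par]
    by (simp add: emeasure_nu_Omega upper_lborel_eq)
qed

lemma O_set_diag:
  assumes w: "w \<in> O_set q \<tau>" and k: "k < q" and \<tau>: "\<tau> > 0" shows "w (k, k) > 0"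
proof -
  have "om_shift \<tau> w k k > 0"
    using w k by (intro pd_on_diag_pos[of "{..<q}"]) (auto simp: O_set_def)
  then show ?thesis using \<tau> by (simp add: om_shift_def om_def)
qed

text \<open>On the whole line the exponential density of a diagonal entry has infinite mass;
  positive definiteness is what excludes negative values. This truncation retains of the constraint
  only the positivity of the diagonal, so that upper bounds factor over the coordinates.\<close>

definition O_dens' :: "real \<Rightarrow> real \<Rightarrow> real \<Rightarrow> nat \<times> nat \<Rightarrow> real \<Rightarrow> real" where
  "O_dens' \<eta> \<xi>1 \<xi>0 c x = (if fst c = snd c \<and> x \<le> 0 then 0 else O_dens \<eta> \<xi>1 \<xi>0 c x)"

lemma O_dens'_measurable [measurable]: "O_dens' \<eta> \<xi>1 \<xi>0 c \<in> borel_measurable borel"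
  unfolding O_dens'_def[abs_def] by measurable

lemma nu_Omega_box_le:
  assumes par: "0 < \<eta>" "\<eta> < 1" "0 < \<xi>1" "0 < \<xi>0" and \<tau>: "\<tau> > 0" and [measurable]: "\<And>c. Jc c \<in> sets borel"
  shows "emeasure (nu_Omega q \<eta> \<xi>1 \<xi>0 \<tau>) ((\<Pi>\<^sub>E c\<in>upper_idx q. Jc c) \<inter> O_set q \<tau>)
    \<le> (\<Prod>c\<in>upper_idx q. \<integral>\<^sup>+x. ennreal (O_dens' \<eta> \<xi>1 \<xi>0 c x) * indicator (Jc c) x \<partial>lborel)"
proof -
  have "emeasure (nu_Omega q \<eta> \<xi>1 \<xi>0 \<tau>) ((\<Pi>\<^sub>E c\<in>upper_idx q. Jc c) \<inter> O_set q \<tau>)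
      \<le> (\<integral>\<^sup>+w. ennreal (\<Prod>c\<in>upper_idx q. O_dens' \<eta> \<xi>1 \<xi>0 c (w c)) * indicator (\<Pi>\<^sub>E c\<in>upper_idx q. Jc c) w \<partial>upper_lborel q)"
  proof (subst emeasure_nu_Omega, measurable, intro nn_integral_mono)
    fix w
    show "ennreal (\<Prod>c\<in>upper_idx q. O_dens \<eta> \<xi>1 \<xi>0 c (w c)) * indicator ((\<Pi>\<^sub>E c\<in>upper_idx q. Jc c) \<inter> O_set q \<tau> \<inter> O_set q \<tau>) w
      \<le> ennreal (\<Prod>c\<in>upper_idx q. O_dens' \<eta> \<xi>1 \<xi>0 c (w c)) * indicator (\<Pi>\<^sub>E c\<in>upper_idx q. Jc c) w"
    proof (cases "w \<in> (\<Pi>\<^sub>E c\<in>upper_idx q. Jc c) \<inter> O_set q \<tau>")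
      case True
      have "(\<Prod>c\<in>upper_idx q. O_dens \<eta> \<xi>1 \<xi>0 c (w c)) = (\<Prod>c\<in>upper_idx q. O_dens' \<eta> \<xi>1 \<xi>0 c (w c))"
      proof (intro prod.cong refl)
        fix c assume "c \<in> upper_idx q"
        then show "O_dens \<eta> \<xi>1 \<xi>0 c (w c) = O_dens' \<eta> \<xi>1 \<xi>0 c (w c)"
          using O_set_diag[of w q \<tau> "fst c"] True \<tau> by (cases c) (auto simp: O_dens'_def upper_idx_def)
      qed
      then show ?thesis using True by simp
    qed (auto split: split_indicator)
  qed
  also have "\<dots> = (\<Prod>c\<in>upper_idx q. \<integral>\<^sup>+x. ennreal (O_dens' \<eta> \<xi>1 \<xi>0 c x) * indicator (Jc c) x \<partial>lborel)"
    unfolding upper_lborel_eq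
    by (intro nn_integral_box) (auto simp: O_dens'_def O_dens_nonneg[OF par])
  finally show ?thesis .
qed

lemma O_dens'_total:
  assumes par: "0 < \<eta>" "\<eta> < 1" "0 < \<xi>1" "0 < \<xi>0"
  shows "(\<integral>\<^sup>+x. ennreal (O_dens' \<eta> \<xi>1 \<xi>0 c x) \<partial>lborel) \<le> 1"
proof (cases "fst c = snd c")
  case True
  have "(\<integral>\<^sup>+x. ennreal (O_dens' \<eta> \<xi>1 \<xi>0 c x) \<partial>lborel) \<le> (\<integral>\<^sup>+x. ennreal (\<xi>1 * exp (- \<xi>1 * x)) * indicator {0..} x \<partial>lborel)"
    using True by (intro nn_integral_mono) (auto simp: O_dens'_def O_dens_def split: split_indicator)
  also have "\<dots> = ennreal (0 - (- exp (- \<xi>1 * 0)))"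
  proof (rule nn_integral_FTC_atLeast[where F = "\<lambda>x. - exp (- \<xi>1 * x)"])
    show "((\<lambda>x. - exp (- \<xi>1 * x)) \<longlongrightarrow> 0) at_top" using par by real_asymp
    show "((\<lambda>x. - exp (- \<xi>1 * x)) has_real_derivative \<xi>1 * exp (- \<xi>1 * x)) (at x)" for x
      by (auto intro!: derivative_eq_intros)
  qed (use par in auto)
  finally show ?thesis by simp
next
  case False
  then show ?thesis using par by (simp add: O_dens'_def O_dens_def ssl_density_total)
qed

lemma prod_le_one_ennreal:
  fixes f :: "'a \<Rightarrow> ennreal" shows "(\<And>i. i \<in> S \<Longrightarrow> f i \<le> 1) \<Longrightarrow> (\<Prod>i\<in>S. f i) \<le> 1"
  using prod_mono_ennreal[of S f "\<lambda>_. 1"] by simp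

lemma nu_Omega_total:
  assumes par: "0 < \<eta>" "\<eta> < 1" "0 < \<xi>1" "0 < \<xi>0" and \<tau>: "\<tau> > 0"
  shows "emeasure (nu_Omega q \<eta> \<xi>1 \<xi>0 \<tau>) (space (O_space q)) \<le> 1"
proof -
  have "emeasure (nu_Omega q \<eta> \<xi>1 \<xi>0 \<tau>) (space (O_space q))
      = emeasure (nu_Omega q \<eta> \<xi>1 \<xi>0 \<tau>) ((\<Pi>\<^sub>E c\<in>upper_idx q. UNIV) \<inter> O_set q \<tau>)"
    by (subst (1 2) emeasure_nu_Omega) (auto simp: space_PiM intro!: nn_integral_cong split: split_indicator)
  also have "\<dots> \<le> (\<Prod>c\<in>upper_idx q. \<integral>\<^sup>+x. ennreal (O_dens' \<eta> \<xi>1 \<xi>0 c x) * indicator UNIV x \<partial>lborel)"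
    by (rule nu_Omega_box_le[OF par \<tau>]) auto
  also have "\<dots> \<le> 1"
    using O_dens'_total[OF par] by (intro prod_le_one_ennreal) auto
  finally show ?thesis .
qed

text \<open>The normalising constant of \<open>prior_Omega\<close> cancels in the posterior.\<close>

definition mu_hat :: "nat \<Rightarrow> nat \<Rightarrow> real \<Rightarrow> real \<Rightarrow> real \<Rightarrow> real \<Rightarrow> real \<Rightarrow> real \<Rightarrow> real \<Rightarrow>
    ((nat \<times> nat \<Rightarrow> real) \<times> (nat \<times> nat \<Rightarrow> real)) measure" where
  "mu_hat p q \<theta> l1 l0 \<eta> \<xi>1 \<xi>0 \<tau> = prior_B p q \<theta> l1 l0 \<Otimes>\<^sub>M nu_Omega q \<eta> \<xi>1 \<xi>0 \<tau>"

lemma sets_prior_B [measurable_cong]: "sets (prior_B p q \<theta> l1 l0) = sets (B_space p q)"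
  unfolding prior_B_def by (intro sets_PiM_cong) auto

lemma sets_mu_hat [measurable_cong]: "sets (mu_hat p q \<theta> l1 l0 \<eta> \<xi>1 \<xi>0 \<tau>) = sets (B_space p q \<Otimes>\<^sub>M O_space q)"
  unfolding mu_hat_def by (intro sets_pair_measure_cong sets_prior_B sets_nu_Omega)

lemma prob_space_ssl:
  assumes "0 < t" "t < 1" "0 < l1" "0 < l0"
  shows "prob_space (density lborel (\<lambda>x. ennreal (ssl_density t l1 l0 x)))"
  by standard (simp add: emeasure_density ssl_density_total[OF assms])

lemma prob_space_prior_B:
  assumes "0 < t" "t < 1" "0 < l1" "0 < l0" shows "prob_space (prior_B p q t l1 l0)"
  unfolding prior_B_def by (intro prob_space_PiM prob_space_ssl assms)

lemma emeasure_prior_B_box: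
  assumes par: "0 < t" "t < 1" "0 < l1" "0 < l0" and [measurable]: "\<And>c. Jc c \<in> sets borel"
  shows "emeasure (prior_B p q t l1 l0) (\<Pi>\<^sub>E c\<in>B_idx p q. Jc c)
    = (\<Prod>c\<in>B_idx p q. \<integral>\<^sup>+x. ennreal (ssl_density t l1 l0 x) * indicator (Jc c) x \<partial>lborel)"
proof -
  interpret product_sigma_finite "\<lambda>_ :: nat \<times> nat. density lborel (\<lambda>x. ennreal (ssl_density t l1 l0 x))"
    by (intro product_sigma_finite.intro prob_space_imp_sigma_finite prob_space_ssl par)
  show ?thesis
    unfolding prior_B_def by (subst emeasure_PiM) (auto simp: emeasure_density)
qed

lemma finite_measure_nu_Omega:
  assumes par: "0 < \<eta>" "\<eta> < 1" "0 < \<xi>1" "0 < \<xi>0" and \<tau>: "\<tau> > 0"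
  shows "finite_measure (nu_Omega q \<eta> \<xi>1 \<xi>0 \<tau>)"
proof
  have sp: "space (nu_Omega q \<eta> \<xi>1 \<xi>0 \<tau>) = space (O_space q)"
    by (rule sets_eq_imp_space_eq[OF sets_nu_Omega])
  have "emeasure (nu_Omega q \<eta> \<xi>1 \<xi>0 \<tau>) (space (O_space q)) < \<top>"
    using nu_Omega_total[OF par \<tau>, of q] by (rule le_less_trans) simp
  then show "emeasure (nu_Omega q \<eta> \<xi>1 \<xi>0 \<tau>) (space (nu_Omega q \<eta> \<xi>1 \<xi>0 \<tau>)) \<noteq> \<infinity>"
    by (simp add: sp)
qed

lemma nn_integral_prior:
  assumes par: "0 < \<theta>" "\<theta> < 1" "0 < l1" "0 < l0" "0 < \<eta>" "\<eta> < 1" "0 < \<xi>1" "0 < \<xi>0" and \<tau>: "\<tau> > 0"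
    and Z: "Z = emeasure (nu_Omega q \<eta> \<xi>1 \<xi>0 \<tau>) (space (O_space q))" "Z > 0"
    and g: "g \<in> borel_measurable (B_space p q \<Otimes>\<^sub>M O_space q)"
  shows "(\<integral>\<^sup>+t. g t \<partial>prior p q \<theta> l1 l0 \<eta> \<xi>1 \<xi>0 \<tau>) = inverse Z * (\<integral>\<^sup>+t. g t \<partial>mu_hat p q \<theta> l1 l0 \<eta> \<xi>1 \<xi>0 \<tau>)"
    and "sets (prior p q \<theta> l1 l0 \<eta> \<xi>1 \<xi>0 \<tau>) = sets (B_space p q \<Otimes>\<^sub>M O_space q)"
proof -
  have [measurable]: "prior_Omega_unnorm q \<eta> \<xi>1 \<xi>0 \<tau> \<in> borel_measurable (upper_lborel q)"
    using prior_Omega_unnorm_measurable measurable_cong_sets[OF sets_upper_lborel refl] by blast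
  have Zint: "(\<integral>\<^sup>+ w'. ennreal (prior_Omega_unnorm q \<eta> \<xi>1 \<xi>0 \<tau> w') \<partial>upper_lborel q) = Z"
    unfolding Z(1) nu_Omega_def space_upper_lborel[symmetric]
    by (subst emeasure_density) (auto intro!: nn_integral_cong)
  have Zfin: "Z < \<top>" unfolding Z(1) by (rule le_less_trans[OF nu_Omega_total[OF par(5-8) \<tau>]]) simp
  have pO: "prior_Omega q \<eta> \<xi>1 \<xi>0 \<tau> = density (upper_lborel q) (\<lambda>w. ennreal (prior_Omega_unnorm q \<eta> \<xi>1 \<xi>0 \<tau> w) / Z)"
    unfolding prior_Omega_def Zint ..
  have setsO: "sets (prior_Omega q \<eta> \<xi>1 \<xi>0 \<tau>) = sets (O_space q)"
    unfolding pO by (simp add: sets_upper_lborel)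
  show sets: "sets (prior p q \<theta> l1 l0 \<eta> \<xi>1 \<xi>0 \<tau>) = sets (B_space p q \<Otimes>\<^sub>M O_space q)"
    unfolding prior_def by (intro sets_pair_measure_cong sets_prior_B setsO)
  interpret O: finite_measure "prior_Omega q \<eta> \<xi>1 \<xi>0 \<tau>"
  proof
    have "emeasure (prior_Omega q \<eta> \<xi>1 \<xi>0 \<tau>) (space (prior_Omega q \<eta> \<xi>1 \<xi>0 \<tau>))
        = (\<integral>\<^sup>+w. ennreal (prior_Omega_unnorm q \<eta> \<xi>1 \<xi>0 \<tau> w) / Z \<partial>upper_lborel q)"
      unfolding pO by (subst emeasure_density) (auto intro!: nn_integral_cong)
    also have "\<dots> = Z / Z" by (subst nn_integral_divide) (auto simp: Zint)
    also have "\<dots> = 1" using Z Zfin by simp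
    finally show "emeasure (prior_Omega q \<eta> \<xi>1 \<xi>0 \<tau>) (space (prior_Omega q \<eta> \<xi>1 \<xi>0 \<tau>)) \<noteq> \<infinity>" by simp
  qed
  interpret N: finite_measure "nu_Omega q \<eta> \<xi>1 \<xi>0 \<tau>" by (rule finite_measure_nu_Omega[OF par(5-8) \<tau>])
  have gm1: "g \<in> borel_measurable (prior_B p q \<theta> l1 l0 \<Otimes>\<^sub>M prior_Omega q \<eta> \<xi>1 \<xi>0 \<tau>)"
    using g measurable_cong_sets[OF sets refl] unfolding prior_def by blast
  have gm2: "g \<in> borel_measurable (prior_B p q \<theta> l1 l0 \<Otimes>\<^sub>M nu_Omega q \<eta> \<xi>1 \<xi>0 \<tau>)"
    using g measurable_cong_sets[OF sets_mu_hat refl] unfolding mu_hat_def by blast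
  have "(\<integral>\<^sup>+t. g t \<partial>prior p q \<theta> l1 l0 \<eta> \<xi>1 \<xi>0 \<tau>)
      = (\<integral>\<^sup>+b. \<integral>\<^sup>+w. g (b, w) \<partial>prior_Omega q \<eta> \<xi>1 \<xi>0 \<tau> \<partial>prior_B p q \<theta> l1 l0)"
    unfolding prior_def by (rule O.nn_integral_fst[OF gm1, symmetric])
  also have "\<dots> = (\<integral>\<^sup>+b. inverse Z * (\<integral>\<^sup>+w. g (b, w) \<partial>nu_Omega q \<eta> \<xi>1 \<xi>0 \<tau>) \<partial>prior_B p q \<theta> l1 l0)"
  proof (intro nn_integral_cong)
    fix b assume b: "b \<in> space (prior_B p q \<theta> l1 l0)"
    have "(\<lambda>w. g (b, w)) \<in> borel_measurable (nu_Omega q \<eta> \<xi>1 \<xi>0 \<tau>)"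
      by (rule measurable_compose_Pair1[OF b gm2])
    then have [measurable]: "(\<lambda>w. g (b, w)) \<in> borel_measurable (upper_lborel q)"
      by (simp add: nu_Omega_def)
    have "(\<integral>\<^sup>+w. g (b, w) \<partial>prior_Omega q \<eta> \<xi>1 \<xi>0 \<tau>)
        = (\<integral>\<^sup>+w. inverse Z * (ennreal (prior_Omega_unnorm q \<eta> \<xi>1 \<xi>0 \<tau> w) * g (b, w)) \<partial>upper_lborel q)"
      unfolding pO by (subst nn_integral_density) (auto intro!: nn_integral_cong simp: divide_ennreal_def mult_ac)
    also have "\<dots> = inverse Z * (\<integral>\<^sup>+w. ennreal (prior_Omega_unnorm q \<eta> \<xi>1 \<xi>0 \<tau> w) * g (b, w) \<partial>upper_lborel q)"
      by (rule nn_integral_cmult) measurable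
    also have "(\<integral>\<^sup>+w. ennreal (prior_Omega_unnorm q \<eta> \<xi>1 \<xi>0 \<tau> w) * g (b, w) \<partial>upper_lborel q)
        = (\<integral>\<^sup>+w. g (b, w) \<partial>nu_Omega q \<eta> \<xi>1 \<xi>0 \<tau>)"
      unfolding nu_Omega_def by (rule nn_integral_density[symmetric]) measurable
    finally show "(\<integral>\<^sup>+w. g (b, w) \<partial>prior_Omega q \<eta> \<xi>1 \<xi>0 \<tau>) = inverse Z * (\<integral>\<^sup>+w. g (b, w) \<partial>nu_Omega q \<eta> \<xi>1 \<xi>0 \<tau>)" .
  qed
  also have "\<dots> = inverse Z * (\<integral>\<^sup>+b. \<integral>\<^sup>+w. g (b, w) \<partial>nu_Omega q \<eta> \<xi>1 \<xi>0 \<tau> \<partial>prior_B p q \<theta> l1 l0)"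
    by (rule nn_integral_cmult) (rule N.borel_measurable_nn_integral_fst[OF gm2])
  also have "(\<integral>\<^sup>+b. \<integral>\<^sup>+w. g (b, w) \<partial>nu_Omega q \<eta> \<xi>1 \<xi>0 \<tau> \<partial>prior_B p q \<theta> l1 l0)
      = (\<integral>\<^sup>+t. g t \<partial>mu_hat p q \<theta> l1 l0 \<eta> \<xi>1 \<xi>0 \<tau>)"
    unfolding mu_hat_def by (rule N.nn_integral_fst[OF gm2])
  finally show "(\<integral>\<^sup>+t. g t \<partial>prior p q \<theta> l1 l0 \<eta> \<xi>1 \<xi>0 \<tau>) = inverse Z * (\<integral>\<^sup>+t. g t \<partial>mu_hat p q \<theta> l1 l0 \<eta> \<xi>1 \<xi>0 \<tau>)" .
qed

text \<open>The likelihood of the truth and the normalising constant are common factors of numerator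
  and denominator. That the constant is positive is assumed here; it follows in
  \<open>contraction_bound\<close> from the mass of the neighbourhood of the truth.\<close>

lemma posterior_eq_ratio:
  assumes par: "0 < \<theta>" "\<theta> < 1" "0 < l1" "0 < l0" "0 < \<eta>" "\<eta> < 1" "0 < \<xi>1" "0 < \<xi>0" and \<tau>: "\<tau> > 0"
    and Zpos: "emeasure (nu_Omega q \<eta> \<xi>1 \<xi>0 \<tau>) (space (O_space q)) > 0"
    and X: "X \<in> carrier_mat n p" and pd: "pd_on {..<q} (om w0)"
    and A: "A = {(b, w) \<in> space (B_space p q \<Otimes>\<^sub>M O_space q). R (B_of p q b) (Omega_of q w)}"
    and Am: "A \<in> sets (B_space p q \<Otimes>\<^sub>M O_space q)"
    and Y: "Y \<in> space (\<Pi>\<^sub>M i\<in>{..<n}. \<Pi>\<^sub>M k\<in>{..<q}. (borel :: real measure))"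
  shows "prob_of p q (posterior n p q X (prior p q \<theta> l1 l0 \<eta> \<xi>1 \<xi>0 \<tau>) Y) R
    = (\<integral>\<^sup>+t\<in>A. ennreal (lr n p q X b0 w0 t Y) \<partial>mu_hat p q \<theta> l1 l0 \<eta> \<xi>1 \<xi>0 \<tau>) /
      (\<integral>\<^sup>+t. ennreal (lr n p q X b0 w0 t Y) \<partial>mu_hat p q \<theta> l1 l0 \<eta> \<xi>1 \<xi>0 \<tau>)"
proof -
  define P where "P = prior p q \<theta> l1 l0 \<eta> \<xi>1 \<xi>0 \<tau>"
  define m where "m = mu_hat p q \<theta> l1 l0 \<eta> \<xi>1 \<xi>0 \<tau>"
  define Z where "Z = emeasure (nu_Omega q \<eta> \<xi>1 \<xi>0 \<tau>) (space (O_space q))"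
  have Z: "Z > 0" using Zpos by (simp add: Z_def)
  note int = nn_integral_prior(1)[where p = p, OF par \<tau> Z_def Z, folded P_def m_def]
  have setsP: "sets P = sets (B_space p q \<Otimes>\<^sub>M O_space q)"
    unfolding P_def by (rule nn_integral_prior(2)[OF par \<tau> Z_def Z, of "\<lambda>_. 0"]) simp
  have spP: "space P = space (B_space p q \<Otimes>\<^sub>M O_space q)" by (rule sets_eq_imp_space_eq[OF setsP])
  define L0 where "L0 = (\<Prod>i<n. nd q (om w0) (mu p X b0 i) (Y i))"
  have L0: "L0 > 0" unfolding L0_def by (intro prod_pos) (simp add: nd_pos[OF pd])
  define l where "l = (\<lambda>t. lr n p q X b0 w0 t Y)"
  have lik: "likelihood n q X Y (B_of p q b) (Omega_of q w) = L0 * l (b, w)" for b w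
  proof -
    have nz: "nd q (om w0) (mu p X b0 i) (Y i) \<noteq> 0" for i using nd_pos[OF pd, of "mu p X b0 i" "Y i"] by simp
    have "L0 * l (b, w) = (\<Prod>i<n. nd q (om w) (mu p X b i) (Y i))"
      unfolding L0_def l_def lr_def prod.distrib[symmetric] using nz by (intro prod.cong) auto
    then show ?thesis unfolding likelihood_def by (simp add: normal_density_prec_eq_nd[OF X])
  qed
  have lm: "l \<in> borel_measurable (B_space p q \<Otimes>\<^sub>M O_space q)"
    unfolding l_def using measurable_compose[OF measurable_Pair2'[OF Y] lr_measurable[of n p q X b0 w0]] by simp
  have lmP [measurable]: "l \<in> borel_measurable P" using lm measurable_cong_sets[OF setsP refl] by blast
  have AP [measurable]: "A \<in> sets P" using Am setsP by simp
  have setsm: "sets m = sets (B_space p q \<Otimes>\<^sub>M O_space q)" unfolding m_def by (rule sets_mu_hat)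
  have lmm [measurable]: "l \<in> borel_measurable m" using lm measurable_cong_sets[OF setsm refl] by blast
  have Amm [measurable]: "A \<in> sets m" using Am setsm by simp
  have e: "ennreal (L0 * l t) = ennreal L0 * ennreal (l t)" for t
    using L0 by (intro ennreal_mult') simp
  define D where "D = (\<integral>\<^sup>+t. ennreal (L0 * l t) \<partial>P)"
  have post: "posterior n p q X P Y = density P (\<lambda>t. ennreal (L0 * l t) / D)"
    unfolding posterior_def D_def lik by (simp add: case_prod_beta')
  have "prob_of p q (posterior n p q X P Y) R = emeasure (density P (\<lambda>t. ennreal (L0 * l t) / D)) A"
    unfolding prob_of_def post A by (simp add: spP)
  also have "\<dots> = (\<integral>\<^sup>+t. ennreal (L0 * l t) / D * indicator A t \<partial>P)"
    by (rule emeasure_density) measurable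
  also have "\<dots> = (\<integral>\<^sup>+t. ennreal (L0 * l t) * indicator A t / D \<partial>P)"
    by (intro nn_integral_cong) (simp add: divide_ennreal_def mult_ac)
  also have "\<dots> = (\<integral>\<^sup>+t. ennreal (L0 * l t) * indicator A t \<partial>P) / D"
    by (rule nn_integral_divide) measurable
  also have "(\<integral>\<^sup>+t. ennreal (L0 * l t) * indicator A t \<partial>P) = ennreal L0 * (inverse Z * (\<integral>\<^sup>+t. ennreal (l t) * indicator A t \<partial>m))"
    using int[of "\<lambda>t. ennreal (l t) * indicator A t"] lm Am
    by (simp add: e nn_integral_cmult mult.assoc)
  also have "D = ennreal L0 * (inverse Z * (\<integral>\<^sup>+t. ennreal (l t) \<partial>m))"
    unfolding D_def using int[of "\<lambda>t. ennreal (l t)"] lm by (simp add: e nn_integral_cmult)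
  also have "ennreal L0 * (inverse Z * (\<integral>\<^sup>+t. ennreal (l t) * indicator A t \<partial>m)) /
      (ennreal L0 * (inverse Z * (\<integral>\<^sup>+t. ennreal (l t) \<partial>m)))
      = (inverse Z * (\<integral>\<^sup>+t. ennreal (l t) * indicator A t \<partial>m)) / (inverse Z * (\<integral>\<^sup>+t. ennreal (l t) \<partial>m))"
    by (rule ennreal_cancel_ratio[OF L0])
  also have "\<dots> = (\<integral>\<^sup>+t. ennreal (l t) * indicator A t \<partial>m) / (\<integral>\<^sup>+t. ennreal (l t) \<partial>m)"
  proof -
    have "Z < \<top>" unfolding Z_def by (rule le_less_trans[OF nu_Omega_total[OF par(5-8) \<tau>]]) simp
    then obtain z where z: "Z = ennreal z" "z > 0" using Z by (cases Z) auto
    then have "inverse Z = ennreal (inverse z)" by (simp add: inverse_ennreal)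
    then show ?thesis using z by (simp add: ennreal_cancel_ratio)
  qed
  finally show ?thesis unfolding P_def m_def l_def .
qed

section \<open>A non-asymptotic contraction bound\<close>

text \<open>Evaluate the form at e_k + e_l and at e_k - e_l.\<close>

lemma psd_entry_le:
  fixes A :: "nat \<Rightarrow> nat \<Rightarrow> real"
  assumes sym: "sym_on {..<q} A" and psd: "\<And>v. bform {..<q} A v v \<ge> 0" and kl: "k < q" "l < q"
  shows "\<bar>A k l\<bar> \<le> (A k k + A l l) / 2"
proof -
  define e :: "nat \<Rightarrow> nat \<Rightarrow> real" where "e = (\<lambda>r i. if i = r then 1 else 0)"
  have u: "bform {..<q} A (e i) (e j) = A i j" if "i < q" "j < q" for i j
    using that bform_unit[of "{..<q}" i j A] by (simp add: e_def)
  have "0 \<le> A k k + 2 * t * A k l + t\<^sup>2 * A l l" for t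
    using psd[of "\<lambda>i. e k i + t * e l i"] unfolding bform_square_add[OF sym] by (simp add: u kl)
  from this[of 1] this[of "-1"] show ?thesis by (simp add: abs_le_iff)
qed

text \<open>Coarse in the vector, but the matrix enters only through its trace, so within a cell the
  bound is governed by the diagonal coordinates alone.\<close>

lemma psd_trace_bound:
  fixes A :: "nat \<Rightarrow> nat \<Rightarrow> real"
  assumes sym: "sym_on {..<q} A" and psd: "\<And>v. bform {..<q} A v v \<ge> 0"
  shows "bform {..<q} A m m \<le> (\<Sum>k<q. A k k) * (\<Sum>k<q. \<bar>m k\<bar>)\<^sup>2"
proof -
  have d: "A k k \<ge> 0" if "k < q" for k
    using psd_entry_le[OF sym psd that that] by simp
  have "bform {..<q} A m m \<le> (\<Sum>k<q. \<Sum>l<q. (A k k + A l l) / 2 * (\<bar>m k\<bar> * \<bar>m l\<bar>))"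
    unfolding bform_def
  proof (intro sum_mono)
    fix k l assume "k \<in> {..<q}" "l \<in> {..<q}"
    then have "\<bar>A k l\<bar> * (\<bar>m k\<bar> * \<bar>m l\<bar>) \<le> (A k k + A l l) / 2 * (\<bar>m k\<bar> * \<bar>m l\<bar>)"
      using psd_entry_le[OF sym psd, of k l] by (intro mult_right_mono) auto
    moreover have "A k l * m k * m l \<le> \<bar>A k l\<bar> * (\<bar>m k\<bar> * \<bar>m l\<bar>)"
      using abs_ge_self[of "A k l * m k * m l"] by (simp add: abs_mult mult.assoc)
    ultimately show "A k l * m k * m l \<le> (A k k + A l l) / 2 * (\<bar>m k\<bar> * \<bar>m l\<bar>)" by linarith
  qed
  also have "\<dots> \<le> (\<Sum>k<q. \<Sum>l<q. (\<Sum>k<q. A k k) * (\<bar>m k\<bar> * \<bar>m l\<bar>))"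
  proof (intro sum_mono mult_right_mono)
    fix k l assume k: "k \<in> {..<q}" and l: "l \<in> {..<q}"
    have "A k k \<le> (\<Sum>k<q. A k k)" "A l l \<le> (\<Sum>k<q. A k k)"
      using k l d by (auto intro!: member_le_sum[of _ "{..<q}" "\<lambda>k. A k k"])
    then show "(A k k + A l l) / 2 \<le> (\<Sum>k<q. A k k)" by simp
  qed auto
  also have "\<dots> = (\<Sum>k<q. A k k) * (\<Sum>k<q. \<bar>m k\<bar>)\<^sup>2"
  proof -
    have "(\<Sum>k<q. \<bar>m k\<bar>)\<^sup>2 = (\<Sum>k<q. \<Sum>l<q. \<bar>m k\<bar> * \<bar>m l\<bar>)"
      by (simp only: power2_eq_square sum_product)
    then show ?thesis by (simp only: sum_distrib_left)
  qed
  finally show ?thesis .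
qed

lemma sum_abs_square_le:
  fixes f :: "nat \<Rightarrow> real" shows "(\<Sum>k<q. \<bar>f k\<bar>)\<^sup>2 \<le> real q * (\<Sum>k<q. (f k)\<^sup>2)"
  using Cauchy_Schwarz_ineq_sum[of "\<lambda>_. 1" "\<lambda>k. \<bar>f k\<bar>" "{..<q}"] by simp

lemma bform_close:
  fixes A B :: "nat \<Rightarrow> nat \<Rightarrow> real"
  assumes "\<And>i j. i < q \<Longrightarrow> j < q \<Longrightarrow> \<bar>A i j - B i j\<bar> \<le> w" and w: "w \<ge> 0"
  shows "\<bar>bform {..<q} A v v - bform {..<q} B v v\<bar> \<le> w * real q * (\<Sum>k<q. (v k)\<^sup>2)"
proof -
  have "bform {..<q} A v v - bform {..<q} B v v = (\<Sum>i<q. \<Sum>j<q. (A i j - B i j) * v i * v j)"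
    by (simp add: bform_def sum_subtractf algebra_simps)
  also have "\<bar>\<dots>\<bar> \<le> (\<Sum>i<q. \<Sum>j<q. w * (\<bar>v i\<bar> * \<bar>v j\<bar>))"
  proof (intro order_trans[OF sum_abs] sum_mono)
    fix i j assume "i \<in> {..<q}" "j \<in> {..<q}"
    then show "\<bar>(A i j - B i j) * v i * v j\<bar> \<le> w * (\<bar>v i\<bar> * \<bar>v j\<bar>)"
      using assms(1)[of i j] by (simp add: abs_mult mult.assoc mult_right_mono)
  qed
  also have "\<dots> = w * (\<Sum>k<q. \<bar>v k\<bar>)\<^sup>2"
    by (simp only: power2_eq_square sum_product) (simp only: sum_distrib_left)
  also have "\<dots> \<le> w * (real q * (\<Sum>k<q. (v k)\<^sup>2))"
    using w by (intro mult_left_mono sum_abs_square_le)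
  finally show ?thesis by (simp add: mult.assoc)
qed

lemma half_inverse_le_one: "N \<ge> 1 \<Longrightarrow> 1 / (2 * real N) \<le> 1"
  by (cases N) (auto simp: field_simps)

text \<open>By Bernoulli's inequality, up to \<open>N\<close> factors \<open>1 - 1 / (2 * N)\<close>
  have a product of at least 1/2: the zero coordinates together cost only a constant.\<close>

lemma prod_if_ge:
  assumes I: "finite I" and l: "0 < l" "l \<le> (1 :: real)" and card: "card {c \<in> I. P c} \<le> s" "card I \<le> N" "N \<ge> 1"
  shows "(\<Prod>c\<in>I. if P c then l else 1 - 1 / (2 * real N)) \<ge> l ^ s / 2"
proof -
  define m where "m = card {c \<in> I. \<not> P c}"
  have m: "m \<le> N" unfolding m_def by (rule order_trans[OF card_mono card(2)]) (use I in auto)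
  have "(\<Prod>c\<in>I. if P c then l else 1 - 1 / (2 * real N)) = l ^ card {c \<in> I. P c} * (1 - 1 / (2 * real N)) ^ m"
    using I by (simp add: prod.If_cases m_def Int_def)
  moreover have "l ^ s \<le> l ^ card {c \<in> I. P c}" using l card(1) by (intro power_decreasing) auto
  moreover have "1 / 2 \<le> (1 - 1 / (2 * real N)) ^ m"
  proof -
    have "1 / 2 \<le> 1 + real m * (- 1 / (2 * real N))" using m card(3) by (simp add: field_simps)
    also have "\<dots> \<le> (1 + - 1 / (2 * real N)) ^ m"
      using card(3) by (intro Bernoulli_inequality) (simp add: field_simps)
    finally show ?thesis by simp
  qed
  ultimately show ?thesis
    using l mult_mono[of "l ^ s" "l ^ card {c \<in> I. P c}" "1 / 2" "(1 - 1 / (2 * real N)) ^ m"] by simp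
qed

lemma prod_if_le:
  assumes I: "finite I" and D: "1 \<le> D" "1 \<le> (E :: real)" and card: "card {c \<in> I. P c} \<le> s" "card I \<le> N"
  shows "(\<Prod>c\<in>I. if P c then D else E) \<le> D ^ s * E ^ N"
proof -
  have m: "card {c \<in> I. \<not> P c} \<le> N" by (rule order_trans[OF card_mono card(2)]) (use I in auto)
  have "(\<Prod>c\<in>I. if P c then D else E) = D ^ card {c \<in> I. P c} * E ^ card {c \<in> I. \<not> P c}"
    using I by (simp add: prod.If_cases Int_def)
  also have "\<dots> \<le> D ^ s * E ^ N"
    using D m card by (intro mult_mono power_increasing) auto
  finally show ?thesis .
qed

lemma card_upper_idx: "card (upper_idx q) \<le> q\<^sup>2"
proof -
  have "upper_idx q \<subseteq> {..<q} \<times> {..<q}" by (auto simp: upper_idx_def)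
  then have "card (upper_idx q) \<le> card ({..<q} \<times> {..<q})" by (intro card_mono) auto
  then show ?thesis by (simp add: power2_eq_square)
qed

lemma diag_upper_idx: "{c \<in> upper_idx q. fst c = snd c} = (\<lambda>k. (k, k)) ` {..<q}"
  by (auto simp: upper_idx_def)

lemma card_diag_upper_idx: "card {c \<in> upper_idx q. fst c = snd c} = q"
  unfolding diag_upper_idx by (subst card_image) (auto simp: inj_on_def)

lemma sum_diag_upper_idx: "(\<Sum>c\<in>upper_idx q. if fst c = snd c then f c else 0) = (\<Sum>k<q. f (k, k))"
  unfolding sum.inter_filter[symmetric, OF finite_upper_idx] diag_upper_idx
  by (subst sum.reindex) (auto simp: inj_on_def)

text \<open>A relative error 1/n of the precision matrices within a cell therefore costs only exp (2
  q) over all \<open>n\<close> observations.\<close>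

lemma one_minus_inverse_power_ge:
  assumes "n \<ge> 2" shows "1 / (1 - 1 / real n) ^ (q * n) \<le> exp (2 * real q)"
proof -
  define x where "x = 1 / real n"
  have x: "0 < x" "x \<le> 1 / 2" "real n * x = 1" using assms by (auto simp: x_def field_simps)
  have "- x - 2 * x\<^sup>2 \<le> ln (1 - x)" using x by (intro ln_one_minus_pos_lower_bound) auto
  moreover have "2 * x\<^sup>2 \<le> x" using x mult_left_mono[of x "1 / 2" x] by (simp add: power2_eq_square)
  ultimately have "- (2 * x) \<le> ln (1 - x)" by simp
  then have "exp (- (2 * x)) \<le> 1 - x" using x by (subst (asm) ln_ge_iff) auto
  then have "exp (- (2 * x)) ^ (q * n) \<le> (1 - x) ^ (q * n)" by (intro power_mono) auto
  moreover have "exp (- (2 * x)) ^ (q * n) = exp (- (2 * real q))"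
    using x by (simp add: exp_of_nat_mult[symmetric])
  ultimately have "exp (- (2 * real q)) \<le> (1 - x) ^ (q * n)" by simp
  moreover have "(1 - x) ^ (q * n) > 0" using x by simp
  ultimately show ?thesis unfolding x_def[symmetric]
    by (simp add: exp_minus field_simps)
qed

text \<open>\<open>lo\<close> and \<beta> bound the spectrum of the true precision matrix; \<tau>0
  is a perturbation that the gap between \<open>lo\<close> and the truncation level \<tau>
  tolerates. \<open>l\<close> will bound from below the prior mass near the true value of one
  coordinate that is nonzero or diagonal.\<close>

locale spike_slab =
  fixes n p q :: nat and X :: "real mat" and \<theta> l1 l0 \<eta> \<xi>1 \<xi>0 \<tau> lo \<beta> \<tau>0 \<alpha> a1 l :: real
    and b0 w0 :: "nat \<times> nat \<Rightarrow> real" and sB sO :: nat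
  assumes n: "n \<ge> 2" and p: "p \<ge> 1" and q: "q \<ge> 1" and X: "X \<in> carrier_mat n p"
    and col: "\<And>j. j < p \<Longrightarrow> (\<Sum>i<n. (X $$ (i, j))\<^sup>2) = real n"
    and parB: "0 < \<theta>" "\<theta> < 1" "0 < l1" "0 < l0" and parO: "0 < \<eta>" "\<eta> < 1" "0 < \<xi>1" "0 < \<xi>0"
    and \<tau>: "\<tau> > 0" and \<tau>0: "\<tau>0 > 0" "\<tau>0 \<le> \<tau>" "\<tau>0 < lo - \<tau>" and \<beta>: "\<beta> > 0"
    and form_lo: "\<And>v. lo * (\<Sum>k<q. (v k)\<^sup>2) \<le> bform {..<q} (om w0) v v"
    and form_hi: "\<And>v. bform {..<q} (om w0) v v \<le> \<beta> * (\<Sum>k<q. (v k)\<^sup>2)"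
    and b0: "\<And>c. c \<in> B_idx p q \<Longrightarrow> \<bar>b0 c\<bar> \<le> a1"
    and sB: "card {c \<in> B_idx p q. b0 c \<noteq> 0} = sB"
    and sO: "card {c \<in> upper_idx q. fst c < snd c \<and> w0 c \<noteq> 0} = sO"
    and \<alpha>: "2 / 3 \<le> \<alpha>" "\<alpha> < 1"
    and l: "0 < l" "l \<le> 1"
begin

text \<open>
  Within a cell the chi-square divergence contains the means through the trace of the precision
  matrix, which is unbounded. The factor \<open>sqrt \<xi>1\<close> in the width \<open>wB\<close> reduces this contribution to
  \<open>exp (\<xi>1 * trace / 2)\<close> (see \<open>cell_chi\<close>), which the exponential prior on the diagonal absorbs.
\<close>

definition wB :: real where "wB = sqrt (\<xi>1 / (6 * real n)) / (real p * real q)"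
definition wO :: real where "wO = \<tau>0 / (real q * real n)"

abbreviation "T0 \<equiv> B_space p q \<Otimes>\<^sub>M O_space q"
abbreviation "mh \<equiv> mu_hat p q \<theta> l1 l0 \<eta> \<xi>1 \<xi>0 \<tau>"
abbreviation "nu \<equiv> nu_Omega q \<eta> \<xi>1 \<xi>0 \<tau>"
abbreviation "pB \<equiv> prior_B p q \<theta> l1 l0"

lemma wB: "wB > 0" using p q n parO by (simp add: wB_def)
lemma wO: "wO > 0" using q n \<tau>0 by (simp add: wO_def)

lemma lo: "lo > \<tau>" using \<tau>0 by simp

lemma form_lo_\<tau>: "\<tau> * (\<Sum>k<q. (v k)\<^sup>2) \<le> bform {..<q} (om w0) v v"
proof -
  have "\<tau> * (\<Sum>k<q. (v k)\<^sup>2) \<le> lo * (\<Sum>k<q. (v k)\<^sup>2)"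
    using lo by (intro mult_right_mono) (auto intro: sum_nonneg)
  then show ?thesis using form_lo[of v] by simp
qed

lemma sum_squares_pos: "\<exists>i\<in>{..<q}. v i \<noteq> 0 \<Longrightarrow> (\<Sum>k<q. (v k :: real)\<^sup>2) > 0"
  by (auto intro!: sum_pos2)

lemma pd_from_lower:
  assumes "c > 0" "\<And>v. c * (\<Sum>k<q. (v k)\<^sup>2) \<le> bform {..<q} (om w) v v"
  shows "pd_on {..<q} (om w)"
  unfolding pd_on_def
proof (intro conjI allI impI sym_on_om)
  fix v :: "nat \<Rightarrow> real" assume "\<exists>i\<in>{..<q}. v i \<noteq> 0"
  then have "0 < c * (\<Sum>k<q. (v k)\<^sup>2)" using sum_squares_pos[of v] assms(1) by simp
  then show "0 < bform {..<q} (om w) v v" using assms(2)[of v] by simp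
qed

lemma pd0: "pd_on {..<q} (om w0)"
  by (rule pd_from_lower[OF \<tau> form_lo_\<tau>])

lemma O_set_form:
  assumes "w \<in> O_set q \<tau>" shows "\<tau> * (\<Sum>k<q. (v k)\<^sup>2) \<le> bform {..<q} (om w) v v"
proof -
  have "0 \<le> bform {..<q} (om_shift \<tau> w) v v"
    using assms by (intro pd_on_nonneg) (auto simp: O_set_def)
  then show ?thesis by (simp add: bform_om_shift)
qed

lemma O_set_pd: "w \<in> O_set q \<tau> \<Longrightarrow> pd_on {..<q} (om w)"
  by (rule pd_from_lower[OF \<tau> O_set_form])

text \<open>Cauchy-Schwarz over the columns, whose squared norms are \<open>n\<close>, bounds the
  sum by \<open>n\<close> times the square of \<open>p * q * wB\<close>, and the width
  \<open>wB\<close> makes this \<xi>1 / 6.\<close>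

lemma mean_diff:
  assumes d: "\<And>c. c \<in> B_idx p q \<Longrightarrow> \<bar>b c - b' c\<bar> \<le> wB"
  shows "(\<Sum>i<n. (\<Sum>k<q. \<bar>mu p X b i k - mu p X b' i k\<bar>)\<^sup>2) \<le> \<xi>1 / 6"
proof -
  have row: "(\<Sum>k<q. \<bar>mu p X b i k - mu p X b' i k\<bar>) \<le> real q * wB * (\<Sum>j<p. \<bar>X $$ (i, j)\<bar>)" for i
  proof -
    have "\<bar>mu p X b i k - mu p X b' i k\<bar> \<le> (\<Sum>j<p. wB * \<bar>X $$ (i, j)\<bar>)" if "k < q" for k
    proof -
      have "mu p X b i k - mu p X b' i k = (\<Sum>j<p. (b (j, k) - b' (j, k)) * X $$ (i, j))"
        by (simp add: mu_def sum_subtractf algebra_simps)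
      also have "\<bar>\<dots>\<bar> \<le> (\<Sum>j<p. wB * \<bar>X $$ (i, j)\<bar>)"
        using d that by (intro order_trans[OF sum_abs] sum_mono) (auto simp: abs_mult intro!: mult_right_mono)
      finally show ?thesis .
    qed
    then have "(\<Sum>k<q. \<bar>mu p X b i k - mu p X b' i k\<bar>) \<le> (\<Sum>k<q. \<Sum>j<p. wB * \<bar>X $$ (i, j)\<bar>)"
      by (intro sum_mono) auto
    then show ?thesis by (simp add: sum_distrib_left mult.assoc)
  qed
  have "(\<Sum>i<n. (\<Sum>k<q. \<bar>mu p X b i k - mu p X b' i k\<bar>)\<^sup>2) \<le> (\<Sum>i<n. (real q * wB * (\<Sum>j<p. \<bar>X $$ (i, j)\<bar>))\<^sup>2)"
    using row by (intro sum_mono power_mono) (auto intro: sum_nonneg)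
  also have "\<dots> = (real q * wB)\<^sup>2 * (\<Sum>i<n. (\<Sum>j<p. \<bar>X $$ (i, j)\<bar>)\<^sup>2)"
    unfolding sum_distrib_left[of "(real q * wB)\<^sup>2"] by (simp only: power_mult_distrib)
  also have "\<dots> \<le> (real q * wB)\<^sup>2 * (\<Sum>i<n. real p * (\<Sum>j<p. (X $$ (i, j))\<^sup>2))"
    by (intro mult_left_mono sum_mono sum_abs_square_le) auto
  also have "(\<Sum>i<n. real p * (\<Sum>j<p. (X $$ (i, j))\<^sup>2)) = real p * (\<Sum>j<p. \<Sum>i<n. (X $$ (i, j))\<^sup>2)"
    unfolding sum_distrib_left[symmetric] by (subst sum.swap) (rule refl)
  also have "(\<Sum>j<p. \<Sum>i<n. (X $$ (i, j))\<^sup>2) = real p * real n" by (simp add: col)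
  also have "(real q * wB)\<^sup>2 * (real p * (real p * real n)) = \<xi>1 / 6"
  proof -
    have "wB\<^sup>2 = \<xi>1 / (6 * real n) / (real p * real q)\<^sup>2"
      using parO n by (simp add: wB_def power_divide)
    then show ?thesis using p q n by (simp add: power_mult_distrib power2_eq_square field_simps)
  qed
  finally show ?thesis .
qed

text \<open>As \<open>wO * q = \<tau>0 / n\<close>, the forms differ by at most \<tau>0 / n times
  the squared norm, and \<tau>0 <= \<tau> turns this into a relative error 1/n. The absolute version
  serves to keep the neighbourhood of the truth inside the constraint.\<close>

lemma cells_close:
  assumes "\<And>c. c \<in> upper_idx q \<Longrightarrow> \<bar>w c - w' c\<bar> \<le> wO" and t: "\<And>v. \<tau> * (\<Sum>k<q. (v k)\<^sup>2) \<le> bform {..<q} (om w) v v"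
  shows "(1 - 1 / real n) * bform {..<q} (om w) v v \<le> bform {..<q} (om w') v v"
    and "bform {..<q} (om w') v v \<le> (1 + 1 / real n) * bform {..<q} (om w) v v"
    and "\<bar>bform {..<q} (om w) v v - bform {..<q} (om w') v v\<bar> \<le> \<tau>0 / real n * (\<Sum>k<q. (v k)\<^sup>2)"
proof -
  have "\<bar>bform {..<q} (om w) v v - bform {..<q} (om w') v v\<bar> \<le> wO * real q * (\<Sum>k<q. (v k)\<^sup>2)"
    using wO assms(1) by (intro bform_close) (auto simp: om_def upper_idx_def)
  also have "wO * real q = \<tau>0 / real n" using q by (simp add: wO_def)
  finally show d: "\<bar>bform {..<q} (om w) v v - bform {..<q} (om w') v v\<bar> \<le> \<tau>0 / real n * (\<Sum>k<q. (v k)\<^sup>2)" .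
  have "\<tau>0 / real n * (\<Sum>k<q. (v k)\<^sup>2) \<le> \<tau> / real n * (\<Sum>k<q. (v k)\<^sup>2)"
    using \<tau>0 by (intro mult_right_mono divide_right_mono) (auto intro: sum_nonneg)
  also have "\<dots> \<le> 1 / real n * bform {..<q} (om w) v v"
    using divide_right_mono[OF t[of v], of "real n"] by simp
  finally have "\<bar>bform {..<q} (om w) v v - bform {..<q} (om w') v v\<bar> \<le> 1 / real n * bform {..<q} (om w) v v"
    using d by linarith
  then show "(1 - 1 / real n) * bform {..<q} (om w) v v \<le> bform {..<q} (om w') v v"
    "bform {..<q} (om w') v v \<le> (1 + 1 / real n) * bform {..<q} (om w) v v"
    unfolding left_diff_distrib distrib_right by linarith+
qed

lemma ratio_le_3: "(1 + 1 / real n) / (1 - 1 / real n) \<le> 3"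
proof -
  have "(1 + x) / (1 - x) \<le> 3" if "x \<le> 1 / 2" for x :: real
    using that by (simp add: divide_le_eq)
  moreover have "1 / real n \<le> 1 / 2" using n by (simp add: field_simps)
  ultimately show ?thesis by blast
qed

text \<open>\<open>G\<close> stands for a bound on the traces in a cell, or for \<beta> q at the
  truth. The 3 of \<open>ratio_le_3\<close> and the \<xi>1 / 6 of \<open>mean_diff\<close> combine
  to \<xi>1 / 2.\<close>

lemma chi_bound:
  assumes t: "\<And>v. \<tau> * (\<Sum>k<q. (v k)\<^sup>2) \<le> bform {..<q} (om w) v v" and u: "pd_on {..<q} (om w')"
    and dB: "\<And>c. c \<in> B_idx p q \<Longrightarrow> \<bar>b' c - b c\<bar> \<le> wB" and dO: "\<And>c. c \<in> upper_idx q \<Longrightarrow> \<bar>w c - w' c\<bar> \<le> wO"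
    and G: "\<And>m. bform {..<q} (om w) m m \<le> G * (\<Sum>k<q. \<bar>m k\<bar>)\<^sup>2" "G \<ge> 0"
  shows "(\<integral>\<^sup>+Y. ennreal ((lr n p q X b0 w0 (b, w) Y)\<^sup>2 / lr n p q X b0 w0 (b', w') Y) \<partial>sm n p q X b0 w0)
    \<le> ennreal (exp (G * \<xi>1 / 2 + 2 * real q))"
proof -
  let ?g = "1 / real n"
  have g: "0 \<le> ?g" "?g < 1" using n by auto
  have pt: "pd_on {..<q} (om w)" by (rule pd_from_lower[OF \<tau> t])
  have "(\<Sum>i<n. bform {..<q} (om w) (\<lambda>k. mu p X b' i k - mu p X b i k) (\<lambda>k. mu p X b' i k - mu p X b i k))
      \<le> (\<Sum>i<n. G * (\<Sum>k<q. \<bar>mu p X b' i k - mu p X b i k\<bar>)\<^sup>2)"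
    by (intro sum_mono G)
  also have "\<dots> = G * (\<Sum>i<n. (\<Sum>k<q. \<bar>mu p X b' i k - mu p X b i k\<bar>)\<^sup>2)" by (simp add: sum_distrib_left)
  also have "\<dots> \<le> G * (\<xi>1 / 6)" using G(2) mean_diff[OF dB] by (intro mult_left_mono)
  finally have "(1 + ?g) / (1 - ?g) * (\<Sum>i<n. bform {..<q} (om w) (\<lambda>k. mu p X b' i k - mu p X b i k) (\<lambda>k. mu p X b' i k - mu p X b i k))
      \<le> 3 * (G * (\<xi>1 / 6))"
    using ratio_le_3 pd_on_nonneg[OF pt] by (intro mult_mono) (auto intro: sum_nonneg)
  then have "(\<integral>\<^sup>+Y. ennreal ((lr n p q X b0 w0 (b, w) Y)\<^sup>2 / lr n p q X b0 w0 (b', w') Y) \<partial>sm n p q X b0 w0)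
      \<le> ennreal (exp (G * \<xi>1 / 2) / (1 - ?g) ^ (q * n))"
    using cells_close[OF dO t] g parO G(2)
    by (intro lr_chi_square[OF pd0]) (auto simp: pt u)
  also have "\<dots> \<le> ennreal (exp (G * \<xi>1 / 2) * exp (2 * real q))"
    using mult_left_mono[OF one_minus_inverse_power_ge[OF n, of q], of "exp (G * \<xi>1 / 2)"]
    by (intro ennreal_leI) simp
  finally show ?thesis by (simp add: exp_add)
qed

subsection \<open>The neighbourhood of the truth\<close>

definition SB where "SB = (\<Pi>\<^sub>E c\<in>B_idx p q. {b0 c - wB..b0 c + wB})"
definition SO where "SO = (\<Pi>\<^sub>E c\<in>upper_idx q. {w0 c - wO..w0 c + wO})"

text \<open>The gap between \<open>lo\<close> and \<tau> exceeds the perturbation possible within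
  the box. Hence the constraint holds on the whole box, and its mass is a product over the
  coordinates.\<close>

lemma SO_sub: "SO \<subseteq> O_set q \<tau>"
proof
  fix w assume w: "w \<in> SO"
  have d: "\<bar>w0 c - w c\<bar> \<le> wO" if "c \<in> upper_idx q" for c
  proof -
    have "w c \<in> {w0 c - wO..w0 c + wO}" using w that by (auto simp: SO_def PiE_iff)
    then show ?thesis by (simp add: abs_le_iff)
  qed
  have "w \<in> space (O_space q)" using w by (auto simp: SO_def space_PiM PiE_iff)
  moreover have "pd_on {..<q} (om_shift \<tau> w)"
    unfolding pd_on_def
  proof (intro conjI allI impI sym_on_om_shift)
    fix v :: "nat \<Rightarrow> real" assume "\<exists>i\<in>{..<q}. v i \<noteq> 0"
    then have pos: "(\<Sum>k<q. (v k)\<^sup>2) > 0" by (rule sum_squares_pos)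
    have "\<tau>0 / real n \<le> \<tau>0" using \<tau>0 n by (simp add: field_simps)
    then have "\<tau>0 / real n * (\<Sum>k<q. (v k)\<^sup>2) \<le> \<tau>0 * (\<Sum>k<q. (v k)\<^sup>2)" using pos by (intro mult_right_mono) auto
    also have "\<dots> < (lo - \<tau>) * (\<Sum>k<q. (v k)\<^sup>2)" using \<tau>0 pos by simp
    finally show "0 < bform {..<q} (om_shift \<tau> w) v v"
      using cells_close(3)[OF d form_lo_\<tau>, of v] form_lo[of v] unfolding bform_om_shift left_diff_distrib by linarith
  qed
  ultimately show "w \<in> O_set q \<tau>" by (simp add: O_set_def)
qed

text \<open>A nonzero coefficient relies on the slab and pays the factor \<open>l\<close>; the zero
  coefficients rely on the spike and together cost at most the factor 1/2.\<close>

lemma SB_mass: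
  assumes "l \<le> \<theta> * l1 * wB * exp (- l1 * (a1 + wB))" and "\<theta> + exp (- l0 * wB) \<le> 1 / (2 * (real p * real q))"
  shows "emeasure pB SB \<ge> ennreal (l ^ sB / 2)"
proof -
  have "ennreal (l ^ sB / 2) \<le> ennreal (\<Prod>c\<in>B_idx p q. if b0 c \<noteq> 0 then l else 1 - 1 / (2 * real (p * q)))"
    using sB l p q by (intro ennreal_leI prod_if_ge) (auto simp: card_cartesian_product)
  also have "\<dots> = (\<Prod>c\<in>B_idx p q. ennreal (if b0 c \<noteq> 0 then l else 1 - 1 / (2 * real (p * q))))"
  proof (subst prod_ennreal)
    have "1 / (2 * real (p * q)) \<le> 1"
      by (rule half_inverse_le_one) (use p q in simp)
    then show "0 \<le> (if b0 c \<noteq> 0 then l else 1 - 1 / (2 * real (p * q)))" if "c \<in> B_idx p q" for c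
      using l by simp
  qed simp
  also have "\<dots> \<le> (\<Prod>c\<in>B_idx p q. \<integral>\<^sup>+x. ennreal (ssl_density \<theta> l1 l0 x) * indicator {b0 c - wB..b0 c + wB} x \<partial>lborel)"
  proof (intro prod_mono_ennreal)
    fix c assume c: "c \<in> B_idx p q"
    show "ennreal (if b0 c \<noteq> 0 then l else 1 - 1 / (2 * real (p * q)))
      \<le> (\<integral>\<^sup>+x. ennreal (ssl_density \<theta> l1 l0 x) * indicator {b0 c - wB..b0 c + wB} x \<partial>lborel)"
    proof (cases "b0 c = 0")
      case True
      have "ennreal (1 - 1 / (2 * real (p * q))) \<le> ennreal (1 - \<theta> - exp (- l0 * wB))"
        using assms(2) by (intro ennreal_leI) simp
      also have "\<dots> \<le> (\<integral>\<^sup>+x. ennreal (ssl_density \<theta> l1 l0 x) * indicator {- wB..wB} x \<partial>lborel)"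
        by (rule ssl_zero_interval[OF parB wB])
      finally show ?thesis using True by simp
    next
      case False
      have "ennreal l \<le> ennreal (\<theta> * l1 * wB * exp (- l1 * (a1 + wB)))" by (rule ennreal_leI[OF assms(1)])
      also have "\<dots> \<le> (\<integral>\<^sup>+x. ennreal (ssl_density \<theta> l1 l0 x) * indicator {b0 c - wB..b0 c + wB} x \<partial>lborel)"
        by (rule ssl_interval[OF parB wB b0[OF c]])
      finally show ?thesis using False by simp
    qed
  qed
  also have "\<dots> = emeasure pB SB"
    unfolding SB_def by (rule emeasure_prior_B_box[OF parB, symmetric]) auto
  finally show ?thesis .
qed

lemma w0_le: "c \<in> upper_idx q \<Longrightarrow> \<bar>w0 c\<bar> \<le> \<beta>"
proof -
  assume c: "c \<in> upper_idx q"
  then obtain i j where ij: "c = (i, j)" "i \<le> j" "j < q" by (auto simp: upper_idx_def)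
  have d: "om w0 k k \<le> \<beta>" if "k < q" for k
  proof -
    define e :: "nat \<Rightarrow> real" where "e = (\<lambda>i. if i = k then 1 else 0)"
    have "bform {..<q} (om w0) e e = om w0 k k" using that bform_unit[of "{..<q}" k k "om w0"] by (simp add: e_def)
    moreover have "(\<Sum>i<q. (e i)\<^sup>2) = (\<Sum>i<q. if i = k then 1 else 0)" by (intro sum.cong) (auto simp: e_def)
    ultimately show ?thesis using form_hi[of e] that by simp
  qed
  have "\<bar>om w0 i j\<bar> \<le> (om w0 i i + om w0 j j) / 2"
    using ij pd_on_nonneg[OF pd0] by (intro psd_entry_le[OF sym_on_om]) auto
  also have "\<dots> \<le> \<beta>" using d[of i] d[of j] ij by simp
  finally show ?thesis using ij by (simp add: om_def)
qed

text \<open>As for the coefficients, except that the \<open>q\<close> diagonal entries have no spike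
  and pay \<open>l\<close> as well.\<close>

lemma SO_mass:
  assumes "l \<le> \<eta> * \<xi>1 * wO * exp (- \<xi>1 * (\<beta> + wO))" and "\<eta> + exp (- \<xi>0 * wO) \<le> 1 / (2 * (real q)\<^sup>2)"
  shows "emeasure nu SO \<ge> ennreal (l ^ (q + sO) / 2)"
proof -
  let ?P = "\<lambda>c. fst c = snd c \<or> w0 c \<noteq> 0"
  have "{c \<in> upper_idx q. ?P c} \<subseteq> {c \<in> upper_idx q. fst c = snd c} \<union> {c \<in> upper_idx q. fst c < snd c \<and> w0 c \<noteq> 0}"
    by (auto simp: upper_idx_def)
  then have "card {c \<in> upper_idx q. ?P c} \<le> card ({c \<in> upper_idx q. fst c = snd c} \<union> {c \<in> upper_idx q. fst c < snd c \<and> w0 c \<noteq> 0})"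
    by (intro card_mono) auto
  also have "\<dots> \<le> q + sO"
    using card_Un_le[of "{c \<in> upper_idx q. fst c = snd c}" "{c \<in> upper_idx q. fst c < snd c \<and> w0 c \<noteq> 0}"]
    by (simp add: card_diag_upper_idx sO)
  finally have card: "card {c \<in> upper_idx q. ?P c} \<le> q + sO" .
  have q2: "1 \<le> q\<^sup>2" using q by simp
  have "ennreal (l ^ (q + sO) / 2) \<le> ennreal (\<Prod>c\<in>upper_idx q. if ?P c then l else 1 - 1 / (2 * real (q\<^sup>2)))"
    using card l card_upper_idx q2 by (intro ennreal_leI prod_if_ge) auto
  also have "\<dots> = (\<Prod>c\<in>upper_idx q. ennreal (if ?P c then l else 1 - 1 / (2 * real (q\<^sup>2))))"
  proof (subst prod_ennreal)
    have "1 / (2 * real (q\<^sup>2)) \<le> 1" by (rule half_inverse_le_one[OF q2])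
    then show "0 \<le> (if ?P c then l else 1 - 1 / (2 * real (q\<^sup>2)))" if "c \<in> upper_idx q" for c
      using l by simp
  qed simp
  also have "\<dots> \<le> (\<Prod>c\<in>upper_idx q. \<integral>\<^sup>+x. ennreal (O_dens \<eta> \<xi>1 \<xi>0 c x) * indicator {w0 c - wO..w0 c + wO} x \<partial>lborel)"
  proof (intro prod_mono_ennreal)
    fix c assume c: "c \<in> upper_idx q"
    show "ennreal (if ?P c then l else 1 - 1 / (2 * real (q\<^sup>2)))
      \<le> (\<integral>\<^sup>+x. ennreal (O_dens \<eta> \<xi>1 \<xi>0 c x) * indicator {w0 c - wO..w0 c + wO} x \<partial>lborel)"
    proof (cases "fst c = snd c")
      case True
      define E where "E = exp (- \<xi>1 * (\<beta> + wO))"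
      have "\<xi>1 * E \<le> O_dens \<eta> \<xi>1 \<xi>0 c x" if "\<bar>x - w0 c\<bar> \<le> wO" for x
      proof -
        have "x \<le> \<beta> + wO" using that w0_le[OF c] by linarith
        then show ?thesis using True parO by (simp add: O_dens_def E_def)
      qed
      then have "ennreal (2 * (\<xi>1 * E) * wO) \<le> (\<integral>\<^sup>+x. ennreal (O_dens \<eta> \<xi>1 \<xi>0 c x) * indicator {w0 c - wO..w0 c + wO} x \<partial>lborel)"
        using wO parO by (intro nn_integral_interval_ge) (auto simp: E_def)
      \<comment> \<open>A diagonal entry carries no slab weight; since \<eta> < 1, the slab bound on
        \<open>l\<close> covers it too.\<close>
      moreover have "l \<le> 2 * (\<xi>1 * E) * wO"
      proof -
        have "\<eta> * (\<xi>1 * wO * E) \<le> 2 * (\<xi>1 * wO * E)"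
          using parO wO by (intro mult_right_mono) (auto simp: E_def)
        then show ?thesis using assms(1) by (simp add: E_def mult_ac)
      qed
      ultimately show ?thesis using True by (auto intro: order_trans ennreal_leI)
    next
      case F: False
      show ?thesis
      proof (cases "w0 c = 0")
        case True
        have "ennreal (1 - 1 / (2 * real (q\<^sup>2))) \<le> ennreal (1 - \<eta> - exp (- \<xi>0 * wO))"
          using assms(2) by (intro ennreal_leI) simp
        also have "\<dots> \<le> (\<integral>\<^sup>+x. ennreal (ssl_density \<eta> \<xi>1 \<xi>0 x) * indicator {- wO..wO} x \<partial>lborel)"
          by (rule ssl_zero_interval[OF parO wO])
        finally show ?thesis using True F by (simp add: O_dens_def)
      next
        case False
        have "ennreal l \<le> ennreal (\<eta> * \<xi>1 * wO * exp (- \<xi>1 * (\<beta> + wO)))" by (rule ennreal_leI[OF assms(1)])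
        also have "\<dots> \<le> (\<integral>\<^sup>+x. ennreal (ssl_density \<eta> \<xi>1 \<xi>0 x) * indicator {w0 c - wO..w0 c + wO} x \<partial>lborel)"
          by (rule ssl_interval[OF parO wO w0_le[OF c]])
        finally show ?thesis using F False by (simp add: O_dens_def)
      qed
    qed
  qed
  also have "\<dots> = emeasure nu SO"
    unfolding SO_def by (rule nu_Omega_box_ge[OF parO, symmetric]) (use SO_sub in \<open>auto simp: SO_def\<close>)
  finally show ?thesis .
qed

lemma SB_sets: "SB \<in> sets (B_space p q)"
  unfolding SB_def by (intro sets_PiM_I_finite) auto

lemma SO_sets: "SO \<in> sets (O_space q)"
  unfolding SO_def by measurable

subsection \<open>Cells of the parameter space\<close>

definition O_cell_bound :: "nat \<times> nat \<Rightarrow> int \<Rightarrow> real" where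
  "O_cell_bound c z = (if fst c = snd c then \<xi>1 * wO * exp (- \<xi>1 * wO * (\<bar>real_of_int z\<bar> - 1 / 2))
     else ssl_cell_bound \<eta> \<xi>1 \<xi>0 wO z)"

lemma O_cell_bound_pos: "O_cell_bound c z > 0"
  using parO wO ssl_cell_bound_pos[of \<eta> \<xi>1 \<xi>0 wO z] by (simp add: O_cell_bound_def)

lemma O_cell_mass:
  "(\<integral>\<^sup>+x. ennreal (O_dens' \<eta> \<xi>1 \<xi>0 c x) * indicator (cell wO z) x \<partial>lborel) \<le> ennreal (O_cell_bound c z)"
proof (cases "fst c = snd c")
  case True
  define C where "C = \<xi>1 * exp (- \<xi>1 * wO * (\<bar>real_of_int z\<bar> - 1 / 2))"
  have "O_dens' \<eta> \<xi>1 \<xi>0 c x \<le> C" if "x \<in> cell wO z" for x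
  proof (cases "x \<le> 0")
    case True
    then show ?thesis using \<open>fst c = snd c\<close> parO by (simp add: O_dens'_def C_def)
  next
    case False
    then have "(\<bar>real_of_int z\<bar> - 1 / 2) * wO \<le> x" using cellD(3)[OF wO that] by simp
    then show ?thesis using False \<open>fst c = snd c\<close> parO
      by (simp add: O_dens'_def O_dens_def C_def mult_ac)
  qed
  then have "(\<integral>\<^sup>+x. ennreal (O_dens' \<eta> \<xi>1 \<xi>0 c x) * indicator (cell wO z) x \<partial>lborel) \<le> ennreal (C * wO)"
    using parO by (intro nn_integral_cell_le wO) (auto simp: C_def)
  then show ?thesis using True by (simp add: O_cell_bound_def C_def mult_ac)
next
  case False
  then show ?thesis using ssl_cell_bound[OF parO wO, of z] by (simp add: O_dens'_def O_dens_def O_cell_bound_def)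
qed

definition cells :: "((nat \<times> nat \<Rightarrow> int) \<times> (nat \<times> nat \<Rightarrow> int)) set" where
  "cells = (\<Pi>\<^sub>E c\<in>B_idx p q. UNIV) \<times> (\<Pi>\<^sub>E c\<in>upper_idx q. UNIV)"

definition cell_of :: "(nat \<times> nat \<Rightarrow> int) \<times> (nat \<times> nat \<Rightarrow> int) \<Rightarrow> ((nat \<times> nat \<Rightarrow> real) \<times> (nat \<times> nat \<Rightarrow> real)) set" where
  "cell_of j = (\<Pi>\<^sub>E c\<in>B_idx p q. cell wB (fst j c)) \<times> (\<Pi>\<^sub>E c\<in>upper_idx q. cell wO (snd j c))"

definition cell_mass :: "(nat \<times> nat \<Rightarrow> int) \<times> (nat \<times> nat \<Rightarrow> int) \<Rightarrow> real" where
  "cell_mass j = (\<Prod>c\<in>B_idx p q. ssl_cell_bound \<theta> l1 l0 wB (fst j c)) * (\<Prod>c\<in>upper_idx q. O_cell_bound c (snd j c))"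

definition cell_chi :: "(nat \<times> nat \<Rightarrow> int) \<times> (nat \<times> nat \<Rightarrow> int) \<Rightarrow> real" where
  "cell_chi j = exp ((\<Sum>k<q. (\<bar>real_of_int (snd j (k, k))\<bar> + 1) * wO) * \<xi>1 / 2 + 2 * real q)"

definition TS :: "((nat \<times> nat \<Rightarrow> real) \<times> (nat \<times> nat \<Rightarrow> real)) set" where
  "TS = space (B_space p q) \<times> O_set q \<tau>"

lemma countable_cells: "countable cells"
  unfolding cells_def by (intro countable_SIGMA countable_PiE) auto

lemma cover: "TS \<subseteq> (\<Union>j\<in>cells. cell_of j)"
proof
  fix t assume t: "t \<in> TS"
  define j where "j = (restrict (\<lambda>c. \<lfloor>fst t c / wB + 1 / 2\<rfloor>) (B_idx p q), restrict (\<lambda>c. \<lfloor>snd t c / wO + 1 / 2\<rfloor>) (upper_idx q))"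
  have "j \<in> cells" by (simp add: j_def cells_def)
  moreover have "t \<in> cell_of j"
    using t by (cases t) (auto simp: j_def cell_of_def TS_def O_set_def cell_def space_PiM PiE_iff)
  ultimately show "t \<in> (\<Union>j\<in>cells. cell_of j)" by blast
qed

lemma cell_of_sets: "cell_of j \<in> sets T0"
  unfolding cell_of_def by (intro pair_measureI sets_PiM_I_finite) auto

lemma TS_sets: "TS \<in> sets T0"
  unfolding TS_def by (intro pair_measureI O_set_measurable) auto

lemma sigma_finite_mh: "sigma_finite_measure mh"
proof -
  interpret prob_space pB by (rule prob_space_prior_B[OF parB])
  interpret N: finite_measure nu by (rule finite_measure_nu_Omega[OF parO \<tau>])
  interpret pair_sigma_finite pB nu ..
  show ?thesis unfolding mu_hat_def by (rule sigma_finite_measure_axioms)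
qed

lemma emeasure_mh_times:
  assumes "A \<in> sets (B_space p q)" "B \<in> sets (O_space q)"
  shows "emeasure mh (A \<times> B) = emeasure pB A * emeasure nu B"
proof -
  interpret N: finite_measure nu by (rule finite_measure_nu_Omega[OF parO \<tau>])
  show ?thesis unfolding mu_hat_def using assms
    by (intro N.emeasure_pair_measure_Times) (simp_all add: sets_prior_B sets_nu_Omega)
qed

lemma AE_mh: "AE t in mh. t \<in> TS"
proof -
  interpret N: finite_measure nu by (rule finite_measure_nu_Omega[OF parO \<tau>])
  have null: "emeasure nu (space (O_space q) - O_set q \<tau>) = 0"
    by (subst emeasure_nu_Omega) (auto intro!: nn_integral_zero' AE_I2)
  have "emeasure mh (space (B_space p q) \<times> (space (O_space q) - O_set q \<tau>)) = 0"
    by (subst emeasure_mh_times) (auto simp: null)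
  then have "space (B_space p q) \<times> (space (O_space q) - O_set q \<tau>) \<in> null_sets mh"
    by (intro null_setsI) (auto simp: sets_mu_hat intro!: pair_measureI)
  moreover have "{t \<in> space mh. t \<notin> TS} \<subseteq> space (B_space p q) \<times> (space (O_space q) - O_set q \<tau>)"
    using sets_eq_imp_space_eq[OF sets_mu_hat, of p q \<theta> l1 l0 \<eta> \<xi>1 \<xi>0 \<tau>]
    by (auto simp: TS_def space_pair_measure)
  ultimately show ?thesis by (intro AE_I') auto
qed

lemma emeasure_cell_of: "emeasure mh (cell_of j \<inter> TS) \<le> ennreal (cell_mass j)"
proof -
  have "cell_of j \<inter> TS = (\<Pi>\<^sub>E c\<in>B_idx p q. cell wB (fst j c)) \<times> ((\<Pi>\<^sub>E c\<in>upper_idx q. cell wO (snd j c)) \<inter> O_set q \<tau>)"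
    unfolding cell_of_def TS_def by (auto simp: space_PiM PiE_iff)
  then have "emeasure mh (cell_of j \<inter> TS)
      = emeasure pB (\<Pi>\<^sub>E c\<in>B_idx p q. cell wB (fst j c)) * emeasure nu ((\<Pi>\<^sub>E c\<in>upper_idx q. cell wO (snd j c)) \<inter> O_set q \<tau>)"
    by (simp add: emeasure_mh_times sets_PiM_I_finite)
  also have "\<dots> \<le> (\<Prod>c\<in>B_idx p q. ennreal (ssl_cell_bound \<theta> l1 l0 wB (fst j c))) * (\<Prod>c\<in>upper_idx q. ennreal (O_cell_bound c (snd j c)))"
  proof (intro mult_mono)
    show "emeasure pB (\<Pi>\<^sub>E c\<in>B_idx p q. cell wB (fst j c)) \<le> (\<Prod>c\<in>B_idx p q. ennreal (ssl_cell_bound \<theta> l1 l0 wB (fst j c)))"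
      by (subst emeasure_prior_B_box[OF parB]) (auto intro!: prod_mono_ennreal ssl_cell_bound parB wB)
    show "emeasure nu ((\<Pi>\<^sub>E c\<in>upper_idx q. cell wO (snd j c)) \<inter> O_set q \<tau>) \<le> (\<Prod>c\<in>upper_idx q. ennreal (O_cell_bound c (snd j c)))"
      by (rule order_trans[OF nu_Omega_box_le[OF parO \<tau>]]) (auto intro!: prod_mono_ennreal O_cell_mass)
  qed auto
  also have "\<dots> = ennreal (cell_mass j)"
    using ssl_cell_bound_pos[of \<theta> l1 l0 wB] parB wB O_cell_bound_pos
    by (subst (1 2) prod_ennreal) (auto simp: cell_mass_def less_imp_le intro!: ennreal_mult[symmetric] prod_nonneg)
  finally show ?thesis .
qed

lemma cell_mass_pos: "cell_mass j > 0"
  unfolding cell_mass_def using ssl_cell_bound_pos[of \<theta> l1 l0 wB] parB wB O_cell_bound_pos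
  by (intro mult_pos_pos prod_pos) auto

lemma cell_chi_bound:
  assumes t: "t \<in> cell_of j \<inter> TS" and u: "u \<in> cell_of j \<inter> TS"
  shows "(\<integral>\<^sup>+Y. ennreal ((lr n p q X b0 w0 t Y)\<^sup>2 / lr n p q X b0 w0 u Y) \<partial>sm n p q X b0 w0) \<le> ennreal (cell_chi j)"
proof -
  obtain b w b' w' where tu: "t = (b, w)" "u = (b', w')" by (cases t, cases u)
  \<comment> \<open>Bounds the trace of every precision matrix in the cell by the grid indices of
    the diagonal.\<close>
  define G where "G = (\<Sum>k<q. (\<bar>real_of_int (snd j (k, k))\<bar> + 1) * wO)"
  have wt: "w \<in> O_set q \<tau>" "w' \<in> O_set q \<tau>" using t u tu by (auto simp: TS_def)
  note form = O_set_form[OF wt(1)]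
  have cB: "b c \<in> cell wB (fst j c)" "b' c \<in> cell wB (fst j c)" if "c \<in> B_idx p q" for c
    using t u tu that by (auto simp: cell_of_def PiE_iff)
  have cO: "w c \<in> cell wO (snd j c)" "w' c \<in> cell wO (snd j c)" if "c \<in> upper_idx q" for c
    using t u tu that by (auto simp: cell_of_def PiE_iff)
  have tr: "(\<Sum>k<q. om w k k) \<le> G"
    unfolding G_def
  proof (intro sum_mono)
    fix k assume "k \<in> {..<q}"
    then have "w (k, k) \<in> cell wO (snd j (k, k))" by (intro cO) (auto simp: upper_idx_def)
    then show "om w k k \<le> (\<bar>real_of_int (snd j (k, k))\<bar> + 1) * wO"
      using cellD(4)[OF wO] by (fastforce simp: om_def)
  qed
  have "(\<integral>\<^sup>+Y. ennreal ((lr n p q X b0 w0 (b, w) Y)\<^sup>2 / lr n p q X b0 w0 (b', w') Y) \<partial>sm n p q X b0 w0)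
      \<le> ennreal (exp (G * \<xi>1 / 2 + 2 * real q))"
  proof (rule chi_bound[OF form O_set_pd[OF wt(2)]])
    show "\<bar>b' c - b c\<bar> \<le> wB" if "c \<in> B_idx p q" for c by (rule cell_diff[OF wB cB(2,1)[OF that]])
    show "\<bar>w c - w' c\<bar> \<le> wO" if "c \<in> upper_idx q" for c by (rule cell_diff[OF wO cO[OF that]])
    show "bform {..<q} (om w) m m \<le> G * (\<Sum>k<q. \<bar>m k\<bar>)\<^sup>2" for m
    proof -
      have "bform {..<q} (om w) m m \<le> (\<Sum>k<q. om w k k) * (\<Sum>k<q. \<bar>m k\<bar>)\<^sup>2"
        by (rule psd_trace_bound[OF sym_on_om pd_on_nonneg[OF O_set_pd[OF wt(1)]]])
      also have "\<dots> \<le> G * (\<Sum>k<q. \<bar>m k\<bar>)\<^sup>2" using tr by (intro mult_right_mono) auto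
      finally show ?thesis .
    qed
    show "G \<ge> 0" unfolding G_def using wO by (intro sum_nonneg) auto
  qed
  then show ?thesis by (simp add: tu cell_chi_def G_def)
qed

text \<open>\<open>GB\<close> and \<open>GO\<close> keep the excess over 1 of the sum for one
  coordinate below the inverse of the number of coordinates, so that each family contributes at most
  exp 1; for the precision matrix the square of \<open>q\<close> bounds that number. Only the
  diagonal entries contribute a growing factor.\<close>

lemma cell_sum:
  assumes sB: "\<alpha> * l0 * wB \<ge> 1" and sO: "\<alpha> * \<xi>0 * wO \<ge> 1" and small: "\<xi>1 * wO \<le> 1"
    and GB: "real p * real q * (2 / \<alpha> * (\<theta> powr \<alpha> * (l1 * wB) powr (\<alpha> - 1)) + 4 * exp (- \<alpha> * l0 * wB / 4)) \<le> 1"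
    and GO: "(real q)\<^sup>2 * (2 / \<alpha> * (\<eta> powr \<alpha> * (\<xi>1 * wO) powr (\<alpha> - 1)) + 4 * exp (- \<alpha> * \<xi>0 * wO / 4)) \<le> 1"
  shows "(\<integral>\<^sup>+j. ennreal (cell_mass j powr \<alpha> * cell_chi j powr (\<alpha> / 2)) \<partial>count_space cells)
    \<le> ennreal (exp (real q + 2) * (15 * (\<xi>1 * wO) powr (\<alpha> - 1)) ^ q)"
proof -
  define f1 where "f1 = (\<lambda>k. \<Prod>c\<in>B_idx p q. ennreal (ssl_cell_bound \<theta> l1 l0 wB (k c) powr \<alpha>))"
  \<comment> \<open>The chi-square bound of a cell is a product over the diagonal; assigning each
    factor to its own coordinate lets the whole sum factorise.\<close>
  define g where "g = (\<lambda>c z. O_cell_bound c z powr \<alpha> * (if fst c = snd c then exp (\<alpha> * \<xi>1 / 4 * ((\<bar>real_of_int z\<bar> + 1) * wO)) else 1))"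
  have g0: "g c z \<ge> 0" for c z by (simp add: g_def)
  define f2 where "f2 = (\<lambda>k. \<Prod>c\<in>upper_idx q. ennreal (g c (k c)))"
  have fac: "ennreal (cell_mass j powr \<alpha> * cell_chi j powr (\<alpha> / 2)) = ennreal (exp (\<alpha> * real q)) * (f1 (fst j) * f2 (snd j))" for j
  proof -
    have m: "cell_mass j powr \<alpha> = (\<Prod>c\<in>B_idx p q. ssl_cell_bound \<theta> l1 l0 wB (fst j c) powr \<alpha>) * (\<Prod>c\<in>upper_idx q. O_cell_bound c (snd j c) powr \<alpha>)"
      unfolding cell_mass_def using ssl_cell_bound_pos[of \<theta> l1 l0 wB] parB wB O_cell_bound_pos
      by (subst powr_mult) (auto simp: prod_powr_distrib less_imp_le intro!: prod_nonneg)
    have "cell_chi j powr (\<alpha> / 2) = exp (\<alpha> * real q) * exp (\<Sum>k<q. \<alpha> * \<xi>1 / 4 * ((\<bar>real_of_int (snd j (k, k))\<bar> + 1) * wO))"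
      unfolding cell_chi_def powr_exp exp_add[symmetric] sum_distrib_left[symmetric] by (simp add: algebra_simps)
    also have "(\<Sum>k<q. \<alpha> * \<xi>1 / 4 * ((\<bar>real_of_int (snd j (k, k))\<bar> + 1) * wO))
        = (\<Sum>c\<in>upper_idx q. if fst c = snd c then \<alpha> * \<xi>1 / 4 * ((\<bar>real_of_int (snd j c)\<bar> + 1) * wO) else 0)"
      by (rule sum_diag_upper_idx[symmetric])
    also have "exp \<dots> = (\<Prod>c\<in>upper_idx q. if fst c = snd c then exp (\<alpha> * \<xi>1 / 4 * ((\<bar>real_of_int (snd j c)\<bar> + 1) * wO)) else 1)"
      by (subst exp_sum) (auto intro!: prod.cong)
    finally have "cell_mass j powr \<alpha> * cell_chi j powr (\<alpha> / 2)
        = exp (\<alpha> * real q) * ((\<Prod>c\<in>B_idx p q. ssl_cell_bound \<theta> l1 l0 wB (fst j c) powr \<alpha>) * (\<Prod>c\<in>upper_idx q. g c (snd j c)))"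
      unfolding m g_def prod.distrib by (simp only: mult_ac)
    then show ?thesis
      using g0 by (simp add: f1_def f2_def prod_ennreal ennreal_mult prod_nonneg)
  qed
  have I1: "(\<integral>\<^sup>+k. f1 k \<partial>count_space (\<Pi>\<^sub>E c\<in>B_idx p q. UNIV)) \<le> ennreal (exp 1)"
  proof -
    define G where "G = 2 / \<alpha> * (\<theta> powr \<alpha> * (l1 * wB) powr (\<alpha> - 1)) + 4 * exp (- \<alpha> * l0 * wB / 4)"
    have G: "G \<ge> 0" using \<alpha> by (simp add: G_def)
    have "(\<integral>\<^sup>+k. f1 k \<partial>count_space (\<Pi>\<^sub>E c\<in>B_idx p q. UNIV)) = (\<Prod>c\<in>B_idx p q. \<integral>\<^sup>+z. ennreal (ssl_cell_bound \<theta> l1 l0 wB z powr \<alpha>) \<partial>count_space UNIV)"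
      unfolding f1_def by (rule nn_integral_PiE_prod) simp
    also have "\<dots> \<le> (\<Prod>c\<in>B_idx p q. ennreal (1 + G))"
      using ssl_grid_sum[OF parB wB _ _ sB] \<alpha> by (intro prod_mono_ennreal) (auto simp: G_def add.assoc)
    also have "\<dots> = ennreal ((1 + G) ^ (p * q))"
      by (simp only: prod_constant card_cartesian_product card_lessThan) (rule ennreal_power, use G in simp)
    also have "\<dots> \<le> ennreal (exp 1)"
    proof (rule ennreal_leI)
      have "(1 + G) ^ (p * q) \<le> exp G ^ (p * q)" using G by (intro power_mono) auto
      also have "\<dots> = exp (real p * real q * G)" by (simp add: exp_of_nat_mult[symmetric])
      also have "\<dots> \<le> exp 1" using GB by (simp add: G_def)
      finally show "(1 + G) ^ (p * q) \<le> exp 1" .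
    qed
    finally show ?thesis .
  qed
  have I2: "(\<integral>\<^sup>+k. f2 k \<partial>count_space (\<Pi>\<^sub>E c\<in>upper_idx q. UNIV)) \<le> ennreal ((15 * (\<xi>1 * wO) powr (\<alpha> - 1)) ^ q * exp 1)"
  proof -
    define G where "G = 2 / \<alpha> * (\<eta> powr \<alpha> * (\<xi>1 * wO) powr (\<alpha> - 1)) + 4 * exp (- \<alpha> * \<xi>0 * wO / 4)"
    have G: "G \<ge> 0" using \<alpha> by (simp add: G_def)
    define D where "D = 15 * (\<xi>1 * wO) powr (\<alpha> - 1)"
    have D: "D \<ge> 1"
    proof -
      have "(\<xi>1 * wO) powr 0 \<le> (\<xi>1 * wO) powr (\<alpha> - 1)" using small parO wO \<alpha> by (intro powr_mono') auto
      then show ?thesis using parO wO by (simp add: D_def)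
    qed
    have "(\<integral>\<^sup>+k. f2 k \<partial>count_space (\<Pi>\<^sub>E c\<in>upper_idx q. UNIV)) = (\<Prod>c\<in>upper_idx q. \<integral>\<^sup>+z. ennreal (g c z) \<partial>count_space UNIV)"
      unfolding f2_def by (rule nn_integral_PiE_prod) simp
    also have "\<dots> \<le> (\<Prod>c\<in>upper_idx q. ennreal (if fst c = snd c then D else 1 + G))"
    proof (intro prod_mono_ennreal)
      fix c :: "nat \<times> nat"
      show "(\<integral>\<^sup>+z. ennreal (g c z) \<partial>count_space UNIV) \<le> ennreal (if fst c = snd c then D else 1 + G)"
        using diag_grid_sum[OF parO(3) wO \<alpha>(1) _ small] ssl_grid_sum[OF parO wO _ _ sO] \<alpha>
        by (auto simp: g_def O_cell_bound_def D_def G_def add.assoc)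
    qed
    also have "\<dots> = ennreal (\<Prod>c\<in>upper_idx q. if fst c = snd c then D else 1 + G)"
      using D G by (intro prod_ennreal) auto
    also have "\<dots> \<le> ennreal (D ^ q * (1 + G) ^ q\<^sup>2)"
      using D G card_upper_idx by (intro ennreal_leI prod_if_le) (auto simp: card_diag_upper_idx)
    also have "\<dots> \<le> ennreal (D ^ q * exp 1)"
    proof (intro ennreal_leI mult_left_mono)
      have "(1 + G) ^ q\<^sup>2 \<le> exp G ^ q\<^sup>2" using G by (intro power_mono) auto
      also have "\<dots> = exp ((real q)\<^sup>2 * G)" by (simp add: exp_of_nat_mult[symmetric])
      also have "\<dots> \<le> exp 1" using GO by (simp add: G_def)
      finally show "(1 + G) ^ q\<^sup>2 \<le> exp 1" .
    qed (use D in auto)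
    finally show ?thesis by (simp add: D_def)
  qed
  let ?C1 = "\<Pi>\<^sub>E c\<in>B_idx p q. (UNIV :: int set)" and ?C2 = "\<Pi>\<^sub>E c\<in>upper_idx q. (UNIV :: int set)"
  have c1: "countable ?C1" and c2: "countable ?C2" by (auto intro!: countable_PiE)
  interpret C2: sigma_finite_measure "count_space ?C2" by (rule sigma_finite_measure_count_space_countable[OF c2])
  have "(\<integral>\<^sup>+j. ennreal (cell_mass j powr \<alpha> * cell_chi j powr (\<alpha> / 2)) \<partial>count_space cells)
      = ennreal (exp (\<alpha> * real q)) * (\<integral>\<^sup>+j. f1 (fst j) * f2 (snd j) \<partial>count_space cells)"
    unfolding fac by (rule nn_integral_cmult) simp
  also have "(\<integral>\<^sup>+j. f1 (fst j) * f2 (snd j) \<partial>count_space cells)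
      = (\<integral>\<^sup>+j. f1 (fst j) * f2 (snd j) \<partial>(count_space ?C1 \<Otimes>\<^sub>M count_space ?C2))"
    unfolding cells_def pair_measure_countable[OF c1 c2] ..
  also have "\<dots> = (\<integral>\<^sup>+k. \<integral>\<^sup>+k'. f1 k * f2 k' \<partial>count_space ?C2 \<partial>count_space ?C1)"
    by (subst C2.nn_integral_fst[symmetric]) (auto simp: pair_measure_countable[OF c1 c2])
  also have "\<dots> = (\<integral>\<^sup>+k. f1 k \<partial>count_space ?C1) * (\<integral>\<^sup>+k'. f2 k' \<partial>count_space ?C2)"
    by (simp add: nn_integral_cmult nn_integral_multc)
  also have "\<dots> \<le> ennreal (exp 1) * ennreal ((15 * (\<xi>1 * wO) powr (\<alpha> - 1)) ^ q * exp 1)"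
    by (intro mult_mono I1 I2) auto
  also have "ennreal (exp (\<alpha> * real q)) * (ennreal (exp 1) * ennreal ((15 * (\<xi>1 * wO) powr (\<alpha> - 1)) ^ q * exp 1))
      = ennreal (exp (\<alpha> * real q + 2) * (15 * (\<xi>1 * wO) powr (\<alpha> - 1)) ^ q)"
    by (simp add: ennreal_mult'[symmetric] exp_add exp_double[symmetric] mult_ac flip: exp_add)
  also have "\<dots> \<le> ennreal (exp (real q + 2) * (15 * (\<xi>1 * wO) powr (\<alpha> - 1)) ^ q)"
    using \<alpha> by (intro ennreal_leI mult_right_mono) (auto simp: mult_le_cancel_right2)
  finally show ?thesis by (simp add: mult_left_mono)
qed

text \<open>\<open>K\<close> has two tasks: it dominates the chi-square divergences between the
  truth and its neighbourhood, and exp (- K) bounds the probability of small evidence. exp (- W)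
  bounds the affinities on \<open>A\<close>.\<close>

lemma contraction_bound:
  assumes lB: "l \<le> \<theta> * l1 * wB * exp (- l1 * (a1 + wB))" and zB: "\<theta> + exp (- l0 * wB) \<le> 1 / (2 * (real p * real q))"
    and lO: "l \<le> \<eta> * \<xi>1 * wO * exp (- \<xi>1 * (\<beta> + wO))" and zO: "\<eta> + exp (- \<xi>0 * wO) \<le> 1 / (2 * (real q)\<^sup>2)"
    and spike: "\<alpha> * l0 * wB \<ge> 1" "\<alpha> * \<xi>0 * wO \<ge> 1" and small: "\<xi>1 * wO \<le> 1"
    and GB: "real p * real q * (2 / \<alpha> * (\<theta> powr \<alpha> * (l1 * wB) powr (\<alpha> - 1)) + 4 * exp (- \<alpha> * l0 * wB / 4)) \<le> 1"
    and GO: "(real q)\<^sup>2 * (2 / \<alpha> * (\<eta> powr \<alpha> * (\<xi>1 * wO) powr (\<alpha> - 1)) + 4 * exp (- \<alpha> * \<xi>0 * wO / 4)) \<le> 1"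
    and K: "\<beta> * real q * \<xi>1 / 2 + 2 * real q \<le> K"
    and A: "A = {(b, w) \<in> space T0. R (B_of p q b) (Omega_of q w)}" "A \<in> sets T0"
    and W: "\<And>b w. (b, w) \<in> A \<Longrightarrow> W \<le> \<tau> / 8 * (\<Sum>i<n. \<Sum>k<q. (mu p X b0 i k - mu p X b i k)\<^sup>2)
         + real n * (min ((\<Sum>i<q. \<Sum>j<q. (om w i j - om w0 i j)\<^sup>2) / \<beta>\<^sup>2) 1 / 64)"
  shows "(\<integral>\<^sup>+Y. prob_of p q (posterior n p q X (prior p q \<theta> l1 l0 \<eta> \<xi>1 \<xi>0 \<tau>) Y) R \<partial>sm n p q X b0 w0)
    \<le> ennreal (exp (- K)) + ennreal (3 * ((exp (2 * K) / (l ^ (sB + q + sO) / 4)) powr \<alpha> * exp (- W) powr (2 - 2 * \<alpha>))) *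
        ennreal (exp (real q + 2) * (15 * (\<xi>1 * wO) powr (\<alpha> - 1)) ^ q)"
proof -
  let ?M = "sm n p q X b0 w0"
  interpret M: prob_space ?M by (rule prob_space_sm[OF pd0])
  \<comment> \<open>The 4 collects the two factors 1/2 of \<open>SB_mass\<close> and
    \<open>SO_mass\<close>.\<close>
  define s where "s = l ^ (sB + q + sO) / 4"
  have s: "s > 0" using l by (simp add: s_def)
  have setsM: "sets ?M = sets (\<Pi>\<^sub>M i\<in>{..<n}. \<Pi>\<^sub>M k\<in>{..<q}. (borel :: real measure))"
    unfolding sm_def by (intro sets_PiM_cong) (auto intro!: sets_PiM_cong)
  have spM: "space ?M = space (\<Pi>\<^sub>M i\<in>{..<n}. \<Pi>\<^sub>M k\<in>{..<q}. (borel :: real measure))"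
    by (rule sets_eq_imp_space_eq[OF setsM])
  have mass: "emeasure mh (SB \<times> SO) \<ge> ennreal s"
  proof -
    have "ennreal s = ennreal (l ^ sB / 2) * ennreal (l ^ (q + sO) / 2)"
      using l by (simp add: s_def power_add mult_ac flip: ennreal_mult)
    also have "\<dots> \<le> emeasure pB SB * emeasure nu SO"
      by (intro mult_mono SB_mass SO_mass lB zB lO zO) auto
    also have "\<dots> = emeasure mh (SB \<times> SO)"
      by (rule emeasure_mh_times[symmetric, OF SB_sets SO_sets])
    finally show ?thesis .
  qed
  have massfin: "emeasure mh (SB \<times> SO) < \<top>"
  proof -
    interpret B: prob_space pB by (rule prob_space_prior_B[OF parB])
    interpret N: finite_measure nu by (rule finite_measure_nu_Omega[OF parO \<tau>])
    show ?thesis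
      using B.emeasure_finite[of SB] N.emeasure_finite[of SO]
      by (simp add: emeasure_mh_times SB_sets SO_sets less_top[symmetric] ennreal_mult_eq_top_iff)
  qed
  have Z: "emeasure nu (space (O_space q)) > 0"
  proof -
    have "0 < ennreal (l ^ (q + sO) / 2)" using l by simp
    also have "\<dots> \<le> emeasure nu SO" by (rule SO_mass[OF lO zO])
    also have "\<dots> \<le> emeasure nu (space (O_space q))"
      using sets.sets_into_space[OF SO_sets] by (intro emeasure_mono) (auto simp: sets_nu_Omega)
    finally show ?thesis .
  qed
  have "(\<integral>\<^sup>+Y. prob_of p q (posterior n p q X (prior p q \<theta> l1 l0 \<eta> \<xi>1 \<xi>0 \<tau>) Y) R \<partial>?M)
      = (\<integral>\<^sup>+Y. (\<integral>\<^sup>+t\<in>A. ennreal (lr n p q X b0 w0 t Y) \<partial>mh) / (\<integral>\<^sup>+t. ennreal (lr n p q X b0 w0 t Y) \<partial>mh) \<partial>?M)"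
    by (intro nn_integral_cong posterior_eq_ratio[OF parB parO \<tau> Z X pd0 A(1) A(2)]) (simp add: spM)
  also have "\<dots> \<le> ennreal (exp (- K)) + ennreal (3 * ((exp (2 * K) / s) powr \<alpha> * exp (- W) powr (2 - 2 * \<alpha>))) *
        (\<integral>\<^sup>+j. ennreal (cell_mass j powr \<alpha> * cell_chi j powr (\<alpha> / 2)) \<partial>count_space cells)"
  proof (rule posterior_mass_bound[where S = "SB \<times> SO" and T = TS and C = cell_of])
    show "prob_space ?M" by (rule M.prob_space_axioms)
    show "sigma_finite_measure mh" by (rule sigma_finite_mh)
    have "sets (mh \<Otimes>\<^sub>M ?M) = sets (T0 \<Otimes>\<^sub>M (\<Pi>\<^sub>M i\<in>{..<n}. \<Pi>\<^sub>M k\<in>{..<q}. (borel :: real measure)))"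
      by (intro sets_pair_measure_cong sets_mu_hat setsM)
    then show "(\<lambda>(t, y). lr n p q X b0 w0 t y) \<in> borel_measurable (mh \<Otimes>\<^sub>M ?M)"
      using lr_measurable[of n p q X b0 w0] measurable_cong_sets by blast
    show "SB \<times> SO \<in> sets mh" unfolding sets_mu_hat by (intro pair_measureI SB_sets SO_sets)
    show "A \<in> sets mh" using A(2) unfolding sets_mu_hat .
    show "cell_of j \<in> sets mh" for j unfolding sets_mu_hat by (rule cell_of_sets)
    show "TS \<in> sets mh" unfolding sets_mu_hat by (rule TS_sets)
    show "AE t in mh. t \<in> TS" by (rule AE_mh)
    show "0 < lr n p q X b0 w0 t y" if "t \<in> TS" for t y
      using that O_set_pd by (intro lr_pos pd0) (auto simp: TS_def)
    show "SB \<times> SO \<subseteq> TS" using SO_sub sets.sets_into_space[OF SB_sets] by (auto simp: TS_def)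
    show "(\<integral>\<^sup>+y. ennreal (1 / lr n p q X b0 w0 t y) \<partial>?M) \<le> ennreal (exp K)" if t: "t \<in> SB \<times> SO" for t
    proof -
      \<comment> \<open>The likelihood ratio of the truth is 1, so the chi-square bound between the
        truth and \<open>(b, w)\<close> is a bound on the mean of the inverse ratio.\<close>
      obtain b w where bw: "t = (b, w)" "b \<in> SB" "w \<in> SO" using t by auto
      have "(\<integral>\<^sup>+Y. ennreal ((lr n p q X b0 w0 (b0, w0) Y)\<^sup>2 / lr n p q X b0 w0 (b, w) Y) \<partial>?M)
        \<le> ennreal (exp (\<beta> * real q * \<xi>1 / 2 + 2 * real q))"
      proof (rule chi_bound[OF form_lo_\<tau>])
        show "pd_on {..<q} (om w)" using SO_sub bw by (intro O_set_pd) auto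
        show "\<bar>b c - b0 c\<bar> \<le> wB" if "c \<in> B_idx p q" for c
        proof -
          have "b c \<in> {b0 c - wB..b0 c + wB}" using bw that unfolding SB_def PiE_iff by blast
          then show ?thesis by (simp add: abs_le_iff)
        qed
        show "\<bar>w0 c - w c\<bar> \<le> wO" if "c \<in> upper_idx q" for c
        proof -
          have "w c \<in> {w0 c - wO..w0 c + wO}" using bw that unfolding SO_def PiE_iff by blast
          then show ?thesis by (simp add: abs_le_iff)
        qed
        show "bform {..<q} (om w0) m m \<le> \<beta> * real q * (\<Sum>k<q. \<bar>m k\<bar>)\<^sup>2" for m
        proof -
          have "om w0 k k \<le> \<beta>" if "k < q" for k
            using w0_le[of "(k, k)"] that by (auto simp: om_def upper_idx_def)
          then have "(\<Sum>k<q. om w0 k k) \<le> (\<Sum>k<q. \<beta>)" by (intro sum_mono) auto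
          then have "(\<Sum>k<q. om w0 k k) * (\<Sum>k<q. \<bar>m k\<bar>)\<^sup>2 \<le> \<beta> * real q * (\<Sum>k<q. \<bar>m k\<bar>)\<^sup>2"
            by (intro mult_right_mono) (auto simp: mult.commute)
          then show ?thesis
            using psd_trace_bound[OF sym_on_om pd_on_nonneg[OF pd0], of m] by linarith
        qed
      qed (use \<beta> in auto)
      also have "\<dots> \<le> ennreal (exp K)" using K by (intro ennreal_leI) simp
      finally show ?thesis by (simp add: lr_self[OF pd0] bw)
    qed
    show "ennreal s \<le> emeasure mh (SB \<times> SO)" by (rule mass)
    show "emeasure mh (SB \<times> SO) < \<top>" by (rule massfin)
    show "0 < s" by (rule s)
    show "countable cells" by (rule countable_cells)
    show "A \<inter> TS \<subseteq> \<Union> (cell_of ` cells)" using cover by blast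
    show "(\<integral>\<^sup>+y. ennreal (lr n p q X b0 w0 t y) \<partial>?M) \<le> 1" if "t \<in> A \<inter> TS" for t
      using that O_set_pd by (subst lr_integral[OF pd0]) (auto simp: TS_def)
    show "(\<integral>\<^sup>+y. ennreal (sqrt (lr n p q X b0 w0 t y)) \<partial>?M) \<le> ennreal (exp (- W))" if t: "t \<in> A \<inter> TS" for t
    proof -
      obtain b w where bw: "t = (b, w)" "(b, w) \<in> A" "w \<in> O_set q \<tau>" using t by (auto simp: TS_def)
      have "(\<integral>\<^sup>+y. ennreal (sqrt (lr n p q X b0 w0 (b, w) y)) \<partial>?M)
        \<le> ennreal (exp (- (\<tau> / 8 * (\<Sum>i<n. \<Sum>k<q. (mu p X b0 i k - mu p X b i k)\<^sup>2))
         - real n * (min ((\<Sum>i<q. \<Sum>j<q. (om w i j - om w0 i j)\<^sup>2) / \<beta>\<^sup>2) 1 / 64)))"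
        using \<tau> by (intro lr_affinity pd0 O_set_pd bw form_lo_\<tau> O_set_form \<beta> form_hi) auto
      also have "\<dots> \<le> ennreal (exp (- W))" using W[OF bw(2)] by (intro ennreal_leI) simp
      finally show ?thesis using bw by simp
    qed
    show "(\<integral>\<^sup>+y. ennreal ((lr n p q X b0 w0 t y)\<^sup>2 / lr n p q X b0 w0 u y) \<partial>?M) \<le> ennreal (cell_chi j)"
      if "t \<in> cell_of j \<inter> TS" "u \<in> cell_of j \<inter> TS" for j t u
      by (rule cell_chi_bound[OF that])
    show "emeasure mh (cell_of j \<inter> TS) \<le> ennreal (cell_mass j)" for j by (rule emeasure_cell_of)
    show "0 < cell_mass j" for j by (rule cell_mass_pos)
    show "0 < cell_chi j" for j by (simp add: cell_chi_def)
  qed (use \<alpha> in auto)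
  also have "\<dots> \<le> ennreal (exp (- K)) + ennreal (3 * ((exp (2 * K) / s) powr \<alpha> * exp (- W) powr (2 - 2 * \<alpha>))) *
        ennreal (exp (real q + 2) * (15 * (\<xi>1 * wO) powr (\<alpha> - 1)) ^ q)"
    by (intro add_left_mono mult_left_mono cell_sum spike small GB GO) auto
  finally show ?thesis unfolding s_def .
qed

end

section \<open>From coordinates to the matrices of the statement\<close>

lemma frobenius_XB:
  assumes "X \<in> carrier_mat n p"
  shows "(frobenius_norm (X * (B_of p q b - B_of p q b0)))\<^sup>2 = (\<Sum>i<n. \<Sum>k<q. (mu p X b0 i k - mu p X b i k)\<^sup>2)"
proof -
  have "(X * (B_of p q b - B_of p q b0)) $$ (i, k) = mu p X b i k - mu p X b0 i k" if "i < n" "k < q" for i k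
  proof -
    have "(X * (B_of p q b - B_of p q b0)) $$ (i, k) = (\<Sum>j<p. X $$ (i, j) * (b (j, k) - b0 (j, k)))"
      using that assms by (simp add: scalar_prod_def B_of_def lessThan_atLeast0)
    then show ?thesis by (simp add: mu_def sum_subtractf algebra_simps)
  qed
  moreover have "dim_row (X * (B_of p q b - B_of p q b0)) = n" "dim_col (X * (B_of p q b - B_of p q b0)) = q"
    using assms by (auto simp: B_of_def)
  ultimately have "(\<Sum>i<dim_row (X * (B_of p q b - B_of p q b0)). \<Sum>j<dim_col (X * (B_of p q b - B_of p q b0)).
       ((X * (B_of p q b - B_of p q b0)) $$ (i, j))\<^sup>2) = (\<Sum>i<n. \<Sum>k<q. (mu p X b0 i k - mu p X b i k)\<^sup>2)"
    by (simp add: power2_commute)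
  then show ?thesis
    unfolding frobenius_norm_def by (simp add: sum_nonneg)
qed

lemma frobenius_Omega:
  "(frobenius_norm (Omega_of q w - Omega_of q w0))\<^sup>2 = (\<Sum>i<q. \<Sum>j<q. (om w i j - om w0 i j)\<^sup>2)"
  unfolding frobenius_norm_def by (simp add: Omega_of_def om_def sum_nonneg)

lemma true_paramsE:
  assumes t: "(B0, \<Omega>0) \<in> true_params p q a1 b1 b2 sB sO"
  obtains b0 w0 where "B0 = B_of p q b0" "\<Omega>0 = Omega_of q w0"
    "\<And>v. inverse b1 * (\<Sum>k<q. (v k)\<^sup>2) \<le> bform {..<q} (om w0) v v"
    "\<And>v. bform {..<q} (om w0) v v \<le> inverse b2 * (\<Sum>k<q. (v k)\<^sup>2)"
    "\<And>c. c \<in> B_idx p q \<Longrightarrow> \<bar>b0 c\<bar> \<le> a1"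
    "card {c \<in> B_idx p q. b0 c \<noteq> 0} = sB"
    "card {c \<in> upper_idx q. fst c < snd c \<and> w0 c \<noteq> 0} = sO"
proof
  define b0 where "b0 = (\<lambda>c. B0 $$ c)"
  define w0 where "w0 = (\<lambda>c. \<Omega>0 $$ c)"
  have B: "B0 \<in> carrier_mat p q" "\<And>j k. j < p \<Longrightarrow> k < q \<Longrightarrow> \<bar>B0 $$ (j, k)\<bar> < a1"
    and O: "\<Omega>0 \<in> carrier_mat q q" "pos_def_mat \<Omega>0"
      "\<And>e. eigenvalue \<Omega>0 e \<Longrightarrow> inverse b1 \<le> e \<and> e \<le> inverse b2"
    and s: "nnz B0 = sB" "nnz_upper \<Omega>0 = sO"
    using t by (auto simp: true_params_def B_class_def Omega_class_def)
  show "B0 = B_of p q b0" using B(1) by (intro eq_matI) (auto simp: B_of_def b0_def)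
  have sym: "sym_on {..<q} (\<lambda>i j. \<Omega>0 $$ (i, j))"
    using O(2) unfolding pos_def_mat_iff[OF O(1)] by (rule pd_on_sym)
  have om: "om w0 i j = \<Omega>0 $$ (i, j)" if "i < q" "j < q" for i j
    using sym_onD[OF sym, of i j] that by (auto simp: om_def w0_def min_def max_def)
  show "\<Omega>0 = Omega_of q w0"
    using O(1) om by (intro eq_matI) (auto simp: Omega_of_def om_def)
  have f: "bform {..<q} (om w0) v v = bform {..<q} (\<lambda>i j. \<Omega>0 $$ (i, j)) v v" for v
    by (intro bform_cong) (auto simp: om)
  show "inverse b1 * (\<Sum>k<q. (v k)\<^sup>2) \<le> bform {..<q} (om w0) v v"
    "bform {..<q} (om w0) v v \<le> inverse b2 * (\<Sum>k<q. (v k)\<^sup>2)" for v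
    unfolding f using eigenvalue_form_bounds[OF O(1) sym O(3), of v] by auto
  show "\<bar>b0 c\<bar> \<le> a1" if "c \<in> B_idx p q" for c
    using B(2)[of "fst c" "snd c"] that by (cases c) (auto simp: b0_def)
  have "{c \<in> B_idx p q. b0 c \<noteq> 0} = {(j, k). j < dim_row B0 \<and> k < dim_col B0 \<and> B0 $$ (j, k) \<noteq> 0}"
    using B(1) by (auto simp: b0_def)
  then show "card {c \<in> B_idx p q. b0 c \<noteq> 0} = sB" using s(1) by (simp add: nnz_def)
  have "{c \<in> upper_idx q. fst c < snd c \<and> w0 c \<noteq> 0} = {(j, k). j < dim_row \<Omega>0 \<and> k < dim_col \<Omega>0 \<and> j < k \<and> \<Omega>0 $$ (j, k) \<noteq> 0}"
    using O(1) by (auto simp: w0_def upper_idx_def)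
  then show "card {c \<in> upper_idx q. fst c < snd c \<and> w0 c \<noteq> 0} = sO" using s(2) by (simp add: nnz_upper_def)
qed

lemma mu_pair_measurable:
  assumes "k < q" shows "(\<lambda>t. mu p X (fst t) i k) \<in> borel_measurable (B_space p q \<Otimes>\<^sub>M O_space q)"
  by (rule measurable_compose[OF measurable_fst mu_measurable[OF assms]])

lemma om_pair_measurable:
  assumes "i < q" "j < q" shows "(\<lambda>t. om (snd t) i j) \<in> borel_measurable (B_space p q \<Otimes>\<^sub>M O_space q)"
  by (rule measurable_compose[OF measurable_snd om_measurable[OF assms]])

text \<open>Each of the two events makes one term of the affinity exponent large while the other is
  nonnegative; hence the separate conditions \<open>W1\<close> and \<open>W2\<close>. The bound
  \<open>bd\<close> depends on the true parameters only through their sparsity, so it passes to the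
  supremum.\<close>

lemma uniform_contraction_bound:
  fixes \<theta> l1 l0 \<eta> \<xi>1 \<xi>0 \<tau> b1 b2 \<tau>0 \<alpha> a1 l K W M1 M2 wB wO :: real and n p q sB sO :: nat and bd :: ennreal
  assumes wB_def: "wB = sqrt (\<xi>1 / (6 * real n)) / (real p * real q)" and wO_def: "wO = \<tau>0 / (real q * real n)"
    and bd_def: "bd = ennreal (exp (- K)) + ennreal (3 * ((exp (2 * K) / (l ^ (sB + q + sO) / 4)) powr \<alpha> * exp (- W) powr (2 - 2 * \<alpha>))) *
        ennreal (exp (real q + 2) * (15 * (\<xi>1 * wO) powr (\<alpha> - 1)) ^ q)"
    and n: "n \<ge> 2" "p \<ge> 1" "q \<ge> 1" and X: "X \<in> carrier_mat n p"
    and col: "\<And>j. j < p \<Longrightarrow> (\<Sum>i<n. (X $$ (i, j))\<^sup>2) = real n"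
    and par: "0 < \<theta>" "\<theta> < 1" "0 < l1" "0 < l0" "0 < \<eta>" "\<eta> < 1" "0 < \<xi>1" "0 < \<xi>0"
    and \<tau>: "\<tau> > 0" "\<tau>0 > 0" "\<tau>0 \<le> \<tau>" "\<tau>0 < inverse b1 - \<tau>" "b2 > 0"
    and \<alpha>: "2 / 3 \<le> \<alpha>" "\<alpha> < 1" and l: "0 < l" "l \<le> 1"
    and lB: "l \<le> \<theta> * l1 * wB * exp (- l1 * (a1 + wB))" and zB: "\<theta> + exp (- l0 * wB) \<le> 1 / (2 * (real p * real q))"
    and lO: "l \<le> \<eta> * \<xi>1 * wO * exp (- \<xi>1 * (inverse b2 + wO))" and zO: "\<eta> + exp (- \<xi>0 * wO) \<le> 1 / (2 * (real q)\<^sup>2)"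
    and spike: "\<alpha> * l0 * wB \<ge> 1" "\<alpha> * \<xi>0 * wO \<ge> 1" and small: "\<xi>1 * wO \<le> 1"
    and GB: "real p * real q * (2 / \<alpha> * (\<theta> powr \<alpha> * (l1 * wB) powr (\<alpha> - 1)) + 4 * exp (- \<alpha> * l0 * wB / 4)) \<le> 1"
    and GO: "(real q)\<^sup>2 * (2 / \<alpha> * (\<eta> powr \<alpha> * (\<xi>1 * wO) powr (\<alpha> - 1)) + 4 * exp (- \<alpha> * \<xi>0 * wO / 4)) \<le> 1"
    and K: "inverse b2 * real q * \<xi>1 / 2 + 2 * real q \<le> K"
    and W1: "W \<le> \<tau> / 8 * M1" and W2: "W \<le> real n * (min (M2 / (inverse b2)\<^sup>2) 1 / 64)"
    and t: "(B0, \<Omega>0) \<in> true_params p q a1 b1 b2 sB sO"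
  shows "(\<integral>\<^sup>+Y. prob_of p q (posterior n p q X (prior p q \<theta> l1 l0 \<eta> \<xi>1 \<xi>0 \<tau>) Y)
            (\<lambda>B \<Omega>. (frobenius_norm (X * (B - B0)))\<^sup>2 \<ge> M1) \<partial>sampling_measure n q X B0 \<Omega>0)
    \<le> bd" (is "?I1 \<le> _")
    and "(\<integral>\<^sup>+Y. prob_of p q (posterior n p q X (prior p q \<theta> l1 l0 \<eta> \<xi>1 \<xi>0 \<tau>) Y)
            (\<lambda>B \<Omega>. (frobenius_norm (\<Omega> - \<Omega>0))\<^sup>2 \<ge> M2) \<partial>sampling_measure n q X B0 \<Omega>0) \<le> bd" (is "?I2 \<le> _")
proof -
  obtain b0 w0 where bw: "B0 = B_of p q b0" "\<Omega>0 = Omega_of q w0"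
    "\<And>v. inverse b1 * (\<Sum>k<q. (v k)\<^sup>2) \<le> bform {..<q} (om w0) v v"
    "\<And>v. bform {..<q} (om w0) v v \<le> inverse b2 * (\<Sum>k<q. (v k)\<^sup>2)"
    "\<And>c. c \<in> B_idx p q \<Longrightarrow> \<bar>b0 c\<bar> \<le> a1"
    "card {c \<in> B_idx p q. b0 c \<noteq> 0} = sB"
    "card {c \<in> upper_idx q. fst c < snd c \<and> w0 c \<noteq> 0} = sO"
    by (rule true_paramsE[OF t]) (rule that; assumption)
  interpret S: spike_slab n p q X \<theta> l1 l0 \<eta> \<xi>1 \<xi>0 \<tau> "inverse b1" "inverse b2" \<tau>0 \<alpha> a1 l b0 w0 sB sO
    by (unfold_locales) (use n X col par \<tau> \<alpha> l bw in auto)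
  have wB: "S.wB = wB" and wO: "S.wO = wO" by (simp_all add: S.wB_def S.wO_def wB_def wO_def)
  note cb = S.contraction_bound[unfolded wB wO, OF lB zB lO zO spike small GB GO K]
  have sm: "sampling_measure n q X B0 \<Omega>0 = sm n p q X b0 w0"
    unfolding bw(1,2) by (rule sampling_measure_eq_sm[OF X])
  let ?T = "B_space p q \<Otimes>\<^sub>M O_space q"
  show "?I1 \<le> bd"
    unfolding sm bd_def
  proof (rule cb)
    let ?A = "{(b, w) \<in> space ?T. M1 \<le> (frobenius_norm (X * (B_of p q b - B0)))\<^sup>2}"
    show "?A = {(b, w) \<in> space ?T. M1 \<le> (frobenius_norm (X * (B_of p q b - B0)))\<^sup>2}" ..
    have "(\<lambda>t. \<Sum>i<n. \<Sum>k<q. (mu p X b0 i k - mu p X (fst t) i k)\<^sup>2) \<in> borel_measurable ?T"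
      by (intro borel_measurable_sum borel_measurable_power borel_measurable_diff borel_measurable_const mu_pair_measurable) auto
    then have "{t \<in> space ?T. M1 \<le> (\<Sum>i<n. \<Sum>k<q. (mu p X b0 i k - mu p X (fst t) i k)\<^sup>2)} \<in> sets ?T" by measurable
    then show "?A \<in> sets ?T"
      unfolding bw(1) frobenius_XB[OF X] by (simp add: case_prod_beta')
    fix b w assume "(b, w) \<in> ?A"
    then have "M1 \<le> (\<Sum>i<n. \<Sum>k<q. (mu p X b0 i k - mu p X b i k)\<^sup>2)"
      unfolding bw(1) frobenius_XB[OF X] by simp
    then have "\<tau> / 8 * M1 \<le> \<tau> / 8 * (\<Sum>i<n. \<Sum>k<q. (mu p X b0 i k - mu p X b i k)\<^sup>2)"
      using \<tau> by (intro mult_left_mono) auto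
    moreover have "0 \<le> real n * (min ((\<Sum>i<q. \<Sum>j<q. (om w i j - om w0 i j)\<^sup>2) / (inverse b2)\<^sup>2) 1 / 64)"
      by (auto intro!: mult_nonneg_nonneg divide_nonneg_nonneg sum_nonneg)
    ultimately show "W \<le> \<tau> / 8 * (\<Sum>i<n. \<Sum>k<q. (mu p X b0 i k - mu p X b i k)\<^sup>2)
         + real n * (min ((\<Sum>i<q. \<Sum>j<q. (om w i j - om w0 i j)\<^sup>2) / (inverse b2)\<^sup>2) 1 / 64)"
      using W1 by linarith
  qed
  show "?I2 \<le> bd"
    unfolding sm bd_def
  proof (rule cb)
    let ?A = "{(b, w) \<in> space ?T. M2 \<le> (frobenius_norm (Omega_of q w - \<Omega>0))\<^sup>2}"
    show "?A = {(b, w) \<in> space ?T. M2 \<le> (frobenius_norm (Omega_of q w - \<Omega>0))\<^sup>2}" ..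
    have "(\<lambda>t. \<Sum>i<q. \<Sum>j<q. (om (snd t) i j - om w0 i j)\<^sup>2) \<in> borel_measurable ?T"
      by (intro borel_measurable_sum borel_measurable_power borel_measurable_diff borel_measurable_const om_pair_measurable) auto
    then have "{t \<in> space ?T. M2 \<le> (\<Sum>i<q. \<Sum>j<q. (om (snd t) i j - om w0 i j)\<^sup>2)} \<in> sets ?T" by measurable
    then show "?A \<in> sets ?T"
      unfolding bw(2) frobenius_Omega by (simp add: case_prod_beta')
    fix b w assume "(b, w) \<in> ?A"
    then have "M2 \<le> (\<Sum>i<q. \<Sum>j<q. (om w i j - om w0 i j)\<^sup>2)"
      unfolding bw(2) frobenius_Omega by simp
    then have "M2 / (inverse b2)\<^sup>2 \<le> (\<Sum>i<q. \<Sum>j<q. (om w i j - om w0 i j)\<^sup>2) / (inverse b2)\<^sup>2"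
      by (intro divide_right_mono) auto
    then have "real n * (min (M2 / (inverse b2)\<^sup>2) 1 / 64)
        \<le> real n * (min ((\<Sum>i<q. \<Sum>j<q. (om w i j - om w0 i j)\<^sup>2) / (inverse b2)\<^sup>2) 1 / 64)"
      by (rule mult_left_mono[OF divide_right_mono[OF min.mono[OF _ order_refl]]]) simp_all
    moreover have "0 \<le> \<tau> / 8 * (\<Sum>i<n. \<Sum>k<q. (mu p X b0 i k - mu p X b i k)\<^sup>2)"
      using \<tau> by (auto intro!: mult_nonneg_nonneg sum_nonneg)
    ultimately show "W \<le> \<tau> / 8 * (\<Sum>i<n. \<Sum>k<q. (mu p X b0 i k - mu p X b i k)\<^sup>2)
         + real n * (min ((\<Sum>i<q. \<Sum>j<q. (om w i j - om w0 i j)\<^sup>2) / (inverse b2)\<^sup>2) 1 / 64)"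
      using W2 by linarith
  qed
qed

section \<open>Asymptotics\<close>

text \<open>\<open>z\<close> stands for the spike rate times the cell width and \<open>L\<close> for
  the logarithm of the number of coordinates. With \<alpha> >= 2/3 the factor 8 gives \<alpha> z / 4
  >= L + 4, and exp 4 >= 16 supplies the constants.\<close>

lemma spike_large:
  fixes z L \<alpha> :: real
  assumes z: "8 * (L + 3) \<le> z" and L: "L \<ge> 0" and \<alpha>: "2 / 3 \<le> \<alpha>"
  shows "\<alpha> * z \<ge> 1" "exp (- z) \<le> exp (- L) / 4" "4 * exp (- (\<alpha> * z) / 4) \<le> exp (- L) / 2"
proof -
  have "2 / 3 * z \<le> \<alpha> * z" using assms by (intro mult_right_mono) auto
  then have az: "16 / 3 * (L + 3) \<le> \<alpha> * z" using z by simp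
  show "\<alpha> * z \<ge> 1" using az L by simp
  have e2: "(2 :: real) \<le> exp 1" using exp_ge_add_one_self[of 1] by simp
  have e4: "(16 :: real) \<le> exp 4"
  proof -
    have "(2 :: real) ^ 4 \<le> exp 1 ^ 4" using e2 by (intro power_mono) auto
    then show ?thesis by (simp add: exp_of_nat_mult[symmetric])
  qed
  have "exp (- z) \<le> exp (- L - 4)" using z L by simp
  also have "\<dots> = exp (- L) / exp 4" by (simp add: exp_diff)
  also have "\<dots> \<le> exp (- L) / 4" using e4 by (intro divide_left_mono) auto
  finally show "exp (- z) \<le> exp (- L) / 4" .
  have "exp (- (\<alpha> * z) / 4) \<le> exp (- L - 4)" using az L by simp
  also have "\<dots> = exp (- L) / exp 4" by (simp add: exp_diff)
  also have "\<dots> \<le> exp (- L) / 16" using e4 by (intro divide_left_mono) auto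
  finally show "4 * exp (- (\<alpha> * z) / 4) \<le> exp (- L) / 2" using exp_gt_zero[of "- L"] by linarith
qed

text \<open>Uses (1 - t) / t = 1 / t - 1; the constant \<open>1 + C\<close> absorbs the 1, since
  \<open>x powr e\<close> is at least 1.\<close>

lemma weight_log_bounds:
  fixes t x e c C :: real
  assumes t: "0 < t" "t < 1" and x: "x \<ge> 1" and c: "0 < c" "0 < C" and e: "e \<ge> 0"
    and b: "c * x powr e \<le> (1 - t) / t" "(1 - t) / t \<le> C * x powr e"
  shows "- ln (1 + C) - e * ln x \<le> ln t" "ln t \<le> - ln c - e * ln x"
proof -
  have xe: "x powr e \<ge> 1" using x e by (intro ge_one_powr_ge_zero) auto
  have "(1 - t) / t = 1 / t - 1" using t by (simp add: field_simps)
  then have 1: "c * x powr e \<le> 1 / t" and 2: "1 / t \<le> (1 + C) * x powr e"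
    using b xe by (simp_all add: algebra_simps)
  have "ln (c * x powr e) \<le> ln (1 / t)" using 1 c x t by (subst ln_le_cancel_iff) auto
  then show "ln t \<le> - ln c - e * ln x" using c x t by (simp add: ln_mult ln_div ln_powr)
  have "ln (1 / t) \<le> ln ((1 + C) * x powr e)" using 2 c x t by (subst ln_le_cancel_iff) auto
  then show "- ln (1 + C) - e * ln x \<le> ln t" using c x t by (simp add: ln_mult ln_div ln_powr)
qed

lemma ln_ge_exp: "(x :: real) > 0 \<Longrightarrow> y \<le> ln x \<Longrightarrow> exp y \<le> x"
  by (simp add: ln_ge_iff)

text \<open>\<open>exp (r * L)\<close> counts the coordinates, and the slab weight \<open>t\<close>
  is at most a constant times its inverse square. The powers \<alpha> and \<alpha> - 1 lose \<delta>
  (2 r + c) L <= L / 2 in the exponent; the surplus is r L >= L, and the L / 2 that remains absorbs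
  the constants by \<open>big\<close>.\<close>

lemma slab_term_le:
  fixes t v \<alpha> \<delta> c L k r m :: real
  assumes pos: "t > 0" "v > 0" and \<alpha>: "0 < \<alpha>" "\<alpha> = 1 - \<delta>" "0 < \<delta>"
    and t: "ln t \<le> k - 2 * r * L" and v: "m - c * L \<le> ln v" and L: "L \<ge> 0" and dc: "\<delta> * (2 * r + c) \<le> 1 / 2" and r: "r \<ge> 1"
    and big: "ln (4 / \<alpha>) + \<alpha> * k - \<delta> * m \<le> L / 2"
  shows "exp (r * L) * (2 / \<alpha> * (t powr \<alpha> * v powr (\<alpha> - 1))) \<le> 1 / 2"
proof -
  have "\<alpha> * ln t \<le> \<alpha> * (k - 2 * r * L)" using t \<alpha> by (intro mult_left_mono) auto
  moreover have "\<delta> * (m - c * L) \<le> \<delta> * ln v" using v \<alpha> by (intro mult_left_mono) auto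
  moreover have "\<delta> * (2 * r + c) * L \<le> 1 / 2 * L" using dc L by (intro mult_right_mono)
  moreover have "1 * L \<le> r * L" using r L by (intro mult_right_mono)
  moreover have eqs: "\<alpha> * (k - 2 * r * L) = \<alpha> * k - 2 * (r * L) + \<delta> * (2 * r) * L"
      "\<delta> * (2 * r + c) * L = \<delta> * (2 * r) * L + \<delta> * c * L" "\<delta> * (m - c * L) = \<delta> * m - \<delta> * c * L"
    by (simp_all add: \<alpha>(2) algebra_simps)
  ultimately have "r * L + ln (4 / \<alpha>) + \<alpha> * ln t - \<delta> * ln v \<le> 0"
    using big eqs by linarith
  then have "exp (r * L + ln (4 / \<alpha>) + \<alpha> * ln t - \<delta> * ln v) \<le> 1" by simp
  also have "exp (r * L + ln (4 / \<alpha>) + \<alpha> * ln t - \<delta> * ln v)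
      = exp (r * L) * (4 / \<alpha> * (t powr \<alpha> * v powr (\<alpha> - 1)))"
  proof -
    have "\<alpha> - 1 = - \<delta>" by (simp add: \<alpha>(2))
    then show ?thesis using pos \<alpha>(1) by (simp add: powr_def exp_add exp_diff exp_minus divide_inverse mult_ac)
  qed
  finally show ?thesis by (simp add: mult_ac)
qed

text \<open>
  All hypotheses on the hyperparameters are stated on the logarithmic scale: \<open>Ln\<close>, \<open>Lp\<close>, \<open>Lq\<close>, \<open>LP\<close>,
  \<open>Ly\<close>, \<open>Lg\<close> are logarithms of sizes, and the numbers \<open>kt1, ..., kB\<close> are the constants left by the
  relations \<open>\<asymp>\<close> of A4 and A5. The exponent \<open>R\<close> is \<open>n\<close> times the squared contraction rate. The value of
  \<open>\<delta>\<close> makes the slab contribution to the sum over all cells of one coordinate at most the inverse of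
  the number of coordinates.
\<close>

lemma regime_bound:
  fixes \<theta> l1 l0 \<eta> \<xi>1 \<xi>0 \<tau> b1 b2 \<tau>0 \<alpha> \<delta> a1 W M1 M2 c0 Ln Lp Lq LP Lg Ly R Cl C1 :: real
    and a a' b' kt1 kt2 k1 k0 ke1 ke2 kx kx0 kB k C5 :: real and n p q sB sO :: nat
  assumes n: "n \<ge> 2" "p \<ge> 2" "q \<ge> 2" "q \<le> n" and X: "X \<in> carrier_mat n p"
    and col: "\<And>j. j < p \<Longrightarrow> (\<Sum>i<n. (X $$ (i, j))\<^sup>2) = real n"
    and par: "0 < \<theta>" "\<theta> < 1" "0 < l1" "0 < l0" "0 < \<eta>" "\<eta> < 1" "0 < \<xi>1" "0 < \<xi>0"
    and \<tau>: "\<tau> > 0" "\<tau>0 > 0" "\<tau>0 \<le> \<tau>" "\<tau>0 < inverse b1 - \<tau>" "b2 > 0"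
    and L: "Ln = ln (real n)" "Lp = ln (real p)" "Lq = ln (real q)" "LP = ln (real p * real q)"
      "Ly = ln (max (real n) (real p * real q))" "Lg = ln (real (max p q))" "Lg \<ge> 1"
    and c0: "c0 \<ge> 1" "Ln \<le> c0 * Lq" "Ln \<le> c0 * Lp" and \<delta>: "\<delta> = 1 / (2 * (5 + 3 * c0))" "\<alpha> = 1 - \<delta>"
    and a: "a > 0" "a' > 0" "b' > 1 / 2" "a1 > 0"
    and th: "kt1 - (2 + a') * LP \<le> ln \<theta>" "ln \<theta> \<le> kt2 - 2 * LP"
    and l1: "k1 - Ln \<le> ln l1" "l1 \<le> C1" and l0: "k0 + (2 + b') * Ly \<le> ln l0"
    and et: "ke1 - 2 * (2 + a) * Lq \<le> ln \<eta>" "ln \<eta> \<le> ke2 - 4 * Lq"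
    and x1: "kx - 2 * Ln \<le> ln \<xi>1" "\<xi>1 \<le> 1" and x0: "kx0 + 4 * Ln \<le> ln \<xi>0"
    and kB: "kB = (kx - ln 6) / 2"
    and big: "8 * (Ly + 3) \<le> exp (k0 + kB + (b' - 1 / 2) * Ly)" "8 * (2 * Ln + 3) \<le> exp (kx0 + ln \<tau>0 + 2 * Ln)"
      "kt2 + ln 4 \<le> LP" "ke2 + ln 4 \<le> 2 * Lq"
      "ln (4 / \<alpha>) + \<alpha> * kt2 - \<delta> * (k1 + kB) \<le> LP / 2" "ln (4 / \<alpha>) + \<alpha> * ke2 - \<delta> * (kx + ln \<tau>0) \<le> Lq / 2"
      "\<tau>0 \<le> real n"
    and Cl: "Cl = \<bar>kt1\<bar> + \<bar>k1\<bar> + \<bar>kB\<bar> + \<bar>C1\<bar> * (a1 + 1) + 2 * (3 + a') + 5 / 2 * c0 + \<bar>ke1\<bar> + \<bar>kx\<bar> + \<bar>ln \<tau>0\<bar> + (inverse b2 + \<tau>0) + (5 + 2 * a) + 3 * c0"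
    and R: "R = real (Max {q, sO, sB}) * Lg"
    and k: "k = inverse b2 / 2 + 2" and C5: "C5 = 4 + \<bar>kx + ln \<tau>0\<bar> + 3 * c0"
    and W: "2 * \<delta> * W = (2 * k + 3 * Cl + C5 + 4) * R"
    and W1: "W \<le> \<tau> / 8 * M1" and W2: "W \<le> real n * (min (M2 / (inverse b2)\<^sup>2) 1 / 64)"
    and t: "(B0, \<Omega>0) \<in> true_params p q a1 b1 b2 sB sO"
  shows "(\<integral>\<^sup>+Y. prob_of p q (posterior n p q X (prior p q \<theta> l1 l0 \<eta> \<xi>1 \<xi>0 \<tau>) Y)
            (\<lambda>B \<Omega>. (frobenius_norm (X * (B - B0)))\<^sup>2 \<ge> M1) \<partial>sampling_measure n q X B0 \<Omega>0) \<le> ennreal (13 * exp (- R))"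
    and "(\<integral>\<^sup>+Y. prob_of p q (posterior n p q X (prior p q \<theta> l1 l0 \<eta> \<xi>1 \<xi>0 \<tau>) Y)
            (\<lambda>B \<Omega>. (frobenius_norm (\<Omega> - \<Omega>0))\<^sup>2 \<ge> M2) \<partial>sampling_measure n q X B0 \<Omega>0) \<le> ennreal (13 * exp (- R))"
proof -
  define wB where "wB = sqrt (\<xi>1 / (6 * real n)) / (real p * real q)"
  define wO where "wO = \<tau>0 / (real q * real n)"
  define P where "P = real p * real q"
  have P: "P \<ge> 4" using mult_mono[of 2 "real p" 2 "real q"] n by (simp add: P_def)
  have wBp: "wB > 0" and wOp: "wO > 0" using n par \<tau> by (auto simp: wB_def wO_def)
  have LPs: "LP = Lp + Lq" using n by (simp add: L ln_mult)
  have pos: "0 \<le> Ln" "0 \<le> Lp" "0 \<le> Lq" "0 \<le> LP" using n by (auto simp: L ln_mult)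
  have Lqn: "Lq \<le> Ln" using n by (simp add: L)
  have Lpg: "Lp \<le> Lg" "Lq \<le> Lg" using n by (auto simp: L)
  have Lny: "Ln \<le> Ly" "LP \<le> Ly" using n P by (auto simp: L P_def)
  have c0P: "Ln \<le> c0 * LP" using c0 pos LPs by (simp add: distrib_left add_increasing)
  have c0g: "Ln \<le> c0 * Lg"
    using c0(2) mult_left_mono[OF Lpg(2), of c0] c0(1) by linarith
  have eLP: "exp LP = P" "exp (- LP) = 1 / P" using P by (simp_all add: L(4) P_def exp_minus inverse_eq_divide)
  have eLq: "exp (2 * Lq) = (real q)\<^sup>2" "exp (- (2 * Lq)) = 1 / (real q)\<^sup>2"
    using n by (simp_all add: L(3) exp_double exp_minus inverse_eq_divide)
  have d8: "0 < \<delta>" "\<delta> \<le> 1 / 16" using c0 by (auto simp: \<delta> field_simps)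
  \<comment> \<open>5 + 3 c0 is \<open>2 * r + c\<close> of \<open>slab_term_le\<close> for the
    off-diagonal entries, with \<open>r = 2\<close> and \<open>c = 3 * c0 + 1\<close>; the
    regression coefficients need less.\<close>
  have dc: "\<delta> * (5 + 3 * c0) = 1 / 2" using c0 by (simp add: \<delta>)
  have al: "2 / 3 \<le> \<alpha>" "\<alpha> < 1" "0 < \<alpha>" using d8 \<delta>(2) by auto
  have lwB: "kB - 3 / 2 * Ln - LP \<le> ln wB"
  proof -
    have "ln wB = (ln \<xi>1 - ln 6 - Ln) / 2 - LP"
      using n par P by (simp add: wB_def ln_div ln_sqrt ln_mult L)
    then show ?thesis using x1(1) unfolding kB by (simp add: field_simps)
  qed
  have lwO: "ln wO = ln \<tau>0 - Lq - Ln" using n \<tau> by (simp add: wO_def ln_div ln_mult L)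
  have wB1: "wB \<le> 1"
  proof -
    have "\<xi>1 / (6 * real n) \<le> 1" using x1(2) n by (simp add: divide_le_eq)
    then have "sqrt (\<xi>1 / (6 * real n)) \<le> P" using P real_sqrt_le_1_iff[of "\<xi>1 / (6 * real n)"] by linarith
    then show ?thesis using P unfolding wB_def P_def[symmetric] by (simp add: divide_le_eq)
  qed
  have wO1: "wO \<le> \<tau>0"
  proof -
    have "1 * 1 \<le> real q * real n" using n by (intro mult_mono) auto
    then show ?thesis using \<tau> by (simp add: wO_def divide_le_eq)
  qed
  \<comment> \<open>The exponent is 2 + b' - 3/2 - 1 = b' - 1/2, as \<open>Ln\<close> and
    \<open>LP\<close> are at most \<open>Ly\<close>; its positivity makes the spike narrower than a
    cell.\<close>
  have sB_large: "8 * (LP + 3) \<le> l0 * wB"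
  proof -
    have "k0 + kB + (b' - 1 / 2) * Ly \<le> ln l0 + ln wB"
      using l0 lwB Lny by (simp add: algebra_simps)
    also have "\<dots> = ln (l0 * wB)" using par wBp by (simp add: ln_mult)
    finally have "exp (k0 + kB + (b' - 1 / 2) * Ly) \<le> l0 * wB" using par wBp by (intro ln_ge_exp) auto
    then have "8 * (Ly + 3) \<le> l0 * wB" by (rule order_trans[OF big(1)])
    then show ?thesis using Lny(2) by simp
  qed
  \<comment> \<open>Of the exponent 4 the width \<open>wO\<close> takes 1 for \<open>n\<close> and
    at most 1 for \<open>q\<close>, as \<open>q \<le> n\<close>; this leaves 2.\<close>
  have sO_large: "8 * (2 * Lq + 3) \<le> \<xi>0 * wO"
  proof -
    have "kx0 + ln \<tau>0 + 2 * Ln \<le> ln \<xi>0 + ln wO" using x0 lwO Lqn by simp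
    also have "\<dots> = ln (\<xi>0 * wO)" using par wOp by (simp add: ln_mult)
    finally have "exp (kx0 + ln \<tau>0 + 2 * Ln) \<le> \<xi>0 * wO" using par wOp by (intro ln_ge_exp) auto
    then have "8 * (2 * Ln + 3) \<le> \<xi>0 * wO" by (rule order_trans[OF big(2)])
    then show ?thesis using Lqn by simp
  qed
  note SB = spike_large[OF sB_large pos(4) al(1)]
  have Lq2: "0 \<le> 2 * Lq" using pos by simp
  note SO = spike_large[OF sO_large Lq2 al(1)]
  have th4: "\<theta> \<le> 1 / (4 * P)"
  proof -
    have "ln \<theta> \<le> - LP - ln 4" using th(2) big(3) by simp
    then have "exp (ln \<theta>) \<le> exp (- LP - ln 4)" by simp
    also have "\<dots> = 1 / (4 * P)" by (simp add: exp_diff eLP)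
    finally show ?thesis using par by simp
  qed
  have et4: "\<eta> \<le> 1 / (4 * (real q)\<^sup>2)"
  proof -
    have "ln \<eta> \<le> - (2 * Lq) - ln 4" using et(2) big(4) by simp
    then have "exp (ln \<eta>) \<le> exp (- (2 * Lq) - ln 4)" by simp
    also have "\<dots> = 1 / (4 * (real q)\<^sup>2)" by (simp only: exp_diff eLq) simp
    finally show ?thesis using par by simp
  qed
  have zB: "\<theta> + exp (- l0 * wB) \<le> 1 / (2 * (real p * real q))"
    using th4 SB(2) unfolding eLP P_def by simp
  have zO: "\<eta> + exp (- \<xi>0 * wO) \<le> 1 / (2 * (real q)\<^sup>2)"
    using et4 SO(2) unfolding eLq by simp
  have GB: "real p * real q * (2 / \<alpha> * (\<theta> powr \<alpha> * (l1 * wB) powr (\<alpha> - 1)) + 4 * exp (- \<alpha> * l0 * wB / 4)) \<le> 1"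
  proof -
    have "exp (1 * LP) * (2 / \<alpha> * (\<theta> powr \<alpha> * (l1 * wB) powr (\<alpha> - 1))) \<le> 1 / 2"
    proof (rule slab_term_le[where k = kt2 and m = "k1 + kB" and c = "5 / 2 * c0 + 1" and \<delta> = \<delta>])
      have "ln (l1 * wB) = ln l1 + ln wB" using par wBp by (simp add: ln_mult)
      then show "k1 + kB - (5 / 2 * c0 + 1) * LP \<le> ln (l1 * wB)"
        using l1(1) lwB c0P by (simp add: algebra_simps)
      have "\<delta> * (2 * 1 + (5 / 2 * c0 + 1)) \<le> \<delta> * (5 + 3 * c0)" using d8 c0 by (intro mult_left_mono) auto
      then show "\<delta> * (2 * 1 + (5 / 2 * c0 + 1)) \<le> 1 / 2" using dc by simp
    qed (use par wBp al \<delta>(2) d8 th(2) pos big(5) in auto)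
    then have h1: "P * (2 / \<alpha> * (\<theta> powr \<alpha> * (l1 * wB) powr (\<alpha> - 1))) \<le> 1 / 2" by (simp only: mult_1 eLP)
    have "P * (4 * exp (- (\<alpha> * (l0 * wB)) / 4)) \<le> 1 / 2"
      using mult_left_mono[OF SB(3), of P] P unfolding eLP by simp
    then have h2: "P * (4 * exp (- \<alpha> * l0 * wB / 4)) \<le> 1 / 2" by (simp add: mult.assoc)
    show ?thesis
      using add_mono[OF h1 h2] unfolding P_def[symmetric] distrib_left by (simp only: field_sum_of_halves)
  qed
  have GO: "(real q)\<^sup>2 * (2 / \<alpha> * (\<eta> powr \<alpha> * (\<xi>1 * wO) powr (\<alpha> - 1)) + 4 * exp (- \<alpha> * \<xi>0 * wO / 4)) \<le> 1"
  proof -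
    have "exp (2 * Lq) * (2 / \<alpha> * (\<eta> powr \<alpha> * (\<xi>1 * wO) powr (\<alpha> - 1))) \<le> 1 / 2"
    proof (rule slab_term_le[where k = ke2 and m = "kx + ln \<tau>0" and c = "3 * c0 + 1" and \<delta> = \<delta>])
      have "ln (\<xi>1 * wO) = ln \<xi>1 + ln wO" using par wOp by (simp add: ln_mult)
      then show "kx + ln \<tau>0 - (3 * c0 + 1) * Lq \<le> ln (\<xi>1 * wO)"
        using x1(1) lwO c0(2) by (simp add: algebra_simps)
      have "2 * 2 + (3 * c0 + 1) = 5 + 3 * c0" by simp
      then show "\<delta> * (2 * 2 + (3 * c0 + 1)) \<le> 1 / 2" using dc by simp
    qed (use par wOp al \<delta>(2) d8 et(2) pos big(6) in auto)
    then have h1: "(real q)\<^sup>2 * (2 / \<alpha> * (\<eta> powr \<alpha> * (\<xi>1 * wO) powr (\<alpha> - 1))) \<le> 1 / 2" by (simp only: eLq)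
    have "(real q)\<^sup>2 * (4 * exp (- (\<alpha> * (\<xi>0 * wO)) / 4)) \<le> 1 / 2"
      using mult_left_mono[OF SO(3), of "(real q)\<^sup>2"] n unfolding eLq by simp
    then have h2: "(real q)\<^sup>2 * (4 * exp (- \<alpha> * \<xi>0 * wO / 4)) \<le> 1 / 2" by (simp add: mult.assoc)
    show ?thesis
      using add_mono[OF h1 h2] unfolding distrib_left by (simp only: field_sum_of_halves)
  qed
  \<comment> \<open>\<open>Cl\<close> adds up, in units of \<open>Lg\<close>, the logarithmic costs
    of a coordinate of either kind, so that one \<open>l\<close> serves the coefficients and the
    precision matrix.\<close>
  define l where "l = exp (- (Cl * Lg))"
  have Cl0: "Cl \<ge> 0" using a c0 \<tau> unfolding Cl by (intro add_nonneg_nonneg mult_nonneg_nonneg) auto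
  have l: "0 < l" "l \<le> 1" using Cl0 L(7) by (auto simp: l_def)
  have absg: "- \<bar>x\<bar> * Lg \<le> x" for x
  proof -
    have "\<bar>x\<bar> * 1 \<le> \<bar>x\<bar> * Lg" using L(7) by (intro mult_left_mono) auto
    then show ?thesis by simp
  qed
  have nng: "x \<le> x * Lg" if "x \<ge> 0" for x using mult_left_mono[OF L(7) that] by simp
  have lB: "l \<le> \<theta> * l1 * wB * exp (- l1 * (a1 + wB))"
  proof -
    have lin: "l1 * (a1 + wB) \<le> \<bar>C1\<bar> * (a1 + 1)"
      using l1(2) par wBp wB1 a by (intro mult_mono) auto
    have LP2: "(3 + a') * LP \<le> (3 + a') * (2 * Lg)" using LPs Lpg a by (intro mult_left_mono) auto
    have LP2: "(3 + a') * LP \<le> 2 * (3 + a') * Lg" using LP2 by (simp only: mult_ac)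
    have cg: "\<bar>C1\<bar> * (a1 + 1) \<le> \<bar>C1\<bar> * (a1 + 1) * Lg" using a by (intro nng) auto
    have c0g: "5 / 2 * Ln \<le> 5 / 2 * c0 * Lg" using c0g by simp
    have "- (Cl * Lg) \<le> - (\<bar>kt1\<bar> * Lg) - \<bar>k1\<bar> * Lg - \<bar>kB\<bar> * Lg - (\<bar>C1\<bar> * (a1 + 1)) * Lg - 2 * (3 + a') * Lg - 5 / 2 * c0 * Lg"
    proof -
      have "0 \<le> (\<bar>ke1\<bar> + \<bar>kx\<bar> + \<bar>ln \<tau>0\<bar> + (inverse b2 + \<tau>0) + (5 + 2 * a) + 3 * c0) * Lg"
        using L(7) a c0 \<tau> by (intro mult_nonneg_nonneg add_nonneg_nonneg) auto
      then show ?thesis unfolding Cl by (simp add: algebra_simps)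
    qed
    also have "\<dots> \<le> kt1 + k1 + kB - \<bar>C1\<bar> * (a1 + 1) - (3 + a') * LP - 5 / 2 * Ln"
      using absg[of kt1] absg[of k1] absg[of kB] cg LP2 c0g by linarith
    also have "\<dots> \<le> ln \<theta> + ln l1 + ln wB - l1 * (a1 + wB)"
      using th(1) l1(1) lwB lin by (simp add: algebra_simps)
    finally have "l \<le> exp (ln \<theta> + ln l1 + ln wB - l1 * (a1 + wB))" by (simp add: l_def)
    also have "\<dots> = \<theta> * l1 * wB * exp (- l1 * (a1 + wB))"
      using par wBp by (simp add: exp_add exp_diff exp_minus field_simps)
    finally show ?thesis .
  qed
  have lO: "l \<le> \<eta> * \<xi>1 * wO * exp (- \<xi>1 * (inverse b2 + wO))"
  proof -
    have lin: "\<xi>1 * (inverse b2 + wO) \<le> 1 * (inverse b2 + \<tau>0)"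
      using x1(2) par wOp wO1 \<tau> by (intro mult_mono) auto
    have Lq5: "(5 + 2 * a) * Lq \<le> (5 + 2 * a) * Lg" using Lpg a by (intro mult_left_mono) auto
    have bg: "inverse b2 + \<tau>0 \<le> (inverse b2 + \<tau>0) * Lg" using \<tau> by (intro nng) auto
    have c0g: "3 * Ln \<le> 3 * c0 * Lg" using c0g by simp
    have "- (Cl * Lg) \<le> - (\<bar>ke1\<bar> * Lg) - \<bar>kx\<bar> * Lg - \<bar>ln \<tau>0\<bar> * Lg - (inverse b2 + \<tau>0) * Lg - (5 + 2 * a) * Lg - 3 * c0 * Lg"
    proof -
      have "0 \<le> (\<bar>kt1\<bar> + \<bar>k1\<bar> + \<bar>kB\<bar> + \<bar>C1\<bar> * (a1 + 1) + 2 * (3 + a') + 5 / 2 * c0) * Lg"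
        using L(7) a c0 \<tau> by (intro mult_nonneg_nonneg add_nonneg_nonneg) auto
      then show ?thesis unfolding Cl by (simp add: algebra_simps)
    qed
    also have "\<dots> \<le> ke1 + kx + ln \<tau>0 - (inverse b2 + \<tau>0) - (5 + 2 * a) * Lq - 3 * Ln"
      using absg[of ke1] absg[of kx] absg[of "ln \<tau>0"] bg Lq5 c0g by linarith
    also have "\<dots> \<le> ln \<eta> + ln \<xi>1 + ln wO - \<xi>1 * (inverse b2 + wO)"
      using et(1) x1(1) lwO lin by (simp add: algebra_simps)
    finally have "l \<le> exp (ln \<eta> + ln \<xi>1 + ln wO - \<xi>1 * (inverse b2 + wO))" by (simp add: l_def)
    also have "\<dots> = \<eta> * \<xi>1 * wO * exp (- \<xi>1 * (inverse b2 + wO))"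
      using par wOp by (simp add: exp_add exp_diff exp_minus field_simps)
    finally show ?thesis .
  qed
  have small: "\<xi>1 * wO \<le> 1"
  proof -
    have "1 * real n \<le> real q * real n" using n by (intro mult_right_mono) auto
    then have "\<tau>0 \<le> real q * real n" using big(7) by simp
    then have "wO \<le> 1" using n by (simp add: wO_def divide_le_eq)
    then show ?thesis using mult_mono[of \<xi>1 1 wO 1] x1(2) par wOp by simp
  qed
  define mx where "mx = Max {q, sO, sB}"
  have mx: "q \<le> mx" "sO \<le> mx" "sB \<le> mx" by (auto simp: mx_def)
  have qR: "real q * Lg \<le> R" unfolding R mx_def[symmetric] using mx L(7) by (intro mult_right_mono) auto
  have qR1: "real q \<le> R" using nng[of "real q"] qR by simp
  have R2: "R \<ge> 2" using qR1 n by simp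
  define K where "K = k * R"
  have k2: "k \<ge> 2" using \<tau> by (simp add: k)
  have K: "inverse b2 * real q * \<xi>1 / 2 + 2 * real q \<le> K"
  proof -
    have "inverse b2 * real q * \<xi>1 \<le> inverse b2 * real q * 1" using x1(2) \<tau> by (intro mult_left_mono) auto
    then have "inverse b2 * real q * \<xi>1 / 2 + 2 * real q \<le> k * real q" by (simp add: k algebra_simps)
    also have "\<dots> \<le> K" unfolding K_def using qR1 k2 by (intro mult_left_mono) auto
    finally show ?thesis .
  qed
  define bd where "bd = ennreal (exp (- K)) + ennreal (3 * ((exp (2 * K) / (l ^ (sB + q + sO) / 4)) powr \<alpha> * exp (- W) powr (2 - 2 * \<alpha>))) *
        ennreal (exp (real q + 2) * (15 * (\<xi>1 * wO) powr (\<alpha> - 1)) ^ q)"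
  have sp1: "\<alpha> * l0 * wB \<ge> 1" and sp2: "\<alpha> * \<xi>0 * wO \<ge> 1" using SB(1) SO(1) by (simp_all add: mult.assoc)
  have p1: "p \<ge> 1" "q \<ge> 1" using n by auto
  note ucb = uniform_contraction_bound[OF wB_def wO_def bd_def n(1) p1 X col par \<tau> al(1,2) l lB zB lO zO sp1 sp2 small GB GO K W1 W2 t]
  have bd: "bd \<le> ennreal (13 * exp (- R))"
  proof -
    \<comment> \<open>The neighbourhood has \<open>sB + q + sO \<le> 3 * mx\<close> costly
      coordinates, each with the factor \<open>l\<close>; hence \<open>3 * Cl * R\<close>.\<close>
    have t1: "(exp (2 * K) / (l ^ (sB + q + sO) / 4)) powr \<alpha> \<le> 4 * exp (2 * K + 3 * Cl * R)"
    proof -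
      have "real (sB + q + sO) * Lg \<le> 3 * R"
        unfolding R mx_def[symmetric] using mx L(7) mult_right_mono[of "real (sB + q + sO)" "3 * real mx" Lg] by simp
      then have "Cl * (real (sB + q + sO) * Lg) \<le> Cl * (3 * R)" using Cl0 by (intro mult_left_mono)
      moreover have "l ^ (sB + q + sO) = exp (- (Cl * (real (sB + q + sO) * Lg)))"
        by (simp only: l_def exp_of_nat_mult[symmetric]) (simp add: algebra_simps)
      ultimately have lp: "exp (- (3 * Cl * R)) \<le> l ^ (sB + q + sO)" by (simp add: mult_ac)
      have "exp (2 * K) / (l ^ (sB + q + sO) / 4) \<le> exp (2 * K) / (exp (- (3 * Cl * R)) / 4)"
        using lp l by (intro divide_left_mono divide_right_mono mult_pos_pos) auto
      also have "\<dots> = 4 * exp (2 * K + 3 * Cl * R)" by (simp add: exp_add exp_minus field_simps)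
      finally have "(exp (2 * K) / (l ^ (sB + q + sO) / 4)) powr \<alpha> \<le> (4 * exp (2 * K + 3 * Cl * R)) powr \<alpha>"
        using l al by (intro powr_mono2) auto
      also have "\<dots> \<le> (4 * exp (2 * K + 3 * Cl * R)) powr 1"
      proof (rule powr_mono)
        have "0 \<le> 2 * K + 3 * Cl * R" using k2 R2 Cl0 by (simp add: K_def)
        then have "1 \<le> exp (2 * K + 3 * Cl * R)" by simp
        then show "1 \<le> 4 * exp (2 * K + 3 * Cl * R)" by linarith
      qed (use al in simp)
      finally show ?thesis by simp
    qed
    have t2: "exp (- W) powr (2 - 2 * \<alpha>) = exp (- ((2 * k + 3 * Cl + C5 + 4) * R))"
      unfolding powr_exp W[symmetric] \<delta>(2) by (simp add: algebra_simps)
    \<comment> \<open>A diagonal entry costs at most exp (C5 Lg), and \<open>q * Lg \<le> R\<close>.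
      The 4 in \<open>C5\<close> consists of 3 for the constant 15 and 1 for
      \<open>Lq\<close>.\<close>
    have t3: "(15 * (\<xi>1 * wO) powr (\<alpha> - 1)) ^ q \<le> exp (C5 * R)"
    proof -
      define y where "y = kx + ln \<tau>0"
      have lx: "ln (\<xi>1 * wO) \<ge> y - 3 * Ln - Lq" using x1(1) lwO par wOp by (simp add: ln_mult y_def)
      have "(\<alpha> - 1) * ln (\<xi>1 * wO) = \<delta> * (- ln (\<xi>1 * wO))" by (simp add: \<delta>(2))
      also have "\<dots> \<le> \<delta> * (\<bar>y\<bar> + 3 * Ln + Lq)" using lx d8 by (intro mult_left_mono) auto
      also have "\<dots> \<le> 1 * (\<bar>y\<bar> + 3 * Ln + Lq)" using d8 pos by (intro mult_right_mono) auto
      also have "\<dots> \<le> (\<bar>y\<bar> + 3 * c0 + 1) * Lg" using nng[of "\<bar>y\<bar>"] c0g Lpg(2) by (simp add: algebra_simps)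
      finally have "(\<xi>1 * wO) powr (\<alpha> - 1) \<le> exp ((\<bar>y\<bar> + 3 * c0 + 1) * Lg)"
        using par wOp by (simp add: powr_def)
      moreover have "(15 :: real) \<le> exp (3 * Lg)"
      proof -
        have "(15 :: real) \<le> (5 / 2) ^ 3" by (simp add: power3_eq_cube)
        also have "\<dots> \<le> exp 1 ^ 3"
        proof (intro power_mono)
          have "1 + 1 + 1\<^sup>2 / 2 \<le> exp (1 :: real)" by (rule exp_lower_Taylor_quadratic) simp
          then show "(5 / 2 :: real) \<le> exp 1" by simp
        qed simp
        also have "\<dots> = exp 3" by (simp add: exp_of_nat_mult[symmetric])
        also have "\<dots> \<le> exp (3 * Lg)" using L(7) by simp
        finally show ?thesis .
      qed
      ultimately have "15 * (\<xi>1 * wO) powr (\<alpha> - 1) \<le> exp (3 * Lg) * exp ((\<bar>y\<bar> + 3 * c0 + 1) * Lg)"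
        by (intro mult_mono) auto
      also have "\<dots> = exp (C5 * Lg)" by (simp add: C5 y_def algebra_simps flip: exp_add)
      finally have "(15 * (\<xi>1 * wO) powr (\<alpha> - 1)) ^ q \<le> exp (C5 * Lg) ^ q" by (intro power_mono) auto
      also have "\<dots> = exp (C5 * (real q * Lg))" by (simp add: exp_of_nat_mult[symmetric] mult_ac)
      also have "\<dots> \<le> exp (C5 * R)"
        using qR c0 by (auto intro!: mult_left_mono simp: C5)
      finally show ?thesis .
    qed
    have t4: "exp (real q + 2) \<le> exp (3 * R)" using qR1 R2 by simp
    \<comment> \<open>As 2 - 2 \<alpha> = 2 \<delta>, the choice of \<open>W\<close> cancels the
      costs 2 k (evidence), 3 Cl (mass of the neighbourhood), C5 (diagonal cells) and 3 (from
      \<open>exp (q + 2)\<close>), and its 4 leaves exp (- R). The factor is 3 * 4 = 12; the summand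
      exp (- K) makes it 13.\<close>
    have "3 * ((exp (2 * K) / (l ^ (sB + q + sO) / 4)) powr \<alpha> * exp (- W) powr (2 - 2 * \<alpha>)) *
        (exp (real q + 2) * (15 * (\<xi>1 * wO) powr (\<alpha> - 1)) ^ q)
      \<le> 3 * ((4 * exp (2 * K + 3 * Cl * R)) * exp (- ((2 * k + 3 * Cl + C5 + 4) * R))) * (exp (3 * R) * exp (C5 * R))"
      unfolding t2 using t1 t3 t4 by (intro mult_mono mult_nonneg_nonneg) auto
    also have "\<dots> = 12 * exp (- R)" by (simp add: K_def algebra_simps flip: exp_add)
    finally have m: "3 * ((exp (2 * K) / (l ^ (sB + q + sO) / 4)) powr \<alpha> * exp (- W) powr (2 - 2 * \<alpha>)) *
        (exp (real q + 2) * (15 * (\<xi>1 * wO) powr (\<alpha> - 1)) ^ q) \<le> 12 * exp (- R)" .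
    have "1 * R \<le> k * R" using k2 R2 by (intro mult_right_mono) auto
    then have "exp (- K) \<le> exp (- R)" by (simp add: K_def)
    then have "exp (- K) + 3 * ((exp (2 * K) / (l ^ (sB + q + sO) / 4)) powr \<alpha> * exp (- W) powr (2 - 2 * \<alpha>)) *
        (exp (real q + 2) * (15 * (\<xi>1 * wO) powr (\<alpha> - 1)) ^ q) \<le> 13 * exp (- R)" using m by linarith
    then show ?thesis
      unfolding bd_def by (simp add: ennreal_leI flip: ennreal_mult ennreal_plus)
  qed
  show "(\<integral>\<^sup>+Y. prob_of p q (posterior n p q X (prior p q \<theta> l1 l0 \<eta> \<xi>1 \<xi>0 \<tau>) Y)
            (\<lambda>B \<Omega>. (frobenius_norm (X * (B - B0)))\<^sup>2 \<ge> M1) \<partial>sampling_measure n q X B0 \<Omega>0) \<le> ennreal (13 * exp (- R))"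
    by (rule order_trans[OF ucb(1) bd])
  show "(\<integral>\<^sup>+Y. prob_of p q (posterior n p q X (prior p q \<theta> l1 l0 \<eta> \<xi>1 \<xi>0 \<tau>) Y)
            (\<lambda>B \<Omega>. (frobenius_norm (\<Omega> - \<Omega>0))\<^sup>2 \<ge> M2) \<partial>sampling_measure n q X B0 \<Omega>0) \<le> ennreal (13 * exp (- R))"
    by (rule order_trans[OF ucb(2) bd])
qed

section \<open>Constants from the asymptotic relations, and the limit\<close>

lemma bigtheta_bounds:
  fixes f g :: "nat \<Rightarrow> real"
  assumes "f \<in> \<Theta>(g)"
  obtains c C where "c > 0" "C > 0" "\<forall>\<^sub>F n in sequentially. c * \<bar>g n\<bar> \<le> \<bar>f n\<bar> \<and> \<bar>f n\<bar> \<le> C * \<bar>g n\<bar>"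
proof -
  from bigthetaD1[OF assms] obtain C where C: "C > 0" "\<forall>\<^sub>F n in sequentially. norm (f n) \<le> C * norm (g n)"
    by (rule landau_o.bigE)
  from bigthetaD2[OF assms] obtain c where c: "c > 0" "\<forall>\<^sub>F n in sequentially. norm (f n) \<ge> c * norm (g n)"
    by (rule landau_omega.bigE)
  show ?thesis
    by (rule that[OF c(1) C(1)]) (use eventually_conj[OF c(2) C(2)] in simp)
qed

lemma log_dimension_bound:
  fixes q :: "nat \<Rightarrow> nat"
  assumes "\<And>n. n \<ge> 1 \<Longrightarrow> q n \<ge> 1" and "(\<lambda>n. ln (real n)) \<in> O(\<lambda>n. ln (real (q n)))"
  obtains c where "c > 0" "\<forall>\<^sub>F n in sequentially. ln (real n) \<le> c * ln (real (q n))"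
proof -
  from assms(2) obtain c where c: "c > 0" "\<forall>\<^sub>F n in sequentially. norm (ln (real n)) \<le> c * norm (ln (real (q n)))"
    by (rule landau_o.bigE)
  show ?thesis
  proof (rule that[OF c(1)])
    show "\<forall>\<^sub>F n in sequentially. ln (real n) \<le> c * ln (real (q n))"
      using c(2) eventually_ge_at_top[of 1]
    proof eventually_elim
      case (elim n)
      then show ?case using assms(1)[of n] by simp
    qed
  qed
qed

theorem theorem2:
  fixes p q sB s\<Omega> :: "nat \<Rightarrow> nat"
    and X :: "nat \<Rightarrow> real mat"
    and \<theta> lam0 lam1 \<eta> \<xi>0 \<xi>1 Q :: "nat \<Rightarrow> real"
    and \<tau> a1 b1 b2 a b a' b' :: real
  assumes dims: "\<And>n. n \<ge> 1 \<Longrightarrow> p n \<ge> 1 \<and> q n \<ge> 1"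
    and Q: "\<And>n. Q n = real (q n) * (real (q n) - 1) / 2"
    and design: "\<And>n. n \<ge> 1 \<Longrightarrow> X n \<in> carrier_mat n (p n)"
    and columns: "\<And>n j. n \<ge> 1 \<Longrightarrow> j < p n \<Longrightarrow> sqrt (\<Sum>i<n. (X n $$ (i, j))\<^sup>2) = sqrt (real n)"
    and weights: "\<And>n. n \<ge> 1 \<Longrightarrow> 0 < \<theta> n \<and> \<theta> n < 1 \<and> 0 < \<eta> n \<and> \<eta> n < 1"
    and rates: "\<And>n. n \<ge> 1 \<Longrightarrow> 0 < lam1 n \<and> lam1 n < lam0 n \<and> 0 < \<xi>1 n \<and> \<xi>1 n < \<xi>0 n"
    and tau: "0 < \<tau>" "\<tau> < inverse b1"
    and A1: "0 < b2" "b2 < b1"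
    and A2: "0 < a1"
    and A3: "(\<lambda>n. ln (real n)) \<in> O(\<lambda>n. ln (real (q n)))"
            "(\<lambda>n. ln (real n)) \<in> O(\<lambda>n. ln (real (p n)))"
            "(\<lambda>n. real (Max {q n, s\<Omega> n, sB n}) * ln (real (max (p n) (q n))) / real n) \<longlonglongrightarrow> 0"
    and A4: "a' > 0" "b' > 1 / 2"
            "(\<lambda>n. (1 - \<theta> n) / \<theta> n) \<in> \<Theta>(\<lambda>n. (real (p n) * real (q n)) powr (2 + a'))"
            "lam0 \<in> \<Theta>(\<lambda>n. max (real n) (real (p n) * real (q n)) powr (2 + b'))"
            "lam1 \<in> \<Theta>(\<lambda>n. 1 / real n)"
    and A5: "a > 0" "b > 0"
            "(\<lambda>n. (1 - \<eta> n) / \<eta> n) \<in> \<Theta>(\<lambda>n. Q n powr (2 + a))"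
            "\<xi>0 \<in> \<Theta>(\<lambda>n. max (Q n) (real n) powr (4 + b))"
            "\<xi>1 \<in> \<Theta>(\<lambda>n. 1 / max (Q n) (real n))"
  shows "\<exists>M1>0.
    (\<lambda>n. SUP (B0, \<Omega>0) \<in> true_params (p n) (q n) a1 b1 b2 (sB n) (s\<Omega> n).
       \<integral>\<^sup>+ Y. prob_of (p n) (q n)
          (posterior n (p n) (q n) (X n)
             (prior (p n) (q n) (\<theta> n) (lam1 n) (lam0 n) (\<eta> n) (\<xi>1 n) (\<xi>0 n) \<tau>) Y)
          (\<lambda>B \<Omega>. (frobenius_norm (X n * (B - B0)))\<^sup>2
             \<ge> M1 * real n * (contraction_rate n (p n) (q n) (sB n) (s\<Omega> n))\<^sup>2)
         \<partial>sampling_measure n (q n) (X n) B0 \<Omega>0) \<longlonglongrightarrow> 0 \<and>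
    (\<lambda>n. SUP (B0, \<Omega>0) \<in> true_params (p n) (q n) a1 b1 b2 (sB n) (s\<Omega> n).
       \<integral>\<^sup>+ Y. prob_of (p n) (q n)
          (posterior n (p n) (q n) (X n)
             (prior (p n) (q n) (\<theta> n) (lam1 n) (lam0 n) (\<eta> n) (\<xi>1 n) (\<xi>0 n) \<tau>) Y)
          (\<lambda>B \<Omega>. (frobenius_norm (\<Omega> - \<Omega>0))\<^sup>2
             \<ge> M1 * (contraction_rate n (p n) (q n) (sB n) (s\<Omega> n))\<^sup>2)
         \<partial>sampling_measure n (q n) (X n) B0 \<Omega>0) \<longlonglongrightarrow> 0"
proof -
  define R where "R n = real (Max {q n, s\<Omega> n, sB n}) * ln (real (max (p n) (q n)))" for n
  define bb where "bb = inverse b2"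
  \<comment> \<open>Half of the gap between the lower eigenvalue bound of A1 and \<tau>, to stay
    strictly inside the gap.\<close>
  define \<tau>0 where "\<tau>0 = min \<tau> ((inverse b1 - \<tau>) / 2)"
  have bb: "bb > 0" using A1 by (simp add: bb_def)
  have \<tau>0: "0 < \<tau>0" "\<tau>0 \<le> \<tau>" "\<tau>0 < inverse b1 - \<tau>" using tau by (auto simp: \<tau>0_def min_less_iff_disj)
  obtain cq where cq: "cq > 0" "\<forall>\<^sub>F n in sequentially. ln (real n) \<le> cq * ln (real (q n))"
    by (rule log_dimension_bound[OF _ A3(1)]) (use dims in auto)
  obtain cp where cp: "cp > 0" "\<forall>\<^sub>F n in sequentially. ln (real n) \<le> cp * ln (real (p n))"
    by (rule log_dimension_bound[OF _ A3(2)]) (use dims in auto)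
  define c0 where "c0 = max 1 (max cq cp)"
  have c0: "c0 \<ge> 1" "cq \<le> c0" "cp \<le> c0" by (auto simp: c0_def)
  obtain c_th C_th where th: "c_th > 0" "C_th > 0" "\<forall>\<^sub>F n in sequentially.
      c_th * \<bar>(real (p n) * real (q n)) powr (2 + a')\<bar> \<le> \<bar>(1 - \<theta> n) / \<theta> n\<bar> \<and> \<bar>(1 - \<theta> n) / \<theta> n\<bar> \<le> C_th * \<bar>(real (p n) * real (q n)) powr (2 + a')\<bar>"
    by (rule bigtheta_bounds[OF A4(3)])
  obtain c_l0 C_l0 where l0: "c_l0 > 0" "C_l0 > 0" "\<forall>\<^sub>F n in sequentially.
      c_l0 * \<bar>max (real n) (real (p n) * real (q n)) powr (2 + b')\<bar> \<le> \<bar>lam0 n\<bar> \<and> \<bar>lam0 n\<bar> \<le> C_l0 * \<bar>max (real n) (real (p n) * real (q n)) powr (2 + b')\<bar>"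
    by (rule bigtheta_bounds[OF A4(4)])
  obtain c_l1 C_l1 where l1: "c_l1 > 0" "C_l1 > 0" "\<forall>\<^sub>F n in sequentially.
      c_l1 * \<bar>1 / real n\<bar> \<le> \<bar>lam1 n\<bar> \<and> \<bar>lam1 n\<bar> \<le> C_l1 * \<bar>1 / real n\<bar>"
    by (rule bigtheta_bounds[OF A4(5)])
  obtain c_et C_et where et: "c_et > 0" "C_et > 0" "\<forall>\<^sub>F n in sequentially.
      c_et * \<bar>Q n powr (2 + a)\<bar> \<le> \<bar>(1 - \<eta> n) / \<eta> n\<bar> \<and> \<bar>(1 - \<eta> n) / \<eta> n\<bar> \<le> C_et * \<bar>Q n powr (2 + a)\<bar>"
    by (rule bigtheta_bounds[OF A5(3)])
  obtain c_x0 C_x0 where x0: "c_x0 > 0" "C_x0 > 0" "\<forall>\<^sub>F n in sequentially.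
      c_x0 * \<bar>max (Q n) (real n) powr (4 + b)\<bar> \<le> \<bar>\<xi>0 n\<bar> \<and> \<bar>\<xi>0 n\<bar> \<le> C_x0 * \<bar>max (Q n) (real n) powr (4 + b)\<bar>"
    by (rule bigtheta_bounds[OF A5(4)])
  obtain c_x1 C_x1 where x1: "c_x1 > 0" "C_x1 > 0" "\<forall>\<^sub>F n in sequentially.
      c_x1 * \<bar>1 / max (Q n) (real n)\<bar> \<le> \<bar>\<xi>1 n\<bar> \<and> \<bar>\<xi>1 n\<bar> \<le> C_x1 * \<bar>1 / max (Q n) (real n)\<bar>"
    by (rule bigtheta_bounds[OF A5(5)])

  define \<delta> where "\<delta> = 1 / (2 * (5 + 3 * c0))"
  define \<alpha> where "\<alpha> = 1 - \<delta>"
  define kt1 where "kt1 = - ln (1 + C_th)"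
  define kt2 where "kt2 = - ln c_th"
  define k1 where "k1 = ln c_l1"
  define k0 where "k0 = ln c_l0"
  define ke1 where "ke1 = - ln (1 + C_et)"
  \<comment> \<open>The summand 2 ln 4 comes from \<open>Q\<close> being at least a quarter of the
    square of \<open>q\<close>.\<close>
  define ke2 where "ke2 = - ln c_et + 2 * ln 4"
  define kx where "kx = ln c_x1"
  define kx0 where "kx0 = ln c_x0"
  define kB where "kB = (kx - ln 6) / 2"
  define k where "k = bb / 2 + 2"
  define C5 where "C5 = 4 + \<bar>kx + ln \<tau>0\<bar> + 3 * c0"
  define Cl where "Cl = \<bar>kt1\<bar> + \<bar>k1\<bar> + \<bar>kB\<bar> + \<bar>C_l1\<bar> * (a1 + 1) + 2 * (3 + a') + 5 / 2 * c0
    + \<bar>ke1\<bar> + \<bar>kx\<bar> + \<bar>ln \<tau>0\<bar> + (bb + \<tau>0) + (5 + 2 * a) + 3 * c0"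
  \<comment> \<open>Chosen so that \<open>w * R\<close> is the exponent \<open>W\<close> of
    \<open>regime_bound\<close>.\<close>
  define w where "w = (2 * k + 3 * Cl + C5 + 4) / (2 * \<delta>)"
  \<comment> \<open>The first entry serves the means, whose affinity exponent has the factor \<tau>
    / 8; the second serves the precision matrix, with its factor 1/64 and the division by the square
    of \<open>bb\<close>.\<close>
  define M where "M = max (8 * w / \<tau>) (64 * w * bb\<^sup>2)"
  have \<delta>: "\<delta> > 0" using c0 by (simp add: \<delta>_def)
  have Cl: "Cl > 0" unfolding Cl_def using A4 A5 A2 c0 bb \<tau>0
    by (intro add_nonneg_pos add_nonneg_nonneg mult_nonneg_nonneg) auto
  have w: "w > 0"
    unfolding w_def using \<delta> Cl bb c0 by (intro divide_pos_pos add_pos_pos) (auto simp: k_def C5_def)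
  have M: "M > 0" "w \<le> \<tau> / 8 * M" "w * bb\<^sup>2 \<le> M / 64"
  proof -
    have m: "8 * w / \<tau> \<le> M" "64 * w * bb\<^sup>2 \<le> M" by (simp_all add: M_def)
    have "0 < 8 * w / \<tau>" using w tau by simp
    then show "M > 0" using m(1) by linarith
    show "w \<le> \<tau> / 8 * M" using m(1) tau by (simp add: divide_le_eq mult.commute)
    show "w * bb\<^sup>2 \<le> M / 64" using m(2) by simp
  qed

  have limn: "filterlim (\<lambda>n. ln (real n)) at_top sequentially" by real_asymp
  \<comment> \<open>If \<open>p\<close> or \<open>q\<close> were 1, the logarithmic bound would give
    ln n <= 0; so both are eventually at least 2.\<close>
  have ev_q: "\<forall>\<^sub>F n in sequentially. n \<ge> 2 \<and> p n \<ge> 2 \<and> q n \<ge> 2 \<and> ln (real n) \<le> c0 * ln (real (q n)) \<and> ln (real n) \<le> c0 * ln (real (p n))"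
    using cq(2) cp(2) eventually_ge_at_top[of 2]
  proof eventually_elim
    case (elim n)
    have ln0: "0 < ln (real n)" using elim by simp
    have d: "p n \<ge> 1" "q n \<ge> 1" using dims[of n] elim by auto
    have nn: "0 \<le> ln (real (p n))" "0 \<le> ln (real (q n))" using d by auto
    have le: "ln (real n) \<le> c0 * ln (real (q n))" "ln (real n) \<le> c0 * ln (real (p n))"
      using elim mult_right_mono[OF c0(2) nn(2)] mult_right_mono[OF c0(3) nn(1)] by linarith+
    have "p n \<noteq> 1" "q n \<noteq> 1" using le ln0 by auto
    then show ?case using d le elim by auto
  qed
  have limq: "filterlim (\<lambda>n. ln (real (q n))) at_top sequentially"
  proof (rule filterlim_at_top_mono)
    show "filterlim (\<lambda>n. ln (real n) / c0) at_top sequentially" using c0 by real_asymp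
    show "\<forall>\<^sub>F n in sequentially. ln (real n) / c0 \<le> ln (real (q n))"
      using ev_q by eventually_elim (use c0 in \<open>simp add: divide_le_eq mult.commute\<close>)
  qed
  have limP: "filterlim (\<lambda>n. ln (real (p n) * real (q n))) at_top sequentially"
    by (rule filterlim_at_top_mono[OF limq], use ev_q in eventually_elim) (auto simp: ln_mult)
  have limy: "filterlim (\<lambda>n. ln (max (real n) (real (p n) * real (q n)))) at_top sequentially"
    by (rule filterlim_at_top_mono[OF limn], use ev_q in eventually_elim) auto
  have limg: "filterlim (\<lambda>n. ln (real (max (p n) (q n)))) at_top sequentially"
    by (rule filterlim_at_top_mono[OF limq], use ev_q in eventually_elim) auto
  have RgeL: "\<forall>\<^sub>F n in sequentially. real (q n) * ln (real (max (p n) (q n))) \<le> R n"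
    using ev_q by eventually_elim (auto simp: R_def intro!: mult_right_mono)
  \<comment> \<open>\<open>R\<close> dominates ln (max p q), which tends to infinity; this drives
    the final bound 13 exp (- R) to 0.\<close>
  have limR: "filterlim R at_top sequentially"
  proof (rule filterlim_at_top_mono[OF limg])
    show "\<forall>\<^sub>F n in sequentially. ln (real (max (p n) (q n))) \<le> R n"
      using RgeL ev_q
    proof eventually_elim
      case (elim n)
      have "1 * ln (real (max (p n) (q n))) \<le> real (q n) * ln (real (max (p n) (q n)))"
        using elim by (intro mult_right_mono) auto
      then show ?case using elim by linarith
    qed
  qed
  have evg: "\<forall>\<^sub>F n in sequentially. 1 \<le> ln (real (max (p n) (q n)))"
    using limg unfolding filterlim_at_top by blast
  have R0: "(\<lambda>n. R n / real n) \<longlonglongrightarrow> 0" using A3(3) by (simp add: R_def)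
  \<comment> \<open>Convergence of the rate to 0 enters here: R below n / (64 w) keeps the required
    affinity exponent under its saturation value n / 64, and R below n yields
    \<open>q \<le> n\<close>.\<close>
  have evR: "\<forall>\<^sub>F n in sequentially. R n / real n < min 1 (1 / (64 * w))"
    using w by (intro order_tendstoD(2)[OF R0]) auto
  have big1: "\<forall>\<^sub>F n in sequentially. 8 * (ln (max (real n) (real (p n) * real (q n))) + 3)
      \<le> exp (k0 + kB + (b' - 1 / 2) * ln (max (real n) (real (p n) * real (q n))))"
  proof (rule eventually_compose_filterlim[OF _ limy])
    have "b' - 1 / 2 > 0" using A4 by simp
    then show "\<forall>\<^sub>F x in at_top. 8 * (x + 3) \<le> exp (k0 + kB + (b' - 1 / 2) * x)" by real_asymp
  qed
  have big2: "\<forall>\<^sub>F n in sequentially. 8 * (2 * ln (real n) + 3) \<le> exp (kx0 + ln \<tau>0 + 2 * ln (real n))"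
    by (rule eventually_compose_filterlim[OF _ limn]) real_asymp
  have big3: "\<forall>\<^sub>F n in sequentially. max (kt2 + ln 4) (2 * (ln (4 / \<alpha>) + \<alpha> * kt2 - \<delta> * (k1 + kB))) \<le> ln (real (p n) * real (q n))"
    using limP unfolding filterlim_at_top by blast
  have big4: "\<forall>\<^sub>F n in sequentially. max ((ke2 + ln 4) / 2) (2 * (ln (4 / \<alpha>) + \<alpha> * ke2 - \<delta> * (kx + ln \<tau>0))) \<le> ln (real (q n))"
    using limq unfolding filterlim_at_top by blast
  have big5: "\<forall>\<^sub>F n in sequentially. max \<tau>0 C_x1 \<le> real n"
    using filterlim_real_sequentially unfolding filterlim_at_top by blast

  let ?I1 = "\<lambda>n B0 \<Omega>0. \<integral>\<^sup>+ Y. prob_of (p n) (q n)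
          (posterior n (p n) (q n) (X n)
             (prior (p n) (q n) (\<theta> n) (lam1 n) (lam0 n) (\<eta> n) (\<xi>1 n) (\<xi>0 n) \<tau>) Y)
          (\<lambda>B \<Omega>. (frobenius_norm (X n * (B - B0)))\<^sup>2
             \<ge> M * real n * (contraction_rate n (p n) (q n) (sB n) (s\<Omega> n))\<^sup>2)
         \<partial>sampling_measure n (q n) (X n) B0 \<Omega>0"
  let ?I2 = "\<lambda>n B0 \<Omega>0. \<integral>\<^sup>+ Y. prob_of (p n) (q n)
          (posterior n (p n) (q n) (X n)
             (prior (p n) (q n) (\<theta> n) (lam1 n) (lam0 n) (\<eta> n) (\<xi>1 n) (\<xi>0 n) \<tau>) Y)
          (\<lambda>B \<Omega>. (frobenius_norm (\<Omega> - \<Omega>0))\<^sup>2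
             \<ge> M * (contraction_rate n (p n) (q n) (sB n) (s\<Omega> n))\<^sup>2)
         \<partial>sampling_measure n (q n) (X n) B0 \<Omega>0"
  have main: "\<forall>\<^sub>F n in sequentially. \<forall>(B0, \<Omega>0) \<in> true_params (p n) (q n) a1 b1 b2 (sB n) (s\<Omega> n).
      ?I1 n B0 \<Omega>0 \<le> ennreal (13 * exp (- R n)) \<and> ?I2 n B0 \<Omega>0 \<le> ennreal (13 * exp (- R n))"
    using ev_q RgeL evg evR big1 big2 big3 big4 big5 th(3) l0(3) l1(3) et(3) x0(3) x1(3)
  proof eventually_elim
    case (elim n)
    let ?Ln = "ln (real n)" and ?Lp = "ln (real (p n))" and ?Lq = "ln (real (q n))"
      and ?LP = "ln (real (p n) * real (q n))" and ?Ly = "ln (max (real n) (real (p n) * real (q n)))"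
    have n: "n \<ge> 2" "p n \<ge> 2" "q n \<ge> 2" and n1: "n \<ge> 1" using elim by auto
    have par: "0 < \<theta> n" "\<theta> n < 1" "0 < lam1 n" "0 < lam0 n" "0 < \<eta> n" "\<eta> n < 1" "0 < \<xi>1 n" "0 < \<xi>0 n"
      using weights[OF n1] rates[OF n1] by auto
    have Rn: "R n \<le> real n" "w * R n \<le> real n / 64"
      using elim(4) n w by (simp_all add: field_simps)
    have qn: "q n \<le> n"
    proof -
      have "real (q n) * 1 \<le> real (q n) * ln (real (max (p n) (q n)))" using elim(3) by (intro mult_left_mono) auto
      then have "real (q n) \<le> real n" using elim(2) Rn(1) by linarith
      then show ?thesis by simp
    qed
    have R0: "0 \<le> R n" using n by (simp add: R_def)
    have rate: "(contraction_rate n (p n) (q n) (sB n) (s\<Omega> n))\<^sup>2 = R n / real n"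
      using R0 unfolding contraction_rate_def R_def by (simp only: real_sqrt_pow2 divide_nonneg_nonneg of_nat_0_le_iff)
    have col: "(\<Sum>i<n. (X n $$ (i, j))\<^sup>2) = real n" if "j < p n" for j
      using columns[OF n1 that] by (simp only: real_sqrt_eq_iff)
    have P1: "real (p n) * real (q n) \<ge> 1" using n mult_mono[of 1 "real (p n)" 1 "real (q n)"] by simp
    have Q1: "Q n \<ge> 1" "(real (q n))\<^sup>2 / 4 \<le> Q n" "Q n \<le> (real (q n))\<^sup>2"
    proof -
      have q2: "2 \<le> real (q n)" using n by simp
      have "2 * 1 \<le> real (q n) * (real (q n) - 1)" using q2 by (intro mult_mono) auto
      then show "Q n \<ge> 1" by (simp add: Q)
      have "0 \<le> real (q n) * (real (q n) - 2)" using q2 by (intro mult_nonneg_nonneg) auto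
      then show "(real (q n))\<^sup>2 / 4 \<le> Q n" by (simp add: Q power2_eq_square algebra_simps)
      have "0 \<le> real (q n) * (real (q n) + 1)" by simp
      then show "Q n \<le> (real (q n))\<^sup>2" by (simp add: Q power2_eq_square algebra_simps)
    qed
    have lnQ: "0 \<le> ln (Q n)" "2 * ?Lq - ln 4 \<le> ln (Q n)" "ln (Q n) \<le> 2 * ?Lq"
    proof -
      show "0 \<le> ln (Q n)" using Q1 by simp
      have "ln ((real (q n))\<^sup>2 / 4) \<le> ln (Q n)" using Q1 n by (subst ln_le_cancel_iff) auto
      then show "2 * ?Lq - ln 4 \<le> ln (Q n)" using n by (simp add: ln_div ln_realpow)
      have "ln (Q n) \<le> ln ((real (q n))\<^sup>2)" using Q1 n by (subst ln_le_cancel_iff) auto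
      then show "ln (Q n) \<le> 2 * ?Lq" using n by (simp add: ln_realpow)
    qed
    \<comment> \<open>Since \<open>q \<le> n\<close>, this maximum lies between n and n^2, so the
      relations for \<xi>0 and \<xi>1 can be expressed through ln n.\<close>
    define m where "m = max (Q n) (real n)"
    have m: "m \<ge> real n" "m \<le> (real n)\<^sup>2" "m > 0"
    proof -
      show "m \<ge> real n" by (simp add: m_def)
      then show "m > 0" using n by simp
      have "(real (q n))\<^sup>2 \<le> (real n)\<^sup>2" using qn by (intro power_mono) auto
      moreover have "real n * 1 \<le> real n * real n" using n by (intro mult_left_mono) auto
      ultimately show "m \<le> (real n)\<^sup>2" using Q1(3) by (simp add: m_def power2_eq_square)
    qed
    have lnm: "?Ln \<le> ln m" "ln m \<le> 2 * ?Ln"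
    proof -
      show "?Ln \<le> ln m" using m n by (subst ln_le_cancel_iff) auto
      have "ln m \<le> ln ((real n)\<^sup>2)" using m n by (subst ln_le_cancel_iff) auto
      then show "ln m \<le> 2 * ?Ln" using n by (simp add: ln_realpow)
    qed
    have Ln0: "0 \<le> ?Ln" "0 \<le> ?LP" using n P1 by auto
    have th': "- ln (1 + C_th) - (2 + a') * ?LP \<le> ln (\<theta> n)" "ln (\<theta> n) \<le> - ln c_th - (2 + a') * ?LP"
      by (rule weight_log_bounds[where c = c_th and C = C_th]; use par P1 th A4 elim(10) in simp)+
    have et': "- ln (1 + C_et) - (2 + a) * ln (Q n) \<le> ln (\<eta> n)" "ln (\<eta> n) \<le> - ln c_et - (2 + a) * ln (Q n)"
      by (rule weight_log_bounds[where c = c_et and C = C_et]; use par Q1 et A5 elim(13) in simp)+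
    have th1: "kt1 - (2 + a') * ?LP \<le> ln (\<theta> n)" using th'(1) by (simp add: kt1_def)
    have th2: "ln (\<theta> n) \<le> kt2 - 2 * ?LP"
      using th'(2) mult_right_mono[of 2 "2 + a'" ?LP] Ln0 A4 unfolding kt2_def by linarith
    have et1: "ke1 - 2 * (2 + a) * ?Lq \<le> ln (\<eta> n)"
    proof -
      have "(2 + a) * ln (Q n) \<le> (2 + a) * (2 * ?Lq)" using lnQ(3) A5(1) by (intro mult_left_mono) auto
      moreover have "(2 + a) * (2 * ?Lq) = 2 * (2 + a) * ?Lq" by simp
      ultimately show ?thesis using et'(1) unfolding ke1_def by linarith
    qed
    have et2: "ln (\<eta> n) \<le> ke2 - 4 * ?Lq"
      using et'(2) mult_right_mono[of 2 "2 + a" "ln (Q n)"] lnQ A5 unfolding ke2_def by linarith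
    have l11: "k1 - ?Ln \<le> ln (lam1 n)" and l12: "lam1 n \<le> C_l1"
    proof -
      have e: "c_l1 / real n \<le> lam1 n" "lam1 n \<le> C_l1 / real n" using elim(12) par by auto
      have "ln (c_l1 / real n) \<le> ln (lam1 n)" using e l1 n par by (subst ln_le_cancel_iff) auto
      then show "k1 - ?Ln \<le> ln (lam1 n)" using l1 n by (simp add: k1_def ln_div)
      have "C_l1 / real n \<le> C_l1" using l1(2) n by (simp add: divide_le_eq)
      then show "lam1 n \<le> C_l1" using e by linarith
    qed
    have l01: "k0 + (2 + b') * ?Ly \<le> ln (lam0 n)"
    proof -
      have mp: "max (real n) (real (p n) * real (q n)) > 0" using n by (simp add: max_def)
      have "ln (c_l0 * max (real n) (real (p n) * real (q n)) powr (2 + b')) \<le> ln (lam0 n)"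
        using elim(11) l0 par mp by (subst ln_le_cancel_iff) auto
      then show ?thesis using l0 mp by (simp add: k0_def ln_mult ln_powr)
    qed
    have x01: "kx0 + 4 * ?Ln \<le> ln (\<xi>0 n)"
    proof -
      have "ln (c_x0 * m powr (4 + b)) \<le> ln (\<xi>0 n)"
        using elim(14) x0 par m unfolding m_def[symmetric] by (subst ln_le_cancel_iff) auto
      then have "kx0 + (4 + b) * ln m \<le> ln (\<xi>0 n)" using x0 m by (simp add: kx0_def ln_mult ln_powr)
      moreover have "4 * ?Ln \<le> (4 + b) * ln m" using lnm Ln0 A5 by (intro mult_mono) auto
      ultimately show ?thesis by linarith
    qed
    have x11: "kx - 2 * ?Ln \<le> ln (\<xi>1 n)" and x12: "\<xi>1 n \<le> 1"
    proof -
      have e: "c_x1 / m \<le> \<xi>1 n" "\<xi>1 n \<le> C_x1 / m" using elim(15) par m unfolding m_def[symmetric] by auto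
      have "ln (c_x1 / m) \<le> ln (\<xi>1 n)" using e x1 m par by (subst ln_le_cancel_iff) auto
      then show "kx - 2 * ?Ln \<le> ln (\<xi>1 n)" using x1 m lnm by (simp add: kx_def ln_div)
      have "C_x1 / m \<le> 1" using m elim(9) by (simp add: divide_le_eq)
      then show "\<xi>1 n \<le> 1" using e by linarith
    qed
    have W: "2 * \<delta> * (w * R n) = (2 * k + 3 * Cl + C5 + 4) * R n" using \<delta> by (simp add: w_def)
    have W1: "w * R n \<le> \<tau> / 8 * (M * real n * (R n / real n))"
      using mult_right_mono[OF M(2) R0] n by simp
    \<comment> \<open>Below the truncation of the minimum the choice of \<open>M\<close> is used, at
      the truncation the smallness of R / n.\<close>
    have W2: "w * R n \<le> real n * (min (M * (R n / real n) / (inverse b2)\<^sup>2) 1 / 64)"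
    proof -
      have "w * bb\<^sup>2 * R n \<le> M / 64 * R n" using M(3) R0 by (intro mult_right_mono)
      then have "w * R n \<le> real n * ((M * (R n / real n) / bb\<^sup>2) / 64)"
        using bb n by (simp add: field_simps)
      then show ?thesis using Rn(2) unfolding bb_def[symmetric] by (cases "M * (R n / real n) / bb\<^sup>2 \<le> 1") (simp_all only: min_def if_True if_False times_divide_eq_right mult_1_right)
    qed
    show ?case
    proof (intro ballI, clarify, unfold rate, rule conjI)
      fix B0 \<Omega>0
      assume t: "(B0, \<Omega>0) \<in> true_params (p n) (q n) a1 b1 b2 (sB n) (s\<Omega> n)"
      have b2: "b2 > 0" and p: "q n \<le> n" using A1 qn by auto
      have bigs: "kt2 + ln 4 \<le> ?LP" "ke2 + ln 4 \<le> 2 * ?Lq"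
        "ln (4 / \<alpha>) + \<alpha> * kt2 - \<delta> * (k1 + kB) \<le> ?LP / 2"
        "ln (4 / \<alpha>) + \<alpha> * ke2 - \<delta> * (kx + ln \<tau>0) \<le> ?Lq / 2" "\<tau>0 \<le> real n"
        using elim(7-9) by auto
      have ln: "?Ln \<le> c0 * ?Lq" "?Ln \<le> c0 * ?Lp" using elim(1) by auto
      note rb = regime_bound[OF n qn design[OF n1] col par tau(1) \<tau>0 b2 refl refl refl refl refl refl elim(3)
          c0(1) ln \<delta>_def \<alpha>_def A5(1) A4(1,2) A2 th1 th2 l11 l12 l01 et1 et2 x11 x12 x01 kB_def elim(5,6) bigs
          Cl_def[unfolded bb_def] R_def k_def[unfolded bb_def] C5_def W W1 W2 t]
      show "(\<integral>\<^sup>+ Y. prob_of (p n) (q n)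
          (posterior n (p n) (q n) (X n)
             (prior (p n) (q n) (\<theta> n) (lam1 n) (lam0 n) (\<eta> n) (\<xi>1 n) (\<xi>0 n) \<tau>) Y)
          (\<lambda>B \<Omega>. (frobenius_norm (X n * (B - B0)))\<^sup>2 \<ge> M * real n * (R n / real n))
         \<partial>sampling_measure n (q n) (X n) B0 \<Omega>0) \<le> ennreal (13 * exp (- R n))"
        by (rule rb(1))
      show "(\<integral>\<^sup>+ Y. prob_of (p n) (q n)
          (posterior n (p n) (q n) (X n)
             (prior (p n) (q n) (\<theta> n) (lam1 n) (lam0 n) (\<eta> n) (\<xi>1 n) (\<xi>0 n) \<tau>) Y)
          (\<lambda>B \<Omega>. (frobenius_norm (\<Omega> - \<Omega>0))\<^sup>2 \<ge> M * (R n / real n))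
         \<partial>sampling_measure n (q n) (X n) B0 \<Omega>0) \<le> ennreal (13 * exp (- R n))"
        by (rule rb(2))
    qed
  qed
  have lim: "(\<lambda>n. ennreal (13 * exp (- R n))) \<longlonglongrightarrow> 0"
  proof -
    have "((\<lambda>x :: real. 13 * exp (- x)) \<longlongrightarrow> 0) at_top" by real_asymp
    then have "(\<lambda>n. 13 * exp (- R n)) \<longlonglongrightarrow> 0" by (rule filterlim_compose[OF _ limR])
    then show ?thesis by (metis ennreal_0 tendsto_ennrealI)
  qed
  show ?thesis
  proof (intro exI[of _ M] conjI M(1))
    show "(\<lambda>n. SUP (B0, \<Omega>0) \<in> true_params (p n) (q n) a1 b1 b2 (sB n) (s\<Omega> n). ?I1 n B0 \<Omega>0) \<longlonglongrightarrow> 0"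
      by (rule tendsto_sandwich[OF _ _ tendsto_const lim], simp, use main in eventually_elim) (auto intro!: SUP_least)
    show "(\<lambda>n. SUP (B0, \<Omega>0) \<in> true_params (p n) (q n) a1 b1 b2 (sB n) (s\<Omega> n). ?I2 n B0 \<Omega>0) \<longlonglongrightarrow> 0"
      by (rule tendsto_sandwich[OF _ _ tendsto_const lim], simp, use main in eventually_elim) (auto intro!: SUP_least)
  qed
qed

end
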